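(* Let $d\ge 3$. There exist constants $C_{\mathrm{wH}}(d)<\infty$ and $\gamma_d<\infty$, depending only on $d$, such that the following holds. Let $\mathbf{a}$ be a normalized elliptic coefficient field on $B_1$ with upper ellipticity constant $\Lambda$, let $0<q<1$, and let $u$ be a positive weak supersolution of $-\nabla\cdot(\mathbf{a}\nabla u)\ge 0$ on $B_1$. Writing $q^*:=\frac{qd}{d-2}$, one has $$\Bigl(\int_{B_{1/4}}|u|^{q^*}\Bigr)^{1/q^*}\le\Bigl(\frac{C_{\mathrm{wH}}(d)}{(1-q)^{\gamma_d}}\Bigr)^{\Lambda^{1/2}}\operatorname*{ess\,inf}_{B_{1/4}}u.$$
   Context: $B_r$ denotes the open ball of radius $r$ centered at the origin in $\mathbb{R}^d$. A normalized elliptic coefficient field on an open set $\Omega\subseteq\mathbb{R}^d$ is a measurable map $\mathbf{a}:\Omega\to\mathbb{R}^{d\times d}$ (not necessarily symmetric) together with a constant $\Lambda\in[1,\infty)$ such that, for Lebesgue-a.e. $x\in\Omega$ and every $\xi\in\mathbb{R}^d$, $\xi\cdot\mathbf{a}(x)\xi\ge|\xi|^2$ and $\xi\cdot\mathbf{a}(x)^{-1}\xi\ge\Lambda^{-1}|\xi|^2$ (that is, the lower ellipticity constant is $\lambda=1$). The space $W^{1,2}(\Omega)$ consists of the functions in $L^2(\Omega)$ all of whose first-order weak partial derivatives (defined by integration by parts against $C_c^\infty(\Omega)$) belong to $L^2(\Omega)$, and $W^{1,2}_0(\Omega)$ is the closure of $C_c^\infty(\Omega)$ in the $W^{1,2}$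 topology. For $u,\varphi\in W^{1,2}(\Omega)$ set $B_{\mathbf{a}}(u,\varphi):=\int_\Omega\nabla\varphi(x)\cdot\mathbf{a}(x)\nabla u(x)\,dx$. A weak supersolution of $-\nabla\cdot(\mathbf{a}\nabla u)\ge 0$ on $\Omega$ is a function $u\in W^{1,2}(\Omega)$ with $B_{\mathbf{a}}(u,\varphi)\ge 0$ for every nonnegative $\varphi\in W^{1,2}_0(\Omega)$. It is positive if $u>0$ a.e. in $\Omega$ (functions being identified up to null sets). *)

theory Defs
  imports "HOL-Analysis.Analysis" "HOL-Probability.Essential_Supremum"
begin

definition partial_deriv :: "'n \<Rightarrow> (real ^ 'n \<Rightarrow> real) \<Rightarrow> real ^ 'n \<Rightarrow> real" where
  "partial_deriv i f x = frechet_derivative f (at x) (axis i 1)"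

primrec Ck :: "nat \<Rightarrow> (real ^ 'n \<Rightarrow> real) \<Rightarrow> bool" where
  "Ck 0 f \<longleftrightarrow> continuous_on UNIV f"
| "Ck (Suc k) f \<longleftrightarrow> (\<forall>x. f differentiable (at x)) \<and> (\<forall>i. Ck k (partial_deriv i f))"

text \<open>The space \<open>C\<^sub>c\<^sup>\<infinity>(\<Omega>)\<close>; its elements are functions on the whole space that are
  extended by zero outside \<open>\<Omega>\<close>.\<close>

definition test_functions :: "(real ^ 'n) set \<Rightarrow> (real ^ 'n \<Rightarrow> real) set" where
  "test_functions \<Omega> = {\<phi>. (\<forall>k. Ck k \<phi>) \<and> compact (closure {x. \<phi> x \<noteq> 0}) \<and>
     closure {x. \<phi> x \<noteq> 0} \<subseteq> \<Omega>}"

text \<open>Functions on \<open>\<Omega>\<close> are total functions of which only the values on \<open>\<Omega>\<close> matter, and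
  everything below is invariant under changing them on null sets.\<close>

definition L2 :: "(real ^ 'n) set \<Rightarrow> (real ^ 'n \<Rightarrow> real) set" where
  "L2 \<Omega> = {f. f \<in> borel_measurable (lebesgue_on \<Omega>) \<and>
     integrable (lebesgue_on \<Omega>) (\<lambda>x. (f x)\<^sup>2)}"

text \<open>Only meaningful for locally integrable \<open>u\<close> and \<open>g\<close>; it is used below only for members
  of \<open>L2 \<Omega>\<close>.\<close>

definition weak_partial ::
    "(real ^ 'n) set \<Rightarrow> 'n \<Rightarrow> (real ^ 'n \<Rightarrow> real) \<Rightarrow> (real ^ 'n \<Rightarrow> real) \<Rightarrow> bool" where
  "weak_partial \<Omega> i u g \<longleftrightarrow> (\<forall>\<phi>\<in>test_functions \<Omega>.
     (LINT x|lebesgue_on \<Omega>. u x * partial_deriv i \<phi> x) = - (LINT x|lebesgue_on \<Omega>. g x * \<phi> x))"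

definition W12 :: "(real ^ 'n) set \<Rightarrow> (real ^ 'n \<Rightarrow> real) set" where
  "W12 \<Omega> = {u \<in> L2 \<Omega>. \<forall>i. \<exists>g\<in>L2 \<Omega>. weak_partial \<Omega> i u g}"

text \<open>A representative of the weak gradient, unique up to null sets for \<open>u \<in> W12 \<Omega>\<close>.\<close>

definition weak_grad ::
    "(real ^ 'n) set \<Rightarrow> (real ^ 'n \<Rightarrow> real) \<Rightarrow> real ^ 'n \<Rightarrow> real ^ 'n" where
  "weak_grad \<Omega> u = (SOME G. \<forall>i. (\<lambda>x. G x $ i) \<in> L2 \<Omega> \<and> weak_partial \<Omega> i u (\<lambda>x. G x $ i))"

definition W12_norm :: "(real ^ 'n) set \<Rightarrow> (real ^ 'n \<Rightarrow> real) \<Rightarrow> real" where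
  "W12_norm \<Omega> u = sqrt ((LINT x|lebesgue_on \<Omega>. (u x)\<^sup>2) +
     (LINT x|lebesgue_on \<Omega>. (norm (weak_grad \<Omega> u x))\<^sup>2))"

definition W12_0 :: "(real ^ 'n) set \<Rightarrow> (real ^ 'n \<Rightarrow> real) set" where
  "W12_0 \<Omega> = {u \<in> W12 \<Omega>. \<forall>\<epsilon>>0. \<exists>\<phi>\<in>test_functions \<Omega>. W12_norm \<Omega> (\<lambda>x. u x - \<phi> x) < \<epsilon>}"

text \<open>The first inequality forces \<open>a x\<close> to be invertible, so \<open>matrix_inv (a x)\<close> is its
  inverse.\<close>

definition normalized_elliptic ::
    "(real ^ 'n) set \<Rightarrow> real \<Rightarrow> (real ^ 'n \<Rightarrow> real ^ 'n ^ 'n) \<Rightarrow> bool" where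
  "normalized_elliptic \<Omega> \<Lambda> a \<longleftrightarrow> 1 \<le> \<Lambda> \<and> a \<in> borel_measurable (lebesgue_on \<Omega>) \<and>
     (AE x in lebesgue_on \<Omega>. \<forall>\<xi>. \<xi> \<bullet> (a x *v \<xi>) \<ge> (norm \<xi>)\<^sup>2 \<and>
        \<xi> \<bullet> (matrix_inv (a x) *v \<xi>) \<ge> inverse \<Lambda> * (norm \<xi>)\<^sup>2)"

definition bilin_form ::
    "(real ^ 'n) set \<Rightarrow> (real ^ 'n \<Rightarrow> real ^ 'n ^ 'n) \<Rightarrow>
     (real ^ 'n \<Rightarrow> real) \<Rightarrow> (real ^ 'n \<Rightarrow> real) \<Rightarrow> real" where
  "bilin_form \<Omega> a u \<phi> = (LINT x|lebesgue_on \<Omega>. weak_grad \<Omega> \<phi> x \<bullet> (a x *v weak_grad \<Omega> u x))"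

definition weak_supersolution ::
    "(real ^ 'n) set \<Rightarrow> (real ^ 'n \<Rightarrow> real ^ 'n ^ 'n) \<Rightarrow> (real ^ 'n \<Rightarrow> real) \<Rightarrow> bool" where
  "weak_supersolution \<Omega> a u \<longleftrightarrow> u \<in> W12 \<Omega> \<and>
     (\<forall>\<phi>\<in>W12_0 \<Omega>. (AE x in lebesgue_on \<Omega>. 0 \<le> \<phi> x) \<longrightarrow> 0 \<le> bilin_form \<Omega> a u \<phi>)"

definition essinf :: "'a measure \<Rightarrow> ('a \<Rightarrow> real) \<Rightarrow> ereal" where
  "essinf M f = - esssup M (\<lambda>x. - ereal (f x))"

end

theory Submission
  imports Defs
begin

text \<open>For \<open>v = u + \<delta>\<close> the supersolution property tested with \<open>\<eta>\<^sup>2 v\<^sup>p\<^sup>-\<^sup>1\<close>, \<open>p < 1\<close>, gives the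
  Caccioppoli inequality \<open>\<integral> \<eta>\<^sup>2 v\<^sup>p\<^sup>-\<^sup>2 |\<nabla>v|\<^sup>2 \<le> 4 \<Lambda> (1 - p)\<^sup>-\<^sup>2 \<integral> |\<nabla>\<eta>|\<^sup>2 v\<^sup>p\<close>; of the
  coefficients only \<open>|\<xi>|\<^sup>2 \<le> \<xi> \<bullet> a \<xi>\<close> and the flux bound \<open>|a \<xi>|\<^sup>2 \<le> \<Lambda> \<xi> \<bullet> a \<xi>\<close> are used. With the Sobolev inequality it
  becomes a reverse Hoelder inequality with constant proportional to \<open>1 + \<Lambda> p\<^sup>2 / (1 - p)\<^sup>2\<close>, and for \<open>p = 0\<close>
  the Poincare inequality bounds the oscillation of \<open>ln v\<close> in \<open>L\<^sup>2\<close> by a multiple of \<open>\<Lambda>\<^sup>1\<^sup>/\<^sup>2\<close>.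

  The exponent \<open>\<Lambda>\<^sup>1\<^sup>/\<^sup>2\<close> of the theorem comes from passing to \<open>f = (v e\<^sup>-\<^sup>m)\<^sup>s\<close> with \<open>s = \<Lambda>\<^sup>-\<^sup>1\<^sup>/\<^sup>2 / 2\<close>, where
  \<open>m\<close> is a mean of \<open>ln v\<close>: for \<open>f\<close> and \<open>1/f\<close> both estimates hold with constants that depend only on the
  dimension, so the Bombieri--Giusti lemma bounds their integrals. Moser iteration then bounds \<open>1/f\<close>
  from above and raises the exponent of \<open>f\<close> to \<open>q\<^sup>*/s\<close>; raising the product of the two bounds to the
  power \<open>1/s\<close> and letting \<open>\<delta>\<close> tend to \<open>0\<close> gives the claim.\<close>

section \<open>Smooth mollifiers\<close>

text \<open>With \<open>p = s * \<alpha>\<close> the quantity \<open>\<Lambda> * p\<^sup>2\<close>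
  becomes \<open>\<alpha>\<^sup>2 / 4\<close>. The cost \<open>1 + \<alpha>\<^sup>2\<close> grows
  only geometrically along a Moser iteration, where the weights \<open>(1 / \<kappa>) ^ j\<close>
  damp it. So the number of steps up to \<open>q / s\<close>, which grows with
  \<open>\<Lambda>\<close>, is harmless: the product of all step constants converges. In the
  Bombieri--Giusti part \<open>p\<close> stays below 1/2 and \<open>1 - p\<close> is under control.
  Only the last iteration, up to \<open>p = q\<close>, meets \<open>(1 - q)\<^sup>2\<close> in a
  denominator; in the Moser product it gets the sum of the \<open>(1 / \<kappa>) ^ j\<close> as its
  power, which is why \<open>\<gamma>\<close> depends on the dimension alone. The bound starts from
  exponent 1 of \<open>f\<close>, so \<open>q / s\<close> should be at least 1; this holds for
  \<open>q\<close> at least 1/2, and smaller \<open>q\<close> are reduced to 1/2 by Jensen at the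
  price of a factor \<open>2 powr \<gamma>\<close>. On the analytic side the difficulty is the chain
  rule for weak gradients that are given by a choice operator. Every function built from
  \<open>v\<close> is therefore carried along with continuously differentiable approximants with
  values in \<open>{\<delta>..}\<close>, where the logarithm and the powers in use have bounded
  derivatives.\<close>

lemma partial_derivI: "(f has_derivative f') (at x) \<Longrightarrow> partial_deriv i f x = f' (axis i 1)"
  unfolding partial_deriv_def using frechet_derivative_at by metis

lemma has_derivative_partial_deriv:
  fixes f :: "real ^ 'n \<Rightarrow> real"
  assumes "f differentiable (at x)"
  shows "(f has_derivative (\<lambda>h. (\<chi> i. partial_deriv i f x) \<bullet> h)) (at x)"
proof -
  let ?f' = "frechet_derivative f (at x)"
  have d: "(f has_derivative ?f') (at x)" using assms frechet_derivative_works by blast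
  then have lin: "linear ?f'" by (rule has_derivative_linear)
  have "?f' = (\<lambda>h. (\<chi> i. partial_deriv i f x) \<bullet> h)"
  proof
    fix h :: "real ^ 'n"
    have "?f' h = ?f' (\<Sum>i\<in>UNIV. (h $ i) *\<^sub>R axis i 1)"
      using basis_expansion[of h] by (simp add: scalar_mult_eq_scaleR)
    also have "\<dots> = (\<Sum>i\<in>UNIV. (h $ i) *\<^sub>R ?f' (axis i 1))"
      using lin by (simp add: linear_sum linear_cmul)
    also have "\<dots> = (\<chi> i. partial_deriv i f x) \<bullet> h"
      by (simp add: inner_vec_def partial_deriv_def mult.commute)
    finally show "?f' h = (\<chi> i. partial_deriv i f x) \<bullet> h" .
  qed
  with d show ?thesis by simp
qed

lemma Ck_SucD: "Ck (Suc k) f \<Longrightarrow> Ck k f"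
proof (induction k arbitrary: f)
  case 0
  then show ?case
    by (auto intro!: differentiable_imp_continuous_on simp: differentiable_on_def
        differentiable_at_withinI)
qed auto

lemma Ck_const [intro]: "Ck k (\<lambda>x::real^'n. c)"
proof (induction k arbitrary: c)
  case (Suc k)
  have "partial_deriv i (\<lambda>x::real^'n. c) = (\<lambda>x. 0)" for i
    by (rule ext, rule partial_derivI[THEN trans]) auto
  with Suc show ?case by simp
qed auto

lemma Ck_coord: "Ck k (\<lambda>x::real^'n. x $ i)"
proof (cases k)
  case (Suc l)
  have d: "((\<lambda>x::real^'n. x $ i) has_derivative (\<lambda>h. h $ i)) (at x)" for x
    by (intro bounded_linear_imp_has_derivative bounded_linear_vec_nth)
  have "partial_deriv j (\<lambda>x::real^'n. x $ i) = (\<lambda>x. axis j 1 $ i)" for j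
    using partial_derivI[OF d] by auto
  with d Suc show ?thesis by (auto simp: differentiable_def)
qed (auto intro!: continuous_intros)

lemma partial_deriv_add:
  assumes "f differentiable (at x)" "g differentiable (at x)"
  shows "partial_deriv i (\<lambda>x. f x + g x) x = partial_deriv i f x + partial_deriv i g x"
proof -
  have "((\<lambda>x. f x + g x) has_derivative
      (\<lambda>h. (\<chi> i. partial_deriv i f x) \<bullet> h + (\<chi> i. partial_deriv i g x) \<bullet> h)) (at x)"
    using assms by (intro has_derivative_add has_derivative_partial_deriv)
  from partial_derivI[OF this, of i] show ?thesis by (simp add: inner_axis)
qed

lemma partial_deriv_mult:
  assumes "f differentiable (at x)" "g differentiable (at x)"
  shows "partial_deriv i (\<lambda>x. f x * g x) x = f x * partial_deriv i g x + partial_deriv i f x * g x"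
proof -
  have "((\<lambda>x. f x * g x) has_derivative
      (\<lambda>h. f x * ((\<chi> i. partial_deriv i g x) \<bullet> h) + ((\<chi> i. partial_deriv i f x) \<bullet> h) * g x)) (at x)"
    using assms by (intro has_derivative_mult has_derivative_partial_deriv)
  from partial_derivI[OF this, of i] show ?thesis by (simp add: inner_axis)
qed

lemma Ck_add: "Ck k f \<Longrightarrow> Ck k g \<Longrightarrow> Ck k (\<lambda>x. f x + g x)"
proof (induction k arbitrary: f g)
  case (Suc k)
  then have "partial_deriv i (\<lambda>x. f x + g x) = (\<lambda>x. partial_deriv i f x + partial_deriv i g x)" for i
    by (auto simp: partial_deriv_add)
  with Suc show ?case by auto
qed (auto intro: continuous_intros)

text \<open>The product rule leaves an undifferentiated factor beside each derivative, so the
  induction has to lower the order of \<open>f\<close> and \<open>g\<close> themselves, by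
  \<open>Ck_SucD\<close>.\<close>

lemma Ck_mult: "Ck k f \<Longrightarrow> Ck k g \<Longrightarrow> Ck k (\<lambda>x. f x * g x)"
proof (induction k arbitrary: f g)
  case (Suc k)
  then have "partial_deriv i (\<lambda>x. f x * g x)
      = (\<lambda>x. f x * partial_deriv i g x + partial_deriv i f x * g x)" for i
    by (auto simp: partial_deriv_mult)
  moreover have "Ck k (\<lambda>x. f x * partial_deriv i g x + partial_deriv i f x * g x)" for i
    using Suc Ck_SucD[OF Suc.prems(1)] Ck_SucD[OF Suc.prems(2)] by (intro Ck_add Suc.IH) auto
  ultimately show ?case using Suc.prems by (auto intro: differentiable_mult)
qed (auto intro: continuous_intros)

text \<open>The function exp(-1/t) alone is not closed under differentiation. With the weight
  \<open>inverse t ^ m\<close> it becomes a family that is, so that smoothness reduces to one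
  induction with \<open>m\<close> left free.\<close>

definition flat :: "nat \<Rightarrow> real \<Rightarrow> real" where
  "flat m t = (if t \<le> 0 then 0 else exp (- inverse t) * inverse t ^ m)"

lemma flat_tendsto_0: "(flat m \<longlongrightarrow> 0) (at 0)"
proof -
  have "((\<lambda>x. x ^ m / exp x) \<longlongrightarrow> (0::real)) at_top" by (rule tendsto_power_div_exp_0)
  \<comment> \<open>Reading \<open>inverse t\<close> as a variable that tends to infinity turns the
    one-sided limit at 0 into the decay of \<open>x ^ m / exp x\<close>.\<close>
  then have "((\<lambda>t. inverse t ^ m / exp (inverse t)) \<longlongrightarrow> (0::real)) (at_right 0)"
    using filterlim_inverse_at_top_right filterlim_compose by blast
  then have R: "(flat m \<longlongrightarrow> 0) (at_right 0)"
    by (rule Lim_transform_eventually)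
       (auto simp: eventually_at_right_less flat_def exp_minus divide_inverse eventually_at_filter)
  have L: "(flat m \<longlongrightarrow> 0) (at_left 0)"
    by (rule Lim_transform_eventually[OF tendsto_const]) (auto simp: flat_def eventually_at_filter)
  show ?thesis using R L by (simp add: filterlim_split_at)
qed

lemma flat_deriv: "(flat m has_real_derivative (flat (m + 2) t - real m * flat (m + 1) t)) (at t)"
proof -
  consider "t < 0" | "t > 0" | "t = 0" by linarith
  then show ?thesis
  proof cases
    case 1
    have "((\<lambda>t. 0) has_real_derivative 0) (at t)" by simp
    then have "(flat m has_real_derivative 0) (at t)"
      by (rule has_field_derivative_transform_within_open[where S="{..<0}"]) (use 1 in \<open>auto simp: flat_def\<close>)
    then show ?thesis using 1 by (simp add: flat_def)
  next
    case 2
    have "((\<lambda>t. exp (- inverse t) * inverse t ^ m) has_real_derivative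
        (flat (m + 2) t - real m * flat (m + 1) t)) (at t)"
    proof -
      have "((\<lambda>t. exp (- inverse t) * inverse t ^ m) has_real_derivative
        (exp (- inverse t) * (real m * inverse t ^ (m - 1) * - (inverse t ^ 2))
          + exp (- inverse t) * inverse t ^ 2 * inverse t ^ m)) (at t)"
        using 2 by (auto intro!: derivative_eq_intros simp: power2_eq_square)
      moreover have "exp (- inverse t) * (real m * inverse t ^ (m - 1) * - (inverse t ^ 2))
          + exp (- inverse t) * inverse t ^ 2 * inverse t ^ m = flat (m + 2) t - real m * flat (m + 1) t"
        using 2 by (cases m) (auto simp: flat_def algebra_simps power2_eq_square)
      ultimately show ?thesis by (rule DERIV_cong)
    qed
    then show ?thesis
      by (rule has_field_derivative_transform_within_open[where S="{0<..}"]) (use 2 in \<open>auto simp: flat_def\<close>)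
  next
    case 3
    \<comment> \<open>The difference quotient of \<open>flat m\<close> at 0 is exactly
      \<open>flat (m + 1)\<close>: the division by \<open>h\<close> adds one factor
      \<open>inverse h\<close>.\<close>
    have "((\<lambda>h. flat (m + 1) h) \<longlongrightarrow> 0) (at 0)" by (rule flat_tendsto_0)
    then have "((\<lambda>h. (flat m (0 + h) - flat m 0) / h) \<longlongrightarrow> 0) (at 0)"
      by (rule Lim_transform_eventually)
         (auto simp: flat_def eventually_at_filter divide_inverse)
    then show ?thesis using 3 by (simp add: DERIV_def flat_def)
  qed
qed

text \<open>The argument is a quadratic polynomial in \<open>y\<close>, so the centre
  \<open>x\<close>, where the norm itself is not differentiable, causes no trouble. A partial
  derivative is an affine coordinate factor times members of the family with indices
  \<open>m + 1\<close> and \<open>m + 2\<close>; hence the induction is for all \<open>m\<close> at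
  once.\<close>

lemma Ck_flat: "Ck k (\<lambda>y::real^'n. flat m (1 - c * ((y - x) \<bullet> (y - x))))"
proof (induction k arbitrary: m)
  case 0
  have "isCont (flat m) t" for t using flat_deriv DERIV_isCont by blast
  then have "continuous_on UNIV (flat m)" by (simp add: continuous_at_imp_continuous_on)
  then show ?case
    by (auto intro!: continuous_on_compose2[of UNIV "flat m"] continuous_intros)
next
  case (Suc k)
  let ?s = "\<lambda>y. 1 - c * ((y - x) \<bullet> (y - x))"
  have s: "(?s has_derivative (\<lambda>h. - (c * (2 * ((y - x) \<bullet> h))))) (at y)" for y
    by (auto intro!: derivative_eq_intros simp: inner_commute)
  have d: "((\<lambda>y. flat m (?s y)) has_derivative
      (\<lambda>h. - (c * (2 * ((y - x) \<bullet> h))) * (flat (m + 2) (?s y) - real m * flat (m + 1) (?s y)))) (at y)" for y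
    by (rule DERIV_compose_FDERIV[OF flat_deriv s])
  have "partial_deriv i (\<lambda>y. flat m (?s y)) =
      (\<lambda>y. ((-2 * c) * (y $ i + - x $ i)) * (flat (m + 2) (?s y) + (- real m) * flat (m + 1) (?s y)))" for i
    using partial_derivI[OF d, of i] by (auto simp: inner_axis algebra_simps)
  moreover have "Ck k (\<lambda>y. ((-2 * c) * (y $ i + - x $ i)) *
      (flat (m + 2) (?s y) + (- real m) * flat (m + 1) (?s y)))" for i
    by (intro Ck_mult Ck_add Ck_const Ck_coord Suc.IH)
  moreover have "(\<lambda>y. flat m (?s y)) differentiable (at y)" for y
    using d by (auto simp: differentiable_def)
  ultimately show ?case by simp
qed

text \<open>The support is bounded by a radius instead of being tied to a domain. The class is then
  closed under partial derivatives, contains the test functions of every domain and serves equally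
  for kernels.\<close>

definition smooth_cs :: "(real ^ 'n \<Rightarrow> real) \<Rightarrow> bool" where
  "smooth_cs K \<longleftrightarrow> (\<forall>k. Ck k K) \<and> (\<exists>R. \<forall>x. norm x > R \<longrightarrow> K x = 0)"

abbreviation grad_cs :: "(real ^ 'n \<Rightarrow> real) \<Rightarrow> real ^ 'n \<Rightarrow> real ^ 'n" where
  "grad_cs f x \<equiv> (\<chi> i. partial_deriv i f x)"

lemma smooth_cs_derivative:
  "smooth_cs K \<Longrightarrow> (K has_derivative (\<lambda>h. grad_cs K x \<bullet> h)) (at x)"
  unfolding smooth_cs_def by (metis Ck.simps(2) has_derivative_partial_deriv)

lemma smooth_cs_partial_deriv:
  fixes K :: "real ^ 'n \<Rightarrow> real"
  assumes "smooth_cs K" shows "smooth_cs (partial_deriv i K)"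
proof -
  from assms obtain R where R: "\<And>x. norm x > R \<Longrightarrow> K x = 0" unfolding smooth_cs_def by auto
  have "partial_deriv i K x = 0" if "norm x > R" for x
  proof -
    have "((\<lambda>x. 0) has_derivative (\<lambda>h. 0)) (at x)" by simp
    moreover have "open {x::real^'n. norm x > R}" by (simp add: open_Collect_less continuous_on_norm)
    ultimately have "(K has_derivative (\<lambda>h. 0)) (at x)"
      by (rule has_derivative_transform_within_open[where s="{x. norm x > R}"]) (use that R in auto)
    then show ?thesis by (rule partial_derivI)
  qed
  moreover have "Ck k (partial_deriv i K)" for k
    using assms unfolding smooth_cs_def by (metis Ck.simps(2))
  ultimately show ?thesis unfolding smooth_cs_def by blast
qed

lemma smooth_cs_continuous: "smooth_cs K \<Longrightarrow> continuous_on UNIV K"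
  unfolding smooth_cs_def by (metis Ck.simps(1))

text \<open>One unit of room around the support: two points at distance below 1 either both lie in
  the compact ball of radius \<open>R + 1\<close>, or both lie where \<open>K\<close>
  vanishes.\<close>

lemma uniformly_continuous_compact_support:
  fixes K :: "real ^ 'n \<Rightarrow> real"
  assumes cont: "continuous_on UNIV K" and R: "\<And>x. norm x > R \<Longrightarrow> K x = 0"
  shows "uniformly_continuous_on UNIV K"
  unfolding uniformly_continuous_on_def
proof (intro allI impI)
  fix e :: real assume "e > 0"
  have "uniformly_continuous_on (cball 0 (R + 1)) K"
    by (rule compact_uniformly_continuous[OF continuous_on_subset[OF cont]]) auto
  then obtain d where d: "d > 0"
    "\<And>x y. x \<in> cball 0 (R+1) \<Longrightarrow> y \<in> cball 0 (R+1) \<Longrightarrow> dist y x < d \<Longrightarrow> dist (K y) (K x) < e"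
    using \<open>e > 0\<close> unfolding uniformly_continuous_on_def by metis
  have "dist (K y) (K x) < e" if "dist y x < min d 1" for x y
  proof (cases "norm x \<le> R + 1 \<and> norm y \<le> R + 1")
    case True with d that show ?thesis by auto
  next
    case False
    have "\<bar>norm x - norm y\<bar> < 1"
      using that norm_triangle_ineq3[of x y] by (simp add: dist_norm norm_minus_commute)
    with False have "norm x > R" "norm y > R" by auto
    then show ?thesis using R \<open>e > 0\<close> by simp
  qed
  then show "\<exists>d>0. \<forall>x\<in>UNIV. \<forall>y\<in>UNIV. dist y x < d \<longrightarrow> dist (K y) (K x) < e"
    using d(1) by (intro exI[of _ "min d 1"]) auto
qed

lemma smooth_cs_uniformly_continuous:
  fixes K :: "real ^ 'n \<Rightarrow> real"
  assumes "smooth_cs K" shows "uniformly_continuous_on UNIV K"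
proof -
  from assms obtain R where "\<And>x. norm x > R \<Longrightarrow> K x = 0" unfolding smooth_cs_def by auto
  with smooth_cs_continuous[OF assms] show ?thesis by (rule uniformly_continuous_compact_support)
qed

lemma smooth_cs_bounded:
  fixes K :: "real ^ 'n \<Rightarrow> real"
  assumes "smooth_cs K" obtains B where "\<And>x. \<bar>K x\<bar> \<le> B" "0 \<le> B"
proof -
  from assms obtain R where R: "\<And>x. norm x > R \<Longrightarrow> K x = 0" unfolding smooth_cs_def by auto
  have "compact (K ` cball 0 R)"
    by (rule compact_continuous_image[OF continuous_on_subset[OF smooth_cs_continuous[OF assms]]]) auto
  then obtain B where B: "\<And>x. x \<in> cball 0 R \<Longrightarrow> \<bar>K x\<bar> \<le> B"
    using compact_imp_bounded[of "K ` cball 0 R"] unfolding bounded_iff by fastforce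
  have "\<bar>K x\<bar> \<le> max B 0" for x
    using B[of x] R[of x] by (cases "norm x \<le> R") auto
  then show ?thesis by (intro that[of "max B 0"]) auto
qed

section \<open>Convolution of an integrable function with a smooth kernel\<close>

definition conv :: "(real ^ 'n \<Rightarrow> real) \<Rightarrow> (real ^ 'n \<Rightarrow> real) \<Rightarrow> real ^ 'n \<Rightarrow> real" where
  "conv f K x = (LINT y|lborel. f y * K (x - y))"

lemma conv_integrable:
  assumes f: "integrable lborel f" and K: "smooth_cs K"
  shows "integrable lborel (\<lambda>y. f y * K (x - y))"
proof -
  obtain B where B: "\<And>x. \<bar>K x\<bar> \<le> B" "0 \<le> B" using smooth_cs_bounded[OF K] by blast
  have [measurable]: "K \<in> borel_measurable borel"
    using smooth_cs_continuous[OF K] borel_measurable_continuous_onI by blast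
  show ?thesis
    by (rule Bochner_Integration.integrable_bound[where f="\<lambda>y. B * f y"])
       (use f B in \<open>auto simp: abs_mult mult.commute[of "\<bar>f _\<bar>"] intro!: mult_right_mono AE_I2\<close>)
qed

text \<open>All regularity comes from the kernel. Its gradient is uniformly continuous, so the
  first-order Taylor remainder of \<open>K\<close> is at most a small multiple of
  \<open>norm h\<close> at every point simultaneously, and this survives integration against
  \<open>f\<close>.\<close>

lemma conv_has_derivative:
  fixes K :: "real ^ 'n \<Rightarrow> real"
  assumes f: "integrable lborel f" and K: "smooth_cs K"
  shows "(conv f K has_derivative (\<lambda>h. (\<chi> i. conv f (partial_deriv i K) x) \<bullet> h)) (at x)"
  unfolding has_derivative_at_alt
proof (intro conjI allI impI)
  show "bounded_linear (\<lambda>h. (\<chi> i. conv f (partial_deriv i K) x) \<bullet> h)"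
    by (rule bounded_linear_inner_right)
next
  fix e :: real assume "e > 0"
  define A where "A = (LINT y|lborel. \<bar>f y\<bar>)"
  have "A \<ge> 0" by (simp add: A_def)
  let ?N = "real CARD('n)"
  \<comment> \<open>\<open>A + 1\<close> keeps the denominator positive if \<open>f\<close>
    vanishes; the division by the dimension pays for estimating the norm of the gradient by the sum
    of its components.\<close>
  define e' where "e' = e / (A + 1) / ?N"
  have "e' > 0" using \<open>e > 0\<close> \<open>A \<ge> 0\<close> by (simp add: e'_def)
  have "\<exists>d>0. \<forall>x y. dist y x < d \<longrightarrow> \<bar>partial_deriv i K y - partial_deriv i K x\<bar> < e'" for i
    using smooth_cs_uniformly_continuous[OF smooth_cs_partial_deriv[OF K, of i]] \<open>e' > 0\<close>
    unfolding uniformly_continuous_on_def dist_real_def by simp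
  then obtain d where d: "\<And>i. d i > 0"
    "\<And>i x y. dist y x < d i \<Longrightarrow> \<bar>partial_deriv i K y - partial_deriv i K x\<bar> < e'" by metis
  define \<delta> where "\<delta> = Min (range d)"
  have "\<delta> > 0" using d by (simp add: \<delta>_def)
  have \<delta>: "\<bar>partial_deriv i K y - partial_deriv i K x\<bar> < e'" if "dist y x < \<delta>" for i x y
    using d(2) that unfolding \<delta>_def by simp
  have G: "norm (grad_cs K y - grad_cs K x) \<le> e / (A + 1)" if "dist y x < \<delta>" for x y
  proof -
    have "norm (grad_cs K y - grad_cs K x) \<le> (\<Sum>i\<in>UNIV. \<bar>(grad_cs K y - grad_cs K x) $ i\<bar>)"
      by (rule norm_le_l1_cart)
    also have "\<dots> \<le> (\<Sum>i\<in>(UNIV::'n set). e')" using \<delta>[OF that] by (intro sum_mono) (simp add: less_imp_le)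
    also have "\<dots> = e / (A + 1)" by (simp add: e'_def)
    finally show ?thesis .
  qed
  have lin: "\<bar>K (z + h) - K z - grad_cs K z \<bullet> h\<bar> \<le> e / (A + 1) * norm h" if "norm h < \<delta>" for z h
  proof -
    have "norm (K (z + h) - K z - grad_cs K z \<bullet> (z + h - z)) \<le> norm (z + h - z) * (e / (A + 1))"
    proof (rule differentiable_bound_linearization[where S="ball z \<delta>" and f'="\<lambda>x. (\<bullet>) (grad_cs K x)"])
      show "z + t *\<^sub>R (z + h - z) \<in> ball z \<delta>" if "t \<in> {0..1}" for t
      proof -
        have "\<bar>t\<bar> * norm h \<le> norm h" using that by (intro mult_left_le_one_le) auto
        then show ?thesis using \<open>norm h < \<delta>\<close> by (simp add: dist_norm)
      qed
      show "(K has_derivative (\<bullet>) (grad_cs K y)) (at y within ball z \<delta>)" if "y \<in> ball z \<delta>" for y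
        using smooth_cs_derivative[OF K] has_derivative_at_withinI by blast
      show "onorm ((\<bullet>) (grad_cs K y) - (\<bullet>) (grad_cs K z)) \<le> e / (A + 1)" if "y \<in> ball z \<delta>" for y
        unfolding fun_diff_def
      proof (rule onorm_le)
        fix h
        have "norm (grad_cs K y \<bullet> h - grad_cs K z \<bullet> h) = norm ((grad_cs K y - grad_cs K z) \<bullet> h)"
          by (simp add: inner_diff_left)
        also have "\<dots> \<le> norm (grad_cs K y - grad_cs K z) * norm h" by (simp add: Cauchy_Schwarz_ineq2)
        also have "\<dots> \<le> e / (A + 1) * norm h"
          using G that by (intro mult_right_mono) (auto simp: dist_commute)
        finally show "norm (grad_cs K y \<bullet> h - grad_cs K z \<bullet> h) \<le> e / (A + 1) * norm h" .
      qed
      show "z \<in> ball z \<delta>" using \<open>\<delta> > 0\<close> by simp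
    qed
    then show ?thesis by (simp add: mult.commute)
  qed
  show "\<exists>d>0. \<forall>y. norm (y - x) < d \<longrightarrow>
      norm (conv f K y - conv f K x - (\<chi> i. conv f (partial_deriv i K) x) \<bullet> (y - x)) \<le> e * norm (y - x)"
  proof (intro exI[of _ \<delta>] conjI allI impI)
    show "\<delta> > 0" by fact
    fix y assume y: "norm (y - x) < \<delta>"
    define h where "h = y - x"
    have I: "integrable lborel (\<lambda>z. f z * K (w - z))" "integrable lborel (\<lambda>z. f z * partial_deriv i K (w - z))" for w i
      using conv_integrable[OF f] K smooth_cs_partial_deriv by auto
    have I3': "integrable lborel (\<lambda>z. f z * partial_deriv i K (x - z) * h $ i)" for i
      using I by (intro integrable_mult_left) auto
    have g: "f z * (grad_cs K (x - z) \<bullet> h) = (\<Sum>i\<in>UNIV. f z * partial_deriv i K (x - z) * h $ i)" for z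
      by (simp add: inner_vec_def sum_distrib_left mult.assoc)
    have I3: "integrable lborel (\<lambda>z. f z * (grad_cs K (x - z) \<bullet> h))"
      unfolding g using I3' by (intro Bochner_Integration.integrable_sum)
    have E3: "(\<chi> i. conv f (partial_deriv i K) x) \<bullet> h = (LINT z|lborel. f z * (grad_cs K (x - z) \<bullet> h))"
      unfolding g using I3' I by (simp add: inner_vec_def conv_def)
    define D where "D z = f z * K (y - z) - f z * K (x - z) - f z * (grad_cs K (x - z) \<bullet> h)" for z
    have ID: "integrable lborel D" unfolding D_def using I I3 by (intro Bochner_Integration.integrable_diff)
    have DB: "norm (D z) \<le> \<bar>f z\<bar> * (e / (A + 1) * norm h)" for z
    proof -
      have "D z = f z * (K ((x - z) + h) - K (x - z) - grad_cs K (x - z) \<bullet> h)"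
        by (simp add: h_def D_def algebra_simps)
      then have "norm (D z) = \<bar>f z\<bar> * \<bar>K ((x - z) + h) - K (x - z) - grad_cs K (x - z) \<bullet> h\<bar>"
        by (simp only: abs_mult real_norm_def)
      moreover have "\<bar>f z\<bar> * \<bar>K ((x - z) + h) - K (x - z) - grad_cs K (x - z) \<bullet> h\<bar>
          \<le> \<bar>f z\<bar> * (e / (A + 1) * norm h)"
        using y by (intro mult_left_mono lin) (auto simp: h_def)
      ultimately show ?thesis by linarith
    qed
    have e1: "conv f K y - conv f K x - (\<chi> i. conv f (partial_deriv i K) x) \<bullet> h = (LINT z|lborel. D z)"
    proof -
      have "(LINT z|lborel. D z) = (LINT z|lborel. f z * K (y - z)) - (LINT z|lborel. f z * K (x - z))
          - (LINT z|lborel. f z * (grad_cs K (x - z) \<bullet> h))"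
        unfolding D_def using I I3 by simp
      then show ?thesis unfolding E3 by (simp add: conv_def)
    qed
    have e2: "norm (LINT z|lborel. D z) \<le> (LINT z|lborel. \<bar>f z\<bar> * (e / (A + 1) * norm h))"
      using f ID DB by (intro order.trans[OF integral_norm_bound] integral_mono) auto
    have e3: "(LINT z|lborel. \<bar>f z\<bar> * (e / (A + 1) * norm h)) = (A / (A + 1)) * (e * norm h)"
      using f by (simp add: A_def)
    have e4: "(A / (A + 1)) * (e * norm h) \<le> 1 * (e * norm h)"
      using \<open>A \<ge> 0\<close> \<open>e > 0\<close> by (intro mult_right_mono) (auto simp: divide_simps)
    show "norm (conv f K y - conv f K x - (\<chi> i. conv f (partial_deriv i K) x) \<bullet> (y - x)) \<le> e * norm (y - x)"
      unfolding h_def[symmetric] e1 using e2 e4 unfolding e3 by linarith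
  qed
qed

lemma partial_deriv_conv:
  assumes "integrable lborel f" "smooth_cs K"
  shows "partial_deriv i (conv f K) = conv f (partial_deriv i K)"
  using partial_derivI[OF conv_has_derivative[OF assms], of i] by (auto simp: inner_axis)

lemma Ck_conv:
  assumes "integrable lborel f"
  shows "smooth_cs K \<Longrightarrow> Ck k (conv f K)"
proof (induction k arbitrary: K)
  case 0
  then have "conv f K differentiable (at x)" for x
    using conv_has_derivative[OF assms] differentiable_def by blast
  then show ?case
    by (auto intro!: differentiable_imp_continuous_on simp: differentiable_on_def
        differentiable_at_withinI)
next
  case (Suc k)
  have "conv f K differentiable (at x)" for x
    using conv_has_derivative[OF assms Suc.prems] differentiable_def by blast
  then show ?case
    using Suc.IH[OF smooth_cs_partial_deriv[OF Suc.prems]] partial_deriv_conv[OF assms Suc.prems] by simp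
qed

text \<open>The standard Friedrichs kernel of radius \<open>\<epsilon>\<close>: the bump
  \<open>flat 0\<close> of a paraboloid, divided by its integral.\<close>

definition mollifier :: "real \<Rightarrow> real ^ 'n \<Rightarrow> real" where
  "mollifier \<epsilon> z = flat 0 (1 - inverse (\<epsilon>\<^sup>2) * (z \<bullet> z)) /
     (LINT z|lborel. flat 0 (1 - inverse (\<epsilon>\<^sup>2) * ((z::real^'n) \<bullet> z)))"

lemma flat_bump_eq_0_iff:
  fixes z :: "real ^ 'n"
  assumes "\<epsilon> > 0"
  shows "flat m (1 - inverse (\<epsilon>\<^sup>2) * (z \<bullet> z)) = 0 \<longleftrightarrow> norm z \<ge> \<epsilon>"
proof -
  have "1 - inverse (\<epsilon>\<^sup>2) * (z \<bullet> z) \<le> 0 \<longleftrightarrow> \<epsilon>\<^sup>2 \<le> (norm z)\<^sup>2"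
    using assms by (simp add: divide_simps power2_norm_eq_inner)
  also have "\<dots> \<longleftrightarrow> \<epsilon> \<le> norm z"
    using assms by (simp add: abs_le_square_iff[symmetric])
  finally show ?thesis by (auto simp: flat_def)
qed

lemma smooth_cs_flat_bump:
  assumes "\<epsilon> > 0"
  shows "smooth_cs (\<lambda>z::real^'n. flat 0 (1 - inverse (\<epsilon>\<^sup>2) * (z \<bullet> z)))"
  unfolding smooth_cs_def
  using Ck_flat[of _ 0 "inverse (\<epsilon>\<^sup>2)" 0]
  by (auto simp: flat_bump_eq_0_iff[OF assms] intro!: exI[of _ \<epsilon>])

lemma smooth_cs_integrable:
  fixes K :: "real ^ 'n \<Rightarrow> real"
  assumes "smooth_cs K" shows "integrable lborel K"
proof -
  from assms obtain R where R: "\<And>x. norm x > R \<Longrightarrow> K x = 0" unfolding smooth_cs_def by auto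
  have "integrable lborel (\<lambda>x. indicator (cball 0 R) x *\<^sub>R K x)"
    by (intro borel_integrable_compact continuous_on_subset[OF smooth_cs_continuous[OF assms]]) auto
  moreover have "(\<lambda>x. indicator (cball 0 R) x *\<^sub>R K x) = K"
    using R by (force simp: indicator_def not_le)
  ultimately show ?thesis by simp
qed

lemma flat_bump_integral_pos:
  assumes "\<epsilon> > 0"
  shows "0 < (LINT z|lborel. flat 0 (1 - inverse (\<epsilon>\<^sup>2) * ((z::real^'n) \<bullet> z)))"
proof -
  let ?f = "\<lambda>z::real^'n. flat 0 (1 - inverse (\<epsilon>\<^sup>2) * (z \<bullet> z))"
  have int: "integrable lborel ?f" by (rule smooth_cs_integrable[OF smooth_cs_flat_bump[OF assms]])
  have nn: "?f z \<ge> 0" for z by (simp add: flat_def)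
  have "(LINT z|lborel. ?f z) \<noteq> 0"
  proof
    assume "(LINT z|lborel. ?f z) = 0"
    then have "AE z in lborel. ?f z = 0" using int nn by (simp add: integral_nonneg_eq_0_iff_AE)
    then have "AE z in lborel. z \<notin> ball (0::real^'n) \<epsilon>"
      by eventually_elim (auto simp: flat_bump_eq_0_iff[OF assms])
    then have "emeasure lborel (ball (0::real^'n) \<epsilon>) = 0"
      by (subst (asm) AE_iff_measurable[where N="ball 0 \<epsilon>"]) auto
    moreover have "ball (0::real^'n) \<epsilon> \<noteq> {}" using assms by auto
    ultimately show False using open_not_negligible[of "ball (0::real^'n) \<epsilon>"]
      by (simp add: negligible_iff_null_sets null_sets_def emeasure_completion)
  qed
  moreover have "(LINT z|lborel. ?f z) \<ge> 0" using nn by simp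
  ultimately show ?thesis by linarith
qed

lemma smooth_cs_mollifier: "\<epsilon> > 0 \<Longrightarrow> smooth_cs (mollifier \<epsilon> :: real^'n \<Rightarrow> real)"
proof -
  assume e: "\<epsilon> > 0"
  let ?c = "inverse (LINT z|lborel. flat 0 (1 - inverse (\<epsilon>\<^sup>2) * ((z::real^'n) \<bullet> z)))"
  have "smooth_cs (\<lambda>z::real^'n. ?c * flat 0 (1 - inverse (\<epsilon>\<^sup>2) * (z \<bullet> z)))"
    using smooth_cs_flat_bump[OF e] unfolding smooth_cs_def by (auto intro!: Ck_mult Ck_const)
  then show ?thesis unfolding mollifier_def[abs_def] by (simp add: divide_inverse mult.commute)
qed

lemma mollifier_nonneg: "\<epsilon> > 0 \<Longrightarrow> 0 \<le> mollifier \<epsilon> z"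
  using flat_bump_integral_pos by (simp add: mollifier_def flat_def less_imp_le)

lemma mollifier_eq_0: "\<epsilon> > 0 \<Longrightarrow> norm z \<ge> \<epsilon> \<Longrightarrow> mollifier \<epsilon> z = 0"
  by (simp add: mollifier_def flat_bump_eq_0_iff)

lemma integral_mollifier: "\<epsilon> > 0 \<Longrightarrow> (LINT z|lborel. mollifier \<epsilon> (z::real^'n)) = 1"
  using flat_bump_integral_pos[of \<epsilon>, where 'n='n] by (simp add: mollifier_def)

section \<open>Approximation in \<open>L\<^sup>2\<close>\<close>

text \<open>The squared \<open>L\<^sup>2\<close> norm as an extended nonnegative integral: limits,
  Fubini and comparison can be used without proving integrability first, and finiteness is a
  separate statement.\<close>

definition nsq :: "('a::euclidean_space) set \<Rightarrow> ('a \<Rightarrow> 'b::real_normed_vector) \<Rightarrow> ennreal" where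
  "nsq A f = (\<integral>\<^sup>+x. ennreal ((norm (f x))\<^sup>2) * indicator A x \<partial>lborel)"

lemma norm_add_sq_le:
  fixes x y :: "'b::real_normed_vector"
  shows "(norm (x + y))\<^sup>2 \<le> 2 * (norm x)\<^sup>2 + 2 * (norm y)\<^sup>2"
proof -
  have "(norm (x + y))\<^sup>2 \<le> (norm x + norm y)\<^sup>2" by (simp add: norm_triangle_ineq power_mono)
  also have "\<dots> \<le> 2 * (norm x)\<^sup>2 + 2 * (norm y)\<^sup>2"
    using sum_squares_bound[of "norm x" "norm y"] by (simp add: power2_sum)
  finally show ?thesis .
qed

text \<open>A quasi-triangle inequality for squares. The factor 2 avoids square roots in
  \<open>ennreal\<close> and does no harm, as it is used only for finiteness, for limits and in
  constants that depend on the dimension.\<close>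

lemma nsq_add:
  fixes f g :: "'a::euclidean_space \<Rightarrow> 'b::euclidean_space"
  assumes [measurable]: "f \<in> borel_measurable borel" "g \<in> borel_measurable borel" "A \<in> sets borel"
  shows "nsq A (\<lambda>x. f x + g x) \<le> 2 * nsq A f + 2 * nsq A g"
proof -
  have "nsq A (\<lambda>x. f x + g x) \<le>
      (\<integral>\<^sup>+x. 2 * (ennreal ((norm (f x))\<^sup>2) * indicator A x) + 2 * (ennreal ((norm (g x))\<^sup>2) * indicator A x) \<partial>lborel)"
    unfolding nsq_def
  proof (rule nn_integral_mono)
    fix x
    have "ennreal ((norm (f x + g x))\<^sup>2) \<le> ennreal (2 * (norm (f x))\<^sup>2 + 2 * (norm (g x))\<^sup>2)"
      by (intro ennreal_leI norm_add_sq_le)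
    also have "\<dots> = 2 * ennreal ((norm (f x))\<^sup>2) + 2 * ennreal ((norm (g x))\<^sup>2)"
      by (simp add: ennreal_plus ennreal_mult)
    finally show "ennreal ((norm (f x + g x))\<^sup>2) * indicator A x
        \<le> 2 * (ennreal ((norm (f x))\<^sup>2) * indicator A x) + 2 * (ennreal ((norm (g x))\<^sup>2) * indicator A x)"
      by (cases "x \<in> A") auto
  qed
  also have "\<dots> = 2 * nsq A f + 2 * nsq A g"
    unfolding nsq_def by (subst nn_integral_add) (auto simp: nn_integral_cmult)
  finally show ?thesis .
qed

lemma nsq_minus: "nsq A (\<lambda>x. - f x) = nsq A f"
  by (simp add: nsq_def)

lemma nsq_diff_commute: "nsq A (\<lambda>x. f x - g x) = nsq A (\<lambda>x. g x - f x)"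
  by (simp add: nsq_def norm_minus_commute)

lemma nsq_triangle:
  fixes f g h :: "'a::euclidean_space \<Rightarrow> 'b::euclidean_space"
  assumes [measurable]: "f \<in> borel_measurable borel" "g \<in> borel_measurable borel"
    "h \<in> borel_measurable borel" "A \<in> sets borel"
  shows "nsq A (\<lambda>x. f x - h x) \<le> 2 * nsq A (\<lambda>x. f x - g x) + 2 * nsq A (\<lambda>x. g x - h x)"
  using nsq_add[of "\<lambda>x. f x - g x" "\<lambda>x. g x - h x" A] by simp

lemma nsq_mono: "(\<And>x. x \<in> A \<Longrightarrow> norm (f x) \<le> norm (g x)) \<Longrightarrow> nsq A f \<le> nsq A g"
  unfolding nsq_def
  by (intro nn_integral_mono) (auto simp: indicator_def intro!: ennreal_leI power_mono)

lemma nsq_mono_set: "A \<subseteq> B \<Longrightarrow> nsq A f \<le> nsq B f"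
  unfolding nsq_def by (intro nn_integral_mono) (auto simp: indicator_def)

lemma nsq_cong: "(\<And>x. x \<in> A \<Longrightarrow> norm (f x) = norm (g x)) \<Longrightarrow> nsq A f = nsq A g"
  by (intro antisym nsq_mono) auto

lemma nsq_cmult:
  assumes "f \<in> borel_measurable borel" "A \<in> sets borel"
  shows "nsq A (\<lambda>x. c *\<^sub>R f x) = ennreal (c\<^sup>2) * nsq A f"
  using assms unfolding nsq_def
  by (subst nn_integral_cmult[symmetric])
     (auto simp: power_mult_distrib ennreal_mult mult.assoc intro!: nn_integral_cong)

lemma nsq_dominated_tendsto:
  fixes f :: "nat \<Rightarrow> 'a::euclidean_space \<Rightarrow> 'b::euclidean_space" and w :: "'a \<Rightarrow> real"
  assumes [measurable]: "\<And>n. f n \<in> borel_measurable borel" "A \<in> sets borel" "w \<in> borel_measurable borel"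
    and dom: "\<And>n. AE x in lborel. x \<in> A \<longrightarrow> norm (f n x) \<le> w x" and w: "nsq A w < \<infinity>"
    and lim: "AE x in lborel. x \<in> A \<longrightarrow> (\<lambda>n. f n x) \<longlonglongrightarrow> 0"
  shows "(\<lambda>n. nsq A (f n)) \<longlonglongrightarrow> 0"
proof -
  have "(\<lambda>n. \<integral>\<^sup>+x. ennreal ((norm (f n x))\<^sup>2) * indicator A x \<partial>lborel) \<longlonglongrightarrow> (\<integral>\<^sup>+(x::'a). 0 \<partial>lborel)"
  proof (rule nn_integral_dominated_convergence[where w="\<lambda>x. ennreal ((w x)\<^sup>2) * indicator A x"])
    show "(\<integral>\<^sup>+x. ennreal ((w x)\<^sup>2) * indicator A x \<partial>lborel) < \<infinity>" using w by (simp add: nsq_def)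
    show "AE x in lborel. ennreal ((norm (f n x))\<^sup>2) * indicator A x \<le> ennreal ((w x)\<^sup>2) * indicator A x" for n
      using dom[of n] by eventually_elim (auto simp: indicator_def intro!: ennreal_leI power_mono)
    show "AE x in lborel. (\<lambda>n. ennreal ((norm (f n x))\<^sup>2) * indicator A x) \<longlonglongrightarrow> 0"
      using lim
    proof eventually_elim
      case (elim x)
      show ?case
      proof (cases "x \<in> A")
        case True
        then have "(\<lambda>n. (norm (f n x))\<^sup>2) \<longlonglongrightarrow> 0" using elim tendsto_norm_zero tendsto_null_power by fastforce
        then have "(\<lambda>n. ennreal ((norm (f n x))\<^sup>2)) \<longlonglongrightarrow> ennreal 0" by (rule tendsto_ennrealI)
        with True show ?thesis by simp
      qed auto
    qed
  qed auto
  then show ?thesis by (simp add: nsq_def)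
qed

definition clip :: "real \<Rightarrow> real \<Rightarrow> real" where "clip M t = max (- M) (min M t)"

lemma clip_measurable [measurable]: "clip M \<in> borel_measurable borel"
  unfolding clip_def[abs_def] by measurable

lemma abs_clip: "M \<ge> 0 \<Longrightarrow> \<bar>clip M t\<bar> \<le> M" "M \<ge> 0 \<Longrightarrow> \<bar>clip M t\<bar> \<le> \<bar>t\<bar>"
  by (auto simp: clip_def)

lemma clip_id: "\<bar>t\<bar> \<le> M \<Longrightarrow> clip M t = t"
  by (auto simp: clip_def)

lemma continuous_clip: "continuous_on UNIV f \<Longrightarrow> continuous_on UNIV (\<lambda>x. clip M (f x))"
  unfolding clip_def by (intro continuous_intros)

text \<open>Two dominated limits. Truncation in height and in space gives a bounded
  \<open>F n\<close> of bounded support; this is an a.e. limit of continuous functions by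
  \<open>measurable_on\<close>, and clipping these at height \<open>n\<close> and cutting them off
  in space provides the majorant.\<close>

lemma L2_dense_continuous:
  fixes f :: "'a::euclidean_space \<Rightarrow> real"
  assumes [measurable]: "f \<in> borel_measurable borel" and fin: "nsq UNIV f < \<infinity>" and e: "e > 0"
  obtains g R where "continuous_on UNIV g" "\<And>x. norm x > R \<Longrightarrow> g x = 0" "nsq UNIV (\<lambda>x. f x - g x) < e"
proof -
  define F where "F n x = clip (real n) (f x) * indicator (cball 0 (real n)) x" for n :: nat and x
  have [measurable]: "cball (0::'a) r \<in> sets borel" for r by simp
  have [measurable]: "F n \<in> borel_measurable borel" for n unfolding F_def[abs_def] by measurable
  have "(\<lambda>n. nsq UNIV (\<lambda>x. f x - F n x)) \<longlonglongrightarrow> 0"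
  proof (rule nsq_dominated_tendsto[where w="\<lambda>x. \<bar>f x\<bar>"])
    show "AE x in lborel. x \<in> UNIV \<longrightarrow> norm (f x - F n x) \<le> \<bar>f x\<bar>" for n
      by (auto simp: F_def clip_def indicator_def)
    show "AE x in lborel. x \<in> UNIV \<longrightarrow> (\<lambda>n. f x - F n x) \<longlonglongrightarrow> 0"
    proof (intro AE_I2 impI)
      fix x :: 'a
      obtain N :: nat where N: "real N \<ge> max \<bar>f x\<bar> (norm x)" using real_arch_simple by blast
      have "f x - F n x = 0" if "n \<ge> N" for n
        using that N by (auto simp: F_def clip_id)
      then show "(\<lambda>n. f x - F n x) \<longlonglongrightarrow> 0"
        by (intro tendsto_eventually) (auto simp: eventually_sequentially)
    qed
  qed (use fin in \<open>auto simp: nsq_def\<close>)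
  then have "\<forall>\<^sub>F n in sequentially. nsq UNIV (\<lambda>x. f x - F n x) < e / 4"
    using e by (intro order_tendstoD(2)) (auto simp: ennreal_zero_less_divide)
  then obtain n where n: "nsq UNIV (\<lambda>x. f x - F n x) < e / 4"
    by (auto simp: eventually_sequentially)
  have "F n measurable_on UNIV"
    by (intro lebesgue_measurable_imp_measurable_on) (auto intro: measurable_completion)
  then obtain N g where N: "negligible N" and g: "\<And>k. continuous_on UNIV (g k)"
    "\<And>x. x \<notin> N \<Longrightarrow> (\<lambda>k. g k x) \<longlonglongrightarrow> F n x"
    unfolding measurable_on_def by auto
  \<comment> \<open>A continuous cutoff that is 1 on the ball carrying \<open>F n\<close>, so that
    it does not disturb the limit, and 0 beyond radius \<open>n + 1\<close>.\<close>
  define c where "c x = max 0 (min 1 (real n + 1 - norm x))" for x :: 'a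
  have c: "0 \<le> c x" "c x \<le> 1" "norm x > real n + 1 \<Longrightarrow> c x = 0" "norm x \<le> real n \<Longrightarrow> c x = 1" for x
    by (auto simp: c_def)
  define H where "H k x = clip (real n) (g k x) * c x" for k x
  have cc: "continuous_on UNIV c" unfolding c_def[abs_def] by (intro continuous_intros)
  have H: "continuous_on UNIV (H k)" for k
    unfolding H_def[abs_def] by (intro continuous_intros continuous_clip g cc)
  have [measurable]: "H k \<in> borel_measurable borel" for k by (intro borel_measurable_continuous_onI H)
  have "(\<lambda>k. nsq UNIV (\<lambda>x. F n x - H k x)) \<longlonglongrightarrow> 0"
  proof (rule nsq_dominated_tendsto[where w="\<lambda>x. 2 * real n * indicator (cball 0 (real n + 1)) x"])
    show "AE x in lborel. x \<in> UNIV \<longrightarrow> norm (F n x - H k x) \<le> 2 * real n * indicator (cball 0 (real n + 1)) x" for k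
    proof (intro AE_I2 impI)
      fix x
      have "\<bar>F n x\<bar> \<le> real n" by (auto simp: F_def indicator_def abs_clip)
      moreover have "\<bar>H k x\<bar> \<le> real n * 1" unfolding H_def abs_mult
        using c[of x] abs_clip(1)[of "real n" "g k x"] by (intro mult_mono) auto
      ultimately show "norm (F n x - H k x) \<le> 2 * real n * indicator (cball 0 (real n + 1)) x"
        using c(3)[of x] by (auto simp: F_def H_def indicator_def)
    qed
    have "(\<integral>\<^sup>+x. ennreal ((norm (2 * real n * indicator (cball (0::'a) (real n + 1)) x))\<^sup>2) * indicator UNIV x \<partial>lborel)
       = (\<integral>\<^sup>+x. ennreal ((2 * real n)\<^sup>2) * indicator (cball (0::'a) (real n + 1)) x \<partial>lborel)"
      by (intro nn_integral_cong) (auto simp: indicator_def)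
    also have "\<dots> < \<infinity>"
      using emeasure_lborel_cball_finite[of "0::'a" "real n + 1"]
      by (simp add: nn_integral_cmult_indicator ennreal_mult_less_top)
    finally show "nsq UNIV (\<lambda>x. 2 * real n * indicator (cball (0::'a) (real n + 1)) x) < \<infinity>"
      by (simp add: nsq_def)
    obtain N' where "N' \<in> null_sets lborel" "N \<subseteq> N'"
      using N unfolding negligible_iff_null_sets null_sets_completion_iff2 by blast
    then have "AE x in lborel. x \<notin> N" by (intro AE_I'[of N']) auto
    then show "AE x in lborel. x \<in> UNIV \<longrightarrow> (\<lambda>k. F n x - H k x) \<longlonglongrightarrow> 0"
    proof eventually_elim
      case (elim x)
      have "(\<lambda>k. clip (real n) (g k x) * c x) \<longlonglongrightarrow> clip (real n) (F n x) * c x"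
        unfolding clip_def by (intro tendsto_intros g(2) elim)
      also have "clip (real n) (F n x) * c x = F n x"
        using c(4)[of x] by (auto simp: F_def indicator_def clip_id abs_clip)
      finally have "(\<lambda>k. F n x - H k x) \<longlonglongrightarrow> F n x - F n x"
        unfolding H_def by (intro tendsto_intros)
      then show ?case by simp
    qed
  qed auto
  then have "\<forall>\<^sub>F k in sequentially. nsq UNIV (\<lambda>x. F n x - H k x) < e / 4"
    using e by (intro order_tendstoD(2)) (auto simp: ennreal_zero_less_divide)
  then obtain k where k: "nsq UNIV (\<lambda>x. F n x - H k x) < e / 4"
    by (auto simp: eventually_sequentially)
  have "nsq UNIV (\<lambda>x. f x - H k x) \<le> 2 * nsq UNIV (\<lambda>x. f x - F n x) + 2 * nsq UNIV (\<lambda>x. F n x - H k x)"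
    by (intro nsq_triangle) auto
  also have "\<dots> < 2 * (e / 4) + 2 * (e / 4)"
    using n k by (intro add_strict_mono ennreal_mult_strict_left_mono) auto
  also have "\<dots> = e"
  proof (cases e)
    case (real r)
    then show ?thesis by (simp add: divide_ennreal ennreal_mult[symmetric] ennreal_plus[symmetric] flip: ennreal_numeral)
  qed (auto simp: ennreal_top_divide)
  finally have "nsq UNIV (\<lambda>x. f x - H k x) < e" .
  then show ?thesis using H[of k] c(3) by (intro that[of "H k" "real n + 1"]) (auto simp: H_def)
qed

section \<open>Translations and mollification in \<open>L\<^sup>2\<close>\<close>

lemma lborel_distr_reflect: "distr lborel borel (\<lambda>z. x - z) = (lborel :: 'a::euclidean_space measure)"
  using lborel_affine[of "-1" x] by (simp add: density_1)

lemma nsq_translate: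
  fixes f :: "'a::euclidean_space \<Rightarrow> 'b::euclidean_space"
  assumes [measurable]: "f \<in> borel_measurable borel"
  shows "nsq UNIV (\<lambda>x. f (x - z)) = nsq UNIV f"
proof -
  have "nsq UNIV f = (\<integral>\<^sup>+x. ennreal ((norm (f x))\<^sup>2) \<partial>distr lborel borel ((+) (- z)))"
    by (simp only: lborel_distr_plus) (simp add: nsq_def)
  also have "\<dots> = nsq UNIV (\<lambda>x. f (x - z))"
    by (subst nn_integral_distr) (auto simp: nsq_def)
  finally show ?thesis ..
qed

text \<open>For a continuous function of bounded support this is uniform continuity on a set of
  finite measure. Density and translation invariance of \<open>nsq\<close> transfer it to
  \<open>f\<close>.\<close>

lemma L2_translation_continuous:
  fixes f :: "real ^ 'n \<Rightarrow> real"
  assumes [measurable]: "f \<in> borel_measurable borel" and fin: "nsq UNIV f < \<infinity>" and e: "e > (0::real)"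
  obtains d where "d > 0" "\<And>z. norm z < d \<Longrightarrow> nsq UNIV (\<lambda>x. f (x - z) - f x) \<le> ennreal e"
proof -
  obtain g R where g: "continuous_on UNIV g" "\<And>x. norm x > R \<Longrightarrow> g x = 0"
    and fg: "nsq UNIV (\<lambda>x. f x - g x) < ennreal (e / 16)"
    using L2_dense_continuous[OF assms(1) fin, of "ennreal (e / 16)"] e by auto
  have [measurable]: "g \<in> borel_measurable borel" by (intro borel_measurable_continuous_onI g)
  define V where "V = measure lborel (cball (0::real^'n) (R + 1))"
  define e' where "e' = sqrt (e / 8 / (V + 1))"
  have V: "V \<ge> 0" by (simp add: V_def)
  have e': "e' > 0" "e'\<^sup>2 * V \<le> e / 8"
  proof -
    show "e' > 0" using e V by (simp add: e'_def)
    have "e'\<^sup>2 * V = e / 8 * (V / (V + 1))" using e V by (simp add: e'_def)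
    also have "\<dots> \<le> e / 8 * 1" using e V by (intro mult_left_mono) auto
    finally show "e'\<^sup>2 * V \<le> e / 8" by simp
  qed
  have uc: "uniformly_continuous_on UNIV g" using g by (rule uniformly_continuous_compact_support)
  have "\<exists>d>0. \<forall>x\<in>UNIV. \<forall>y\<in>UNIV. dist y x < d \<longrightarrow> dist (g y) (g x) < e'"
    using spec[OF uc[unfolded uniformly_continuous_on_def], of e'] e'(1) by simp
  then obtain d where d: "d > 0" "\<And>x y. dist y x < d \<Longrightarrow> dist (g y) (g x) < e'"
    by auto
  show ?thesis
  proof (rule that[of "min d 1"])
    show "min d 1 > 0" using d by simp
    fix z :: "real ^ 'n" assume z: "norm z < min d 1"
    have g3: "nsq UNIV (\<lambda>x. g (x - z) - g x) \<le> ennreal (e / 8)"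
    proof -
      have "nsq UNIV (\<lambda>x. g (x - z) - g x) \<le> (\<integral>\<^sup>+x. ennreal (e'\<^sup>2) * indicator (cball (0::real^'n) (R + 1)) x \<partial>lborel)"
        unfolding nsq_def
      proof (rule nn_integral_mono)
        fix x
        have "\<bar>g (x - z) - g x\<bar> \<le> e'" using d(2)[of "x - z" x] z by (simp add: dist_norm)
        then have "(norm (g (x - z) - g x))\<^sup>2 \<le> e'\<^sup>2" by (intro power_mono) auto
        moreover have "g (x - z) - g x = 0" if "norm x > R + 1"
        proof -
          have "norm (x - z) > R" using that z norm_triangle_ineq2[of x z] by simp
          then show ?thesis using g(2)[of x] g(2)[of "x - z"] that by simp
        qed
        ultimately show "ennreal ((norm (g (x - z) - g x))\<^sup>2) * indicator UNIV x
            \<le> ennreal (e'\<^sup>2) * indicator (cball 0 (R + 1)) x"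
          by (cases "norm x \<le> R + 1") (auto intro: ennreal_leI)
      qed
      also have "\<dots> = ennreal (e'\<^sup>2 * V)"
      proof -
        have "emeasure lborel (cball (0::real^'n) (R + 1)) \<noteq> top"
          using emeasure_lborel_cball_finite[of "0::real^'n" "R + 1"] by simp
        then have "emeasure lborel (cball (0::real^'n) (R + 1)) = ennreal V"
          unfolding V_def by (rule emeasure_eq_ennreal_measure)
        then show ?thesis using V by (simp add: nn_integral_cmult_indicator ennreal_mult)
      qed
      also have "\<dots> \<le> ennreal (e / 8)" using e' by (intro ennreal_leI)
      finally show ?thesis .
    qed
    have "nsq UNIV (\<lambda>x. f (x - z) - f x) \<le> 2 * nsq UNIV (\<lambda>x. f (x - z) - g x) + 2 * nsq UNIV (\<lambda>x. g x - f x)"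
      by (rule nsq_triangle[of "\<lambda>x. f (x - z)" g f]) measurable
    also have "\<dots> \<le> 2 * (2 * nsq UNIV (\<lambda>x. f (x - z) - g (x - z)) + 2 * nsq UNIV (\<lambda>x. g (x - z) - g x))
        + 2 * nsq UNIV (\<lambda>x. g x - f x)"
    proof -
      have "nsq UNIV (\<lambda>x. f (x - z) - g x)
          \<le> 2 * nsq UNIV (\<lambda>x. f (x - z) - g (x - z)) + 2 * nsq UNIV (\<lambda>x. g (x - z) - g x)"
        by (rule nsq_triangle[of "\<lambda>x. f (x - z)" "\<lambda>x. g (x - z)" g]) measurable
      then show ?thesis by (intro add_mono mult_left_mono) simp_all
    qed
    also have "\<dots> \<le> 2 * (2 * ennreal (e / 16) + 2 * ennreal (e / 8)) + 2 * ennreal (e / 16)"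
    proof -
      have "nsq UNIV (\<lambda>x. f (x - z) - g (x - z)) \<le> ennreal (e / 16)"
        using fg nsq_translate[of "\<lambda>x. f x - g x" z] by simp
      moreover have "nsq UNIV (\<lambda>x. g x - f x) \<le> ennreal (e / 16)"
        using fg nsq_diff_commute[of UNIV g f] by simp
      ultimately show ?thesis using g3 by (intro add_mono mult_left_mono) simp_all
    qed
    \<comment> \<open>The total is 7/8 of \<open>e\<close>; the shares 1/16 and 1/8 chosen above
      allow for the factor 2 of the two nested uses of \<open>nsq_triangle\<close>.\<close>
    also have "\<dots> = ennreal (2 * (2 * (e/16) + 2 * (e/8)) + 2 * (e/16))"
    proof -
      have two: "2 * ennreal x = ennreal (2 * x)" if "x \<ge> 0" for x
        using that by (simp add: ennreal_mult)
      show ?thesis using e by (simp add: two flip: ennreal_plus)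
    qed
    also have "\<dots> \<le> ennreal e" using e by (intro ennreal_leI) simp
    finally show "nsq UNIV (\<lambda>x. f (x - z) - f x) \<le> ennreal e" .
  qed
qed

text \<open>Reflection \<open>y = x - z\<close> under Lebesgue measure. In the non-measurable case
  both integrands fail to be integrable and both integrals are 0 by convention, so the identity is
  unconditional.\<close>

lemma conv_eq_translate:
  "conv f K x = (LINT z|lborel. f (x - z) * K z)"
proof (cases "(\<lambda>y. f y * K (x - y)) \<in> borel_measurable borel")
  case True
  have "conv f K x = (LINT y|distr lborel borel (\<lambda>z. x - z). f y * K (x - y))"
    by (simp add: conv_def lborel_distr_reflect)
  also have "\<dots> = (LINT z|lborel. f (x - z) * K z)"
    using True by (subst integral_distr) auto
  finally show ?thesis .
next
  case False
  have "(\<lambda>z. f (x - z) * K z) \<notin> borel_measurable borel"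
  proof
    assume [measurable]: "(\<lambda>z. f (x - z) * K z) \<in> borel_measurable borel"
    have "(\<lambda>y. (\<lambda>z. f (x - z) * K z) (x - y)) \<in> borel_measurable borel" by measurable
    with False show False by simp
  qed
  then have "\<not> integrable lborel (\<lambda>z. f (x - z) * K z)"
    by (auto dest: borel_measurable_integrable)
  moreover have "\<not> integrable lborel (\<lambda>y. f y * K (x - y))"
    using False by (auto dest: borel_measurable_integrable)
  ultimately show ?thesis by (simp add: conv_def not_integrable_integral_eq)
qed

text \<open>The kernel is a probability density: split it as the product of two square roots, apply
  Cauchy--Schwarz, and use that one of the two resulting integrals is 1. If the integrand on the
  left is not integrable, the left-hand side is 0.\<close>

lemma mollifier_Jensen:
  fixes h :: "real ^ 'n \<Rightarrow> real"
  assumes [measurable]: "h \<in> borel_measurable borel" and e: "\<epsilon> > 0"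
  shows "ennreal ((LINT z|lborel. h z * mollifier \<epsilon> z)\<^sup>2)
    \<le> (\<integral>\<^sup>+z. ennreal ((h z)\<^sup>2) * ennreal (mollifier \<epsilon> z) \<partial>lborel)"
proof -
  let ?m = "mollifier \<epsilon> :: real ^ 'n \<Rightarrow> real"
  have [measurable]: "?m \<in> borel_measurable borel"
    by (intro borel_measurable_continuous_onI smooth_cs_continuous smooth_cs_mollifier e)
  have m0: "?m z \<ge> 0" for z by (rule mollifier_nonneg[OF e])
  have m1: "(\<integral>\<^sup>+z. ennreal (?m z) \<partial>lborel) = 1"
    using m0 by (subst nn_integral_eq_integral[OF smooth_cs_integrable[OF smooth_cs_mollifier[OF e]]])
      (auto simp: integral_mollifier[OF e])
  have "ennreal \<bar>LINT z|lborel. h z * ?m z\<bar> \<le> (\<integral>\<^sup>+z. ennreal (norm (h z * ?m z)) \<partial>lborel)"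
    using integral_norm_bound_ennreal[of lborel "\<lambda>z. h z * ?m z"]
    by (cases "integrable lborel (\<lambda>z. h z * ?m z)") (auto simp: not_integrable_integral_eq)
  also have "\<dots> = (\<integral>\<^sup>+z. ennreal (\<bar>h z\<bar> * sqrt (?m z)) * ennreal (sqrt (?m z)) \<partial>lborel)"
    using m0 by (intro nn_integral_cong) (simp add: abs_mult mult.assoc flip: ennreal_mult)
  finally have "(ennreal \<bar>LINT z|lborel. h z * ?m z\<bar>)\<^sup>2
      \<le> (\<integral>\<^sup>+z. ennreal (\<bar>h z\<bar> * sqrt (?m z)) * ennreal (sqrt (?m z)) \<partial>lborel)\<^sup>2"
    by (simp add: power_mono)
  also have "\<dots> \<le> (\<integral>\<^sup>+z. (ennreal (\<bar>h z\<bar> * sqrt (?m z)))\<^sup>2 \<partial>lborel) * (\<integral>\<^sup>+z. (ennreal (sqrt (?m z)))\<^sup>2 \<partial>lborel)"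
    by (rule Cauchy_Schwarz_nn_integral) auto
  also have "\<dots> = (\<integral>\<^sup>+z. ennreal ((h z)\<^sup>2) * ennreal (?m z) \<partial>lborel)"
    using m0 m1 by (simp add: ennreal_power power_mult_distrib ennreal_mult)
  finally show ?thesis by (simp add: ennreal_power)
qed

text \<open>The error is an average of the differences \<open>f (x - z) - f x\<close> over
  \<open>z\<close> in the support of the kernel. Jensen and Fubini bound its norm by the worst
  translation error at distance below \<open>\<epsilon>\<close>.\<close>

lemma conv_mollifier_L2:
  fixes f :: "real ^ 'n \<Rightarrow> real"
  assumes [measurable]: "f \<in> borel_measurable borel" and f: "integrable lborel f"
    and fin: "nsq UNIV f < \<infinity>" and e: "e > (0::real)"
  obtains d where "d > 0" "\<And>\<epsilon>. 0 < \<epsilon> \<Longrightarrow> \<epsilon> \<le> d \<Longrightarrow> nsq UNIV (\<lambda>x. conv f (mollifier \<epsilon>) x - f x) \<le> ennreal e"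
proof -
  obtain d where d: "d > 0" "\<And>z. norm z < d \<Longrightarrow> nsq UNIV (\<lambda>x. f (x - z) - f x) \<le> ennreal e"
    using L2_translation_continuous[OF assms(1) fin e] by blast
  show ?thesis
  proof (rule that[OF d(1)])
    fix \<epsilon> :: real assume \<epsilon>: "0 < \<epsilon>" "\<epsilon> \<le> d"
    let ?m = "mollifier \<epsilon> :: real ^ 'n \<Rightarrow> real"
    have [measurable]: "?m \<in> borel_measurable borel"
      by (intro borel_measurable_continuous_onI smooth_cs_continuous smooth_cs_mollifier \<epsilon>)
    have im: "integrable lborel ?m" by (rule smooth_cs_integrable[OF smooth_cs_mollifier[OF \<epsilon>(1)]])
    have m0: "?m z \<ge> 0" for z by (rule mollifier_nonneg[OF \<epsilon>(1)])
    have m1: "(\<integral>\<^sup>+z. ennreal (?m z) \<partial>lborel) = 1"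
      using m0 by (subst nn_integral_eq_integral[OF im]) (auto simp: integral_mollifier[OF \<epsilon>(1)])
    have eq: "conv f ?m x - f x = (LINT z|lborel. (f (x - z) - f x) * ?m z)" for x
    proof -
      have "integrable lborel (\<lambda>y. f y * ?m (x - y))"
        by (rule conv_integrable[OF f smooth_cs_mollifier[OF \<epsilon>(1)]])
      then have "integrable (distr lborel borel (\<lambda>z. x - z)) (\<lambda>y. f y * ?m (x - y))"
        by (simp add: lborel_distr_reflect)
      then have "integrable lborel (\<lambda>z. f (x - z) * ?m z)"
        by (subst (asm) integrable_distr_eq) auto
      then have "(LINT z|lborel. (f (x - z) - f x) * ?m z) = (LINT z|lborel. f (x - z) * ?m z) - (LINT z|lborel. f x * ?m z)"
        using im by (simp add: left_diff_distrib)
      then show ?thesis by (simp add: conv_eq_translate integral_mollifier[OF \<epsilon>(1)])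
    qed
    have "nsq UNIV (\<lambda>x. conv f ?m x - f x)
        \<le> (\<integral>\<^sup>+x. (\<integral>\<^sup>+z. ennreal ((f (x - z) - f x)\<^sup>2) * ennreal (?m z) \<partial>lborel) \<partial>lborel)"
      unfolding nsq_def eq
    proof (rule nn_integral_mono)
      fix x
      have "(\<lambda>z. f (x - z) - f x) \<in> borel_measurable borel" by measurable
      from mollifier_Jensen[OF this \<epsilon>(1)]
      show "ennreal ((norm (LINT z|lborel. (f (x - z) - f x) * ?m z))\<^sup>2) * indicator UNIV x
        \<le> (\<integral>\<^sup>+z. ennreal ((f (x - z) - f x)\<^sup>2) * ennreal (?m z) \<partial>lborel)" by simp
    qed
    also have "\<dots> = (\<integral>\<^sup>+z. (\<integral>\<^sup>+x. ennreal ((f (x - z) - f x)\<^sup>2) * ennreal (?m z) \<partial>lborel) \<partial>lborel)"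
      by (rule lborel_pair.Fubini') measurable
    also have "\<dots> = (\<integral>\<^sup>+z. nsq UNIV (\<lambda>x. f (x - z) - f x) * ennreal (?m z) \<partial>lborel)"
      by (simp add: nsq_def nn_integral_multc)
    also have "\<dots> \<le> (\<integral>\<^sup>+z. ennreal e * ennreal (?m z) \<partial>lborel)"
    proof (rule nn_integral_mono)
      fix z
      show "nsq UNIV (\<lambda>x. f (x - z) - f x) * ennreal (?m z) \<le> ennreal e * ennreal (?m z)"
        using d(2)[of z] mollifier_eq_0[OF \<epsilon>(1), of z] \<epsilon>
        by (cases "norm z < \<epsilon>") (auto intro!: mult_right_mono)
    qed
    also have "\<dots> = ennreal e" using m1 by (simp add: nn_integral_cmult)
    finally show "nsq UNIV (\<lambda>x. conv f ?m x - f x) \<le> ennreal e" .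
  qed
qed

section \<open>Weak gradients\<close>

lemma AE_completion_iff: "(AE x in completion M. P x) \<longleftrightarrow> (AE x in M. P x)"
proof
  assume "AE x in completion M. P x"
  then obtain N where "{x \<in> space M. \<not> P x} \<subseteq> N" "N \<in> null_sets (completion M)"
    unfolding eventually_ae_filter by auto
  then obtain N' where "N' \<in> null_sets M" "{x \<in> space M. \<not> P x} \<subseteq> N'"
    unfolding null_sets_completion_iff2 by blast
  then show "AE x in M. P x" unfolding eventually_ae_filter by blast
qed (rule AE_completion)

lemma AE_lebesgue_on_iff:
  fixes \<Omega> :: "'a::euclidean_space set"
  assumes "\<Omega> \<in> sets borel"
  shows "(AE x in lebesgue_on \<Omega>. P x) \<longleftrightarrow> (AE x in lborel. x \<in> \<Omega> \<longrightarrow> P x)"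
  using assms by (subst AE_restrict_space_iff) (auto simp: AE_completion_iff)

text \<open>The notions of the theorem live on \<open>lebesgue_on \<Omega>\<close>. From here on
  they are replaced by Borel functions that vanish off \<open>\<Omega>\<close>, for which
  translation, reflection and product measures are directly available.\<close>

lemma borel_representative:
  fixes f :: "'a::euclidean_space \<Rightarrow> real"
  assumes f: "f \<in> borel_measurable (lebesgue_on \<Omega>)" and \<Omega>[measurable]: "\<Omega> \<in> sets borel"
  obtains g where "g \<in> borel_measurable borel" "\<And>x. x \<notin> \<Omega> \<Longrightarrow> g x = 0"
    "AE x in lborel. x \<in> \<Omega> \<longrightarrow> f x = g x"
proof -
  have "(\<lambda>x. if x \<in> \<Omega> then f x else 0) \<in> borel_measurable (completion lborel)"
    using f by (intro borel_measurable_if_I) auto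
  then obtain g where g: "g \<in> borel_measurable lborel" "AE x in lborel. (if x \<in> \<Omega> then f x else 0) = g x"
    using completion_ex_borel_measurable_real by blast
  have [measurable]: "g \<in> borel_measurable borel" using g(1) by simp
  show ?thesis
  proof (rule that[of "\<lambda>x. if x \<in> \<Omega> then g x else 0"])
    show "AE x in lborel. x \<in> \<Omega> \<longrightarrow> f x = (if x \<in> \<Omega> then g x else 0)"
      using g(2) by eventually_elim auto
  qed auto
qed

lemma measurable_lebesgue_on_AE:
  fixes f g :: "'a::euclidean_space \<Rightarrow> real"
  assumes g[measurable]: "g \<in> borel_measurable borel" and \<Omega>[measurable]: "\<Omega> \<in> sets borel"
    and ae: "AE x in lborel. x \<in> \<Omega> \<longrightarrow> f x = g x"
  shows "f \<in> borel_measurable (lebesgue_on \<Omega>)"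
proof -
  have [measurable]: "\<Omega> \<in> sets (completion lborel)" using \<Omega> by simp
  have "(\<lambda>x. if x \<in> \<Omega> then g x else 0) \<in> borel_measurable (completion lborel)"
    by (intro measurable_completion) simp
  moreover have "AE x in completion lborel. (if x \<in> \<Omega> then g x else 0) = (if x \<in> \<Omega> then f x else 0)"
    using AE_completion[OF ae] by eventually_elim auto
  ultimately have "(\<lambda>x. if x \<in> \<Omega> then f x else 0) \<in> borel_measurable (completion lborel)"
    by (rule borel_measurable_AE)
  then show ?thesis by (rule borel_measurable_if_D)
qed

lemma lebesgue_on_eq_lborel:
  fixes f g :: "'a::euclidean_space \<Rightarrow> real"
  assumes g[measurable]: "g \<in> borel_measurable borel" and \<Omega>[measurable]: "\<Omega> \<in> sets borel"
    and ae: "AE x in lborel. x \<in> \<Omega> \<longrightarrow> f x = g x"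
  shows "(LINT x|lebesgue_on \<Omega>. f x) = (LINT x|lborel. indicator \<Omega> x * g x)"
    and "integrable (lebesgue_on \<Omega>) f \<longleftrightarrow> integrable lborel (\<lambda>x. indicator \<Omega> x * g x)"
proof -
  have [measurable]: "f \<in> borel_measurable (lebesgue_on \<Omega>)"
    using g \<Omega> ae by (rule measurable_lebesgue_on_AE)
  have gm [measurable]: "g \<in> borel_measurable (lebesgue_on \<Omega>)"
    by (intro measurable_restrict_space1 measurable_completion) simp
  have "AE x in lebesgue_on \<Omega>. f x = g x" using ae by (simp add: AE_lebesgue_on_iff)
  then have 1: "(LINT x|lebesgue_on \<Omega>. f x) = (LINT x|lebesgue_on \<Omega>. g x)"
    by (intro integral_cong_AE) auto
  have 2: "integrable (lebesgue_on \<Omega>) f \<longleftrightarrow> integrable (lebesgue_on \<Omega>) g"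
    by (rule Bochner_Integration.integrable_cong_AE) (use \<open>AE x in lebesgue_on \<Omega>. f x = g x\<close> in auto)
  show "(LINT x|lebesgue_on \<Omega>. f x) = (LINT x|lborel. indicator \<Omega> x * g x)"
    unfolding 1 using \<Omega> by (subst integral_restrict_space) (auto simp: integral_completion)
  show "integrable (lebesgue_on \<Omega>) f \<longleftrightarrow> integrable lborel (\<lambda>x. indicator \<Omega> x * g x)"
    unfolding 2 using \<Omega> by (subst integrable_restrict_space) (auto simp: integrable_completion)
qed

lemma nsq_finite_iff_integrable:
  fixes f :: "'a::euclidean_space \<Rightarrow> real"
  assumes [measurable]: "f \<in> borel_measurable borel" "A \<in> sets borel"
  shows "nsq A f < \<infinity> \<longleftrightarrow> integrable lborel (\<lambda>x. indicator A x * (f x)\<^sup>2)"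
  unfolding integrable_iff_bounded nsq_def
  by (auto simp: indicator_def intro!: arg_cong[where f="\<lambda>x. x < top"] nn_integral_cong)

lemma nsq_UNIV_eq: "(\<And>x. x \<notin> A \<Longrightarrow> f x = 0) \<Longrightarrow> nsq UNIV f = nsq A f"
  unfolding nsq_def by (intro nn_integral_cong) (auto simp: indicator_def)

text \<open>On a set of finite measure the majorant is the square of \<open>f\<close> plus
  1.\<close>

lemma L2_imp_integrable:
  fixes f :: "'a::euclidean_space \<Rightarrow> real"
  assumes [measurable]: "f \<in> borel_measurable borel" and fin: "nsq UNIV f < \<infinity>"
    and z: "\<And>x. x \<notin> A \<Longrightarrow> f x = 0" and A: "emeasure lborel A < \<infinity>" and [measurable]: "A \<in> sets borel"
  shows "integrable lborel f"
proof (rule Bochner_Integration.integrable_bound)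
  show "integrable lborel (\<lambda>x. (f x)\<^sup>2 + indicator A x)"
    using fin A nsq_finite_iff_integrable[of f UNIV] by (intro Bochner_Integration.integrable_add) auto
  have "\<bar>f x\<bar> \<le> (f x)\<^sup>2 + indicator A x" for x
  proof (cases "x \<in> A")
    case True
    have "2 * \<bar>f x\<bar> * 1 \<le> \<bar>f x\<bar>\<^sup>2 + 1\<^sup>2" by (rule sum_squares_bound)
    then show ?thesis using True by simp
  qed (use z in simp)
  then show "AE x in lborel. norm (f x) \<le> norm ((f x)\<^sup>2 + indicator A x)" by (intro AE_I2) force
qed auto

section \<open>Test functions, and mollifiers as test functions\<close>

lemma test_functions_smooth_cs: "\<phi> \<in> test_functions \<Omega> \<Longrightarrow> smooth_cs \<phi>"
proof -
  assume a: "\<phi> \<in> test_functions \<Omega>"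
  then have "bounded {x. \<phi> x \<noteq> 0}"
    unfolding test_functions_def using compact_imp_bounded bounded_subset closure_subset by blast
  then obtain R where "\<And>x. \<phi> x \<noteq> 0 \<Longrightarrow> norm x \<le> R" unfolding bounded_iff by auto
  then have "\<exists>R. \<forall>x. norm x > R \<longrightarrow> \<phi> x = 0" by (metis not_le)
  with a show ?thesis unfolding smooth_cs_def test_functions_def by auto
qed

lemma partial_deriv_eq_0:
  assumes "open S" "x \<in> S" "\<And>y. y \<in> S \<Longrightarrow> \<phi> y = 0"
  shows "partial_deriv i \<phi> x = 0"
proof -
  have "((\<lambda>x. 0) has_derivative (\<lambda>h. 0)) (at x)" by simp
  then have "(\<phi> has_derivative (\<lambda>h. 0)) (at x)"
    by (rule has_derivative_transform_within_open[OF _ assms(1,2)]) (use assms in auto)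
  then show ?thesis by (rule partial_derivI)
qed

lemma test_function_zero_outside:
  assumes "\<phi> \<in> test_functions \<Omega>" "x \<notin> \<Omega>"
  shows "\<phi> x = 0" "partial_deriv i \<phi> x = 0"
proof -
  have c: "closure {x. \<phi> x \<noteq> 0} \<subseteq> \<Omega>" using assms(1) by (auto simp: test_functions_def)
  have s: "y \<in> closure {x. \<phi> x \<noteq> 0}" if "\<phi> y \<noteq> 0" for y
    using that closure_subset[of "{x. \<phi> x \<noteq> 0}"] by auto
  show "\<phi> x = 0" using assms(2) c s[of x] by auto
  show "partial_deriv i \<phi> x = 0"
  proof (rule partial_deriv_eq_0)
    show "open (- closure {x. \<phi> x \<noteq> 0})" by auto
    show "x \<in> - closure {x. \<phi> x \<noteq> 0}" using c assms(2) by auto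
    show "\<phi> y = 0" if "y \<in> - closure {x. \<phi> x \<noteq> 0}" for y using that s[of y] by auto
  qed
qed

lemma mollifier_reflect_Ck:
  "Ck k (\<lambda>y. mollifier \<epsilon> (x - y) :: real)" for x :: "real ^ 'n"
proof -
  let ?c = "inverse (LINT z|lborel. flat 0 (1 - inverse (\<epsilon>\<^sup>2) * ((z::real^'n) \<bullet> z)))"
  have "(\<lambda>y. mollifier \<epsilon> (x - y)) = (\<lambda>y. ?c * flat 0 (1 - inverse (\<epsilon>\<^sup>2) * ((y - x) \<bullet> (y - x))))"
    by (rule ext) (simp add: mollifier_def divide_inverse inner_diff_left inner_diff_right inner_commute algebra_simps)
  moreover have "Ck k (\<lambda>y. ?c * flat 0 (1 - inverse (\<epsilon>\<^sup>2) * ((y - x) \<bullet> (y - x))))"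
    by (intro Ck_mult Ck_const Ck_flat)
  ultimately show ?thesis by simp
qed

lemma mollifier_test_function:
  fixes x :: "real ^ 'n"
  assumes e: "\<epsilon> > 0" and sub: "cball x \<epsilon> \<subseteq> \<Omega>"
  shows "(\<lambda>y. mollifier \<epsilon> (x - y)) \<in> test_functions \<Omega>"
proof -
  have "{y. mollifier \<epsilon> (x - y) \<noteq> 0} \<subseteq> cball x \<epsilon>"
    using mollifier_eq_0[OF e] by (force simp: dist_norm not_le)
  then have c: "closure {y. mollifier \<epsilon> (x - y) \<noteq> 0} \<subseteq> cball x \<epsilon>"
    by (simp add: closure_minimal)
  then have "compact (closure {y. mollifier \<epsilon> (x - y) \<noteq> 0})"
    using bounded_subset compact_eq_bounded_closed by blast
  with c sub show ?thesis unfolding test_functions_def by (auto simp: mollifier_reflect_Ck)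
qed

lemma partial_deriv_reflect:
  assumes "smooth_cs K"
  shows "partial_deriv i (\<lambda>y. K (x - y)) y = - partial_deriv i K (x - y)"
proof -
  have "((\<lambda>y. x - y) has_derivative (\<lambda>h. - h)) (at y)" by (auto intro!: derivative_eq_intros)
  from has_derivative_compose[OF this smooth_cs_derivative[OF assms]]
  have "((\<lambda>y. K (x - y)) has_derivative (\<lambda>h. grad_cs K (x - y) \<bullet> (- h))) (at y)" .
  from partial_derivI[OF this, of i] show ?thesis by (simp add: inner_axis)
qed

text \<open>Extending both functions by zero off \<open>\<Omega>\<close> turns all integrals into Lebesgue integrals over the whole space.\<close>

definition wgrad :: "(real ^ 'n) set \<Rightarrow> (real ^ 'n \<Rightarrow> real) \<Rightarrow> (real ^ 'n \<Rightarrow> real ^ 'n) \<Rightarrow> bool" where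
  "wgrad \<Omega> u G \<longleftrightarrow> u \<in> borel_measurable borel \<and> G \<in> borel_measurable borel \<and>
     nsq UNIV u < \<infinity> \<and> nsq UNIV G < \<infinity> \<and> (\<forall>x. x \<notin> \<Omega> \<longrightarrow> u x = 0 \<and> G x = 0) \<and>
     (\<forall>\<phi>\<in>test_functions \<Omega>. \<forall>i. (LINT x|lborel. u x * partial_deriv i \<phi> x) = - (LINT x|lborel. G x $ i * \<phi> x))"

text \<open>The reflected kernel centred at \<open>x\<close> is an admissible test function because
  its closed support ball lies in \<open>\<Omega>\<close>. The sign from the reflection cancels the
  sign in the definition of the weak gradient.\<close>

lemma conv_partial_mollifier:
  fixes u :: "real ^ 'n \<Rightarrow> real"
  assumes w: "wgrad \<Omega> u G" and e: "\<epsilon> > 0" and sub: "cball x \<epsilon> \<subseteq> \<Omega>"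
  shows "conv u (partial_deriv i (mollifier \<epsilon>)) x = conv (\<lambda>y. G y $ i) (mollifier \<epsilon>) x"
proof -
  let ?\<phi> = "\<lambda>y. mollifier \<epsilon> (x - y)"
  have "(LINT y|lborel. u y * partial_deriv i ?\<phi> y) = - (LINT y|lborel. G y $ i * ?\<phi> y)"
    using w mollifier_test_function[OF e sub] unfolding wgrad_def by blast
  then show ?thesis
    unfolding conv_def by (simp add: partial_deriv_reflect[OF smooth_cs_mollifier[OF e]])
qed

lemma nsq_nth_le: "nsq A (\<lambda>x. G x $ i) \<le> nsq A G"
  by (rule nsq_mono) (rule Finite_Cartesian_Product.norm_nth_le)

lemma measurable_vec_nth [measurable (raw)]:
  fixes G :: "'a \<Rightarrow> real ^ 'n"
  assumes "G \<in> borel_measurable M" shows "(\<lambda>x. G x $ i) \<in> borel_measurable M"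
  using borel_measurable_continuous_onI[OF linear_continuous_on[OF bounded_linear_vec_nth[of i], of UNIV]] assms
  by (rule measurable_compose[rotated])

lemma nsq_eq_sum_nth:
  fixes G :: "'a::euclidean_space \<Rightarrow> real ^ 'n"
  assumes [measurable]: "G \<in> borel_measurable borel" "A \<in> sets borel"
  shows "nsq A G = (\<Sum>i\<in>UNIV. nsq A (\<lambda>x. G x $ i))"
proof -
  have eq: "ennreal ((norm (G x))\<^sup>2) = (\<Sum>i\<in>UNIV. ennreal ((G x $ i)\<^sup>2))" for x
    by (simp add: norm_vec_def L2_set_def sum_nonneg)
  have "nsq A G = (\<integral>\<^sup>+x. (\<Sum>i\<in>UNIV. ennreal ((norm (G x $ i))\<^sup>2) * indicator A x) \<partial>lborel)"
    unfolding nsq_def eq by (simp only: sum_distrib_right real_norm_def power2_abs)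
  also have "\<dots> = (\<Sum>i\<in>UNIV. nsq A (\<lambda>x. G x $ i))"
    unfolding nsq_def by (rule nn_integral_sum) measurable
  finally show ?thesis .
qed

lemma borel_measurable_vec_lambda [measurable (raw)]:
  fixes g :: "'n::finite \<Rightarrow> 'a \<Rightarrow> real"
  assumes "\<And>i. g i \<in> borel_measurable M" shows "(\<lambda>x. \<chi> i. g i x) \<in> borel_measurable M"
  unfolding borel_measurable_euclidean_space[of "\<lambda>x. \<chi> i. g i x"]
  using assms by (auto simp: Basis_vec_def inner_axis)

lemma wgrad_integrable:
  fixes u :: "real ^ 'n \<Rightarrow> real"
  assumes w: "wgrad \<Omega> u G" and "bounded \<Omega>" "\<Omega> \<in> sets borel"
  shows "integrable lborel u" "integrable lborel (\<lambda>x. G x $ i)"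
proof -
  have fin: "emeasure lborel \<Omega> < \<infinity>" using emeasure_bounded_finite[OF assms(2)] by simp
  show "integrable lborel u"
    by (rule L2_imp_integrable[of _ \<Omega>]) (use w assms fin in \<open>auto simp: wgrad_def\<close>)
  have "nsq UNIV (\<lambda>x. G x $ i) < \<infinity>"
    using nsq_nth_le[of UNIV G i] w by (auto simp: wgrad_def elim: le_less_trans)
  then show "integrable lborel (\<lambda>x. G x $ i)"
    by (intro L2_imp_integrable[of _ \<Omega>]) (use w assms fin in \<open>auto simp: wgrad_def\<close>)
qed

lemma grad_conv_mollifier_measurable [measurable]:
  fixes u :: "real ^ 'n \<Rightarrow> real"
  assumes "integrable lborel u" "\<epsilon> > 0"
  shows "conv u (mollifier \<epsilon>) \<in> borel_measurable borel"
    "conv u (partial_deriv i (mollifier \<epsilon>)) \<in> borel_measurable borel"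
  using Ck_conv[OF assms(1) smooth_cs_mollifier[OF assms(2)], of 0]
    Ck_conv[OF assms(1) smooth_cs_partial_deriv[OF smooth_cs_mollifier[OF assms(2)]], of 0]
  by (auto intro: borel_measurable_continuous_onI)

text \<open>The functions converge everywhere, the gradients only on a set \<open>B\<close> that
  keeps distance \<open>r\<close> from the complement of \<open>\<Omega>\<close>: closer to the
  boundary the derivative of the convolution is no longer the mollified weak gradient.\<close>

lemma wgrad_mollify:
  fixes u :: "real ^ 'n \<Rightarrow> real"
  assumes w: "wgrad \<Omega> u G" and \<Omega>: "bounded \<Omega>" "\<Omega> \<in> sets borel" and B[measurable]: "B \<in> sets borel"
    and r: "r > 0" and sub: "\<And>x. x \<in> B \<Longrightarrow> cball x r \<subseteq> \<Omega>" and e: "e > (0::real)"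
  obtains \<epsilon> where "0 < \<epsilon>" "\<epsilon> \<le> r"
    "nsq UNIV (\<lambda>x. conv u (mollifier \<epsilon>) x - u x) \<le> ennreal e"
    "nsq B (\<lambda>x. (\<chi> i. conv u (partial_deriv i (mollifier \<epsilon>)) x) - G x) \<le> ennreal e"
proof -
  note int = wgrad_integrable[OF w \<Omega>]
  have [measurable]: "u \<in> borel_measurable borel" "G \<in> borel_measurable borel" using w by (auto simp: wgrad_def)
  have fu: "nsq UNIV u < \<infinity>" using w by (auto simp: wgrad_def)
  have fG: "nsq UNIV (\<lambda>x. G x $ i) < \<infinity>" for i
    using nsq_nth_le[of UNIV G i] w by (auto simp: wgrad_def elim: le_less_trans)
  define e' where "e' = e / real CARD('n)"
  have e': "e' > 0" using e by (simp add: e'_def)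
  obtain d0 where d0: "d0 > 0" "\<And>\<epsilon>. 0 < \<epsilon> \<Longrightarrow> \<epsilon> \<le> d0 \<Longrightarrow> nsq UNIV (\<lambda>x. conv u (mollifier \<epsilon>) x - u x) \<le> ennreal e"
    using conv_mollifier_L2[OF _ int(1) fu e] by auto
  have "\<exists>d>0. \<forall>\<epsilon>. 0 < \<epsilon> \<longrightarrow> \<epsilon> \<le> d \<longrightarrow> nsq UNIV (\<lambda>x. conv (\<lambda>x. G x $ i) (mollifier \<epsilon>) x - G x $ i) \<le> ennreal e'" for i
  proof -
    have "(\<lambda>x. G x $ i) \<in> borel_measurable borel" by measurable
    from conv_mollifier_L2[OF this int(2) fG e'] show ?thesis by metis
  qed
  then obtain d where d: "\<And>i. d i > 0"
    "\<And>i \<epsilon>. 0 < \<epsilon> \<Longrightarrow> \<epsilon> \<le> d i \<Longrightarrow> nsq UNIV (\<lambda>x. conv (\<lambda>x. G x $ i) (mollifier \<epsilon>) x - G x $ i) \<le> ennreal e'"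
    by metis
  define \<epsilon> where "\<epsilon> = min (min r d0) (Min (range d))"
  have \<epsilon>: "0 < \<epsilon>" "\<epsilon> \<le> r" "\<epsilon> \<le> d0" using r d0 d by (auto simp: \<epsilon>_def)
  have \<epsilon>d: "\<epsilon> \<le> d i" for i
  proof -
    have "\<epsilon> \<le> Min (range d)" by (simp add: \<epsilon>_def)
    also have "\<dots> \<le> d i" by (rule Min_le) auto
    finally show ?thesis .
  qed
  note [measurable] = grad_conv_mollifier_measurable[OF int(1) \<epsilon>(1)]
  show ?thesis
  proof (rule that[OF \<epsilon>(1,2) d0(2)[OF \<epsilon>(1,3)]])
    have "nsq B (\<lambda>x. (\<chi> i. conv u (partial_deriv i (mollifier \<epsilon>)) x) - G x)
        = (\<Sum>i\<in>UNIV. nsq B (\<lambda>x. conv u (partial_deriv i (mollifier \<epsilon>)) x - G x $ i))"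
      by (subst nsq_eq_sum_nth) auto
    also have "\<dots> \<le> (\<Sum>i\<in>(UNIV::'n set). ennreal e')"
    proof (rule sum_mono)
      fix i
      have "nsq B (\<lambda>x. conv u (partial_deriv i (mollifier \<epsilon>)) x - G x $ i)
          = nsq B (\<lambda>x. conv (\<lambda>x. G x $ i) (mollifier \<epsilon>) x - G x $ i)"
      proof (rule nsq_cong)
        fix x assume "x \<in> B"
        then have "cball x \<epsilon> \<subseteq> \<Omega>" using sub[of x] \<epsilon>(2) by (meson subset_cball subset_trans)
        then show "norm (conv u (partial_deriv i (mollifier \<epsilon>)) x - G x $ i)
            = norm (conv (\<lambda>x. G x $ i) (mollifier \<epsilon>) x - G x $ i)"
          using conv_partial_mollifier[OF w \<epsilon>(1)] by simp
      qed
      also have "\<dots> \<le> nsq UNIV (\<lambda>x. conv (\<lambda>x. G x $ i) (mollifier \<epsilon>) x - G x $ i)" by (rule nsq_mono_set) auto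
      also have "\<dots> \<le> ennreal e'" using d(2)[OF \<epsilon>(1) \<epsilon>d] .
      finally show "nsq B (\<lambda>x. conv u (partial_deriv i (mollifier \<epsilon>)) x - G x $ i) \<le> ennreal e'" .
    qed
    also have "\<dots> = ennreal e" using e by (simp add: e'_def ennreal_of_nat_eq_real_of_nat flip: ennreal_mult')
    finally show "nsq B (\<lambda>x. (\<chi> i. conv u (partial_deriv i (mollifier \<epsilon>)) x) - G x) \<le> ennreal e" .
  qed
qed

lemma nsq_eq_0_iff:
  fixes f :: "'a::euclidean_space \<Rightarrow> 'b::euclidean_space"
  assumes [measurable]: "f \<in> borel_measurable borel" "A \<in> sets borel"
  shows "nsq A f = 0 \<longleftrightarrow> (AE x in lborel. x \<in> A \<longrightarrow> f x = 0)"
  unfolding nsq_def by (subst nn_integral_0_iff_AE) (auto simp: indicator_def intro!: AE_cong)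

text \<open>At points with room around them the mollification of \<open>g\<close> is an integral of
  \<open>g\<close> against a test function, hence 0; as the mollifications converge to
  \<open>g\<close> in \<open>L\<^sup>2\<close>, the norm of \<open>g\<close> on every smaller ball
  vanishes.\<close>

lemma fundamental_lemma_ball:
  fixes g :: "real ^ 'n \<Rightarrow> real"
  assumes [measurable]: "g \<in> borel_measurable borel" and z: "\<And>x. x \<notin> ball 0 R \<Longrightarrow> g x = 0" and fin: "nsq UNIV g < \<infinity>"
    and t: "\<And>\<phi>. \<phi> \<in> test_functions (ball 0 R) \<Longrightarrow> (LINT x|lborel. g x * \<phi> x) = 0"
  shows "AE x in lborel. g x = 0"
proof -
  have int: "integrable lborel g"
    by (rule L2_imp_integrable[of _ "ball 0 R"]) (use z fin emeasure_lborel_ball_finite in auto)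
  have nsq0: "nsq (ball 0 r) g = 0" if r: "r < R" for r
  proof -
    have small: "nsq (ball 0 r) g \<le> ennreal e" if e: "e > 0" for e :: real
    proof -
      obtain d where d: "d > 0" "\<And>\<epsilon>. 0 < \<epsilon> \<Longrightarrow> \<epsilon> \<le> d \<Longrightarrow> nsq UNIV (\<lambda>x. conv g (mollifier \<epsilon>) x - g x) \<le> ennreal e"
        using conv_mollifier_L2[OF assms(1) int fin e] by auto
      define \<epsilon> where "\<epsilon> = min d (R - r)"
      have \<epsilon>: "0 < \<epsilon>" "\<epsilon> \<le> d" "\<epsilon> \<le> R - r" using d r by (auto simp: \<epsilon>_def)
      have "conv g (mollifier \<epsilon>) x = 0" if "x \<in> ball 0 r" for x
      proof -
        have "cball x \<epsilon> \<subseteq> ball 0 R"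
        proof
          fix y assume "y \<in> cball x \<epsilon>"
          then show "y \<in> ball 0 R" using that \<epsilon>(3) norm_triangle_ineq2[of y x] by (simp add: dist_norm norm_minus_commute)
        qed
        then show ?thesis unfolding conv_def by (intro t mollifier_test_function \<epsilon>(1))
      qed
      then have "nsq (ball 0 r) g = nsq (ball 0 r) (\<lambda>x. conv g (mollifier \<epsilon>) x - g x)"
        by (intro nsq_cong) auto
      also have "\<dots> \<le> nsq UNIV (\<lambda>x. conv g (mollifier \<epsilon>) x - g x)" by (rule nsq_mono_set) auto
      also have "\<dots> \<le> ennreal e" using d(2) \<epsilon> by auto
      finally show ?thesis .
    qed
    have "nsq (ball 0 r) g \<le> 0"
    proof (rule ennreal_le_epsilon)
      fix e :: real assume "0 < e"
      then show "nsq (ball 0 r) g \<le> 0 + ennreal e"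
        using small[of e] by (simp only: add_0)
    qed
    then show ?thesis by simp
  qed
  \<comment> \<open>Countably many smaller balls exhaust \<open>ball 0 R\<close>, so the exceptional
    null sets can be united.\<close>
  have "AE x in lborel. \<forall>n::nat. x \<in> ball 0 (R - 1 / real (Suc n)) \<longrightarrow> g x = 0"
    unfolding AE_all_countable
  proof (intro allI)
    fix n :: nat
    have "nsq (ball 0 (R - 1 / real (Suc n))) g = 0" by (rule nsq0) simp
    then show "AE x in lborel. x \<in> ball 0 (R - 1 / real (Suc n)) \<longrightarrow> g x = 0"
      by (subst (asm) nsq_eq_0_iff) simp_all
  qed
  then show ?thesis
  proof eventually_elim
    case (elim x)
    show ?case
    proof (cases "x \<in> ball 0 R")
      case True
      then have "R - norm x > 0" by simp
      then obtain n where "inverse (real (Suc n)) < R - norm x" using reals_Archimedean by blast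
      with elim show ?thesis by (auto simp: inverse_eq_divide algebra_simps)
    qed (use z in auto)
  qed
qed

lemma integrable_mult_L2:
  fixes f g :: "'a::euclidean_space \<Rightarrow> real"
  assumes [measurable]: "f \<in> borel_measurable borel" "g \<in> borel_measurable borel"
    and "nsq UNIV f < \<infinity>" "nsq UNIV g < \<infinity>"
  shows "integrable lborel (\<lambda>x. f x * g x)"
proof (rule Bochner_Integration.integrable_bound)
  show "integrable lborel (\<lambda>x. (f x)\<^sup>2 + (g x)\<^sup>2)"
    using assms nsq_finite_iff_integrable[of f UNIV] nsq_finite_iff_integrable[of g UNIV]
    by (intro Bochner_Integration.integrable_add) auto
  have "\<bar>f x * g x\<bar> \<le> (f x)\<^sup>2 + (g x)\<^sup>2" for x
  proof -
    have "2 * \<bar>f x\<bar> * \<bar>g x\<bar> \<le> (f x)\<^sup>2 + (g x)\<^sup>2" using sum_squares_bound[of "\<bar>f x\<bar>" "\<bar>g x\<bar>"] by simp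
    moreover have "0 \<le> \<bar>f x\<bar> * \<bar>g x\<bar>" by simp
    ultimately show ?thesis unfolding abs_mult by linarith
  qed
  then show "AE x in lborel. norm (f x * g x) \<le> norm ((f x)\<^sup>2 + (g x)\<^sup>2)" by (intro AE_I2) simp
qed auto

lemma L2_pairing_tendsto:
  fixes f :: "'a::euclidean_space \<Rightarrow> real"
  assumes [measurable]: "\<And>n. F n \<in> borel_measurable borel" "f \<in> borel_measurable borel" "k \<in> borel_measurable borel"
    and fF: "\<And>n. nsq UNIV (F n) < \<infinity>" and ff: "nsq UNIV f < \<infinity>" and fk: "nsq UNIV k < \<infinity>"
    and lim: "(\<lambda>n. nsq UNIV (\<lambda>x. F n x - f x)) \<longlonglongrightarrow> 0"
  shows "(\<lambda>n. LINT x|lborel. F n x * k x) \<longlonglongrightarrow> (LINT x|lborel. f x * k x)"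
proof -
  have iF: "integrable lborel (\<lambda>x. F n x * k x)" for n
    by (rule integrable_mult_L2) (use fF fk in measurable)
  have if': "integrable lborel (\<lambda>x. f x * k x)"
    by (rule integrable_mult_L2) (use ff fk in measurable)
  define I where "I n = (LINT x|lborel. F n x * k x) - (LINT x|lborel. f x * k x)" for n
  have "ennreal ((I n)\<^sup>2) \<le> nsq UNIV (\<lambda>x. F n x - f x) * nsq UNIV k" for n
  proof -
    have "I n = (LINT x|lborel. (F n x - f x) * k x)"
      unfolding I_def by (simp add: left_diff_distrib iF if')
    then have "ennreal \<bar>I n\<bar> \<le> (\<integral>\<^sup>+x. ennreal (norm ((F n x - f x) * k x)) \<partial>lborel)"
      using integral_norm_bound_ennreal[of lborel "\<lambda>x. (F n x - f x) * k x"]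
      by (simp add: left_diff_distrib iF if')
    also have "\<dots> = (\<integral>\<^sup>+x. ennreal \<bar>F n x - f x\<bar> * ennreal \<bar>k x\<bar> \<partial>lborel)"
      by (simp add: abs_mult ennreal_mult)
    finally have "(ennreal \<bar>I n\<bar>)\<^sup>2 \<le> (\<integral>\<^sup>+x. ennreal \<bar>F n x - f x\<bar> * ennreal \<bar>k x\<bar> \<partial>lborel)\<^sup>2"
      by (simp add: power_mono)
    also have "\<dots> \<le> (\<integral>\<^sup>+x. (ennreal \<bar>F n x - f x\<bar>)\<^sup>2 \<partial>lborel) * (\<integral>\<^sup>+x. (ennreal \<bar>k x\<bar>)\<^sup>2 \<partial>lborel)"
      by (rule Cauchy_Schwarz_nn_integral) auto
    also have "\<dots> = nsq UNIV (\<lambda>x. F n x - f x) * nsq UNIV k"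
      by (simp add: nsq_def ennreal_power)
    finally show ?thesis by (simp add: ennreal_power)
  qed
  moreover have "(\<lambda>n. nsq UNIV (\<lambda>x. F n x - f x) * nsq UNIV k) \<longlonglongrightarrow> 0 * nsq UNIV k"
    using lim fk by (intro tendsto_mult_ennreal tendsto_const) auto
  ultimately have "(\<lambda>n. ennreal ((I n)\<^sup>2)) \<longlonglongrightarrow> 0"
    by (intro tendsto_sandwich[of "\<lambda>_. 0" "\<lambda>n. ennreal ((I n)\<^sup>2)" sequentially "\<lambda>n. nsq UNIV (\<lambda>x. F n x - f x) * nsq UNIV k"])
       auto
  then have "(\<lambda>n. (I n)\<^sup>2) \<longlonglongrightarrow> 0"
    by (subst (asm) tendsto_ennreal_iff[of _ _ 0, simplified]) auto
  then have "I \<longlonglongrightarrow> 0" using tendsto_real_sqrt[of "\<lambda>n. (I n)\<^sup>2" 0] by (simp add: tendsto_rabs_zero_iff)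
  then show ?thesis unfolding I_def by (simp add: LIM_zero_iff)
qed

lemma nsq_tendsto_le:
  assumes "\<And>n. nsq A (f n) \<le> ennreal c * h n" "h \<longlonglongrightarrow> 0"
  shows "(\<lambda>n. nsq A (f n)) \<longlonglongrightarrow> 0"
proof -
  have "(\<lambda>n. ennreal c * h n) \<longlonglongrightarrow> ennreal c * 0"
    using assms(2) by (intro tendsto_mult_ennreal tendsto_const) auto
  then show ?thesis
    by (intro tendsto_sandwich[of "\<lambda>_. 0" "\<lambda>n. nsq A (f n)" sequentially "\<lambda>n. ennreal c * h n"])
       (use assms(1) in auto)
qed

lemma nsq_tendsto_add:
  fixes f g :: "nat \<Rightarrow> 'a::euclidean_space \<Rightarrow> 'b::euclidean_space"
  assumes [measurable]: "\<And>n. f n \<in> borel_measurable borel" "\<And>n. g n \<in> borel_measurable borel" "A \<in> sets borel"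
    and "(\<lambda>n. nsq A (f n)) \<longlonglongrightarrow> 0" "(\<lambda>n. nsq A (g n)) \<longlonglongrightarrow> 0"
  shows "(\<lambda>n. nsq A (\<lambda>x. f n x + g n x)) \<longlonglongrightarrow> 0"
proof (rule nsq_tendsto_le[where c=2])
  show "nsq A (\<lambda>x. f n x + g n x) \<le> ennreal 2 * (nsq A (f n) + nsq A (g n))" for n
    using nsq_add[of "f n" "g n" A] by (simp add: distrib_left)
  show "(\<lambda>n. nsq A (f n) + nsq A (g n)) \<longlonglongrightarrow> 0"
    using tendsto_add[OF assms(4,5)] by simp
qed

lemma nsq_le_cmult:
  assumes [measurable]: "g \<in> borel_measurable borel" "A \<in> sets borel"
    and "\<And>x. x \<in> A \<Longrightarrow> norm (f x) \<le> L * norm (g x)" and "L \<ge> 0"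
  shows "nsq A f \<le> ennreal (L\<^sup>2) * nsq A g"
proof -
  have "nsq A f \<le> nsq A (\<lambda>x. L *\<^sub>R g x)" using assms by (intro nsq_mono) auto
  then show ?thesis using assms by (simp add: nsq_cmult)
qed

lemma has_gradient_continuous:
  assumes "\<And>x. (F has_derivative (\<lambda>h. D x \<bullet> h)) (at x)"
  shows "continuous_on UNIV F"
  using has_derivative_continuous[OF assms] by (intro continuous_at_imp_continuous_on) simp

text \<open>The range constraint \<open>I\<close> makes compositions with functions that are smooth only on \<open>I\<close> possible.\<close>

definition aprx :: "(real ^ 'n) set \<Rightarrow> real set \<Rightarrow> (real ^ 'n \<Rightarrow> real) \<Rightarrow> (real ^ 'n \<Rightarrow> real ^ 'n) \<Rightarrow>
    (nat \<Rightarrow> real ^ 'n \<Rightarrow> real) \<Rightarrow> (nat \<Rightarrow> real ^ 'n \<Rightarrow> real ^ 'n) \<Rightarrow> bool" where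
  "aprx B I f G F D \<longleftrightarrow> B \<in> sets borel \<and> f \<in> borel_measurable borel \<and> G \<in> borel_measurable borel \<and>
     nsq B f < \<infinity> \<and> nsq B G < \<infinity> \<and> (\<forall>x. f x \<in> I) \<and>
     (\<forall>n x. (F n has_derivative (\<lambda>h. D n x \<bullet> h)) (at x)) \<and> (\<forall>n. continuous_on UNIV (D n)) \<and>
     (\<forall>n x. F n x \<in> I) \<and>
     (\<lambda>n. nsq B (\<lambda>x. F n x - f x)) \<longlonglongrightarrow> 0 \<and> (\<lambda>n. nsq B (\<lambda>x. D n x - G x)) \<longlonglongrightarrow> 0 \<and>
     (AE x in lborel. x \<in> B \<longrightarrow> (\<lambda>n. F n x) \<longlonglongrightarrow> f x)"

lemma aprx_measurable:
  assumes "aprx B I f G F D"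
  shows "B \<in> sets borel" "f \<in> borel_measurable borel" "G \<in> borel_measurable borel"
    "F n \<in> borel_measurable borel" "D n \<in> borel_measurable borel"
  using assms unfolding aprx_def by (auto intro!: borel_measurable_continuous_onI has_gradient_continuous)

text \<open>Since \<open>\<phi>\<close> is Lipschitz on \<open>{\<delta>..}\<close>, where all
  values lie, the convergence of the functions is immediate. The gradient error is split into
  \<open>\<phi>' (F n x)\<close> times the error of \<open>D n\<close>, which the bound
  \<open>L\<close> controls, and a change of the factor \<open>\<phi>'\<close> in front of the fixed
  \<open>G\<close>.\<close>

lemma aprx_chain:
  fixes \<phi> \<phi>' :: "real \<Rightarrow> real"
  assumes a: "aprx B {\<delta>..} v G F D" and B: "emeasure lborel B < \<infinity>"
    and d: "\<And>t. t \<ge> \<delta> \<Longrightarrow> (\<phi> has_real_derivative \<phi>' t) (at t)"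
    and c: "continuous_on {\<delta>..} \<phi>'" and L: "\<And>t. t \<ge> \<delta> \<Longrightarrow> \<bar>\<phi>' t\<bar> \<le> L"
    and m[measurable]: "\<phi> \<in> borel_measurable borel" "\<phi>' \<in> borel_measurable borel"
  shows "aprx B UNIV (\<lambda>x. \<phi> (v x)) (\<lambda>x. \<phi>' (v x) *\<^sub>R G x) (\<lambda>n x. \<phi> (F n x)) (\<lambda>n x. \<phi>' (F n x) *\<^sub>R D n x)"
proof -
  note [measurable] = aprx_measurable[OF a]
  have L0: "L \<ge> 0" using L[of \<delta>] by linarith
  have v: "v x \<ge> \<delta>" "F n x \<ge> \<delta>" for n x using a by (auto simp: aprx_def)
  have fin: "nsq B v < \<infinity>" "nsq B G < \<infinity>" using a by (auto simp: aprx_def)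
  have l1: "(\<lambda>n. nsq B (\<lambda>x. F n x - v x)) \<longlonglongrightarrow> 0" and l2: "(\<lambda>n. nsq B (\<lambda>x. D n x - G x)) \<longlonglongrightarrow> 0"
    and ae: "AE x in lborel. x \<in> B \<longrightarrow> (\<lambda>n. F n x) \<longlonglongrightarrow> v x" using a by (auto simp: aprx_def)
  have lip: "\<bar>\<phi> s - \<phi> t\<bar> \<le> L * \<bar>s - t\<bar>" if "s \<ge> \<delta>" "t \<ge> \<delta>" for s t
  proof -
    have "norm (\<phi> s - \<phi> t) \<le> L * norm (s - t)"
      by (rule field_differentiable_bound[of "{\<delta>..}" \<phi> \<phi>'])
         (use that d L in \<open>auto intro: has_field_derivative_at_within\<close>)
    then show ?thesis by simp
  qed
  have cont: "continuous_on {\<delta>..} \<phi>"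
    using d by (intro continuous_at_imp_continuous_on) (auto intro: DERIV_isCont)
  have grad: "((\<lambda>x. \<phi> (F n x)) has_derivative (\<lambda>h. (\<phi>' (F n x) *\<^sub>R D n x) \<bullet> h)) (at x)" for n x
  proof -
    have "((\<lambda>x. \<phi> (F n x)) has_derivative (\<lambda>h. (D n x \<bullet> h) * \<phi>' (F n x))) (at x)"
      using a d v by (intro DERIV_compose_FDERIV) (auto simp: aprx_def)
    then show ?thesis by (simp add: mult.commute)
  qed
  have cD: "continuous_on UNIV (\<lambda>x. \<phi>' (F n x) *\<^sub>R D n x)" for n
    using a v unfolding aprx_def
    by (intro continuous_intros continuous_on_compose2[OF c] has_gradient_continuous) auto
  have nf: "nsq B (\<lambda>x. \<phi> (v x)) < \<infinity>"
  proof -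
    let ?c = "\<bar>\<phi> \<delta>\<bar> + L * \<bar>\<delta>\<bar>"
    have "\<bar>\<phi> (v x)\<bar> \<le> \<bar>?c + L * \<bar>v x\<bar>\<bar>" for x
    proof -
      have "\<bar>\<phi> (v x)\<bar> \<le> \<bar>\<phi> \<delta>\<bar> + L * \<bar>v x - \<delta>\<bar>" using lip[of "v x" \<delta>] v(1) by auto
      also have "L * \<bar>v x - \<delta>\<bar> \<le> L * (\<bar>v x\<bar> + \<bar>\<delta>\<bar>)" using L0 by (intro mult_left_mono) auto
      finally show ?thesis using L0 by (simp add: algebra_simps)
    qed
    then have "nsq B (\<lambda>x. \<phi> (v x)) \<le> nsq B (\<lambda>x. ?c + L * \<bar>v x\<bar>)" by (intro nsq_mono) simp
    also have "\<dots> \<le> 2 * nsq B (\<lambda>x. ?c) + 2 * nsq B (\<lambda>x. L * \<bar>v x\<bar>)" by (rule nsq_add) auto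
    also have "nsq B (\<lambda>x. L * \<bar>v x\<bar>) \<le> ennreal (L\<^sup>2) * nsq B v"
      using L0 by (intro nsq_le_cmult) (auto simp: abs_mult)
    also have "2 * nsq B (\<lambda>x. ?c) + 2 * (ennreal (L\<^sup>2) * nsq B v) < \<infinity>"
      using B fin by (auto simp: nsq_def nn_integral_cmult_indicator ennreal_mult_less_top)
    finally show ?thesis by (simp add: add_left_mono mult_left_mono)
  qed
  have nG: "nsq B (\<lambda>x. \<phi>' (v x) *\<^sub>R G x) < \<infinity>"
  proof -
    have "nsq B (\<lambda>x. \<phi>' (v x) *\<^sub>R G x) \<le> ennreal (L\<^sup>2) * nsq B G"
      using L0 L v by (intro nsq_le_cmult) (auto intro!: mult_right_mono)
    also have "\<dots> < \<infinity>" using fin by (simp add: ennreal_mult_less_top)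
    finally show ?thesis .
  qed
  have t1: "(\<lambda>n. nsq B (\<lambda>x. \<phi> (F n x) - \<phi> (v x))) \<longlonglongrightarrow> 0"
    using lip v L0 by (intro nsq_tendsto_le[OF nsq_le_cmult l1]) auto
  have t2: "(\<lambda>n. nsq B (\<lambda>x. \<phi>' (F n x) *\<^sub>R D n x - \<phi>' (v x) *\<^sub>R G x)) \<longlonglongrightarrow> 0"
  proof -
    have "(\<lambda>n. nsq B (\<lambda>x. \<phi>' (F n x) *\<^sub>R (D n x - G x))) \<longlonglongrightarrow> 0"
      using L v L0 by (intro nsq_tendsto_le[OF nsq_le_cmult l2]) (auto intro!: mult_right_mono)
    \<comment> \<open>For this term the a.e. convergence recorded in \<open>aprx\<close> is
      essential: \<open>\<phi>'\<close> is only continuous, so dominated convergence replaces a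
      Lipschitz estimate.\<close>
    moreover have "(\<lambda>n. nsq B (\<lambda>x. (\<phi>' (F n x) - \<phi>' (v x)) *\<^sub>R G x)) \<longlonglongrightarrow> 0"
    proof (rule nsq_dominated_tendsto[where w="\<lambda>x. 2 * L * norm (G x)"])
      show "AE x in lborel. x \<in> B \<longrightarrow> norm ((\<phi>' (F n x) - \<phi>' (v x)) *\<^sub>R G x) \<le> 2 * L * norm (G x)" for n
      proof (intro AE_I2 impI)
        fix x
        have "\<bar>\<phi>' (F n x) - \<phi>' (v x)\<bar> \<le> 2 * L" using L[of "v x"] L[of "F n x"] v by (smt (verit))
        then show "norm ((\<phi>' (F n x) - \<phi>' (v x)) *\<^sub>R G x) \<le> 2 * L * norm (G x)"
          by (auto intro: mult_right_mono)
      qed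
      have "nsq B (\<lambda>x. 2 * L * norm (G x)) \<le> ennreal ((2 * L)\<^sup>2) * nsq B G"
        using L0 by (intro nsq_le_cmult) (auto simp: abs_mult)
      also have "\<dots> < \<infinity>" using fin by (simp add: ennreal_mult_less_top)
      finally show "nsq B (\<lambda>x. 2 * L * norm (G x)) < \<infinity>" .
      show "AE x in lborel. x \<in> B \<longrightarrow> (\<lambda>n. (\<phi>' (F n x) - \<phi>' (v x)) *\<^sub>R G x) \<longlonglongrightarrow> 0"
        using ae
      proof eventually_elim
        case (elim x)
        show ?case
        proof
          assume "x \<in> B"
          with elim have "(\<lambda>n. \<phi>' (F n x)) \<longlonglongrightarrow> \<phi>' (v x)"
            using v by (intro continuous_on_tendsto_compose[OF c]) auto
          then have "(\<lambda>n. (\<phi>' (F n x) - \<phi>' (v x)) *\<^sub>R G x) \<longlonglongrightarrow> (\<phi>' (v x) - \<phi>' (v x)) *\<^sub>R G x"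
            by (intro tendsto_intros)
          then show "(\<lambda>n. (\<phi>' (F n x) - \<phi>' (v x)) *\<^sub>R G x) \<longlonglongrightarrow> 0" by simp
        qed
      qed
    qed auto
    ultimately have "(\<lambda>n. nsq B (\<lambda>x. \<phi>' (F n x) *\<^sub>R (D n x - G x) + (\<phi>' (F n x) - \<phi>' (v x)) *\<^sub>R G x)) \<longlonglongrightarrow> 0"
      by (intro nsq_tendsto_add) auto
    then show ?thesis by (simp add: algebra_simps)
  qed
  have t3: "AE x in lborel. x \<in> B \<longrightarrow> (\<lambda>n. \<phi> (F n x)) \<longlonglongrightarrow> \<phi> (v x)"
    using ae by eventually_elim (use v in \<open>auto intro!: continuous_on_tendsto_compose[OF cont]\<close>)
  show ?thesis unfolding aprx_def
    by (intro conjI allI grad cD nf nG t1 t2 t3) simp_all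
qed

text \<open>Since \<open>\<eta>\<close> and its gradient \<open>H\<close> vanish off
  \<open>B\<close>, an approximation that is good only on \<open>B\<close> becomes one on the whole
  space, where integration by parts and the Sobolev inequality can be applied.\<close>

lemma aprx_cutoff:
  fixes f \<eta> :: "real ^ 'n \<Rightarrow> real"
  assumes a: "aprx B UNIV f G F D"
    and \<eta>: "\<And>x. (\<eta> has_derivative (\<lambda>h. H x \<bullet> h)) (at x)" and H: "continuous_on UNIV H"
    and K: "\<And>x. \<bar>\<eta> x\<bar> \<le> K" "\<And>x. norm (H x) \<le> K" and z: "\<And>x. x \<notin> B \<Longrightarrow> \<eta> x = 0" "\<And>x. x \<notin> B \<Longrightarrow> H x = 0"
  shows "aprx UNIV UNIV (\<lambda>x. \<eta> x * f x) (\<lambda>x. \<eta> x *\<^sub>R G x + f x *\<^sub>R H x)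
    (\<lambda>n x. \<eta> x * F n x) (\<lambda>n x. \<eta> x *\<^sub>R D n x + F n x *\<^sub>R H x)"
proof -
  note [measurable] = aprx_measurable[OF a]
  have \<eta>c: "continuous_on UNIV \<eta>" by (rule has_gradient_continuous[OF \<eta>])
  have [measurable]: "\<eta> \<in> borel_measurable borel" "H \<in> borel_measurable borel"
    using \<eta>c H by (auto intro: borel_measurable_continuous_onI)
  have K0: "K \<ge> 0" using K(1)[of 0] by linarith
  have fin: "nsq B f < \<infinity>" "nsq B G < \<infinity>" using a by (auto simp: aprx_def)
  have l1: "(\<lambda>n. nsq B (\<lambda>x. F n x - f x)) \<longlonglongrightarrow> 0" and l2: "(\<lambda>n. nsq B (\<lambda>x. D n x - G x)) \<longlonglongrightarrow> 0"
    and ae: "AE x in lborel. x \<in> B \<longrightarrow> (\<lambda>n. F n x) \<longlonglongrightarrow> f x" using a by (auto simp: aprx_def)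
  have le1: "nsq B (\<lambda>x. \<eta> x *\<^sub>R g x) \<le> ennreal (K\<^sup>2) * nsq B g"
    if [measurable]: "g \<in> borel_measurable borel" for g :: "real ^ 'n \<Rightarrow> real ^ 'n"
    using K K0 by (intro nsq_le_cmult) (auto intro!: mult_right_mono)
  have le2: "nsq B (\<lambda>x. \<eta> x * g x) \<le> ennreal (K\<^sup>2) * nsq B g"
    if [measurable]: "g \<in> borel_measurable borel" for g :: "real ^ 'n \<Rightarrow> real"
    using K K0 by (intro nsq_le_cmult) (auto intro!: mult_right_mono simp: abs_mult)
  have le3: "nsq B (\<lambda>x. g x *\<^sub>R H x) \<le> ennreal (K\<^sup>2) * nsq B g"
    if [measurable]: "g \<in> borel_measurable borel" for g :: "real ^ 'n \<Rightarrow> real"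
    using K K0 by (intro nsq_le_cmult) (auto intro!: mult_left_mono simp: mult.commute[of K])
  have n1: "nsq UNIV (\<lambda>x. \<eta> x * f x) < \<infinity>"
    using le2[of f] fin by (subst nsq_UNIV_eq[of B]) (auto simp: z ennreal_mult_less_top elim: le_less_trans)
  have n2: "nsq UNIV (\<lambda>x. \<eta> x *\<^sub>R G x + f x *\<^sub>R H x) < \<infinity>"
  proof -
    have "nsq UNIV (\<lambda>x. \<eta> x *\<^sub>R G x + f x *\<^sub>R H x) = nsq B (\<lambda>x. \<eta> x *\<^sub>R G x + f x *\<^sub>R H x)"
      by (rule nsq_UNIV_eq) (simp add: z)
    also have "\<dots> \<le> 2 * nsq B (\<lambda>x. \<eta> x *\<^sub>R G x) + 2 * nsq B (\<lambda>x. f x *\<^sub>R H x)"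
      by (rule nsq_add) auto
    also have "\<dots> \<le> 2 * (ennreal (K\<^sup>2) * nsq B G) + 2 * (ennreal (K\<^sup>2) * nsq B f)"
      by (intro add_mono mult_left_mono le1 le3) auto
    also have "\<dots> < \<infinity>" using fin by (simp add: ennreal_mult_less_top)
    finally show ?thesis .
  qed
  have g: "((\<lambda>x. \<eta> x * F n x) has_derivative (\<lambda>h. (\<eta> x *\<^sub>R D n x + F n x *\<^sub>R H x) \<bullet> h)) (at x)" for n x
  proof -
    have "((\<lambda>x. \<eta> x * F n x) has_derivative (\<lambda>h. \<eta> x * (D n x \<bullet> h) + (H x \<bullet> h) * F n x)) (at x)"
      using a \<eta> by (intro has_derivative_mult) (auto simp: aprx_def)
    then show ?thesis by (simp add: inner_add_left mult.commute)
  qed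
  have c: "continuous_on UNIV (\<lambda>x. \<eta> x *\<^sub>R D n x + F n x *\<^sub>R H x)" for n
    using a unfolding aprx_def by (intro continuous_intros \<eta>c H has_gradient_continuous) auto
  have t1: "(\<lambda>n. nsq UNIV (\<lambda>x. \<eta> x * F n x - \<eta> x * f x)) \<longlonglongrightarrow> 0"
  proof (rule nsq_tendsto_le[OF _ l1, where c="K\<^sup>2"])
    fix n
    have "nsq UNIV (\<lambda>x. \<eta> x * F n x - \<eta> x * f x) = nsq B (\<lambda>x. \<eta> x * (F n x - f x))"
      by (subst nsq_UNIV_eq[of B]) (auto simp: z right_diff_distrib)
    then show "nsq UNIV (\<lambda>x. \<eta> x * F n x - \<eta> x * f x) \<le> ennreal (K\<^sup>2) * nsq B (\<lambda>x. F n x - f x)"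
      using le2[of "\<lambda>x. F n x - f x"] by simp
  qed
  have t2: "(\<lambda>n. nsq UNIV (\<lambda>x. (\<eta> x *\<^sub>R D n x + F n x *\<^sub>R H x) - (\<eta> x *\<^sub>R G x + f x *\<^sub>R H x))) \<longlonglongrightarrow> 0"
  proof -
    have "(\<lambda>n. nsq B (\<lambda>x. \<eta> x *\<^sub>R (D n x - G x) + (F n x - f x) *\<^sub>R H x)) \<longlonglongrightarrow> 0"
      by (intro nsq_tendsto_add nsq_tendsto_le[OF le1 l2] nsq_tendsto_le[OF le3 l1]) auto
    moreover have "nsq UNIV (\<lambda>x. (\<eta> x *\<^sub>R D n x + F n x *\<^sub>R H x) - (\<eta> x *\<^sub>R G x + f x *\<^sub>R H x))
        = nsq B (\<lambda>x. \<eta> x *\<^sub>R (D n x - G x) + (F n x - f x) *\<^sub>R H x)" for n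
      by (subst nsq_UNIV_eq[of B]) (auto simp: z algebra_simps)
    ultimately show ?thesis by simp
  qed
  have t3: "AE x in lborel. x \<in> UNIV \<longrightarrow> (\<lambda>n. \<eta> x * F n x) \<longlonglongrightarrow> \<eta> x * f x"
    using ae
  proof eventually_elim
    case (elim x)
    then show ?case by (cases "x \<in> B") (auto simp: z intro: tendsto_intros)
  qed
  show ?thesis unfolding aprx_def
    by (intro conjI allI g c n1 n2 t1 t2 t3) simp_all
qed

lemma L2_AE_subseq:
  fixes F :: "nat \<Rightarrow> 'a::euclidean_space \<Rightarrow> real"
  assumes [measurable]: "\<And>n. F n \<in> borel_measurable borel"
    and fin: "\<And>n. nsq UNIV (F n) < \<infinity>" and lim: "(\<lambda>n. nsq UNIV (F n)) \<longlonglongrightarrow> 0"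
  obtains r where "strict_mono r" "AE x in lborel. (\<lambda>n. F (r n) x) \<longlonglongrightarrow> 0"
proof -
  have int: "integrable lborel (\<lambda>x. (F n x)\<^sup>2)" for n
    using fin[of n] nsq_finite_iff_integrable[of "F n" UNIV] by simp
  have "ennreal (LINT x|lborel. norm ((F n x)\<^sup>2)) = nsq UNIV (F n)" for n
    using nn_integral_eq_integral[OF int[of n]] by (simp add: nsq_def)
  then have "(\<lambda>n. ennreal (LINT x|lborel. norm ((F n x)\<^sup>2))) \<longlonglongrightarrow> ennreal 0"
    using lim by simp
  then have "(\<lambda>n. LINT x|lborel. norm ((F n x)\<^sup>2)) \<longlonglongrightarrow> 0"
    by (subst (asm) tendsto_ennreal_iff) auto
  from tendsto_L1_AE_subseq[OF int this]
  obtain r where r: "strict_mono r" "AE x in lborel. (\<lambda>n. (F (r n) x)\<^sup>2) \<longlonglongrightarrow> 0" by blast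
  have "AE x in lborel. (\<lambda>n. F (r n) x) \<longlonglongrightarrow> 0"
    using r(2)
  proof eventually_elim
    case (elim x)
    from tendsto_real_sqrt[OF this] show ?case by (simp add: tendsto_rabs_zero_iff)
  qed
  with r(1) show ?thesis by (rule that)
qed

text \<open>Mollifying preserves nonnegativity, so adding \<open>\<delta>\<close> keeps all
  approximants in \<open>{\<delta>..}\<close>. The mollification radii are chosen to make both
  errors at most \<open>1 / Suc n\<close>, and a subsequence provides the a.e. convergence.\<close>

lemma wgrad_aprx:
  fixes u :: "real ^ 'n \<Rightarrow> real"
  assumes w: "wgrad (ball 0 1) u G" and u0: "\<And>x. u x \<ge> 0" and r: "r < 1"
  obtains F D where "aprx (ball 0 r) {\<delta>..} (\<lambda>x. u x + \<delta>) G F D"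
proof -
  have [measurable]: "u \<in> borel_measurable borel" "G \<in> borel_measurable borel" using w by (auto simp: wgrad_def)
  have fin: "nsq UNIV u < \<infinity>" "nsq UNIV G < \<infinity>" using w by (auto simp: wgrad_def)
  have int: "integrable lborel u" by (rule wgrad_integrable[OF w]) auto
  have sub: "cball x (1 - r) \<subseteq> ball 0 1" if "x \<in> ball 0 r" for x :: "real ^ 'n"
  proof
    fix y assume "y \<in> cball x (1 - r)"
    then show "y \<in> ball 0 1" using that norm_triangle_ineq2[of y x] by (simp add: dist_norm norm_minus_commute)
  qed
  define P where "P n \<epsilon> \<longleftrightarrow> 0 < \<epsilon> \<and>
      nsq UNIV (\<lambda>x. conv u (mollifier \<epsilon>) x - u x) \<le> ennreal (1 / real (Suc n)) \<and>
      nsq (ball 0 r) (\<lambda>x. (\<chi> i. conv u (partial_deriv i (mollifier \<epsilon>)) x) - G x) \<le> ennreal (1 / real (Suc n))"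
    for n \<epsilon>
  have "\<forall>n. \<exists>\<epsilon>. P n \<epsilon>"
  proof
    fix n
    show "\<exists>\<epsilon>. P n \<epsilon>"
      by (rule wgrad_mollify[OF w _ _ _ _ sub, where e="1 / real (Suc n)" and B="ball 0 r"])
         (use r in \<open>auto simp: P_def\<close>)
  qed
  from choice[OF this] obtain \<epsilon> where P: "P n (\<epsilon> n)" for n by auto
  then have \<epsilon>: "\<epsilon> n > 0"
    and e1: "nsq UNIV (\<lambda>x. conv u (mollifier (\<epsilon> n)) x - u x) \<le> ennreal (1 / real (Suc n))"
    and e2: "nsq (ball 0 r) (\<lambda>x. (\<chi> i. conv u (partial_deriv i (mollifier (\<epsilon> n))) x) - G x) \<le> ennreal (1 / real (Suc n))"
    for n unfolding P_def by simp_all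
  note [measurable] = grad_conv_mollifier_measurable[OF int \<epsilon>]
  have l0: "(\<lambda>n. ennreal (1 / real (Suc n))) \<longlonglongrightarrow> 0"
    using LIMSEQ_inverse_real_of_nat by (intro tendsto_ennrealI[of _ 0, simplified]) (simp add: inverse_eq_divide)
  have l1: "(\<lambda>n. nsq UNIV (\<lambda>x. conv u (mollifier (\<epsilon> n)) x - u x)) \<longlonglongrightarrow> 0"
    by (rule nsq_tendsto_le[where c=1, OF _ l0]) (use e1 in simp)
  have l2: "(\<lambda>n. nsq (ball 0 r) (\<lambda>x. (\<chi> i. conv u (partial_deriv i (mollifier (\<epsilon> n))) x) - G x)) \<longlonglongrightarrow> 0"
    by (rule nsq_tendsto_le[where c=1, OF _ l0]) (use e2 in simp)
  have "nsq UNIV (\<lambda>x. conv u (mollifier (\<epsilon> n)) x - u x) < \<infinity>" for n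
    using e1[of n] by (rule le_less_trans) simp
  with l1 obtain s where s: "strict_mono s"
    "AE x in lborel. (\<lambda>n. conv u (mollifier (\<epsilon> (s n))) x - u x) \<longlonglongrightarrow> 0"
    using L2_AE_subseq[of "\<lambda>n x. conv u (mollifier (\<epsilon> n)) x - u x"] by auto
  define F where "F n x = conv u (mollifier (\<epsilon> (s n))) x + \<delta>" for n x
  define D where "D n x = (\<chi> i. conv u (partial_deriv i (mollifier (\<epsilon> (s n)))) x)" for n x
  have "aprx (ball 0 r) {\<delta>..} (\<lambda>x. u x + \<delta>) G F D"
    unfolding aprx_def
  proof (intro conjI allI)
    show "nsq (ball 0 r) (\<lambda>x. u x + \<delta>) < \<infinity>"
    proof -
      have "nsq (ball 0 r) (\<lambda>x. u x + \<delta>) \<le> 2 * nsq (ball 0 r) u + 2 * nsq (ball 0 r) (\<lambda>x::real^'n. \<delta>)"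
        by (rule nsq_add) auto
      also have "\<dots> < \<infinity>"
        using fin(1) nsq_mono_set[of "ball 0 r" UNIV u] emeasure_lborel_ball_finite[of "0::real^'n" r]
        by (auto simp: nsq_def[of _ "\<lambda>x::real^'n. \<delta>"] nn_integral_cmult_indicator ennreal_mult_less_top elim: le_less_trans)
      finally show ?thesis .
    qed
    show "nsq (ball 0 r) G < \<infinity>" using fin(2) nsq_mono_set[of "ball 0 r" UNIV G] by (auto elim: le_less_trans)
    show "u x + \<delta> \<in> {\<delta>..}" for x using u0 by simp
    show "(F n has_derivative (\<lambda>h. D n x \<bullet> h)) (at x)" for n x
    proof -
      have "(conv u (mollifier (\<epsilon> (s n))) has_derivative (\<lambda>h. D n x \<bullet> h)) (at x)"
        unfolding D_def by (rule conv_has_derivative[OF int smooth_cs_mollifier[OF \<epsilon>]])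
      from has_derivative_add[OF this has_derivative_const[of \<delta>]]
      show ?thesis unfolding F_def[abs_def] by simp
    qed
    show "continuous_on UNIV (D n)" for n
    proof -
      have "continuous_on UNIV (conv u (partial_deriv i (mollifier (\<epsilon> (s n)))))" for i
        using Ck_conv[OF int smooth_cs_partial_deriv[OF smooth_cs_mollifier[OF \<epsilon>]], of 0] by simp
      then show ?thesis unfolding D_def[abs_def] by (intro continuous_on_vec_lambda)
    qed
    show "F n x \<in> {\<delta>..}" for n x
      unfolding F_def conv_def using u0 mollifier_nonneg[OF \<epsilon>] by (auto intro!: integral_nonneg_AE AE_I2 mult_nonneg_nonneg)
    have "(\<lambda>n. nsq (ball 0 r) (\<lambda>x. F n x - (u x + \<delta>))) \<longlonglongrightarrow> 0"
    proof (rule nsq_tendsto_le[where c=1, OF _ LIMSEQ_subseq_LIMSEQ[OF l1 s(1)]])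
      fix n
      show "nsq (ball 0 r) (\<lambda>x. F n x - (u x + \<delta>)) \<le> ennreal 1 * ((\<lambda>n. nsq UNIV (\<lambda>x. conv u (mollifier (\<epsilon> n)) x - u x)) \<circ> s) n"
        unfolding F_def by (simp add: nsq_mono_set)
    qed
    then show "(\<lambda>n. nsq (ball 0 r) (\<lambda>x. F n x - (u x + \<delta>))) \<longlonglongrightarrow> 0" .
    show "(\<lambda>n. nsq (ball 0 r) (\<lambda>x. D n x - G x)) \<longlonglongrightarrow> 0"
      using LIMSEQ_subseq_LIMSEQ[OF l2 s(1)] by (simp add: D_def o_def)
    show "AE x in lborel. x \<in> ball 0 r \<longrightarrow> (\<lambda>n. F n x) \<longlonglongrightarrow> u x + \<delta>"
      using s(2)
    proof eventually_elim
      case (elim x)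
      then have "(\<lambda>n. conv u (mollifier (\<epsilon> (s n))) x) \<longlonglongrightarrow> u x" by (simp add: LIM_zero_iff)
      then show ?case unfolding F_def by (intro impI tendsto_intros)
    qed
  qed auto
  then show ?thesis by (rule that)
qed

section \<open>Integration by parts for continuously differentiable functions\<close>

lemma gradient_zero_outside:
  assumes "\<And>x. (g has_derivative (\<lambda>h. D x \<bullet> h)) (at x)" and "\<And>x. norm x > R \<Longrightarrow> g x = 0" and "norm x > R"
  shows "D x = (0 :: real ^ 'n)"
proof -
  have "open {x::real^'n. norm x > R}" by (simp add: open_Collect_less continuous_on_norm)
  moreover have "((\<lambda>x. 0) has_derivative (\<lambda>h. 0)) (at x)" by simp
  ultimately have "(g has_derivative (\<lambda>h. 0)) (at x)"
    using has_derivative_transform_within_open[of "\<lambda>x. 0" "\<lambda>h. 0" x UNIV "{x. norm x > R}" g] assms(2,3)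
    by simp
  with assms(1)[of x] have "(\<lambda>h. D x \<bullet> h) = (\<lambda>h. 0)" by (rule has_derivative_unique)
  then have "D x \<bullet> D x = 0" by (rule fun_cong)
  then show ?thesis by simp
qed

lemma continuous_cs_bounded:
  fixes D :: "real ^ 'n \<Rightarrow> 'b::real_normed_vector"
  assumes "continuous_on UNIV D" "\<And>x. norm x > R \<Longrightarrow> D x = 0"
  obtains M where "M \<ge> 0" "\<And>x. norm (D x) \<le> M"
proof -
  have "compact (D ` cball 0 R)"
    by (rule compact_continuous_image[OF continuous_on_subset[OF assms(1)]]) auto
  then obtain M where M: "\<And>x. x \<in> cball 0 R \<Longrightarrow> norm (D x) \<le> M"
    using compact_imp_bounded[of "D ` cball 0 R"] unfolding bounded_iff by fastforce
  have "norm (D x) \<le> max M 0" for x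
    using M[of x] assms(2)[of x] by (cases "norm x \<le> R") auto
  then show ?thesis by (intro that[of "max M 0"]) auto
qed

text \<open>The integrals of the difference quotients vanish by translation invariance.\<close>

lemma integral_partial_eq_0:
  fixes g :: "real ^ 'n \<Rightarrow> real"
  assumes d: "\<And>x. (g has_derivative (\<lambda>h. D x \<bullet> h)) (at x)" and c: "continuous_on UNIV D"
    and z: "\<And>x. norm x > R \<Longrightarrow> g x = 0"
  shows "(LINT x|lborel. D x $ i) = 0"
proof -
  have Dz: "\<And>x. norm x > R \<Longrightarrow> D x = 0" using d z by (rule gradient_zero_outside)
  obtain M where M: "M \<ge> 0" "\<And>x. norm (D x) \<le> M" using continuous_cs_bounded[OF c Dz] by blast
  have gc: "continuous_on UNIV g" by (rule has_gradient_continuous[OF d])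
  have [measurable]: "g \<in> borel_measurable borel" "D \<in> borel_measurable borel"
    using gc c by (auto intro: borel_measurable_continuous_onI)
  have gint: "integrable lborel g"
  proof -
    have "integrable lborel (\<lambda>x. indicator (cball 0 R) x *\<^sub>R g x)"
      by (intro borel_integrable_compact continuous_on_subset[OF gc]) auto
    moreover have "(\<lambda>x. indicator (cball 0 R) x *\<^sub>R g x) = g"
      using z by (force simp: indicator_def not_le)
    ultimately show ?thesis by simp
  qed
  define t where "t n = inverse (real (Suc n))" for n
  have t: "t n > 0" "t n \<le> 1" for n by (auto simp: t_def field_simps)
  define e where "e = (axis i 1 :: real ^ 'n)"
  have e1: "norm e = 1" by (simp add: e_def norm_axis_1)
  define q where "q n x = (g (x + t n *\<^sub>R e) - g x) / t n" for n x
  have lip: "\<bar>g y - g x\<bar> \<le> M * norm (y - x)" for x y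
  proof -
    have "norm (g y - g x) \<le> M * norm (y - x)"
    proof (rule differentiable_bound[of UNIV g "\<lambda>x h. D x \<bullet> h"])
      show "onorm (\<lambda>h. D x \<bullet> h) \<le> M" for x
      proof (rule onorm_le)
        fix h
        have "norm (D x \<bullet> h) \<le> norm (D x) * norm h" using Cauchy_Schwarz_ineq2[of "D x" h] by simp
        also have "\<dots> \<le> M * norm h" using M(2) by (rule mult_right_mono) simp
        finally show "norm (D x \<bullet> h) \<le> M * norm h" .
      qed
    qed (use d in auto)
    then show ?thesis by simp
  qed
  have q0: "(LINT x|lborel. q n x) = 0" for n
  proof -
    have i1: "integrable (distr lborel borel ((+) (t n *\<^sub>R e))) g"
      using gint by (simp only: lborel_distr_plus)
    then have i2: "integrable lborel (\<lambda>x. g (x + t n *\<^sub>R e))"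
      by (subst (asm) integrable_distr_eq) (auto simp: add.commute)
    have "(LINT x|lborel. g x) = (LINT x|distr lborel borel ((+) (t n *\<^sub>R e)). g x)"
      by (simp only: lborel_distr_plus)
    also have "\<dots> = (LINT x|lborel. g (x + t n *\<^sub>R e))"
      by (subst integral_distr) (auto simp: add.commute)
    finally show ?thesis unfolding q_def using i2 gint by simp
  qed
  have "(\<lambda>n. LINT x|lborel. q n x) \<longlonglongrightarrow> (LINT x|lborel. D x $ i)"
  \<comment> \<open>The step sizes are at most 1, so all quotients vanish outside radius
    \<open>R + 1\<close>; they are bounded by the Lipschitz constant \<open>M\<close>.\<close>
  proof (rule integral_dominated_convergence[where w="\<lambda>x. M * indicator (cball 0 (R + 1)) x"])
    show "q n \<in> borel_measurable lborel" for n unfolding q_def[abs_def] by measurable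
    show "integrable lborel (\<lambda>x. M * indicator (cball (0::real^'n) (R + 1)) x)"
      using emeasure_lborel_cball_finite[of "0::real^'n" "R + 1"] by simp
    show "AE x in lborel. (\<lambda>n. q n x) \<longlonglongrightarrow> D x $ i"
    proof (rule AE_I2)
      fix x
      have "((\<lambda>s. x + s *\<^sub>R e) has_derivative (\<lambda>s. s *\<^sub>R e)) (at 0)" by (auto intro!: derivative_eq_intros)
      moreover have "(g has_derivative (\<lambda>h. D x \<bullet> h)) (at (x + 0 *\<^sub>R e))" using d[of x] by simp
      ultimately have "((\<lambda>s. g (x + s *\<^sub>R e)) has_derivative (\<lambda>s. D x \<bullet> (s *\<^sub>R e))) (at 0)"
        by (rule has_derivative_compose)
      moreover have "(\<lambda>s. D x \<bullet> (s *\<^sub>R e)) = (*) (D x $ i)"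
        by (auto simp: e_def inner_axis mult.commute)
      ultimately have "((\<lambda>s. g (x + s *\<^sub>R e)) has_real_derivative D x $ i) (at 0)"
        by (simp add: has_field_derivative_def)
      then have "((\<lambda>s. (g (x + s *\<^sub>R e) - g x) / s) \<longlongrightarrow> D x $ i) (at 0)"
        by (simp add: DERIV_def)
      moreover have "filterlim t (at 0) sequentially"
        unfolding filterlim_at t_def using LIMSEQ_inverse_real_of_nat by auto
      ultimately show "(\<lambda>n. q n x) \<longlonglongrightarrow> D x $ i" unfolding q_def by (rule filterlim_compose)
    qed
    show "AE x in lborel. norm (q n x) \<le> M * indicator (cball 0 (R + 1)) x" for n
    proof (rule AE_I2)
      fix x
      have n: "norm (t n *\<^sub>R e) \<le> 1" using t[of n] e1 by simp
      have "\<bar>g (x + t n *\<^sub>R e) - g x\<bar> \<le> M * t n" using lip[of "x + t n *\<^sub>R e" x] t[of n] e1 by simp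
      then have "\<bar>q n x\<bar> \<le> M" using t(1)[of n] by (simp add: q_def abs_divide divide_le_eq)
      moreover have "q n x = 0" if "norm x > R + 1"
        using that z[of x] z[of "x + t n *\<^sub>R e"] norm_diff_ineq[of x "t n *\<^sub>R e"] n by (simp add: q_def)
      ultimately show "norm (q n x) \<le> M * indicator (cball 0 (R + 1)) x"
        by (cases "norm x \<le> R + 1") auto
    qed
  qed measurable
  with q0 show ?thesis by (simp add: LIMSEQ_const_iff)
qed

text \<open>The product \<open>F * K\<close> inherits bounded support from \<open>K\<close>, so its
  partial derivatives integrate to 0.\<close>

lemma C1_integration_by_parts:
  fixes F K :: "real ^ 'n \<Rightarrow> real"
  assumes F: "\<And>x. (F has_derivative (\<lambda>h. D x \<bullet> h)) (at x)" "continuous_on UNIV D"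
    and K: "smooth_cs K"
  shows "(LINT x|lborel. F x * partial_deriv i K x) = - (LINT x|lborel. D x $ i * K x)"
proof -
  from K obtain R where R: "\<And>x. norm x > R \<Longrightarrow> K x = 0" unfolding smooth_cs_def by auto
  from smooth_cs_partial_deriv[OF K, of i] obtain R' where R': "\<And>x. norm x > R' \<Longrightarrow> partial_deriv i K x = 0"
    unfolding smooth_cs_def by auto
  have Fc: "continuous_on UNIV F" by (rule has_gradient_continuous[OF F(1)])
  have Kc: "continuous_on UNIV K" "continuous_on UNIV (partial_deriv i K)" for i
    using K smooth_cs_continuous smooth_cs_partial_deriv by blast+
  have ci: "integrable lborel g" if "continuous_on UNIV g" "\<And>x. norm x > S \<Longrightarrow> g x = 0" for g :: "real^'n \<Rightarrow> real" and S
  proof -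
    have "integrable lborel (\<lambda>x. indicator (cball 0 S) x *\<^sub>R g x)"
      by (intro borel_integrable_compact continuous_on_subset[OF that(1)]) auto
    moreover have "(\<lambda>x. indicator (cball 0 S) x *\<^sub>R g x) = g"
      using that(2) by (force simp: indicator_def not_le)
    ultimately show ?thesis by simp
  qed
  have i1: "integrable lborel (\<lambda>x. F x * partial_deriv i K x)"
    by (rule ci[of _ R']) (auto intro!: continuous_intros Fc Kc R')
  have i2: "integrable lborel (\<lambda>x. D x $ i * K x)"
    by (rule ci[of _ R]) (auto intro!: continuous_intros F Kc R)
  have "(LINT x|lborel. (F x *\<^sub>R grad_cs K x + K x *\<^sub>R D x) $ i) = 0"
  proof (rule integral_partial_eq_0)
    show "((\<lambda>x. F x * K x) has_derivative (\<lambda>h. (F x *\<^sub>R grad_cs K x + K x *\<^sub>R D x) \<bullet> h)) (at x)" for x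
      using has_derivative_mult[OF F(1) smooth_cs_derivative[OF K], of x]
      by (simp add: inner_add_left mult.commute)
    show "continuous_on UNIV (\<lambda>x. F x *\<^sub>R grad_cs K x + K x *\<^sub>R D x)"
      by (intro continuous_intros continuous_on_vec_lambda Fc Kc F)
    show "F x * K x = 0" if "norm x > R" for x using R that by simp
  qed
  then show ?thesis using i1 i2 by (simp add: mult.commute[of "K _"])
qed

lemma smooth_cs_nsq_finite:
  fixes K :: "real ^ 'n \<Rightarrow> real"
  assumes "smooth_cs K" shows "nsq UNIV K < \<infinity>"
proof -
  have [measurable]: "K \<in> borel_measurable borel"
    using smooth_cs_continuous[OF assms] by (rule borel_measurable_continuous_onI)
  obtain B where B: "\<And>x. \<bar>K x\<bar> \<le> B" "0 \<le> B" using smooth_cs_bounded[OF assms] by blast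
  have "integrable lborel (\<lambda>x. (K x)\<^sup>2)"
  proof (rule Bochner_Integration.integrable_bound)
    show "integrable lborel (\<lambda>x. B * K x)" using smooth_cs_integrable[OF assms] by simp
    show "AE x in lborel. norm ((K x)\<^sup>2) \<le> norm (B * K x)"
    proof (rule AE_I2)
      fix x
      have "\<bar>K x\<bar> * \<bar>K x\<bar> \<le> B * \<bar>K x\<bar>" using B by (intro mult_right_mono) auto
      then show "norm ((K x)\<^sup>2) \<le> norm (B * K x)" using B by (simp add: power2_eq_square abs_mult)
    qed
  qed auto
  then show ?thesis using nsq_finite_iff_integrable[of K UNIV] by simp
qed

text \<open>Each approximant can be integrated by parts classically; both sides are
  \<open>L\<^sup>2\<close> pairings with fixed functions and pass to the limit. This is how chain
  and product rule reach the weak gradients.\<close>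

lemma aprx_weak_identity:
  fixes f :: "real ^ 'n \<Rightarrow> real"
  assumes a: "aprx UNIV UNIV f G F D" and K: "smooth_cs K"
    and fin: "\<And>n. nsq UNIV (F n) < \<infinity>" "\<And>n. nsq UNIV (D n) < \<infinity>"
  shows "(LINT x|lborel. f x * partial_deriv i K x) = - (LINT x|lborel. G x $ i * K x)"
proof -
  note [measurable] = aprx_measurable[OF a]
  have Kc: "continuous_on UNIV K" "continuous_on UNIV (partial_deriv i K)" for i
    using K smooth_cs_continuous smooth_cs_partial_deriv by blast+
  have [measurable]: "K \<in> borel_measurable borel" "partial_deriv i K \<in> borel_measurable borel"
    using Kc by (auto intro: borel_measurable_continuous_onI)
  have l1: "(\<lambda>n. nsq UNIV (\<lambda>x. F n x - f x)) \<longlonglongrightarrow> 0" and l2: "(\<lambda>n. nsq UNIV (\<lambda>x. D n x - G x)) \<longlonglongrightarrow> 0"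
    and f: "nsq UNIV f < \<infinity>" "nsq UNIV G < \<infinity>" using a by (auto simp: aprx_def)
  have l3: "(\<lambda>n. nsq UNIV (\<lambda>x. D n x $ i - G x $ i)) \<longlonglongrightarrow> 0"
    by (rule nsq_tendsto_le[where c=1, OF _ l2]) (use nsq_nth_le[of UNIV "\<lambda>x. D _ x - G x" i] in simp)
  have fi: "nsq UNIV (\<lambda>x. D n x $ i) < \<infinity>" "nsq UNIV (\<lambda>x. G x $ i) < \<infinity>" for n
    using nsq_nth_le[of UNIV "D n" i] nsq_nth_le[of UNIV G i] fin(2)[of n] f(2) by (auto elim: le_less_trans)
  have L: "(\<lambda>n. LINT x|lborel. F n x * partial_deriv i K x) \<longlonglongrightarrow> (LINT x|lborel. f x * partial_deriv i K x)"
    by (rule L2_pairing_tendsto) (use fin f l1 smooth_cs_nsq_finite[OF smooth_cs_partial_deriv[OF K]] in measurable)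
  have "(\<lambda>n. LINT x|lborel. D n x $ i * K x) \<longlonglongrightarrow> (LINT x|lborel. G x $ i * K x)"
    by (rule L2_pairing_tendsto) (use fi l3 smooth_cs_nsq_finite[OF K] in measurable)
  then have "(\<lambda>n. - (LINT x|lborel. D n x $ i * K x)) \<longlonglongrightarrow> - (LINT x|lborel. G x $ i * K x)"
    by (rule tendsto_minus)
  moreover have "- (LINT x|lborel. D n x $ i * K x) = (LINT x|lborel. F n x * partial_deriv i K x)" for n
    using a K by (subst C1_integration_by_parts[of "F n" "D n"]) (auto simp: aprx_def)
  ultimately show ?thesis using L LIMSEQ_unique by simp
qed

section \<open>Correspondence with \<open>W12\<close> and \<open>weak_grad\<close>\<close>

lemma weak_partial_lborel:
  fixes u u' g g' :: "real ^ 'n \<Rightarrow> real"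
  assumes [measurable]: "u' \<in> borel_measurable borel" "g' \<in> borel_measurable borel" "\<Omega> \<in> sets borel"
    and u: "AE x in lborel. x \<in> \<Omega> \<longrightarrow> u x = u' x" and g: "AE x in lborel. x \<in> \<Omega> \<longrightarrow> g x = g' x"
  shows "weak_partial \<Omega> i u g \<longleftrightarrow> (\<forall>\<phi>\<in>test_functions \<Omega>.
     (LINT x|lborel. u' x * partial_deriv i \<phi> x) = - (LINT x|lborel. g' x * \<phi> x))"
  unfolding weak_partial_def
proof (rule ball_cong[OF refl])
  fix \<phi> :: "real ^ 'n \<Rightarrow> real" assume \<phi>: "\<phi> \<in> test_functions \<Omega>"
  note K = test_functions_smooth_cs[OF \<phi>]
  have [measurable]: "\<phi> \<in> borel_measurable borel" "partial_deriv i \<phi> \<in> borel_measurable borel"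
    using smooth_cs_continuous[OF K] smooth_cs_continuous[OF smooth_cs_partial_deriv[OF K]]
    by (auto intro: borel_measurable_continuous_onI)
  have "(LINT x|lebesgue_on \<Omega>. u x * partial_deriv i \<phi> x)
      = (LINT x|lborel. indicator \<Omega> x * (u' x * partial_deriv i \<phi> x))"
    by (rule lebesgue_on_eq_lborel) (use u in \<open>auto elim: AE_mp\<close>)
  also have "\<dots> = (LINT x|lborel. u' x * partial_deriv i \<phi> x)"
    by (rule Bochner_Integration.integral_cong) (auto simp: test_function_zero_outside[OF \<phi>] indicator_def)
  finally have 1: "(LINT x|lebesgue_on \<Omega>. u x * partial_deriv i \<phi> x) = (LINT x|lborel. u' x * partial_deriv i \<phi> x)" .
  have "(LINT x|lebesgue_on \<Omega>. g x * \<phi> x) = (LINT x|lborel. indicator \<Omega> x * (g' x * \<phi> x))"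
    by (rule lebesgue_on_eq_lborel) (use g in \<open>auto elim: AE_mp\<close>)
  also have "\<dots> = (LINT x|lborel. g' x * \<phi> x)"
    by (rule Bochner_Integration.integral_cong) (auto simp: test_function_zero_outside[OF \<phi>] indicator_def)
  finally show "(LINT x|lebesgue_on \<Omega>. u x * partial_deriv i \<phi> x) = - (LINT x|lebesgue_on \<Omega>. g x * \<phi> x)
      \<longleftrightarrow> (LINT x|lborel. u' x * partial_deriv i \<phi> x) = - (LINT x|lborel. g' x * \<phi> x)"
    using 1 by simp
qed

lemma L2_iff_nsq:
  fixes u u' :: "real ^ 'n \<Rightarrow> real"
  assumes [measurable]: "u' \<in> borel_measurable borel" "\<Omega> \<in> sets borel"
    and u: "AE x in lborel. x \<in> \<Omega> \<longrightarrow> u x = u' x"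
  shows "u \<in> L2 \<Omega> \<longleftrightarrow> nsq \<Omega> u' < \<infinity>"
proof -
  have "u \<in> borel_measurable (lebesgue_on \<Omega>)" by (rule measurable_lebesgue_on_AE[OF _ _ u]) auto
  moreover have "integrable (lebesgue_on \<Omega>) (\<lambda>x. (u x)\<^sup>2) \<longleftrightarrow> integrable lborel (\<lambda>x. indicator \<Omega> x * (u' x)\<^sup>2)"
    by (rule lebesgue_on_eq_lborel) (use u in \<open>auto elim: AE_mp\<close>)
  ultimately show ?thesis unfolding L2_def using nsq_finite_iff_integrable[of u' \<Omega>] by simp
qed

lemma borel_vec_representative:
  fixes G :: "real ^ 'n \<Rightarrow> real ^ 'n"
  assumes "\<And>i. (\<lambda>x. G x $ i) \<in> borel_measurable (lebesgue_on \<Omega>)" and \<Omega>: "\<Omega> \<in> sets borel"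
  obtains H where "H \<in> borel_measurable borel" "\<And>x. x \<notin> \<Omega> \<Longrightarrow> H x = 0"
    "AE x in lborel. x \<in> \<Omega> \<longrightarrow> G x = H x"
proof -
  have "\<forall>i. \<exists>g. g \<in> borel_measurable borel \<and> (\<forall>x. x \<notin> \<Omega> \<longrightarrow> g x = 0) \<and> (AE x in lborel. x \<in> \<Omega> \<longrightarrow> G x $ i = g x)"
    using borel_representative[OF assms(1) \<Omega>] by blast
  from choice[OF this] obtain h where h: "\<And>i. h i \<in> borel_measurable borel" "\<And>i x. x \<notin> \<Omega> \<Longrightarrow> h i x = 0"
    "\<And>i. AE x in lborel. x \<in> \<Omega> \<longrightarrow> G x $ i = h i x" by auto
  have "AE x in lborel. \<forall>i. x \<in> \<Omega> \<longrightarrow> G x $ i = h i x" unfolding AE_all_countable using h(3) by blast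
  then have "AE x in lborel. x \<in> \<Omega> \<longrightarrow> G x = (\<chi> i. h i x)" by eventually_elim (auto simp: vec_eq_iff)
  moreover have "(\<lambda>x. \<chi> i. h i x) \<in> borel_measurable borel" using h(1) by measurable
  moreover have "(\<chi> i. h i x) = 0" if "x \<notin> \<Omega>" for x using h(2) that by (simp add: vec_eq_iff)
  ultimately show ?thesis using that by blast
qed

lemma nsq_finite_nth:
  fixes G :: "real ^ 'n \<Rightarrow> real ^ 'n"
  assumes [measurable]: "G \<in> borel_measurable borel" "A \<in> sets borel"
  shows "nsq A G < \<infinity> \<longleftrightarrow> (\<forall>i. nsq A (\<lambda>x. G x $ i) < \<infinity>)"
  by (subst nsq_eq_sum_nth) auto

text \<open>\<open>weak_grad\<close> is an unspecified choice among all weak gradients. The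
  difference of two candidates annihilates every test function, so the fundamental lemma identifies
  the choice with \<open>G\<close> almost everywhere.\<close>

lemma wgrad_imp_W12:
  fixes u :: "real ^ 'n \<Rightarrow> real"
  assumes w: "wgrad (ball 0 1) u G"
  shows "u \<in> W12 (ball 0 1)" and "AE x in lborel. x \<in> ball 0 1 \<longrightarrow> weak_grad (ball 0 1) u x = G x"
proof -
  let ?B = "ball (0::real^'n) 1"
  have [measurable]: "u \<in> borel_measurable borel" "G \<in> borel_measurable borel" using w by (auto simp: wgrad_def)
  have fin: "nsq UNIV u < \<infinity>" "nsq UNIV G < \<infinity>" using w by (auto simp: wgrad_def)
  have fi: "nsq UNIV (\<lambda>x. G x $ i) < \<infinity>" for i using fin(2) nsq_finite_nth[of G UNIV] by auto
  have L: "u \<in> L2 ?B" "(\<lambda>x. G x $ i) \<in> L2 ?B" for i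
    using fin(1) fi[of i] nsq_mono_set[of ?B UNIV u] nsq_mono_set[of ?B UNIV "\<lambda>x. G x $ i"]
    by (auto simp: L2_iff_nsq[of u] L2_iff_nsq[of "\<lambda>x. G x $ i"] elim: le_less_trans)
  have P: "weak_partial ?B i u (\<lambda>x. G x $ i)" for i
    using w by (subst weak_partial_lborel[of u "\<lambda>x. G x $ i"]) (auto simp: wgrad_def)
  show "u \<in> W12 ?B" unfolding W12_def using L P by blast
  have ex: "\<forall>i. (\<lambda>x. weak_grad ?B u x $ i) \<in> L2 ?B \<and> weak_partial ?B i u (\<lambda>x. weak_grad ?B u x $ i)"
    unfolding weak_grad_def
    by (rule someI_ex[of "\<lambda>G. \<forall>i. (\<lambda>x. G x $ i) \<in> L2 ?B \<and> weak_partial ?B i u (\<lambda>x. G x $ i)"])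
       (use L P in blast)
  let ?W = "weak_grad ?B u"
  obtain H where H[measurable]: "H \<in> borel_measurable borel" and Hz: "\<And>x. x \<notin> ?B \<Longrightarrow> H x = 0"
    and HW: "AE x in lborel. x \<in> ?B \<longrightarrow> ?W x = H x"
  proof (rule borel_vec_representative)
    show "(\<lambda>x. ?W x $ i) \<in> borel_measurable (lebesgue_on ?B)" for i using ex by (simp add: L2_def)
  qed auto
  have HWi: "AE x in lborel. x \<in> ?B \<longrightarrow> ?W x $ i = H x $ i" for i using HW by eventually_elim auto
  have "nsq ?B (\<lambda>x. H x $ i) < \<infinity>" for i
    using ex L2_iff_nsq[OF _ _ HWi, of i] by simp
  then have Hf: "nsq UNIV (\<lambda>x. H x $ i) < \<infinity>" for i
    by (subst nsq_UNIV_eq[of ?B]) (auto simp: Hz)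
  have "AE x in lborel. G x $ i - H x $ i = 0" for i
  proof (rule fundamental_lemma_ball[where R=1])
    show "G x $ i - H x $ i = 0" if "x \<notin> ?B" for x using Hz[OF that] w that by (auto simp: wgrad_def)
    show "nsq UNIV (\<lambda>x. G x $ i - H x $ i) < \<infinity>"
    proof -
      have "nsq UNIV (\<lambda>x. G x $ i + - H x $ i) \<le> 2 * nsq UNIV (\<lambda>x. G x $ i) + 2 * nsq UNIV (\<lambda>x. - H x $ i)"
        by (rule nsq_add) auto
      also have "\<dots> < \<infinity>" using fi[of i] Hf[of i] by (simp add: nsq_minus ennreal_mult_less_top)
      finally show ?thesis by simp
    qed
    fix \<phi> assume \<phi>: "\<phi> \<in> test_functions ?B"
    note K = test_functions_smooth_cs[OF \<phi>]
    have [measurable]: "\<phi> \<in> borel_measurable borel"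
      using smooth_cs_continuous[OF K] by (auto intro: borel_measurable_continuous_onI)
    have 1: "(LINT x|lborel. u x * partial_deriv i \<phi> x) = - (LINT x|lborel. G x $ i * \<phi> x)"
      using w \<phi> by (auto simp: wgrad_def)
    have "\<forall>\<phi>\<in>test_functions ?B. (LINT x|lborel. u x * partial_deriv i \<phi> x) = - (LINT x|lborel. H x $ i * \<phi> x)"
      using ex by (subst weak_partial_lborel[of u "\<lambda>x. H x $ i" ?B u "\<lambda>x. ?W x $ i", symmetric]) (use HWi in auto)
    then have 2: "(LINT x|lborel. u x * partial_deriv i \<phi> x) = - (LINT x|lborel. H x $ i * \<phi> x)"
      using \<phi> by blast
    have "integrable lborel (\<lambda>x. G x $ i * \<phi> x)" "integrable lborel (\<lambda>x. H x $ i * \<phi> x)"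
      using fi[of i] Hf[of i] smooth_cs_nsq_finite[OF K] by (auto intro!: integrable_mult_L2)
    then show "(LINT x|lborel. (G x $ i - H x $ i) * \<phi> x) = 0"
      using 1 2 by (simp add: left_diff_distrib)
  qed measurable
  then have "AE x in lborel. \<forall>i. G x $ i - H x $ i = 0" by (simp add: AE_all_countable)
  with HW show "AE x in lborel. x \<in> ?B \<longrightarrow> ?W x = G x"
    by eventually_elim (auto simp: vec_eq_iff)
qed

text \<open>The weak partial derivatives provided by \<open>W12\<close> one index at a time form a
  witness for the choice in \<open>weak_grad\<close>; hence the chosen gradient is a genuine one and
  has a Borel version.\<close>

lemma W12_wgrad:
  fixes u :: "real ^ 'n \<Rightarrow> real"
  assumes "u \<in> W12 (ball 0 1)"
  obtains u' G where "wgrad (ball 0 1) u' G" "AE x in lborel. x \<in> ball 0 1 \<longrightarrow> u x = u' x"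
    "AE x in lborel. x \<in> ball 0 1 \<longrightarrow> weak_grad (ball 0 1) u x = G x"
proof -
  let ?B = "ball (0::real^'n) 1"
  obtain u' where u'[measurable]: "u' \<in> borel_measurable borel" and uz: "\<And>x. x \<notin> ?B \<Longrightarrow> u' x = 0"
    and uu: "AE x in lborel. x \<in> ?B \<longrightarrow> u x = u' x"
  proof (rule borel_representative)
    show "u \<in> borel_measurable (lebesgue_on ?B)" using assms by (simp add: W12_def L2_def)
  qed auto
  have "\<forall>i. \<exists>g. g \<in> L2 ?B \<and> weak_partial ?B i u g" using assms by (auto simp: W12_def)
  from choice[OF this] obtain g where g: "\<And>i. g i \<in> L2 ?B" "\<And>i. weak_partial ?B i u (g i)" by auto
  have ex: "\<forall>i. (\<lambda>x. weak_grad ?B u x $ i) \<in> L2 ?B \<and> weak_partial ?B i u (\<lambda>x. weak_grad ?B u x $ i)"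
    unfolding weak_grad_def
    by (rule someI[of "\<lambda>G. \<forall>i. (\<lambda>x. G x $ i) \<in> L2 ?B \<and> weak_partial ?B i u (\<lambda>x. G x $ i)" "\<lambda>x. \<chi> i. g i x"])
       (use g in simp)
  let ?W = "weak_grad ?B u"
  obtain H where H[measurable]: "H \<in> borel_measurable borel" and Hz: "\<And>x. x \<notin> ?B \<Longrightarrow> H x = 0"
    and HW: "AE x in lborel. x \<in> ?B \<longrightarrow> ?W x = H x"
  proof (rule borel_vec_representative)
    show "(\<lambda>x. ?W x $ i) \<in> borel_measurable (lebesgue_on ?B)" for i using ex by (simp add: L2_def)
  qed auto
  have HWi: "AE x in lborel. x \<in> ?B \<longrightarrow> ?W x $ i = H x $ i" for i using HW by eventually_elim auto
  have "nsq ?B (\<lambda>x. H x $ i) < \<infinity>" for i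
    using ex L2_iff_nsq[OF _ _ HWi, of i] by simp
  then have "nsq UNIV (\<lambda>x. H x $ i) < \<infinity>" for i
    by (subst nsq_UNIV_eq[of ?B]) (auto simp: Hz)
  then have Hf: "nsq UNIV H < \<infinity>" using nsq_finite_nth[of H UNIV] by simp
  have "nsq ?B u' < \<infinity>" using assms L2_iff_nsq[OF _ _ uu] by (simp add: W12_def)
  then have uf: "nsq UNIV u' < \<infinity>" by (subst nsq_UNIV_eq[of ?B]) (auto simp: uz)
  have "\<forall>\<phi>\<in>test_functions ?B. (LINT x|lborel. u' x * partial_deriv i \<phi> x) = - (LINT x|lborel. H x $ i * \<phi> x)" for i
    using ex by (subst weak_partial_lborel[of u' "\<lambda>x. H x $ i" ?B u "\<lambda>x. ?W x $ i", symmetric]) (use HWi uu in auto)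
  then have "wgrad ?B u' H" unfolding wgrad_def using uz Hz uf Hf by auto
  then show ?thesis using uu HW by (rule that)
qed

lemma LINT_eq_nsq:
  fixes f :: "'a::euclidean_space \<Rightarrow> 'b::euclidean_space"
  assumes [measurable]: "f \<in> borel_measurable borel" "A \<in> sets borel"
  shows "(LINT x|lborel. indicator A x * (norm (f x))\<^sup>2) = enn2real (nsq A f)"
proof -
  have "(LINT x|lborel. indicator A x * (norm (f x))\<^sup>2)
      = enn2real (\<integral>\<^sup>+x. ennreal (indicator A x * (norm (f x))\<^sup>2) \<partial>lborel)"
    by (rule integral_eq_nn_integral) auto
  also have "(\<integral>\<^sup>+x. ennreal (indicator A x * (norm (f x))\<^sup>2) \<partial>lborel) = nsq A f"
    unfolding nsq_def by (intro nn_integral_cong) (auto simp: indicator_def)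
  finally show ?thesis .
qed

lemma W12_norm_wgrad:
  assumes w: "wgrad (ball 0 1) w H"
  shows "W12_norm (ball 0 1) w = sqrt (enn2real (nsq (ball 0 1) w) + enn2real (nsq (ball 0 1) H))"
proof -
  have [measurable]: "w \<in> borel_measurable borel" "H \<in> borel_measurable borel" using w by (auto simp: wgrad_def)
  have "(LINT x|lebesgue_on (ball 0 1). (w x)\<^sup>2) = (LINT x|lborel. indicator (ball 0 1) x * (norm (w x))\<^sup>2)"
    by (rule lebesgue_on_eq_lborel) auto
  moreover have "(LINT x|lebesgue_on (ball 0 1). (norm (weak_grad (ball 0 1) w x))\<^sup>2)
      = (LINT x|lborel. indicator (ball 0 1) x * (norm (H x))\<^sup>2)"
    by (rule lebesgue_on_eq_lborel) (use wgrad_imp_W12(2)[OF w] in \<open>auto elim: AE_mp\<close>)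
  ultimately show ?thesis unfolding W12_norm_def by (simp add: LINT_eq_nsq del: real_norm_def)
qed

lemma smooth_cs_finite_partial:
  fixes K :: "real ^ 'n \<Rightarrow> real"
  assumes "smooth_cs K"
  shows "(\<lambda>x. grad_cs K x) \<in> borel_measurable borel" "nsq UNIV (\<lambda>x. grad_cs K x) < \<infinity>"
proof -
  have c: "continuous_on UNIV (partial_deriv i K)" for i
    using smooth_cs_continuous[OF smooth_cs_partial_deriv[OF assms]] .
  then show m: "(\<lambda>x. grad_cs K x) \<in> borel_measurable borel"
    by (intro borel_measurable_continuous_onI continuous_on_vec_lambda)
  show "nsq UNIV (\<lambda>x. grad_cs K x) < \<infinity>"
    using nsq_finite_nth[OF m, of UNIV] smooth_cs_nsq_finite[OF smooth_cs_partial_deriv[OF assms]] by simp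
qed

text \<open>Mollifying a compactly supported function yields the approximating test functions.\<close>

lemma compact_support_W12_0:
  fixes f :: "real ^ 'n \<Rightarrow> real"
  assumes m[measurable]: "f \<in> borel_measurable borel" "G \<in> borel_measurable borel"
    and fin: "nsq UNIV f < \<infinity>" "nsq UNIV G < \<infinity>" and r: "0 < r" "r < 1"
    and z: "\<And>x. x \<notin> ball 0 r \<Longrightarrow> f x = 0 \<and> G x = 0"
    and id: "\<And>K i. smooth_cs K \<Longrightarrow> (LINT x|lborel. f x * partial_deriv i K x) = - (LINT x|lborel. G x $ i * K x)"
  shows "f \<in> W12_0 (ball 0 1)" "AE x in lborel. x \<in> ball 0 1 \<longrightarrow> weak_grad (ball 0 1) f x = G x"
proof -
  have w: "wgrad (ball 0 R) f G" if "R \<ge> r" for R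
    unfolding wgrad_def using m fin z id that test_functions_smooth_cs by force
  \<comment> \<open>The unit ball is where membership is claimed. The larger ball gives
    \<open>wgrad_mollify\<close> room around every point of the unit ball; \<open>f\<close> has a
    weak gradient there too because \<open>id\<close> holds for all kernels, wherever they are
    supported.\<close>
  have w1: "wgrad (ball 0 1) f G" and w2: "wgrad (ball 0 2) f G" using r by (auto intro: w)
  have int: "integrable lborel f" by (rule wgrad_integrable[OF w2]) auto
  show "AE x in lborel. x \<in> ball 0 1 \<longrightarrow> weak_grad (ball 0 1) f x = G x" by (rule wgrad_imp_W12(2)[OF w1])
  have sub: "cball x ((1 - r) / 2) \<subseteq> ball 0 2" if "x \<in> ball 0 1" for x :: "real ^ 'n"
  proof
    fix y assume "y \<in> cball x ((1 - r) / 2)"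
    then have "norm (y - x) \<le> (1 - r) / 2" by (simp add: dist_norm norm_minus_commute)
    then show "y \<in> ball 0 2" using that r norm_triangle_ineq2[of y x] by (simp add: field_simps)
  qed
  have "\<exists>\<phi>\<in>test_functions (ball 0 1). W12_norm (ball 0 1) (\<lambda>x. f x - \<phi> x) < e" if e: "e > 0" for e
  proof -
    \<comment> \<open>Two errors of size \<open>e0\<close> add up to half of the square of
      \<open>e\<close>, which leaves a strict inequality.\<close>
    define e0 where "e0 = e\<^sup>2 / 4"
    have e0: "e0 > 0" using e by (simp add: e0_def)
    obtain \<epsilon> where \<epsilon>: "0 < \<epsilon>" "\<epsilon> \<le> (1 - r) / 2"
      and n1: "nsq UNIV (\<lambda>x. conv f (mollifier \<epsilon>) x - f x) \<le> ennreal e0"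
      and n2: "nsq (ball 0 1) (\<lambda>x. (\<chi> i. conv f (partial_deriv i (mollifier \<epsilon>)) x) - G x) \<le> ennreal e0"
      by (rule wgrad_mollify[where B="ball 0 1", OF w2 _ _ _ _ sub e0]) (use r in auto)
    define \<phi> where "\<phi> = conv f (mollifier \<epsilon>)"
    note mol = smooth_cs_mollifier[OF \<epsilon>(1)]
    have ck: "Ck k \<phi>" for k unfolding \<phi>_def by (rule Ck_conv[OF int mol])
    have gr: "partial_deriv i \<phi> = conv f (partial_deriv i (mollifier \<epsilon>))" for i
      unfolding \<phi>_def by (rule partial_deriv_conv[OF int mol])
    have z0: "\<phi> x = 0" if x: "norm x > r + \<epsilon>" for x
    proof -
      have "f y * mollifier \<epsilon> (x - y) = 0" for y
      proof (cases "y \<in> ball 0 r")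
        case True
        then have "norm (x - y) \<ge> \<epsilon>" using x norm_triangle_ineq2[of x y] by simp
        then show ?thesis using mollifier_eq_0[OF \<epsilon>(1), of "x - y"] by simp
      qed (use z in simp)
      then show ?thesis unfolding \<phi>_def conv_def by (simp only: Bochner_Integration.integral_zero)
    qed
    have cs: "smooth_cs \<phi>" unfolding smooth_cs_def using ck z0 by auto
    have "{x. \<phi> x \<noteq> 0} \<subseteq> cball 0 (r + \<epsilon>)" using z0 by (force simp: not_le)
    then have cl: "closure {x. \<phi> x \<noteq> 0} \<subseteq> cball 0 (r + \<epsilon>)" by (simp add: closure_minimal)
    moreover have "cball 0 (r + \<epsilon>) \<subseteq> ball (0::real^'n) 1" using \<epsilon> r by auto
    moreover have "compact (closure {x. \<phi> x \<noteq> 0})"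
      using bounded_subset[OF bounded_cball cl] by (simp add: compact_eq_bounded_closed)
    ultimately have tf: "\<phi> \<in> test_functions (ball 0 1)"
      unfolding test_functions_def using ck by auto
    note zt = test_function_zero_outside[OF tf]
    note [measurable] = smooth_cs_finite_partial(1)[OF cs]
    have [measurable]: "\<phi> \<in> borel_measurable borel" by (intro borel_measurable_continuous_onI smooth_cs_continuous cs)
    let ?w = "\<lambda>x. f x - \<phi> x" and ?H = "\<lambda>x. G x - grad_cs \<phi> x"
    have "wgrad (ball 0 1) ?w ?H"
      unfolding wgrad_def
    proof (intro conjI allI ballI impI)
      have "nsq UNIV ?w \<le> ennreal e0" using n1 by (simp add: \<phi>_def nsq_diff_commute)
      then show "nsq UNIV ?w < \<infinity>" by (auto elim: le_less_trans)
      have "nsq UNIV (\<lambda>x. G x + - grad_cs \<phi> x) \<le> 2 * nsq UNIV G + 2 * nsq UNIV (\<lambda>x. - grad_cs \<phi> x)"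
        by (rule nsq_add) auto
      also have "\<dots> < \<infinity>"
        using fin(2) smooth_cs_finite_partial(2)[OF cs] by (simp add: nsq_minus ennreal_mult_less_top)
      finally show "nsq UNIV ?H < \<infinity>" by simp
      show "?w x = 0" if "x \<notin> ball 0 1" for x using zt(1)[OF that] w1 that by (auto simp: wgrad_def)
      show "?H x = 0" if "x \<notin> ball 0 1" for x using zt(2)[OF that] w1 that by (auto simp: wgrad_def vec_eq_iff)
      fix \<psi> i assume "\<psi> \<in> test_functions (ball (0::real^'n) 1)"
      then have ps: "smooth_cs \<psi>" by (rule test_functions_smooth_cs)
      note pp = smooth_cs_partial_deriv[OF ps]
      have [measurable]: "\<psi> \<in> borel_measurable borel" "partial_deriv i \<psi> \<in> borel_measurable borel"
        "partial_deriv i \<phi> \<in> borel_measurable borel"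
        by (intro borel_measurable_continuous_onI smooth_cs_continuous ps pp smooth_cs_partial_deriv cs)+
      have Gi: "nsq UNIV (\<lambda>x. G x $ i) < \<infinity>" using fin(2) nsq_finite_nth[of G UNIV] by auto
      have 1: "(LINT x|lborel. \<phi> x * partial_deriv i \<psi> x) = - (LINT x|lborel. grad_cs \<phi> x $ i * \<psi> x)"
      proof (rule C1_integration_by_parts[OF _ _ ps])
        show "(\<phi> has_derivative (\<lambda>h. grad_cs \<phi> x \<bullet> h)) (at x)" for x by (rule smooth_cs_derivative[OF cs])
        show "continuous_on UNIV (\<lambda>x. grad_cs \<phi> x)"
          by (intro continuous_on_vec_lambda smooth_cs_continuous smooth_cs_partial_deriv cs)
      qed
      have 2: "integrable lborel (\<lambda>x. f x * partial_deriv i \<psi> x)" "integrable lborel (\<lambda>x. \<phi> x * partial_deriv i \<psi> x)"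
        "integrable lborel (\<lambda>x. G x $ i * \<psi> x)" "integrable lborel (\<lambda>x. partial_deriv i \<phi> x * \<psi> x)"
        using fin(1) Gi smooth_cs_nsq_finite[OF ps] smooth_cs_nsq_finite[OF pp] smooth_cs_nsq_finite[OF cs]
          smooth_cs_nsq_finite[OF smooth_cs_partial_deriv[OF cs]]
        by (auto intro!: integrable_mult_L2)
      show "(LINT x|lborel. ?w x * partial_deriv i \<psi> x) = - (LINT x|lborel. ?H x $ i * \<psi> x)"
        using id[OF ps, of i] 1 2 by (simp add: left_diff_distrib)
    qed measurable
    then have "W12_norm (ball 0 1) ?w = sqrt (enn2real (nsq (ball 0 1) ?w) + enn2real (nsq (ball 0 1) ?H))"
      by (rule W12_norm_wgrad)
    also have "\<dots> \<le> sqrt (e0 + e0)"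
    proof -
      have "nsq (ball 0 1) ?w \<le> nsq UNIV ?w" by (rule nsq_mono_set) auto
      then have "nsq (ball 0 1) ?w \<le> ennreal e0"
        using n1 nsq_diff_commute[of UNIV f \<phi>] by (simp add: \<phi>_def)
      moreover have "nsq (ball 0 1) ?H \<le> ennreal e0"
        using n2 nsq_diff_commute[of "ball 0 1" G "grad_cs \<phi>"] by (simp add: gr)
      ultimately show ?thesis
        using enn2real_leI e0 by (intro real_sqrt_le_mono add_mono) auto
    qed
    also have "\<dots> < e"
    proof -
      have "e0 + e0 = e\<^sup>2 / 2" by (simp add: e0_def)
      also have "\<dots> < e\<^sup>2" using e by simp
      finally have "sqrt (e0 + e0) < sqrt (e\<^sup>2)" by (rule real_sqrt_less_mono)
      then show ?thesis using e by simp
    qed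
    finally show ?thesis using tf by blast
  qed
  then show "f \<in> W12_0 (ball 0 1)" unfolding W12_0_def using wgrad_imp_W12(1)[OF w1] by auto
qed

section \<open>The Sobolev inequality\<close>

text \<open>Concavity of the logarithm on the indices with nonzero weight; if some such factor is 0
  the product vanishes.\<close>

lemma weighted_AM_GM:
  fixes a e :: "'i \<Rightarrow> real"
  assumes "finite S" "\<And>i. i \<in> S \<Longrightarrow> a i \<ge> 0" "\<And>i. i \<in> S \<Longrightarrow> e i \<ge> 0" "(\<Sum>i\<in>S. e i) = 1"
  shows "(\<Prod>i\<in>S. if e i = 0 then 1 else a i powr e i) \<le> (\<Sum>i\<in>S. e i * a i)"
proof -
  define T where "T = {i\<in>S. e i \<noteq> 0}"
  have T: "finite T" "T \<subseteq> S" using assms(1) by (auto simp: T_def)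
  have eT: "(\<Sum>i\<in>T. e i) = 1" using assms(4) T by (subst sum.mono_neutral_left[of S T e]) (auto simp: T_def assms(1))
  have P: "(\<Prod>i\<in>S. if e i = 0 then 1 else a i powr e i) = (\<Prod>i\<in>T. a i powr e i)"
    by (rule prod.mono_neutral_cong_right) (auto simp: T_def assms(1))
  have Q: "(\<Sum>i\<in>S. e i * a i) = (\<Sum>i\<in>T. e i * a i)"
    by (rule sum.mono_neutral_right) (auto simp: T_def assms(1))
  show ?thesis
  proof (cases "\<exists>i\<in>T. a i = 0")
    case True
    then have "(\<Prod>i\<in>T. a i powr e i) = 0" using T by (auto intro!: prod_zero)
    moreover have "(\<Sum>i\<in>T. e i * a i) \<ge> 0" using T assms by (intro sum_nonneg) auto
    ultimately show ?thesis unfolding P Q by simp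
  next
    case False
    then have pos: "a i > 0" if "i \<in> T" for i using that T assms(2)[of i] by force
    have "ln (\<Prod>i\<in>T. a i powr e i) = (\<Sum>i\<in>T. e i * ln (a i))"
    proof -
      have "a i \<noteq> 0" if "i \<in> T" for i using pos[OF that] by simp
      then show ?thesis using T by (subst ln_prod) (auto simp: ln_powr)
    qed
    also have "\<dots> \<le> ln (\<Sum>i\<in>T. e i * a i)"
    proof -
      have "T \<noteq> {}" using eT by auto
      then have "ln (\<Sum>i\<in>T. e i *\<^sub>R a i) \<ge> (\<Sum>i\<in>T. e i * ln (a i))"
        by (intro concave_on_sum[OF T(1) _ ln_concave eT]) (use pos T assms in auto)
      then show ?thesis by simp
    qed
    finally have "ln (\<Prod>i\<in>T. a i powr e i) \<le> ln (\<Sum>i\<in>T. e i * a i)" .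
    moreover have "(\<Prod>i\<in>T. a i powr e i) > 0" using pos by (intro prod_pos) (simp add: powr_gt_zero less_imp_neq[symmetric])
    moreover have "(\<Sum>i\<in>T. e i * a i) > 0"
    proof -
      obtain j where "j \<in> T" using eT by fastforce
      then show ?thesis
      proof (intro sum_pos2[OF T(1) \<open>j \<in> T\<close>])
        show "0 < e j * a j" using \<open>j \<in> T\<close> pos[of j] assms(3)[of j] by (auto simp: T_def)
        show "0 \<le> e i * a i" if "i \<in> T" for i using that pos[of i] assms(3)[of i] by (auto simp: T_def)
      qed
    qed
    ultimately show ?thesis unfolding P Q by simp
  qed
qed

text \<open>In HOL \<open>0 powr 0\<close> is 0, while a Hoelder factor with exponent 0 has to count
  as 1 even where its base vanishes.\<close>

definition pw :: "real \<Rightarrow> real \<Rightarrow> real" where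
  "pw x e = (if e = 0 then 1 else x powr e)"

lemma pw_nonneg [simp]: "0 \<le> pw x e" by (simp add: pw_def)

lemma pw_mono: "0 \<le> x \<Longrightarrow> x \<le> y \<Longrightarrow> 0 \<le> e \<Longrightarrow> pw x e \<le> pw y e"
  by (auto simp: pw_def intro: powr_mono2)

lemma pw_mult: "0 \<le> x \<Longrightarrow> 0 \<le> y \<Longrightarrow> pw (x * y) e = pw x e * pw y e"
  by (simp add: pw_def powr_mult)

lemma pw_add: "0 \<le> x \<Longrightarrow> 0 \<le> e \<Longrightarrow> 0 \<le> e' \<Longrightarrow> pw x e * pw x e' = pw x (e + e')"
  by (auto simp: pw_def powr_add)

lemma measurable_pw [measurable (raw)]:
  assumes "f \<in> borel_measurable M" shows "(\<lambda>x. pw (f x) e) \<in> borel_measurable M"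
  using assms unfolding pw_def by measurable

text \<open>After division of each \<open>f i\<close> by its integral the pointwise weighted AM--GM
  inequality integrates to the claim. If the integral of a factor with nonzero exponent is 0, the
  product vanishes almost everywhere.\<close>

lemma Holder_prod:
  fixes f :: "'i \<Rightarrow> 'a \<Rightarrow> real"
  assumes S: "finite S" and f: "\<And>i. i \<in> S \<Longrightarrow> integrable M (f i)"
    and nn: "\<And>i x. i \<in> S \<Longrightarrow> 0 \<le> f i x" and e: "\<And>i. i \<in> S \<Longrightarrow> 0 \<le> e i" "(\<Sum>i\<in>S. e i) = 1"
  shows "(LINT x|M. (\<Prod>i\<in>S. pw (f i x) (e i))) \<le> (\<Prod>i\<in>S. pw (LINT x|M. f i x) (e i))"
proof -
  have A0: "(LINT x|M. f i x) \<ge> 0" if "i \<in> S" for i using nn that by simp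
  show ?thesis
  proof (cases "\<exists>i\<in>S. e i \<noteq> 0 \<and> (LINT x|M. f i x) = 0")
    case True
    then obtain i where i: "i \<in> S" "e i \<noteq> 0" "(LINT x|M. f i x) = 0" by blast
    then have "AE x in M. f i x = 0" using f nn by (simp add: integral_nonneg_eq_0_iff_AE)
    then have "AE x in M. (\<Prod>i\<in>S. pw (f i x) (e i)) = 0"
    proof eventually_elim
      case (elim x)
      then have "pw (f i x) (e i) = 0" using i by (simp add: pw_def)
      then show ?case using i S by (auto intro!: prod_zero)
    qed
    then have "(LINT x|M. (\<Prod>i\<in>S. pw (f i x) (e i))) = 0" by (rule integral_eq_zero_AE)
    then show ?thesis by (simp add: prod_nonneg)
  next
    case False
    \<comment> \<open>A factor with exponent 0 may well have integral 0; the value 1 keeps the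
      normalising division meaningful.\<close>
    define A where "A i = (if e i = 0 then 1 else LINT x|M. f i x)" for i
    have A: "A i > 0" if "i \<in> S" for i using False that A0[OF that] by (force simp: A_def)
    have Ae: "e i * ((LINT x|M. f i x) / A i) = e i" if "i \<in> S" for i using A[OF that] unfolding A_def by (cases "e i = 0") auto
    have le: "(\<Prod>i\<in>S. pw (f i x) (e i)) \<le> (\<Prod>i\<in>S. pw (A i) (e i)) * (\<Sum>i\<in>S. e i * (f i x / A i))" for x
    proof -
      have "(\<Prod>i\<in>S. pw (f i x) (e i)) = (\<Prod>i\<in>S. pw (A i) (e i) * pw (f i x / A i) (e i))"
      proof (rule prod.cong[OF refl])
        fix i assume i: "i \<in> S"
        have "pw (f i x) (e i) = pw (A i * (f i x / A i)) (e i)" using A[OF i] by simp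
        also have "\<dots> = pw (A i) (e i) * pw (f i x / A i) (e i)"
          using A[OF i] nn[OF i] by (intro pw_mult) auto
        finally show "pw (f i x) (e i) = pw (A i) (e i) * pw (f i x / A i) (e i)" .
      qed
      also have "\<dots> = (\<Prod>i\<in>S. pw (A i) (e i)) * (\<Prod>i\<in>S. pw (f i x / A i) (e i))" by (rule prod.distrib)
      also have "\<dots> \<le> (\<Prod>i\<in>S. pw (A i) (e i)) * (\<Sum>i\<in>S. e i * (f i x / A i))"
        unfolding pw_def[of "f _ x / A _"] using S e nn A
        by (intro mult_left_mono weighted_AM_GM prod_nonneg) (auto intro: divide_nonneg_pos)
      finally show ?thesis .
    qed
    have int: "integrable M (\<lambda>x. (\<Prod>i\<in>S. pw (A i) (e i)) * (\<Sum>i\<in>S. e i * (f i x / A i)))"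
      using f by auto
    have [measurable]: "f i \<in> borel_measurable M" if "i \<in> S" for i using f that by auto
    have "integrable M (\<lambda>x. \<Prod>i\<in>S. pw (f i x) (e i))"
    proof (rule Bochner_Integration.integrable_bound[OF int])
      show "AE x in M. norm (\<Prod>i\<in>S. pw (f i x) (e i))
          \<le> norm ((\<Prod>i\<in>S. pw (A i) (e i)) * (\<Sum>i\<in>S. e i * (f i x / A i)))"
        using le by (intro AE_I2) (auto simp: abs_of_nonneg prod_nonneg intro: order_trans[OF _ abs_ge_self])
    qed measurable
    then have "(LINT x|M. (\<Prod>i\<in>S. pw (f i x) (e i)))
        \<le> (LINT x|M. (\<Prod>i\<in>S. pw (A i) (e i)) * (\<Sum>i\<in>S. e i * (f i x / A i)))"
      using int le by (rule integral_mono)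
    also have "\<dots> = (\<Prod>i\<in>S. pw (A i) (e i)) * (\<Sum>i\<in>S. e i * ((LINT x|M. f i x) / A i))"
      using f by (simp add: Bochner_Integration.integral_sum)
    also have "\<dots> = (\<Prod>i\<in>S. pw (A i) (e i))" using Ae e by simp
    also have "\<dots> = (\<Prod>i\<in>S. pw (LINT x|M. f i x) (e i))"
      by (rule prod.cong) (auto simp: A_def pw_def)
    finally show ?thesis .
  qed
qed

section \<open>Finite product measures and integrals along coordinate lines\<close>

lemma finite_measure_PiM:
  fixes J :: "'i set"
  assumes N: "finite_measure N" and J: "finite J"
  shows "finite_measure (PiM J (\<lambda>_. N))"
proof (rule finite_measureI)
  interpret N: finite_measure N by fact
  interpret P: product_sigma_finite "\<lambda>_::'i. N" by standard
  have "emeasure (PiM J (\<lambda>_. N)) (space (PiM J (\<lambda>_. N))) = (\<Prod>j\<in>J. emeasure N (space N))"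
    unfolding space_PiM using J by (intro P.emeasure_PiM) auto
  also have "\<dots> \<noteq> \<infinity>" using N.emeasure_finite by (simp add: power_eq_top_ennreal)
  finally show "emeasure (PiM J (\<lambda>_. N)) (space (PiM J (\<lambda>_. N))) \<noteq> \<infinity>" .
qed

lemma marginal_measurable:
  fixes h :: "('i \<Rightarrow> 'b) \<Rightarrow> real"
  assumes N: "finite_measure N" and h: "h \<in> borel_measurable (PiM J (\<lambda>_. N))" and j: "j \<in> J"
  shows "(\<lambda>x. LINT t|N. h (x(j := t))) \<in> borel_measurable (PiM J (\<lambda>_. N))"
proof -
  interpret N: finite_measure N by fact
  have "(\<lambda>z. (fst z)(j := snd z)) \<in> PiM J (\<lambda>_. N) \<Otimes>\<^sub>M N \<rightarrow>\<^sub>M PiM J (\<lambda>_. N)"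
    by (rule measurable_fun_upd[of _ J]) (use j in auto)
  from measurable_compose[OF this h]
  show ?thesis by (intro N.borel_measurable_lebesgue_integral) (simp add: case_prod_beta')
qed

lemma marginal_bounds:
  fixes h :: "('i \<Rightarrow> 'b) \<Rightarrow> real"
  assumes N: "finite_measure N" and h: "\<And>x. 0 \<le> h x \<and> h x \<le> C"
  shows "0 \<le> (LINT t|N. h (x(j := t)))" "(LINT t|N. h (x(j := t))) \<le> C * measure N (space N)"
proof -
  interpret N: finite_measure N by fact
  show "0 \<le> (LINT t|N. h (x(j := t)))" using h by simp
  show "(LINT t|N. h (x(j := t))) \<le> C * measure N (space N)"
  proof (cases "(\<lambda>t. h (x(j := t))) \<in> borel_measurable N")
    case True
    then have "integrable N (\<lambda>t. h (x(j := t)))" using h by (intro N.integrable_const_bound[of _ C]) auto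
    then have "(LINT t|N. h (x(j := t))) \<le> (LINT t|N. C)" using h by (intro integral_mono) auto
    then show ?thesis by (simp add: mult.commute)
  next
    case False
    then have "(LINT t|N. h (x(j := t))) = 0" using borel_measurable_integrable not_integrable_integral_eq by blast
    moreover have "0 \<le> C" using h[of undefined] by linarith
    ultimately show ?thesis by simp
  qed
qed

lemma grid_integrable:
  fixes h :: "('i \<Rightarrow> 'b) \<Rightarrow> real"
  assumes N: "finite_measure N" and J: "finite J"
    and h: "h \<in> borel_measurable (PiM J (\<lambda>_. N))" "\<And>x. 0 \<le> h x \<and> h x \<le> C" and b: "0 \<le> b" "0 \<le> p"
  shows "integrable (PiM J (\<lambda>_. N)) (\<lambda>x. pw (h x) b * (\<Prod>j\<in>J. pw (LINT t|N. h (x(j := t))) p))"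
proof -
  interpret finite_measure "PiM J (\<lambda>_. N)" by (rule finite_measure_PiM[OF N J])
  let ?V = "measure N (space N)"
  have m: "(\<lambda>x. pw (h x) b * (\<Prod>j\<in>J. pw (LINT t|N. h (x(j := t))) p)) \<in> borel_measurable (PiM J (\<lambda>_. N))"
    using h(1) marginal_measurable[OF N h(1)] by measurable
  have "\<bar>pw (h x) b * (\<Prod>j\<in>J. pw (LINT t|N. h (x(j := t))) p)\<bar> \<le> pw C b * (\<Prod>j\<in>J. pw (C * ?V) p)" for x
  proof -
    have "(\<Prod>j\<in>J. pw (LINT t|N. h (x(j := t))) p) \<le> (\<Prod>j\<in>J. pw (C * ?V) p)"
      by (intro prod_mono conjI pw_mono pw_nonneg marginal_bounds[OF N h(2)] b)
    then have "pw (h x) b * (\<Prod>j\<in>J. pw (LINT t|N. h (x(j := t))) p) \<le> pw C b * (\<Prod>j\<in>J. pw (C * ?V) p)"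
      using h(2)[of x] b by (intro mult_mono pw_mono prod_nonneg) auto
    moreover have "0 \<le> pw (h x) b * (\<Prod>j\<in>J. pw (LINT t|N. h (x(j := t))) p)"
      by (intro mult_nonneg_nonneg prod_nonneg) auto
    ultimately show ?thesis by simp
  qed
  then show ?thesis using m by (intro integrable_const_bound) auto
qed

text \<open>The ``grid-lines'' inequality: the induction integrates out one coordinate at a time, and the
  factor \<open>f\<close> with exponent \<open>1 - p (card I - 1)\<close> makes the Hoelder exponents add up to one.\<close>

lemma grid_lines:
  fixes N :: "real measure" and I :: "'i set"
  assumes N: "finite_measure N" and p: "0 < p" and I: "finite I" and c: "p * (real (card I) - 1) \<le> 1"
    and f: "f \<in> borel_measurable (PiM I (\<lambda>_. N))" and B: "\<And>x. 0 \<le> f x \<and> f x \<le> B"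
  shows "(LINT x|PiM I (\<lambda>_. N). pw (f x) (1 - p * (real (card I) - 1)) * (\<Prod>i\<in>I. pw (LINT t|N. f (x(i := t))) p))
    \<le> pw (LINT x|PiM I (\<lambda>_. N). f x) (1 + p)"
  using I c f B
proof (induction I arbitrary: f B)
  case empty
  interpret finite_measure N by fact
  interpret product_sigma_finite "\<lambda>_::'i. N" by standard
  show ?case by (simp add: PiM_empty lebesgue_integral_count_space_finite)
next
  case (insert i I)
  interpret N: finite_measure N by fact
  interpret P: product_sigma_finite "\<lambda>_::'i. N" by standard
  interpret PI: finite_product_sigma_finite "\<lambda>_::'i. N" I by standard fact
  interpret NN: pair_sigma_finite N N by standard
  let ?M = "\<lambda>_::'i. N"
  note finM = finite_measure_PiM[OF N]
  have cI: "real (card (insert i I)) - 1 = real (card I)" using insert by simp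
  define a where "a = 1 - p * real (card I)"
  have a: "a \<ge> 0" using insert.prems(1) unfolding cI a_def by simp
  have [measurable]: "f \<in> borel_measurable (PiM (insert i I) ?M)" by fact
  have f0: "0 \<le> f x" "f x \<le> B" for x using insert.prems(3) by auto
  have B0: "0 \<le> B" using f0[of undefined] by linarith
  define V where "V = measure N (space N)"
  have V: "V \<ge> 0" by (simp add: V_def)
  define F where "F x = (LINT t|N. f (x(i := t)))" for x
  have bN: "integrable N g" if "g \<in> borel_measurable N" "\<And>t. 0 \<le> g t \<and> g t \<le> C" for g and C :: real
    using that by (intro N.integrable_const_bound[of _ C]) auto
  have F0: "0 \<le> F x \<and> F x \<le> B * V" for x
    unfolding F_def V_def using marginal_bounds[OF N, of f B x i] insert.prems(3) by auto
  have upd[measurable]: "(\<lambda>(x, t). x(i := t)) \<in> PiM I ?M \<Otimes>\<^sub>M N \<rightarrow>\<^sub>M PiM (insert i I) ?M"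
    by (rule measurable_add_dim)
  have fm: "(\<lambda>(x, t). f (x(i := t))) \<in> borel_measurable (PiM I ?M \<Otimes>\<^sub>M N)"
    using measurable_compose[OF upd \<open>f \<in> borel_measurable (PiM (insert i I) ?M)\<close>] by (simp add: case_prod_beta')
  have Fm: "F \<in> borel_measurable (PiM I ?M)"
    unfolding F_def using fm by (intro N.borel_measurable_lebesgue_integral)
  have Isub: "j \<in> I \<Longrightarrow> insert j I = I" for j by auto
  have IHc: "p * (real (card I) - 1) \<le> 1"
    using insert.prems(1) p unfolding cI by (simp add: algebra_simps)
  note IH = insert.IH[OF IHc Fm F0]
  define g where "g k x y = (if k = i then f (x(i := y)) else LINT t|N. f (x(i := y, k := t)))" for k x y
  define e where "e k = (if k = i then a else p)" for k
  have ni: "j \<noteq> i" if "j \<in> I" for j using that insert.hyps by auto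
  \<comment> \<open>The marginal in direction \<open>i\<close> does not depend on \<open>y\<close>
    and leaves the integral as \<open>pw (F x) p\<close>. It merges with the Hoelder factor
    \<open>pw (F x) a\<close>, and \<open>p + a\<close> is exactly the exponent that the induction
    hypothesis expects for \<open>I\<close>.\<close>
  have inner: "(LINT y|N. pw (f (x(i := y))) a * (pw (F x) p * (\<Prod>j\<in>I. pw (LINT t|N. f (x(i := y, j := t))) p)))
      \<le> pw (F x) (1 - p * (real (card I) - 1)) * (\<Prod>j\<in>I. pw (LINT t|N. F (x(j := t))) p)"
    if x: "x \<in> space (PiM I ?M)" for x
  proof -
    have m1: "(\<lambda>y. f (x(i := y))) \<in> borel_measurable N"
      using measurable_compose[OF measurable_component_update[OF x insert.hyps(2)]
        \<open>f \<in> borel_measurable (PiM (insert i I) ?M)\<close>] .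
    have m2: "(\<lambda>(y, t). f (x(i := y, j := t))) \<in> borel_measurable (N \<Otimes>\<^sub>M N)" if j: "j \<in> I" for j
    proof -
      have "(\<lambda>(y, t). x(i := y, j := t)) \<in> N \<Otimes>\<^sub>M N \<rightarrow>\<^sub>M PiM (insert i I) ?M"
      proof -
        have "(\<lambda>z. (x(i := fst z))(j := snd z)) \<in> N \<Otimes>\<^sub>M N \<rightarrow>\<^sub>M PiM (insert i I) ?M"
          by (rule measurable_fun_upd[of _ "insert i I"])
             (use j measurable_compose[OF measurable_fst measurable_component_update[OF x insert.hyps(2)]] in auto)
        then show ?thesis by (simp add: case_prod_beta')
      qed
      from measurable_compose[OF this \<open>f \<in> borel_measurable (PiM (insert i I) ?M)\<close>]
      show ?thesis by (simp add: case_prod_beta')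
    qed
    have m3: "(\<lambda>y. LINT t|N. f (x(i := y, j := t))) \<in> borel_measurable N" if "j \<in> I" for j
      using m2[OF that] by (intro N.borel_measurable_lebesgue_integral)
    have b3: "0 \<le> (LINT t|N. f (x(i := y, j := t))) \<and> (LINT t|N. f (x(i := y, j := t))) \<le> B * V"
      if j: "j \<in> I" and y: "y \<in> space N" for j y
    proof -
      have "(\<lambda>t. f (x(i := y, j := t))) \<in> borel_measurable N"
        using measurable_Pair2[OF m2[OF j] y] by simp
      then have "integrable N (\<lambda>t. f (x(i := y, j := t)))" using f0 by (intro bN[of _ B]) auto
      then have "(LINT t|N. f (x(i := y, j := t))) \<le> (LINT t|N. B)" using f0 by (intro integral_mono) auto
      then show ?thesis using f0 by (simp add: V_def mult.commute)
    qed
    have gi: "integrable N (g k x)" if "k \<in> insert i I" for k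
    proof (cases "k = i")
      case True
      then show ?thesis unfolding g_def[abs_def] using f0 m1 by (auto intro!: bN[of _ B])
    next
      case False
      then have k: "k \<in> I" using that by simp
      show ?thesis
        by (rule N.integrable_const_bound[of _ "B * V"])
           (use False m3[OF k] b3[OF k] in \<open>auto simp: g_def[abs_def] intro!: AE_I2\<close>)
    qed
    have "(LINT y|N. (\<Prod>k\<in>insert i I. pw (g k x y) (e k))) \<le> (\<Prod>k\<in>insert i I. pw (LINT y|N. g k x y) (e k))"
    proof (rule Holder_prod)
      show "finite (insert i I)" using insert.hyps by simp
      show "0 \<le> g k x y" for k y using f0 by (simp add: g_def)
      show "0 \<le> e k" for k using a p by (simp add: e_def)
      have "(\<Sum>k\<in>I. e k) = (\<Sum>k\<in>I. p)" by (intro sum.cong) (auto simp: e_def dest: ni)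
      then show "(\<Sum>k\<in>insert i I. e k) = 1" using insert.hyps by (simp add: e_def a_def mult.commute)
    qed (use gi in auto)
    moreover have "(\<Prod>k\<in>insert i I. pw (g k x y) (e k))
        = pw (f (x(i := y))) a * (\<Prod>j\<in>I. pw (LINT t|N. f (x(i := y, j := t))) p)" for y
    proof -
      have "(\<Prod>k\<in>I. pw (g k x y) (e k)) = (\<Prod>j\<in>I. pw (LINT t|N. f (x(i := y, j := t))) p)"
        by (intro prod.cong) (auto simp: e_def g_def dest: ni)
      then show ?thesis using insert.hyps by (simp add: e_def g_def)
    qed
    moreover have "(\<Prod>k\<in>insert i I. pw (LINT y|N. g k x y) (e k))
        = pw (F x) a * (\<Prod>j\<in>I. pw (LINT t|N. F (x(j := t))) p)"
    proof -
      \<comment> \<open>By Fubini, integrating the \<open>k\<close>-marginal of \<open>f\<close>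
        over coordinate \<open>i\<close> gives the \<open>k\<close>-marginal of
        \<open>F\<close>.\<close>
      have "(LINT y|N. g k x y) = (LINT t|N. F (x(k := t)))" if k: "k \<in> I" for k
      proof -
        have ik: "integrable (N \<Otimes>\<^sub>M N) (\<lambda>(y, t). f (x(i := y, k := t)))"
        proof -
          interpret P2: finite_measure "N \<Otimes>\<^sub>M N"
            by (rule finite_measure_pair_measure) (fact N)+
          show ?thesis using m2[OF k] f0 by (intro P2.integrable_const_bound[of _ B]) (auto simp: case_prod_beta')
        qed
        have "(LINT y|N. g k x y) = (LINT y|N. LINT t|N. f (x(i := y, k := t)))"
          using ni[OF k] by (simp add: g_def)
        also have "\<dots> = (LINT t|N. LINT y|N. f (x(i := y, k := t)))"
          by (rule NN.Fubini_integral[OF ik, symmetric])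
        also have "\<dots> = (LINT t|N. F (x(k := t)))"
          using ni[OF k] by (simp add: F_def fun_upd_twist[of i k])
        finally show ?thesis .
      qed
      then have "(\<Prod>k\<in>I. pw (LINT y|N. g k x y) (e k)) = (\<Prod>j\<in>I. pw (LINT t|N. F (x(j := t))) p)"
        by (intro prod.cong) (auto simp: e_def dest: ni)
      moreover have "(LINT y|N. g i x y) = F x" by (simp add: g_def F_def)
      ultimately show ?thesis using insert.hyps by (simp add: e_def)
    qed
    ultimately have H: "(LINT y|N. pw (f (x(i := y))) a * (\<Prod>j\<in>I. pw (LINT t|N. f (x(i := y, j := t))) p))
        \<le> pw (F x) a * (\<Prod>j\<in>I. pw (LINT t|N. F (x(j := t))) p)" by simp
    have "(LINT y|N. pw (f (x(i := y))) a * (pw (F x) p * (\<Prod>j\<in>I. pw (LINT t|N. f (x(i := y, j := t))) p)))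
       = pw (F x) p * (LINT y|N. pw (f (x(i := y))) a * (\<Prod>j\<in>I. pw (LINT t|N. f (x(i := y, j := t))) p))"
      by (subst integral_mult_right_zero[symmetric]) (simp add: mult.left_commute)
    also have "\<dots> \<le> pw (F x) p * (pw (F x) a * (\<Prod>j\<in>I. pw (LINT t|N. F (x(j := t))) p))"
      using H by (intro mult_left_mono) auto
    also have "pw (F x) p * (pw (F x) a * (\<Prod>j\<in>I. pw (LINT t|N. F (x(j := t))) p))
       = (pw (F x) p * pw (F x) a) * (\<Prod>j\<in>I. pw (LINT t|N. F (x(j := t))) p)" by simp
    also have "pw (F x) p * pw (F x) a = pw (F x) (p + a)" using F0 p a by (intro pw_add) auto
    also have "p + a = 1 - p * (real (card I) - 1)" by (simp add: a_def algebra_simps)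
    finally show ?thesis .
  qed
  define \<Phi> where "\<Phi> x = pw (f x) a * (\<Prod>j\<in>insert i I. pw (LINT t|N. f (x(j := t))) p)" for x
  have \<Phi>i: "integrable (PiM (insert i I) ?M) \<Phi>"
    unfolding \<Phi>_def using insert.hyps f0 a by (intro grid_integrable[OF N, of _ _ B]) (auto simp: p less_imp_le)
  have "(LINT x|PiM (insert i I) ?M. \<Phi> x) = (LINT x|PiM I ?M. LINT y|N. \<Phi> (x(i := y)))"
    by (rule P.product_integral_insert[OF insert.hyps \<Phi>i])
  also have "\<dots> = (LINT x|PiM I ?M. LINT y|N. pw (f (x(i := y))) a * (pw (F x) p * (\<Prod>j\<in>I. pw (LINT t|N. f (x(i := y, j := t))) p)))"
    using insert.hyps by (simp add: \<Phi>_def F_def)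
  also have "\<dots> \<le> (LINT x|PiM I ?M. pw (F x) (1 - p * (real (card I) - 1)) * (\<Prod>j\<in>I. pw (LINT t|N. F (x(j := t))) p))"
  proof (rule integral_mono')
    show "integrable (PiM I ?M) (\<lambda>x. pw (F x) (1 - p * (real (card I) - 1)) * (\<Prod>j\<in>I. pw (LINT t|N. F (x(j := t))) p))"
      using insert.hyps Fm F0 IHc by (intro grid_integrable[OF N, of _ _ "B * V"]) (auto simp: p less_imp_le)
  qed (use inner in \<open>auto intro!: mult_nonneg_nonneg prod_nonneg\<close>)
  also have "\<dots> \<le> pw (LINT x|PiM I ?M. F x) (1 + p)" by (rule IH)
  also have "(LINT x|PiM I ?M. F x) = (LINT x|PiM (insert i I) ?M. f x)"
  proof -
    interpret finite_measure "PiM (insert i I) ?M" using insert.hyps by (intro finM) simp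
    have "integrable (PiM (insert i I) ?M) f" using f0 by (intro integrable_const_bound[of _ B]) auto
    from P.product_integral_insert[OF insert.hyps this] show ?thesis by (simp add: F_def)
  qed
  finally show ?case unfolding cI \<Phi>_def a_def .
qed

text \<open>The grid-lines inequality updates single coordinates of functions in a product space.
  This identification carries it over to \<open>real ^ 'n\<close>; measures of boxes determine both
  sides.\<close>

lemma lborel_vec_eq:
  "(lborel :: (real ^ 'n) measure) = distr (PiM UNIV (\<lambda>_::'n. lborel)) borel (\<lambda>f. \<chi> i. f i)"
proof (rule lborel_eqI)
  interpret P: product_sigma_finite "\<lambda>_::'n. lborel :: real measure" by standard
  have m[measurable]: "(\<lambda>f. \<chi> i. f i) \<in> PiM UNIV (\<lambda>_::'n. lborel) \<rightarrow>\<^sub>M (borel :: (real ^ 'n) measure)"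
    by (intro borel_measurable_vec_lambda measurable_compose[OF measurable_component_singleton]) auto
  fix l u :: "real ^ 'n" assume le: "\<And>b. b \<in> Basis \<Longrightarrow> l \<bullet> b \<le> u \<bullet> b"
  have le': "l $ i \<le> u $ i" for i using le[of "axis i 1"] by (auto simp: Basis_vec_def inner_axis)
  have "emeasure (distr (PiM UNIV (\<lambda>_::'n. lborel)) borel (\<lambda>f. \<chi> i. f i)) (box l u)
      = emeasure (PiM UNIV (\<lambda>_::'n. lborel)) (PiE UNIV (\<lambda>i. {l $ i <..< u $ i}))"
    by (subst emeasure_distr[OF m])
       (auto simp: mem_box Basis_vec_def inner_axis space_PiM PiE_UNIV_domain Pi_iff intro!: arg_cong2[where f=emeasure])
  also have "\<dots> = (\<Prod>i\<in>UNIV. emeasure lborel {l $ i <..< u $ i})"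
    by (rule P.emeasure_PiM) auto
  also have "\<dots> = ennreal (\<Prod>i\<in>UNIV. (u - l) $ i)"
    using le' by (simp add: prod_ennreal)
  also have "(\<Prod>i\<in>UNIV. (u - l) $ i) = (\<Prod>b\<in>Basis. (u - l) \<bullet> b)"
  proof -
    have B: "(Basis :: (real ^ 'n) set) = range (\<lambda>i. axis i 1)" by (auto simp: Basis_vec_def)
    have "inj (\<lambda>i::'n. axis i (1::real))" by (auto simp: inj_def axis_eq_axis)
    then show ?thesis unfolding B by (simp add: prod.reindex inner_axis)
  qed
  finally show "emeasure (distr (PiM UNIV (\<lambda>_::'n. lborel)) borel (\<lambda>f. \<chi> i. f i)) (box l u)
      = (\<Prod>b\<in>Basis. (u - l) \<bullet> b)" .
qed simp

text \<open>\<open>grid_lines\<close> is stated for finite measures, so Lebesgue measure on the line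
  is cut down to an interval; the product is then Lebesgue measure on a cube containing the
  support.\<close>

lemma PiM_density_box:
  "PiM UNIV (\<lambda>_::'n::finite. density lborel (indicator {-S..S::real}))
    = density (PiM UNIV (\<lambda>_. lborel)) (indicator (PiE UNIV (\<lambda>_. {-S..S})))"
proof -
  let ?N = "density lborel (indicator {-S..S::real})"
  interpret L: product_sigma_finite "\<lambda>_::'n. lborel :: real measure" by standard
  have "finite_measure ?N" by (rule finite_measureI) (simp add: emeasure_density emeasure_lborel_Icc_eq)
  then interpret N: finite_measure ?N .
  interpret P: product_sigma_finite "\<lambda>_::'n. ?N" by standard
  have sN: "sets (PiM UNIV (\<lambda>_::'n. lborel :: real measure)) = sets (PiM UNIV (\<lambda>_::'n. ?N))"
    by (intro sets_PiM_cong) auto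
  have box: "PiE UNIV (\<lambda>_::'n. {-S..S}) \<in> sets (PiM UNIV (\<lambda>_::'n. lborel :: real measure))"
    by (intro sets_PiM_I_finite) auto
  show ?thesis
  proof (rule P.PiM_eqI[symmetric])
    fix A :: "'n \<Rightarrow> real set" assume A: "\<And>i. i \<in> UNIV \<Longrightarrow> A i \<in> sets ?N"
    have "emeasure (density (PiM UNIV (\<lambda>_::'n. lborel :: real measure)) (indicator (PiE UNIV (\<lambda>_. {-S..S})))) (PiE UNIV A)
        = emeasure (PiM UNIV (\<lambda>_::'n. lborel :: real measure)) (PiE UNIV (\<lambda>_. {-S..S}) \<inter> PiE UNIV A)"
      using box A by (subst emeasure_density)
        (auto simp: indicator_inter_arith[symmetric] intro!: sets_PiM_I_finite nn_integral_indicator)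
    also have "PiE UNIV (\<lambda>_. {-S..S}) \<inter> PiE UNIV A = PiE UNIV (\<lambda>i. {-S..S} \<inter> A i)" by auto
    also have "emeasure (PiM UNIV (\<lambda>_::'n. lborel :: real measure)) \<dots> = (\<Prod>i\<in>UNIV. emeasure lborel ({-S..S} \<inter> A i))"
      using A by (intro L.emeasure_PiM) auto
    also have "\<dots> = (\<Prod>i\<in>UNIV. emeasure ?N (A i))"
      using A by (intro prod.cong) (auto simp: emeasure_density indicator_inter_arith[symmetric])
    finally show "emeasure (density (PiM UNIV (\<lambda>_::'n. lborel :: real measure)) (indicator (PiE UNIV (\<lambda>_. {-S..S})))) (PiE UNIV A)
        = (\<Prod>i\<in>UNIV. emeasure ?N (A i))" .
  qed (auto simp: sN)
qed

lemma vec_integral_box: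
  fixes h :: "real ^ 'n \<Rightarrow> real"
  assumes h[measurable]: "h \<in> borel_measurable borel" and z: "\<And>x i. \<bar>x $ i\<bar> > S \<Longrightarrow> h x = 0"
  shows "(LINT x|PiM UNIV (\<lambda>_. density lborel (indicator {-S..S})). h (\<chi> i. x i)) = (LINT x|lborel. h x)"
proof -
  have m[measurable]: "(\<lambda>f. \<chi> i. f i) \<in> PiM UNIV (\<lambda>_::'n. lborel) \<rightarrow>\<^sub>M (borel :: (real ^ 'n) measure)"
    by (intro borel_measurable_vec_lambda measurable_compose[OF measurable_component_singleton]) auto
  have box[measurable]: "PiE UNIV (\<lambda>_::'n. {-S..S}) \<in> sets (PiM UNIV (\<lambda>_::'n. lborel :: real measure))"
    by (intro sets_PiM_I_finite) auto
  have "(LINT x|PiM UNIV (\<lambda>_::'n. density lborel (indicator {-S..S})). h (\<chi> i. x i))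
     = (LINT x|density (PiM UNIV (\<lambda>_::'n. lborel)) (\<lambda>x. ennreal (indicator (PiE UNIV (\<lambda>_. {-S..S})) x)). h (\<chi> i. x i))"
    unfolding PiM_density_box by (simp add: ennreal_indicator)
  also have "\<dots> = (LINT x|PiM UNIV (\<lambda>_::'n. lborel). indicator (PiE UNIV (\<lambda>_. {-S..S})) x *\<^sub>R h (\<chi> i. x i))"
    by (rule integral_density) auto
  also have "\<dots> = (LINT x|PiM UNIV (\<lambda>_::'n. lborel). h (\<chi> i. x i))"
  proof (rule Bochner_Integration.integral_cong[OF refl])
    fix x :: "'n \<Rightarrow> real"
    show "indicator (PiE UNIV (\<lambda>_. {-S..S})) x *\<^sub>R h (\<chi> i. x i) = h (\<chi> i. x i)"
    proof (cases "x \<in> PiE UNIV (\<lambda>_. {-S..S})")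
      case False
      then obtain i where "x i < - S \<or> x i > S" by (auto simp: PiE_UNIV_domain Pi_iff not_le)
      then have "h (\<chi> i. x i) = 0" by (intro z[of _ i]) auto
      then show ?thesis by simp
    qed simp
  qed
  also have "\<dots> = (LINT x|lborel. h x)"
    unfolding lborel_vec_eq[where 'n='n] by (rule integral_distr[symmetric]) auto
  finally show ?thesis .
qed

text \<open>The argument of Gagliardo and Nirenberg: in each coordinate direction
  \<open>\<bar>u\<bar>\<close> is at most the integral of the norm of \<open>D\<close> along the
  line. Multiplying these bounds, each to the power \<open>1 / (k - 1)\<close>, leaves the product
  of marginals that \<open>grid_lines\<close> estimates.\<close>

lemma GNS_L1:
  fixes u :: "real ^ 'n \<Rightarrow> real"
  assumes n: "CARD('n) \<ge> 2"
    and d: "\<And>x. (u has_derivative (\<lambda>h. D x \<bullet> h)) (at x)" and c: "continuous_on UNIV D"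
    and z: "\<And>x. norm x > R \<Longrightarrow> u x = 0"
  defines "k \<equiv> real CARD('n)"
  shows "(LINT x|lborel. \<bar>u x\<bar> powr (k / (k - 1))) \<le> (LINT x|lborel. norm (D x)) powr (k / (k - 1))"
proof -
  \<comment> \<open>The half side of the cube exceeds \<open>R\<close>, so \<open>u\<close> vanishes
    at the point where each coordinate line enters it.\<close>
  define S where "S = max R 0 + 1"
  have S: "S > R" "S > 0" by (auto simp: S_def)
  have Dz: "\<And>x. norm x > R \<Longrightarrow> D x = 0" using d z by (rule gradient_zero_outside)
  obtain M where M: "M \<ge> 0" "\<And>x. norm (D x) \<le> M" using continuous_cs_bounded[OF c Dz] by blast
  have uc: "continuous_on UNIV u" by (rule has_gradient_continuous[OF d])
  have [measurable]: "u \<in> borel_measurable borel" "D \<in> borel_measurable borel"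
    using uc c by (auto intro: borel_measurable_continuous_onI)
  have k: "k \<ge> 2" using n by (simp add: k_def)
  \<comment> \<open>For this value the extra factor in \<open>grid_lines\<close> has exponent 0,
    that is, only the marginals remain.\<close>
  define p where "p = 1 / (k - 1)"
  have p: "p > 0" "p * (k - 1) = 1" "1 + p = k / (k - 1)" "k * p = k / (k - 1)"
    using k by (auto simp: p_def field_simps)
  define N where "N = density lborel (indicator {-S..S::real})"
  have sN[measurable_cong]: "sets N = sets borel" by (simp add: N_def)
  have fN: "finite_measure N" unfolding N_def by (rule finite_measureI) (simp add: emeasure_density emeasure_lborel_Icc_eq)
  define f where "f x = norm (D (\<chi> i. x i))" for x :: "'n \<Rightarrow> real"
  have nz: "norm x > R" if "\<bar>x $ i\<bar> > S" for x :: "real ^ 'n" and i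
    using that S component_le_norm_cart[of x i] by linarith
  have fm: "f \<in> borel_measurable (PiM UNIV (\<lambda>_. N))"
  proof -
    have "(\<lambda>f. \<chi> i. f i) \<in> PiM UNIV (\<lambda>_::'n. N) \<rightarrow>\<^sub>M (borel :: (real ^ 'n) measure)"
    proof (intro borel_measurable_vec_lambda)
      fix i :: 'n
      have "(\<lambda>f. f i) \<in> PiM UNIV (\<lambda>_::'n. N) \<rightarrow>\<^sub>M N" by (intro measurable_component_singleton) simp
      then show "(\<lambda>f. f i) \<in> borel_measurable (PiM UNIV (\<lambda>_::'n. N))"
        using measurable_cong_sets[OF refl sN] by blast
    qed
    then show ?thesis unfolding f_def[abs_def] by measurable
  qed
  \<comment> \<open>The fundamental theorem of calculus from the face at \<open>- S\<close>, where
    \<open>u\<close> is 0, up to the point. Outside the cube \<open>u\<close> is 0 and there is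
    nothing to show.\<close>
  have line: "\<bar>u (\<chi> j. x j)\<bar> \<le> (LINT t|N. f (x(i := t)))" for x i
  proof (cases "\<bar>x i\<bar> \<le> S")
    case False
    then have "u (\<chi> j. x j) = 0" using nz[of "\<chi> j. x j" i] z by simp
    moreover have "0 \<le> (LINT t|N. f (x(i := t)))" by (simp add: f_def)
    ultimately show ?thesis by simp
  next
    case True
    define y where "y t = (\<chi> j. (x(i := t)) j)" for t
    have "continuous_on UNIV (\<lambda>t. (x(i := t)) j)" for j by (cases "j = i") auto
    then have yc: "continuous_on UNIV y"
      unfolding y_def[abs_def] by (rule continuous_on_vec_lambda)
    have yd: "(y has_derivative (\<lambda>h. h *\<^sub>R axis i 1)) (at t)" for t
    proof -
      have "y = (\<lambda>s. y t + (s - t) *\<^sub>R axis i 1)"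
        by (auto simp: y_def vec_eq_iff axis_def)
      moreover have "((\<lambda>s. y t + (s - t) *\<^sub>R axis i 1) has_derivative (\<lambda>h. h *\<^sub>R axis i 1)) (at t)"
        by (auto intro!: derivative_eq_intros)
      ultimately show ?thesis by metis
    qed
    have der: "((\<lambda>t. u (y t)) has_real_derivative D (y t) $ i) (at t)" for t
    proof -
      have "((\<lambda>t. u (y t)) has_derivative (\<lambda>h. D (y t) \<bullet> (h *\<^sub>R axis i 1))) (at t)"
        by (rule has_derivative_compose[OF yd d])
      moreover have "(\<lambda>h. D (y t) \<bullet> (h *\<^sub>R axis i 1)) = (*) (D (y t) $ i)"
        by (auto simp: inner_axis mult.commute)
      ultimately show ?thesis by (simp add: has_field_derivative_def)
    qed
    have Dy: "continuous_on UNIV (\<lambda>t. D (y t))" by (rule continuous_on_compose2[OF c yc]) auto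
    have [measurable]: "(\<lambda>t. D (y t)) \<in> borel_measurable borel" using Dy by (rule borel_measurable_continuous_onI)
    have "(LINT t|lborel. D (y t) $ i * indicator {- S..x i} t) = u (y (x i)) - u (y (- S))"
    proof (rule integral_FTC_Icc_real)
      show "- S \<le> x i" using True by simp
      show "isCont (\<lambda>t. D (y t) $ i) t" for t
      proof -
        have "continuous_on UNIV (\<lambda>t. D (y t) $ i)" by (intro continuous_intros Dy)
        then show ?thesis by (simp add: continuous_on_eq_continuous_at)
      qed
    qed (use der in auto)
    moreover have "y (x i) = (\<chi> j. x j)" by (auto simp: y_def vec_eq_iff)
    moreover have "u (y (- S)) = 0"
    proof (rule z)
      have "\<bar>y (- S) $ i\<bar> = S" using S by (simp add: y_def)
      then show "norm (y (- S)) > R" using component_le_norm_cart[of "y (- S)" i] S by linarith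
    qed
    ultimately have "\<bar>u (\<chi> j. x j)\<bar> = \<bar>LINT t|lborel. D (y t) $ i * indicator {- S..x i} t\<bar>" by simp
    also have "\<dots> \<le> (LINT t|lborel. indicator {-S..S} t * norm (D (y t)))"
    proof (rule order_trans[OF integral_abs_bound integral_mono'])
      have "integrable lborel (\<lambda>t. indicator {-S..S} t *\<^sub>R norm (D (y t)))"
        by (intro borel_integrable_compact continuous_on_norm continuous_on_subset[OF Dy]) auto
      then show "integrable lborel (\<lambda>t. indicator {-S..S} t * norm (D (y t)))" by simp
      show "\<bar>D (y t) $ i * indicator {- S..x i} t\<bar> \<le> indicator {-S..S} t * norm (D (y t))" for t
        using True component_le_norm_cart[of "D (y t)" i] by (auto simp: indicator_def)
    qed simp
    also have "\<dots> = (LINT t|density lborel (\<lambda>t. ennreal (indicator {-S..S} t)). norm (D (y t)))"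
      by (subst integral_density) auto
    also have "\<dots> = (LINT t|N. f (x(i := t)))"
      unfolding N_def f_def y_def by (simp add: ennreal_indicator)
    finally show ?thesis .
  qed
  have grid: "(LINT x|PiM UNIV (\<lambda>_. N). (\<Prod>i\<in>UNIV. pw (LINT t|N. f (x(i := t))) p)) \<le> pw (LINT x|PiM UNIV (\<lambda>_. N). f x) (1 + p)"
    using grid_lines[OF fN p(1) finite _ fm, of M] M p by (simp add: f_def k_def[symmetric] pw_def[of _ 0])
  have "(LINT x|lborel. \<bar>u x\<bar> powr (k / (k - 1))) = (LINT x|PiM UNIV (\<lambda>_. N). \<bar>u (\<chi> i. x i)\<bar> powr (k / (k - 1)))"
    unfolding N_def using nz z by (intro vec_integral_box[symmetric]) auto
  also have "\<dots> \<le> (LINT x|PiM UNIV (\<lambda>_. N). (\<Prod>i\<in>UNIV. pw (LINT t|N. f (x(i := t))) p))"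
  proof (rule integral_mono')
    have "integrable (PiM UNIV (\<lambda>_. N)) (\<lambda>x. pw (f x) 0 * (\<Prod>i\<in>UNIV. pw (LINT t|N. f (x(i := t))) p))"
      using M p by (intro grid_integrable[OF fN finite fm, of M]) (auto simp: f_def)
    then show "integrable (PiM UNIV (\<lambda>_. N)) (\<lambda>x. \<Prod>i\<in>UNIV. pw (LINT t|N. f (x(i := t))) p)"
      by (simp add: pw_def[of _ 0])
    fix x
    have "\<bar>u (\<chi> i. x i)\<bar> powr (k / (k - 1)) = (\<bar>u (\<chi> i. x i)\<bar> powr p) ^ CARD('n)"
    proof (cases "u (\<chi> i. x i) = 0")
      case False
      then show ?thesis using p by (subst powr_power) (auto simp: k_def)
    qed simp
    also have "\<dots> = (\<Prod>i\<in>(UNIV::'n set). \<bar>u (\<chi> i. x i)\<bar> powr p)" by simp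
    also have "\<dots> \<le> (\<Prod>i\<in>UNIV. pw (LINT t|N. f (x(i := t))) p)"
      using p line by (intro prod_mono) (auto simp: pw_def intro!: powr_mono2)
    finally show "\<bar>u (\<chi> i. x i)\<bar> powr (k / (k - 1)) \<le> (\<Prod>i\<in>UNIV. pw (LINT t|N. f (x(i := t))) p)" .
  qed (intro prod_nonneg, auto)
  also note grid
  also have "(LINT x|PiM UNIV (\<lambda>_. N). f x) = (LINT x|lborel. norm (D x))"
    unfolding N_def f_def using nz Dz by (intro vec_integral_box) auto
  finally show ?thesis using p k by (simp add: pw_def)
qed

section \<open>From the Sobolev inequality for \<open>L\<^sup>1\<close> gradients to that for
  \<open>L\<^sup>2\<close> gradients\<close>

lemma Cauchy_Schwarz_integral:
  fixes f g :: "'a::euclidean_space \<Rightarrow> real"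
  assumes [measurable]: "f \<in> borel_measurable borel" "g \<in> borel_measurable borel"
    and i: "integrable lborel (\<lambda>x. (f x)\<^sup>2)" "integrable lborel (\<lambda>x. (g x)\<^sup>2)"
  shows "integrable lborel (\<lambda>x. f x * g x)"
    "(LINT x|lborel. f x * g x)\<^sup>2 \<le> (LINT x|lborel. (f x)\<^sup>2) * (LINT x|lborel. (g x)\<^sup>2)"
proof -
  have n: "nsq UNIV f < \<infinity>" "nsq UNIV g < \<infinity>"
    using i nsq_finite_iff_integrable[of f UNIV] nsq_finite_iff_integrable[of g UNIV] by auto
  show int: "integrable lborel (\<lambda>x. f x * g x)" by (rule integrable_mult_L2) (use n in auto)
  let ?I = "LINT x|lborel. f x * g x"
  have "ennreal \<bar>?I\<bar> \<le> (\<integral>\<^sup>+x. ennreal (norm (f x * g x)) \<partial>lborel)"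
    using integral_norm_bound_ennreal[OF int] by simp
  also have "\<dots> = (\<integral>\<^sup>+x. ennreal \<bar>f x\<bar> * ennreal \<bar>g x\<bar> \<partial>lborel)"
    by (simp add: abs_mult ennreal_mult)
  finally have "(ennreal \<bar>?I\<bar>)\<^sup>2 \<le> (\<integral>\<^sup>+x. ennreal \<bar>f x\<bar> * ennreal \<bar>g x\<bar> \<partial>lborel)\<^sup>2"
    by (simp add: power_mono)
  also have "\<dots> \<le> (\<integral>\<^sup>+x. (ennreal \<bar>f x\<bar>)\<^sup>2 \<partial>lborel) * (\<integral>\<^sup>+x. (ennreal \<bar>g x\<bar>)\<^sup>2 \<partial>lborel)"
    by (rule Cauchy_Schwarz_nn_integral) auto
  also have "\<dots> = ennreal (LINT x|lborel. (f x)\<^sup>2) * ennreal (LINT x|lborel. (g x)\<^sup>2)"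
    using i by (simp add: ennreal_power nn_integral_eq_integral)
  finally have "ennreal (?I\<^sup>2) \<le> ennreal ((LINT x|lborel. (f x)\<^sup>2) * (LINT x|lborel. (g x)\<^sup>2))"
    by (simp add: ennreal_power ennreal_mult)
  then show "?I\<^sup>2 \<le> (LINT x|lborel. (f x)\<^sup>2) * (LINT x|lborel. (g x)\<^sup>2)"
    by (subst (asm) ennreal_le_iff) auto
qed

lemma abs_powr_has_derivative:
  assumes "g > 1"
  shows "((\<lambda>t::real. \<bar>t\<bar> powr g) has_real_derivative (g * \<bar>t\<bar> powr (g - 1) * sgn t)) (at t)"
proof -
  consider "t > 0" | "t < 0" | "t = 0" by linarith
  then show ?thesis
  proof cases
    case 1
    have "((\<lambda>t. t powr g) has_real_derivative (g * \<bar>t\<bar> powr (g - 1) * sgn t)) (at t)"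
      using 1 by (auto intro!: derivative_eq_intros simp: field_simps powr_diff)
    then show ?thesis
      by (rule has_field_derivative_transform_within_open[where S="{0<..}"]) (use 1 in auto)
  next
    case 2
    have "((\<lambda>t. (- t) powr g) has_real_derivative (g * \<bar>t\<bar> powr (g - 1) * sgn t)) (at t)"
      using 2 by (auto intro!: derivative_eq_intros simp: field_simps powr_diff)
    then show ?thesis
      by (rule has_field_derivative_transform_within_open[where S="{..<0}"]) (use 2 in auto)
  next
    case 3
    have "((\<lambda>h. \<bar>h\<bar> powr (g - 1)) \<longlongrightarrow> 0) (at 0)"
    proof -
      have "((\<lambda>h::real. \<bar>h\<bar> powr (g - 1)) \<longlongrightarrow> 0 powr (g - 1)) (at 0)"
        using assms by (intro tendsto_powr2) (auto intro!: tendsto_eq_intros)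
      then show ?thesis by simp
    qed
    then have "((\<lambda>h. norm (\<bar>h\<bar> powr g / h)) \<longlongrightarrow> 0) (at 0)"
      by (rule Lim_transform_eventually)
         (auto simp: eventually_at_filter powr_diff)
    then have "((\<lambda>h. \<bar>h\<bar> powr g / h) \<longlongrightarrow> 0) (at 0)" by (rule tendsto_norm_zero_cancel)
    then show ?thesis using 3 by (simp add: DERIV_def)
  qed
qed

lemma continuous_sgn_powr:
  assumes "e > 0"
  shows "continuous_on UNIV (\<lambda>t::real. \<bar>t\<bar> powr e * sgn t)"
proof -
  have "isCont (\<lambda>t::real. \<bar>t\<bar> powr e * sgn t) t" for t
  proof (cases "t = 0")
    case True
    have "((\<lambda>h::real. \<bar>h\<bar> powr e) \<longlongrightarrow> 0 powr e) (at 0)"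
      using assms by (intro tendsto_powr2) (auto intro!: tendsto_eq_intros)
    then have "((\<lambda>h::real. \<bar>h\<bar> powr e) \<longlongrightarrow> 0) (at 0)" by simp
    then have "((\<lambda>h::real. \<bar>h\<bar> powr e * sgn h) \<longlongrightarrow> 0) (at 0)"
      by (rule Lim_null_comparison[rotated]) (auto simp: abs_mult abs_sgn_eq intro!: always_eventually)
    then show ?thesis using True unfolding isCont_def by simp
  next
    case False
    then show ?thesis by (intro continuous_intros isCont_sgn) auto
  qed
  then show ?thesis by (simp add: continuous_at_imp_continuous_on)
qed

lemma continuous_cs_integrable:
  fixes g :: "real ^ 'n \<Rightarrow> real"
  assumes "continuous_on UNIV g" "\<And>x. norm x > R \<Longrightarrow> g x = 0"
  shows "integrable lborel g"
proof -
  have "integrable lborel (\<lambda>x. indicator (cball 0 R) x *\<^sub>R g x)"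
    by (intro borel_integrable_compact continuous_on_subset[OF assms(1)]) auto
  moreover have "(\<lambda>x. indicator (cball 0 R) x *\<^sub>R g x) = g"
    using assms(2) by (force simp: indicator_def not_le)
  ultimately show ?thesis by simp
qed

text \<open>The \<open>L\<^sup>1\<close> inequality is applied to
  \<open>\<bar>u\<bar> powr g\<close>, which is continuously differentiable since
  \<open>g > 1\<close>. The choice of \<open>g\<close> makes the power of \<open>u\<close> on the
  left and the one left over by Cauchy--Schwarz on the right the same, namely
  \<open>2 * k / (k - 2)\<close>.\<close>

lemma sobolev_C1:
  fixes u :: "real ^ 'n \<Rightarrow> real"
  assumes n: "CARD('n) \<ge> 3"
    and d: "\<And>x. (u has_derivative (\<lambda>h. D x \<bullet> h)) (at x)" and c: "continuous_on UNIV D"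
    and z: "\<And>x. norm x > R \<Longrightarrow> u x = 0"
  defines "k \<equiv> real CARD('n)"
  shows "integrable lborel (\<lambda>x. \<bar>u x\<bar> powr (2 * k / (k - 2)))"
    "(LINT x|lborel. \<bar>u x\<bar> powr (2 * k / (k - 2))) powr ((k - 2) / k)
      \<le> (2 * (k - 1) / (k - 2))\<^sup>2 * (LINT x|lborel. (norm (D x))\<^sup>2)"
proof -
  have k: "k \<ge> 3" using n by (simp add: k_def)
  define g where "g = 2 * (k - 1) / (k - 2)"
  have g: "g > 1" "2 * (g - 1) = 2 * k / (k - 2)" "g * (k / (k - 1)) = 2 * k / (k - 2)"
  proof -
    show "g > 1" "2 * (g - 1) = 2 * k / (k - 2)" using k by (auto simp: g_def field_simps)
    have nz: "(k - 2) * (k - 1) \<noteq> 0" "k - 2 \<noteq> 0" using k by auto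
    show "g * (k / (k - 1)) = 2 * k / (k - 2)"
      unfolding g_def times_divide_times_eq by (subst frac_eq_eq[OF nz]) (simp add: algebra_simps)
  qed
  define q where "q = 2 * k / (k - 2)"
  have q: "q > 0" using k by (simp add: q_def)
  have Dz: "\<And>x. norm x > R \<Longrightarrow> D x = 0" using d z by (rule gradient_zero_outside)
  have uc: "continuous_on UNIV u" by (rule has_gradient_continuous[OF d])
  have [measurable]: "u \<in> borel_measurable borel" "D \<in> borel_measurable borel"
    using uc c by (auto intro: borel_measurable_continuous_onI)
  define H where "H x = (g * \<bar>u x\<bar> powr (g - 1) * sgn (u x)) *\<^sub>R D x" for x
  have dw: "((\<lambda>x. \<bar>u x\<bar> powr g) has_derivative (\<lambda>h. H x \<bullet> h)) (at x)" for x
    using DERIV_compose_FDERIV[OF abs_powr_has_derivative[OF g(1)] d, of x]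
    by (simp add: H_def mult.commute)
  have cp: "continuous_on UNIV (\<lambda>x. \<bar>u x\<bar> powr e)" if "e > 0" for e
    using that uc by (intro continuous_on_powr' continuous_intros) auto
  have cH: "continuous_on UNIV H"
  proof -
    have "continuous_on UNIV (\<lambda>x. \<bar>u x\<bar> powr (g - 1) * sgn (u x))"
      using g by (intro continuous_on_compose2[OF continuous_sgn_powr uc]) auto
    then have "continuous_on UNIV (\<lambda>x. (g * (\<bar>u x\<bar> powr (g - 1) * sgn (u x))) *\<^sub>R D x)"
      by (intro continuous_on_scaleR continuous_on_mult_left c)
    then show ?thesis by (simp add: H_def[abs_def] mult.assoc)
  qed
  define A where "A = (LINT x|lborel. \<bar>u x\<bar> powr q)"
  define E where "E = (LINT x|lborel. (norm (D x))\<^sup>2)"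
  have A0: "A \<ge> 0" "E \<ge> 0" by (auto simp: A_def E_def)
  show iA: "integrable lborel (\<lambda>x. \<bar>u x\<bar> powr (2 * k / (k - 2)))"
    using q z by (intro continuous_cs_integrable[of _ R] cp) (auto simp: q_def)
  have iE: "integrable lborel (\<lambda>x. (norm (D x))\<^sup>2)"
    by (rule continuous_cs_integrable[of _ R]) (use c Dz in \<open>auto intro!: continuous_intros\<close>)
  have nH: "norm (H x) = g * (\<bar>u x\<bar> powr (g - 1) * norm (D x))" for x
    using g by (cases "u x = 0") (auto simp: H_def abs_mult abs_sgn_eq)
  have sq: "(\<bar>u x\<bar> powr (g - 1))\<^sup>2 = \<bar>u x\<bar> powr q" for x
    using g by (cases "u x = 0") (auto simp: q_def powr_power)
  have CS: "(LINT x|lborel. \<bar>u x\<bar> powr (g - 1) * norm (D x))\<^sup>2 \<le> A * E"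
    using Cauchy_Schwarz_integral(2)[of "\<lambda>x. \<bar>u x\<bar> powr (g - 1)" "\<lambda>x. norm (D x)"] iA iE
    by (simp add: sq A_def E_def q_def)
  have "A = (LINT x|lborel. \<bar>\<bar>u x\<bar> powr g\<bar> powr (k / (k - 1)))"
    unfolding A_def q_def g(3)[symmetric] by (simp add: powr_powr)
  also have "\<dots> \<le> (LINT x|lborel. norm (H x)) powr (k / (k - 1))"
    unfolding k_def using n z g by (intro GNS_L1[OF _ dw cH, of R]) auto
  finally have 1: "A \<le> (LINT x|lborel. norm (H x)) powr (k / (k - 1))" .
  have 2: "(LINT x|lborel. norm (H x))\<^sup>2 \<le> g\<^sup>2 * (A * E)"
    unfolding nH using CS by (simp add: power_mult_distrib mult_left_mono)
  have "A powr ((k - 2) / k) \<le> g\<^sup>2 * E"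
  proof (cases "A = 0")
    case False
    then have A: "A > 0" using A0 by simp
    have "A powr (2 * (k - 1) / k) \<le> ((LINT x|lborel. norm (H x)) powr (k / (k - 1))) powr (2 * (k - 1) / k)"
      using 1 A0 k by (intro powr_mono2) auto
    also have "\<dots> = (LINT x|lborel. norm (H x)) powr 2"
    proof -
      have nz: "(k - 1) * k \<noteq> 0" using k by auto
      have "k / (k - 1) * (2 * (k - 1) / k) = 2"
        unfolding times_divide_times_eq by (subst nonzero_divide_eq_eq[OF nz]) (simp add: algebra_simps)
      then show ?thesis by (simp only: powr_powr)
    qed
    also have "\<dots> = (LINT x|lborel. norm (H x))\<^sup>2" by (simp add: powr_numeral)
    also have "\<dots> \<le> g\<^sup>2 * (A * E)" by (rule 2)
    finally have "A powr (2 * (k - 1) / k) \<le> (g\<^sup>2 * E) * A" by (simp add: mult_ac)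
    \<comment> \<open>One full power of \<open>A\<close> splits off and cancels against the
      \<open>A\<close> on the right; this division is the reason for treating \<open>A = 0\<close>
      separately.\<close>
    moreover have "A powr (2 * (k - 1) / k) = A powr ((k - 2) / k) * A powr 1"
      using k by (subst powr_add[symmetric]) (simp add: field_simps)
    ultimately show ?thesis using A by simp
  qed (use A0 in simp)
  then show "(LINT x|lborel. \<bar>u x\<bar> powr (2 * k / (k - 2))) powr ((k - 2) / k)
      \<le> (2 * (k - 1) / (k - 2))\<^sup>2 * (LINT x|lborel. (norm (D x))\<^sup>2)"
    by (simp add: A_def E_def q_def g_def)
qed

text \<open>Fatou along the a.e. convergent approximants. The additional factor 2 comes from
  bounding the energy of \<open>D n\<close> by twice that of \<open>G\<close> plus twice the
  error.\<close>

lemma sobolev_aprx: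
  fixes f :: "real ^ 'n \<Rightarrow> real"
  assumes n: "CARD('n) \<ge> 3" and a: "aprx UNIV UNIV f G F D" and z: "\<And>n x. norm x > R \<Longrightarrow> F n x = 0"
  defines "k \<equiv> real CARD('n)"
  shows "integrable lborel (\<lambda>x. \<bar>f x\<bar> powr (2 * k / (k - 2)))"
    "(LINT x|lborel. \<bar>f x\<bar> powr (2 * k / (k - 2))) powr ((k - 2) / k)
      \<le> 2 * (2 * (k - 1) / (k - 2))\<^sup>2 * (LINT x|lborel. (norm (G x))\<^sup>2)"
proof -
  note [measurable] = aprx_measurable[OF a]
  define q where "q = 2 * k / (k - 2)"
  define S where "S = (2 * (k - 1) / (k - 2))\<^sup>2"
  have k: "k \<ge> 3" using n by (simp add: k_def)
  have dF: "\<And>n x. (F n has_derivative (\<lambda>h. D n x \<bullet> h)) (at x)" and cD: "\<And>n. continuous_on UNIV (D n)"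
    and lD: "(\<lambda>n. nsq UNIV (\<lambda>x. D n x - G x)) \<longlonglongrightarrow> 0" and fG: "nsq UNIV G < \<infinity>"
    and ae: "AE x in lborel. (\<lambda>n. F n x) \<longlonglongrightarrow> f x"
    using a by (auto simp: aprx_def)
  define E where "E = (LINT x|lborel. (norm (G x))\<^sup>2)"
  have E: "E \<ge> 0" by (simp add: E_def)
  have iG: "integrable lborel (\<lambda>x. (norm (G x))\<^sup>2)"
    using fG nsq_finite_iff_integrable[of "\<lambda>x. norm (G x)" UNIV] by (simp add: nsq_def)
  have nG: "nsq UNIV G = ennreal E"
    unfolding E_def using iG by (simp add: nsq_def nn_integral_eq_integral)
  define \<delta> where "\<delta> n = enn2real (nsq UNIV (\<lambda>x. D n x - G x))" for n
  have Dz: "\<And>n x. norm x > R \<Longrightarrow> D n x = 0" using dF z by (rule gradient_zero_outside)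
  have iD: "integrable lborel (\<lambda>x. (norm (D n x))\<^sup>2)" for n
    by (rule continuous_cs_integrable[of _ R]) (use cD Dz in \<open>auto intro!: continuous_intros\<close>)
  have nD: "nsq UNIV (D n) = ennreal (LINT x|lborel. (norm (D n x))\<^sup>2)" for n
    using iD by (simp add: nsq_def nn_integral_eq_integral)
  have \<delta>e: "ennreal (\<delta> n) = nsq UNIV (\<lambda>x. D n x - G x)" for n
  proof -
    have "nsq UNIV (\<lambda>x. D n x + - G x) \<le> 2 * nsq UNIV (D n) + 2 * nsq UNIV (\<lambda>x. - G x)"
      by (rule nsq_add) auto
    also have "\<dots> < \<infinity>" using fG by (simp add: nsq_minus nD ennreal_mult_less_top)
    finally show ?thesis by (simp add: \<delta>_def)
  qed
  have l\<delta>: "\<delta> \<longlonglongrightarrow> 0" unfolding \<delta>_def using tendsto_enn2real[of _ 0] lD by simp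
  have \<delta>0: "\<delta> n \<ge> 0" for n by (simp add: \<delta>_def)
  have DE: "(LINT x|lborel. (norm (D n x))\<^sup>2) \<le> 2 * E + 2 * \<delta> n" for n
  proof -
    have "nsq UNIV (\<lambda>x. G x + (D n x - G x)) \<le> 2 * nsq UNIV G + 2 * nsq UNIV (\<lambda>x. D n x - G x)"
      by (rule nsq_add) auto
    then have "ennreal (LINT x|lborel. (norm (D n x))\<^sup>2) \<le> ennreal (2 * E + 2 * \<delta> n)"
      using E \<delta>0[of n] by (simp add: nD nG \<delta>e[symmetric] ennreal_plus ennreal_mult)
    then show ?thesis using E \<delta>0[of n] by (subst (asm) ennreal_le_iff) auto
  qed
  define T where "T n = (S * (2 * E + 2 * \<delta> n)) powr (k / (k - 2))" for n
  have S0: "S \<ge> 0" by (simp add: S_def)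
  have FT: "(\<integral>\<^sup>+x. ennreal (\<bar>F n x\<bar> powr q) \<partial>lborel) \<le> ennreal (T n)" for n
  proof -
    have i: "integrable lborel (\<lambda>x. \<bar>F n x\<bar> powr q)"
      unfolding q_def k_def by (rule sobolev_C1(1)[OF n dF cD z])
    define A where "A = (LINT x|lborel. \<bar>F n x\<bar> powr q)"
    have A0: "A \<ge> 0" by (simp add: A_def)
    have "A powr ((k - 2) / k) \<le> S * (LINT x|lborel. (norm (D n x))\<^sup>2)"
      unfolding A_def q_def S_def k_def by (rule sobolev_C1(2)[OF n dF cD z])
    also have "\<dots> \<le> S * (2 * E + 2 * \<delta> n)" using DE S0 by (intro mult_left_mono)
    finally have "(A powr ((k - 2) / k)) powr (k / (k - 2)) \<le> T n"
      unfolding T_def using k by (intro powr_mono2) auto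
    then have "A \<le> T n" using k A0 by (simp add: powr_powr)
    then show ?thesis using i by (simp add: nn_integral_eq_integral A_def ennreal_leI)
  qed
  have lT: "T \<longlonglongrightarrow> (S * (2 * E)) powr (k / (k - 2))"
    unfolding T_def using k S0 E \<delta>0
    by (intro tendsto_powr2) (auto intro!: tendsto_eq_intros l\<delta> always_eventually mult_nonneg_nonneg add_nonneg_nonneg)
  have q0: "q > 0" using k by (simp add: q_def)
  have "(\<integral>\<^sup>+x. ennreal (\<bar>f x\<bar> powr q) \<partial>lborel)
      = (\<integral>\<^sup>+x. liminf (\<lambda>n. ennreal (\<bar>F n x\<bar> powr q)) \<partial>lborel)"
  proof (rule nn_integral_cong_AE)
    show "AE x in lborel. ennreal (\<bar>f x\<bar> powr q) = liminf (\<lambda>n. ennreal (\<bar>F n x\<bar> powr q))"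
      using ae
    proof eventually_elim
      case (elim x)
      have "(\<lambda>n. ennreal (\<bar>F n x\<bar> powr q)) \<longlonglongrightarrow> ennreal (\<bar>f x\<bar> powr q)"
        using q0 elim by (intro tendsto_ennrealI tendsto_powr2 tendsto_rabs) auto
      then show ?case using lim_imp_Liminf[OF sequentially_bot] by metis
    qed
  qed
  also have "\<dots> \<le> liminf (\<lambda>n. \<integral>\<^sup>+x. ennreal (\<bar>F n x\<bar> powr q) \<partial>lborel)"
    by (rule nn_integral_liminf) measurable
  also have "\<dots> \<le> liminf (\<lambda>n. ennreal (T n))"
    using FT by (intro Liminf_mono always_eventually) auto
  also have "\<dots> = ennreal ((S * (2 * E)) powr (k / (k - 2)))"
    by (rule lim_imp_Liminf[OF sequentially_bot tendsto_ennrealI[OF lT]])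
  finally have le: "(\<integral>\<^sup>+x. ennreal (\<bar>f x\<bar> powr q) \<partial>lborel) \<le> ennreal ((S * (2 * E)) powr (k / (k - 2)))" .
  then have i: "integrable lborel (\<lambda>x. \<bar>f x\<bar> powr q)"
    unfolding integrable_iff_bounded by (auto elim: le_less_trans)
  then show "integrable lborel (\<lambda>x. \<bar>f x\<bar> powr (2 * k / (k - 2)))" by (simp add: q_def)
  have "(LINT x|lborel. \<bar>f x\<bar> powr q) \<le> (S * (2 * E)) powr (k / (k - 2))"
    using le i by (simp add: nn_integral_eq_integral)
  then have "(LINT x|lborel. \<bar>f x\<bar> powr q) powr ((k - 2) / k) \<le> ((S * (2 * E)) powr (k / (k - 2))) powr ((k - 2) / k)"
    using k by (intro powr_mono2) auto
  also have "\<dots> = S * (2 * E)" using k S0 E by (simp add: powr_powr)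
  finally show "(LINT x|lborel. \<bar>f x\<bar> powr (2 * k / (k - 2))) powr ((k - 2) / k)
      \<le> 2 * (2 * (k - 1) / (k - 2))\<^sup>2 * (LINT x|lborel. (norm (G x))\<^sup>2)"
    by (simp add: q_def S_def E_def mult_ac)
qed

section \<open>The Poincare inequality on a ball\<close>

lemma nn_integral_lborel_affine:
  fixes h :: "'a::euclidean_space \<Rightarrow> ennreal"
  assumes [measurable]: "h \<in> borel_measurable borel" and c: "c > 0"
  shows "(\<integral>\<^sup>+x. h x \<partial>lborel) = ennreal (c ^ DIM('a)) * (\<integral>\<^sup>+x. h (a + c *\<^sub>R x) \<partial>lborel)"
proof -
  have "(\<integral>\<^sup>+x. h x \<partial>lborel) = (\<integral>\<^sup>+x. h x \<partial>density (distr lborel borel (\<lambda>x. a + c *\<^sub>R x)) (\<lambda>_. ennreal (\<bar>c\<bar> ^ DIM('a))))"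
    using lborel_affine[of c a] c by simp
  also have "\<dots> = ennreal (c ^ DIM('a)) * (\<integral>\<^sup>+x. h (a + c *\<^sub>R x) \<partial>lborel)"
    using c by (subst nn_integral_density) (auto simp: nn_integral_distr nn_integral_cmult)
  finally show ?thesis .
qed

text \<open>The substitution costs the Jacobian factor \<open>t ^ (- n)\<close>, \<open>n\<close>
  being the dimension, which is at most \<open>2 ^ n\<close> on this range of
  \<open>t\<close>.\<close>

lemma nn_integral_segment_le:
  fixes h :: "real ^ 'n \<Rightarrow> ennreal"
  assumes [measurable]: "h \<in> borel_measurable borel" and t: "1 / 2 \<le> t"
  shows "(\<integral>\<^sup>+y. h (a + t *\<^sub>R y) \<partial>lborel) \<le> ennreal (2 ^ CARD('n)) * (\<integral>\<^sup>+x. h x \<partial>lborel)"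
proof -
  have "(\<integral>\<^sup>+y. h (a + t *\<^sub>R y) \<partial>lborel) = 1 * (\<integral>\<^sup>+y. h (a + t *\<^sub>R y) \<partial>lborel)" by simp
  also have "\<dots> \<le> ennreal ((2 * t) ^ CARD('n)) * (\<integral>\<^sup>+y. h (a + t *\<^sub>R y) \<partial>lborel)"
  proof (rule mult_right_mono)
    have "1 \<le> (2 * t) ^ CARD('n)" using t by (intro one_le_power) simp
    from ennreal_leI[OF this] show "1 \<le> ennreal ((2 * t) ^ CARD('n))" by simp
  qed simp
  also have "\<dots> = ennreal (2 ^ CARD('n)) * (ennreal (t ^ CARD('n)) * (\<integral>\<^sup>+y. h (a + t *\<^sub>R y) \<partial>lborel))"
    using t by (simp add: power_mult_distrib ennreal_mult mult.assoc)
  also have "\<dots> = ennreal (2 ^ CARD('n)) * (\<integral>\<^sup>+x. h x \<partial>lborel)"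
    using t by (subst nn_integral_lborel_affine[of h t a]) auto
  finally show ?thesis .
qed

text \<open>The fundamental theorem of calculus on the segment, then Cauchy--Schwarz in
  \<open>t\<close>. The right side is an extended integral because Tonelli is applied to it
  next.\<close>

lemma segment_diff_sq_le:
  fixes F :: "real ^ 'n \<Rightarrow> real"
  assumes d: "\<And>x. (F has_derivative (\<lambda>h. D x \<bullet> h)) (at x)" and c: "continuous_on UNIV D"
  shows "ennreal ((F x - F y)\<^sup>2) \<le> ennreal ((norm (y - x))\<^sup>2) *
    (\<integral>\<^sup>+t. ennreal ((norm (D ((1 - t) *\<^sub>R x + t *\<^sub>R y)))\<^sup>2) * indicator {0..1::real} t \<partial>lborel)"
proof -
  define p where "p t = (1 - t) *\<^sub>R x + t *\<^sub>R y" for t :: real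
  have pc: "continuous_on UNIV p" unfolding p_def[abs_def] by (intro continuous_intros)
  have Dp: "continuous_on UNIV (\<lambda>t. D (p t))" by (rule continuous_on_compose2[OF c pc]) auto
  have [measurable]: "(\<lambda>t. D (p t)) \<in> borel_measurable borel" using Dp by (rule borel_measurable_continuous_onI)
  have der: "((\<lambda>t. F (p t)) has_real_derivative D (p t) \<bullet> (y - x)) (at t)" for t
  proof -
    have "(p has_derivative (\<lambda>h. h *\<^sub>R (y - x))) (at t)"
      unfolding p_def[abs_def] by (auto intro!: derivative_eq_intros simp: algebra_simps)
    from has_derivative_compose[OF this d]
    have "((\<lambda>t. F (p t)) has_derivative (\<lambda>h. D (p t) \<bullet> (h *\<^sub>R (y - x)))) (at t)" .
    moreover have "(\<lambda>h. D (p t) \<bullet> (h *\<^sub>R (y - x))) = (*) (D (p t) \<bullet> (y - x))" by (auto simp: mult.commute)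
    ultimately show ?thesis by (simp add: has_field_derivative_def)
  qed
  have ftc: "(LINT t|lborel. (D (p t) \<bullet> (y - x)) * indicator {0..1} t) = F y - F x"
  proof -
    have "(LINT t|lborel. (D (p t) \<bullet> (y - x)) * indicator {0..1} t) = F (p 1) - F (p 0)"
    proof (rule integral_FTC_Icc_real)
      have "continuous_on UNIV (\<lambda>t. D (p t) \<bullet> (y - x))" by (intro continuous_intros Dp)
      then show "isCont (\<lambda>t. D (p t) \<bullet> (y - x)) t" for t by (simp add: continuous_on_eq_continuous_at)
    qed (use der in auto)
    then show ?thesis by (simp add: p_def)
  qed
  have "(LINT t|lborel. (indicator {0..1} t * norm (D (p t))) * indicator {0..1} t)\<^sup>2
      \<le> (LINT t|lborel. (indicator {0..1} t * norm (D (p t)))\<^sup>2) * (LINT t|lborel. (indicator {0..1::real} t)\<^sup>2)"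
  proof (rule Cauchy_Schwarz_integral(2))
    have "integrable lborel (\<lambda>t. indicator {0..1} t *\<^sub>R (norm (D (p t)))\<^sup>2)"
      by (intro borel_integrable_compact continuous_intros continuous_on_subset[OF Dp]) auto
    then show "integrable lborel (\<lambda>t. (indicator {0..1} t * norm (D (p t)))\<^sup>2)"
      by (rule Bochner_Integration.integrable_cong[THEN iffD1, rotated -1]) (auto simp: indicator_def)
    show "integrable lborel (\<lambda>t. (indicator {0..1::real} t)\<^sup>2 :: real)"
      by (auto simp: power2_eq_square indicator_inter_arith[symmetric])
  qed auto
  moreover have "(LINT t|lborel. (indicator {0..1::real} t)\<^sup>2) = (1::real)"
    by (simp add: power2_eq_square indicator_inter_arith[symmetric])
  moreover have "(LINT t|lborel. (indicator {0..1} t * norm (D (p t))) * indicator {0..1} t)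
      = (LINT t|lborel. indicator {0..1} t * norm (D (p t)))"
    by (rule Bochner_Integration.integral_cong) (auto simp: indicator_def)
  ultimately have CS: "(LINT t|lborel. indicator {0..1} t * norm (D (p t)))\<^sup>2
      \<le> (LINT t|lborel. (indicator {0..1} t * norm (D (p t)))\<^sup>2)" by simp
  have i1: "integrable lborel (\<lambda>t. indicator {0..1} t * norm (D (p t)))"
    using borel_integrable_compact[of "{0..1}" "\<lambda>t. norm (D (p t))"] continuous_on_subset[OF continuous_on_norm[OF Dp]]
    by simp
  have "\<bar>F x - F y\<bar> = \<bar>LINT t|lborel. (D (p t) \<bullet> (y - x)) * indicator {0..1} t\<bar>" using ftc by simp
  also have "\<dots> \<le> (LINT t|lborel. norm (y - x) * (indicator {0..1} t * norm (D (p t))))"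
  proof (rule order_trans[OF integral_abs_bound integral_mono'])
    show "integrable lborel (\<lambda>t. norm (y - x) * (indicator {0..1} t * norm (D (p t))))" using i1 by simp
    show "\<bar>D (p t) \<bullet> (y - x) * indicator {0..1} t\<bar> \<le> norm (y - x) * (indicator {0..1} t * norm (D (p t)))" for t
      using Cauchy_Schwarz_ineq2[of "D (p t)" "y - x"] by (auto simp: indicator_def mult.commute)
  qed simp
  also have "\<dots> = norm (y - x) * (LINT t|lborel. indicator {0..1} t * norm (D (p t)))" by simp
  finally have "\<bar>F x - F y\<bar>\<^sup>2 \<le> (norm (y - x) * (LINT t|lborel. indicator {0..1} t * norm (D (p t))))\<^sup>2"
    by (intro power_mono) auto
  also have "\<dots> \<le> (norm (y - x))\<^sup>2 * (LINT t|lborel. (indicator {0..1} t * norm (D (p t)))\<^sup>2)"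
    using CS by (simp add: power_mult_distrib mult_left_mono)
  finally have "ennreal ((F x - F y)\<^sup>2) \<le> ennreal ((norm (y - x))\<^sup>2) * ennreal (LINT t|lborel. (indicator {0..1} t * norm (D (p t)))\<^sup>2)"
    by (simp add: ennreal_leI flip: ennreal_mult)
  also have "ennreal (LINT t|lborel. (indicator {0..1} t * norm (D (p t)))\<^sup>2)
      \<le> (\<integral>\<^sup>+t. ennreal ((norm (D (p t)))\<^sup>2) * indicator {0..1} t \<partial>lborel)"
  proof -
    have "ennreal (LINT t|lborel. (indicator {0..1} t * norm (D (p t)))\<^sup>2)
        \<le> (\<integral>\<^sup>+t. ennreal (norm ((indicator {0..1} t * norm (D (p t)))\<^sup>2)) \<partial>lborel)"
    proof (cases "integrable lborel (\<lambda>t. (indicator {0..1} t * norm (D (p t)))\<^sup>2)")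
      case True
      from integral_norm_bound_ennreal[OF this] show ?thesis by simp
    qed (simp add: not_integrable_integral_eq)
    also have "\<dots> = (\<integral>\<^sup>+t. ennreal ((norm (D (p t)))\<^sup>2) * indicator {0..1} t \<partial>lborel)"
      by (intro nn_integral_cong) (auto simp: indicator_def)
    finally show ?thesis .
  qed
  finally show ?thesis by (simp add: p_def mult_left_mono)
qed

text \<open>Convexity keeps the segments in the ball. On a segment one of \<open>t\<close> and
  \<open>1 - t\<close> is at least 1/2; the corresponding endpoint is the variable that is
  substituted, so the Jacobian never degenerates.\<close>

lemma double_diff_sq_le:
  fixes F :: "real ^ 'n \<Rightarrow> real"
  assumes d: "\<And>x. (F has_derivative (\<lambda>h. D x \<bullet> h)) (at x)" and c: "continuous_on UNIV D" and \<rho>: "\<rho> > 0"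
  defines "B \<equiv> ball (0::real^'n) \<rho>"
  shows "(\<integral>\<^sup>+x. (\<integral>\<^sup>+y. ennreal ((F x - F y)\<^sup>2) * indicator B y \<partial>lborel) * indicator B x \<partial>lborel)
    \<le> ennreal ((2 * \<rho>)\<^sup>2 * 2 ^ CARD('n)) * emeasure lborel B * nsq B D"
proof -
  define h where "h z = ennreal ((norm (D z))\<^sup>2) * indicator B z" for z
  have [measurable]: "D \<in> borel_measurable borel" "F \<in> borel_measurable borel"
    using c has_gradient_continuous[OF d] by (auto intro: borel_measurable_continuous_onI)
  have [measurable]: "B \<in> sets borel" by (simp add: B_def)
  have [measurable]: "h \<in> borel_measurable borel" unfolding h_def[abs_def] by measurable
  define g where "g x y t = h ((1 - t) *\<^sub>R x + t *\<^sub>R y) * indicator {0..1::real} t * indicator B y * indicator B x" for x y t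
  have gm: "(\<lambda>(x, t). g x y t) \<in> borel_measurable (lborel \<Otimes>\<^sub>M lborel)"
    "(\<lambda>(y, t). g x y t) \<in> borel_measurable (lborel \<Otimes>\<^sub>M lborel)"
    "(\<lambda>(x, y). g x y t) \<in> borel_measurable (lborel \<Otimes>\<^sub>M lborel)" for x y t
    unfolding g_def by measurable
  have m1: "(\<lambda>(x, y). \<integral>\<^sup>+t. g x y t \<partial>lborel) \<in> borel_measurable (lborel \<Otimes>\<^sub>M lborel)"
    unfolding g_def by measurable
  have m2: "(\<lambda>y. \<integral>\<^sup>+t. g x y t \<partial>lborel) \<in> borel_measurable lborel"
    "(\<lambda>x. \<integral>\<^sup>+y. (\<integral>\<^sup>+t. g x y t \<partial>lborel) \<partial>lborel) \<in> borel_measurable lborel" for x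
    using m1 lborel.borel_measurable_nn_integral[OF m1] by measurable
  have conv: "(1 - t) *\<^sub>R x + t *\<^sub>R y \<in> B" if "x \<in> B" "y \<in> B" "t \<in> {0..1}" for x y t
    using that convex_ball[of "0::real^'n" \<rho>] unfolding B_def convex_alt by auto
  have pt: "ennreal ((F x - F y)\<^sup>2) * indicator B y * indicator B x
      \<le> ennreal ((2 * \<rho>)\<^sup>2) * (\<integral>\<^sup>+t. g x y t \<partial>lborel)" for x y
  proof (cases "x \<in> B \<and> y \<in> B")
    case True
    then have "norm (y - x) \<le> 2 * \<rho>" using norm_triangle_ineq4[of y x] by (simp add: B_def)
    then have n: "ennreal ((norm (y - x))\<^sup>2) \<le> ennreal ((2 * \<rho>)\<^sup>2)" by (intro ennreal_leI power_mono) auto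
    have "(\<integral>\<^sup>+t. ennreal ((norm (D ((1 - t) *\<^sub>R x + t *\<^sub>R y)))\<^sup>2) * indicator {0..1::real} t \<partial>lborel) = (\<integral>\<^sup>+t. g x y t \<partial>lborel)"
      using True conv by (intro nn_integral_cong) (auto simp: g_def h_def indicator_def)
    then have "ennreal ((F x - F y)\<^sup>2) \<le> ennreal ((norm (y - x))\<^sup>2) * (\<integral>\<^sup>+t. g x y t \<partial>lborel)"
      using segment_diff_sq_le[OF d c, of x y] by simp
    also have "\<dots> \<le> ennreal ((2 * \<rho>)\<^sup>2) * (\<integral>\<^sup>+t. g x y t \<partial>lborel)" using n by (rule mult_right_mono) simp
    finally show ?thesis using True by simp
  qed auto
  have tbound: "(\<integral>\<^sup>+x. (\<integral>\<^sup>+y. g x y t \<partial>lborel) \<partial>lborel)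
      \<le> ennreal (2 ^ CARD('n)) * emeasure lborel B * nsq B D * indicator {0..1} t" for t
  proof (cases "t \<in> {0..1}")
    case True
    have hh: "(\<integral>\<^sup>+x. h x \<partial>lborel) = nsq B D" by (simp add: h_def nsq_def)
    consider "1 / 2 \<le> t" | "1 / 2 \<le> 1 - t" by linarith
    then show ?thesis
    proof cases
      case 1
      have "(\<integral>\<^sup>+x. (\<integral>\<^sup>+y. g x y t \<partial>lborel) \<partial>lborel) \<le> (\<integral>\<^sup>+x. (ennreal (2 ^ CARD('n)) * nsq B D) * indicator B x \<partial>lborel)"
      proof (rule nn_integral_mono)
        fix x
        have "(\<integral>\<^sup>+y. g x y t \<partial>lborel) \<le> (\<integral>\<^sup>+y. h ((1 - t) *\<^sub>R x + t *\<^sub>R y) * indicator B x \<partial>lborel)"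
          by (intro nn_integral_mono) (auto simp: g_def indicator_def)
        also have "\<dots> = (\<integral>\<^sup>+y. h ((1 - t) *\<^sub>R x + t *\<^sub>R y) \<partial>lborel) * indicator B x" by (rule nn_integral_multc) measurable
        also have "\<dots> \<le> (ennreal (2 ^ CARD('n)) * nsq B D) * indicator B x"
          using nn_integral_segment_le[OF _ 1, of h "(1 - t) *\<^sub>R x"] by (intro mult_right_mono) (auto simp: hh)
        finally show "(\<integral>\<^sup>+y. g x y t \<partial>lborel) \<le> (ennreal (2 ^ CARD('n)) * nsq B D) * indicator B x" .
      qed
      also have "\<dots> = ennreal (2 ^ CARD('n)) * nsq B D * emeasure lborel B"
        by (rule nn_integral_cmult_indicator) simp
      finally show ?thesis using True by (simp add: mult_ac)
    next
      case 2
      have "(\<integral>\<^sup>+x. (\<integral>\<^sup>+y. g x y t \<partial>lborel) \<partial>lborel) = (\<integral>\<^sup>+y. (\<integral>\<^sup>+x. g x y t \<partial>lborel) \<partial>lborel)"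
        by (rule lborel_pair.Fubini'[symmetric]) (use gm(3)[of t] in \<open>simp add: case_prod_beta'\<close>)
      also have "\<dots> \<le> (\<integral>\<^sup>+y. (ennreal (2 ^ CARD('n)) * nsq B D) * indicator B y \<partial>lborel)"
      proof (rule nn_integral_mono)
        fix y
        have "(\<integral>\<^sup>+x. g x y t \<partial>lborel) \<le> (\<integral>\<^sup>+x. h (t *\<^sub>R y + (1 - t) *\<^sub>R x) * indicator B y \<partial>lborel)"
          by (intro nn_integral_mono) (auto simp: g_def indicator_def add.commute)
        also have "\<dots> = (\<integral>\<^sup>+x. h (t *\<^sub>R y + (1 - t) *\<^sub>R x) \<partial>lborel) * indicator B y" by (rule nn_integral_multc) measurable
        also have "\<dots> \<le> (ennreal (2 ^ CARD('n)) * nsq B D) * indicator B y"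
          using nn_integral_segment_le[OF _ 2, of h "t *\<^sub>R y"] by (intro mult_right_mono) (auto simp: hh)
        finally show "(\<integral>\<^sup>+x. g x y t \<partial>lborel) \<le> (ennreal (2 ^ CARD('n)) * nsq B D) * indicator B y" .
      qed
      also have "\<dots> = ennreal (2 ^ CARD('n)) * nsq B D * emeasure lborel B"
        by (rule nn_integral_cmult_indicator) simp
      finally show ?thesis using True by (simp add: mult_ac)
    qed
  qed (simp add: g_def)
  have "(\<integral>\<^sup>+x. (\<integral>\<^sup>+y. ennreal ((F x - F y)\<^sup>2) * indicator B y \<partial>lborel) * indicator B x \<partial>lborel)
      = (\<integral>\<^sup>+x. (\<integral>\<^sup>+y. ennreal ((F x - F y)\<^sup>2) * indicator B y * indicator B x \<partial>lborel) \<partial>lborel)"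
    by (simp add: nn_integral_multc)
  also have "\<dots> \<le> (\<integral>\<^sup>+x. (\<integral>\<^sup>+y. ennreal ((2 * \<rho>)\<^sup>2) * (\<integral>\<^sup>+t. g x y t \<partial>lborel) \<partial>lborel) \<partial>lborel)"
    by (intro nn_integral_mono pt)
  also have "\<dots> = ennreal ((2 * \<rho>)\<^sup>2) * (\<integral>\<^sup>+x. (\<integral>\<^sup>+y. (\<integral>\<^sup>+t. g x y t \<partial>lborel) \<partial>lborel) \<partial>lborel)"
    unfolding nn_integral_cmult[OF m2(1)] by (rule nn_integral_cmult[OF m2(2)])
  also have "(\<integral>\<^sup>+x. (\<integral>\<^sup>+y. (\<integral>\<^sup>+t. g x y t \<partial>lborel) \<partial>lborel) \<partial>lborel) = (\<integral>\<^sup>+x. (\<integral>\<^sup>+t. (\<integral>\<^sup>+y. g x y t \<partial>lborel) \<partial>lborel) \<partial>lborel)"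
  proof (rule nn_integral_cong)
    fix x :: "real ^ 'n"
    show "(\<integral>\<^sup>+y. (\<integral>\<^sup>+t. g x y t \<partial>lborel) \<partial>lborel) = (\<integral>\<^sup>+t. (\<integral>\<^sup>+y. g x y t \<partial>lborel) \<partial>lborel)"
      by (rule lborel_pair.Fubini'[symmetric]) (rule gm(2))
  qed
  also have "\<dots> = (\<integral>\<^sup>+t. (\<integral>\<^sup>+x. (\<integral>\<^sup>+y. g x y t \<partial>lborel) \<partial>lborel) \<partial>lborel)"
  proof (rule lborel_pair.Fubini'[symmetric])
    show "(\<lambda>(x, t). \<integral>\<^sup>+y. g x y t \<partial>lborel) \<in> borel_measurable (lborel \<Otimes>\<^sub>M lborel)"
      unfolding g_def by measurable
  qed
  also have "\<dots> \<le> (\<integral>\<^sup>+t. ennreal (2 ^ CARD('n)) * emeasure lborel B * nsq B D * indicator {0..1::real} t \<partial>lborel)"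
    by (intro nn_integral_mono tbound)
  also have "\<dots> = ennreal (2 ^ CARD('n)) * emeasure lborel B * nsq B D"
    by (subst nn_integral_cmult_indicator) auto
  finally show ?thesis by (simp add: mult_left_mono ennreal_mult mult.assoc)
qed

text \<open>The subtracted constant is the value of \<open>w\<close> at a suitable point instead of
  the average: the double integral of \<open>(w x - w y)\<^sup>2\<close> is bounded, so some
  \<open>y\<close> is no worse than the mean. In the constant, 6 is 3 from the square of a
  three-term sum times 2 from \<open>nsq_add\<close>.\<close>

lemma poincare_aprx:
  fixes w :: "real ^ 'n \<Rightarrow> real"
  assumes \<rho>: "\<rho> > 0" and a: "aprx (ball 0 \<rho>) UNIV w G F D"
  obtains k where "nsq (ball 0 \<rho>) (\<lambda>x. w x - k)
    \<le> ennreal (6 * (2 * \<rho>)\<^sup>2 * 2 ^ CARD('n)) * nsq (ball 0 \<rho>) G + 1"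
proof -
  let ?B = "ball (0::real^'n) \<rho>"
  let ?V = "emeasure lborel ?B"
  note [measurable] = aprx_measurable[OF a]
  define c where "c = ennreal ((2 * \<rho>)\<^sup>2 * 2 ^ CARD('n))"
  define J where "J f = (\<integral>\<^sup>+x. (\<integral>\<^sup>+y. ennreal ((f x - f y)\<^sup>2) * indicator ?B y \<partial>lborel) * indicator ?B x \<partial>lborel)"
    for f :: "real ^ 'n \<Rightarrow> real"
  have V: "?V < \<infinity>" by (rule emeasure_lborel_ball_finite)
  have V0: "?V \<noteq> 0"
  proof
    assume "?V = 0"
    moreover have "?B \<noteq> {}" using \<rho> by auto
    ultimately show False using open_not_negligible[of ?B]
      by (simp add: negligible_iff_null_sets null_sets_def emeasure_completion)
  qed
  have fin: "nsq ?B G < \<infinity>" using a by (simp add: aprx_def)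
  have l1: "(\<lambda>n. nsq ?B (\<lambda>x. F n x - w x)) \<longlonglongrightarrow> 0" and l2: "(\<lambda>n. nsq ?B (\<lambda>x. D n x - G x)) \<longlonglongrightarrow> 0"
    using a by (auto simp: aprx_def)
  have JF: "J (F n) \<le> c * ?V * nsq ?B (D n)" for n
    unfolding J_def c_def using a by (intro double_diff_sq_le \<rho>) (auto simp: aprx_def)
  have Dn: "nsq ?B (D n) \<le> 2 * nsq ?B G + 2 * nsq ?B (\<lambda>x. D n x - G x)" for n
    using nsq_add[of G "\<lambda>x. D n x - G x" ?B] by simp
  have three: "ennreal ((w x - w y)\<^sup>2) \<le> 3 * ennreal ((F n x - w x)\<^sup>2) + 3 * ennreal ((F n x - F n y)\<^sup>2) + 3 * ennreal ((F n y - w y)\<^sup>2)" for n x y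
  proof -
    define p q r where "p = F n x - w x" and "q = F n x - F n y" and "r = F n y - w y"
    have "(w x - w y)\<^sup>2 = (- p + q + r)\<^sup>2" by (simp add: p_def q_def r_def)
    also have "\<dots> \<le> 3 * p\<^sup>2 + 3 * q\<^sup>2 + 3 * r\<^sup>2"
    proof -
      have "3 * p\<^sup>2 + 3 * q\<^sup>2 + 3 * r\<^sup>2 - (- p + q + r)\<^sup>2 = (p + q)\<^sup>2 + (p + r)\<^sup>2 + (q - r)\<^sup>2"
        by (simp add: power2_eq_square algebra_simps)
      moreover have "0 \<le> (p + q)\<^sup>2 + (p + r)\<^sup>2 + (q - r)\<^sup>2" by simp
      ultimately show ?thesis by linarith
    qed
    finally have "ennreal ((w x - w y)\<^sup>2) \<le> ennreal (3 * p\<^sup>2 + 3 * q\<^sup>2 + 3 * r\<^sup>2)" by (rule ennreal_leI)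
    also have "\<dots> = 3 * ennreal (p\<^sup>2) + 3 * ennreal (q\<^sup>2) + 3 * ennreal (r\<^sup>2)"
      by (simp add: ennreal_plus ennreal_mult)
    finally show ?thesis by (simp add: p_def q_def r_def)
  qed
  have Jw: "J w \<le> 3 * (nsq ?B (\<lambda>x. F n x - w x) * ?V) + 3 * J (F n) + 3 * (nsq ?B (\<lambda>x. F n x - w x) * ?V)" for n
  proof -
    let ?s = "\<lambda>x. ennreal ((F n x - w x)\<^sup>2)"
    have "J w \<le> (\<integral>\<^sup>+x. (\<integral>\<^sup>+y. (3 * ?s x + 3 * ennreal ((F n x - F n y)\<^sup>2) + 3 * ?s y) * indicator ?B y \<partial>lborel) * indicator ?B x \<partial>lborel)"
      unfolding J_def using three[of _ _ n] by (intro nn_integral_mono mult_right_mono) auto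
    also have "\<dots> = (\<integral>\<^sup>+x. (3 * (?s x * ?V) + 3 * (\<integral>\<^sup>+y. ennreal ((F n x - F n y)\<^sup>2) * indicator ?B y \<partial>lborel)
        + 3 * nsq ?B (\<lambda>x. F n x - w x)) * indicator ?B x \<partial>lborel)"
      by (simp add: distrib_right nn_integral_add nn_integral_cmult nn_integral_cmult_indicator nsq_def mult.assoc)
    also have "\<dots> = (\<integral>\<^sup>+x. 3 * ?V * (?s x * indicator ?B x) + 3 * ((\<integral>\<^sup>+y. ennreal ((F n x - F n y)\<^sup>2) * indicator ?B y \<partial>lborel) * indicator ?B x)
        + 3 * nsq ?B (\<lambda>x. F n x - w x) * indicator ?B x \<partial>lborel)"
      by (intro nn_integral_cong) (auto simp: algebra_simps indicator_def)
    also have "\<dots> = 3 * ?V * nsq ?B (\<lambda>x. F n x - w x) + 3 * J (F n) + 3 * nsq ?B (\<lambda>x. F n x - w x) * ?V"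
      by (simp add: nn_integral_add nn_integral_cmult nn_integral_cmult_indicator J_def nsq_def)
    finally show ?thesis by (simp add: mult_ac)
  qed
  define X where "X n = 3 * (nsq ?B (\<lambda>x. F n x - w x) * ?V)
      + 3 * (c * ?V * (2 * nsq ?B G + 2 * nsq ?B (\<lambda>x. D n x - G x))) + 3 * (nsq ?B (\<lambda>x. F n x - w x) * ?V)" for n
  have cfin: "c * ?V < \<infinity>" using V by (simp add: c_def ennreal_mult_less_top)
  have g2: "2 * nsq ?B G \<noteq> top" using fin by (simp add: ennreal_mult_eq_top_iff)
  have "X \<longlonglongrightarrow> 3 * (0 * ?V) + 3 * (c * ?V * (2 * nsq ?B G + 2 * 0)) + 3 * (0 * ?V)"
    unfolding X_def using V cfin fin l1 l2 g2
    by (intro tendsto_add tendsto_mult_ennreal tendsto_const) (auto simp: c_def)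
  moreover have "J w \<le> X n" for n
  proof -
    have "J (F n) \<le> c * ?V * (2 * nsq ?B G + 2 * nsq ?B (\<lambda>x. D n x - G x))"
      using JF Dn by (rule order_trans[OF _ mult_left_mono]) simp
    then show ?thesis unfolding X_def by (intro order_trans[OF Jw[of n]] add_mono mult_left_mono) auto
  qed
  ultimately have JX: "J w \<le> 3 * (0 * ?V) + 3 * (c * ?V * (2 * nsq ?B G + 2 * 0)) + 3 * (0 * ?V)"
    by (intro LIMSEQ_le_const) auto
  define K where "K = 6 * c * nsq ?B G"
  have JK: "J w \<le> K * ?V"
  proof -
    have "(6::ennreal) = 3 * 2" by simp
    then show ?thesis using JX unfolding K_def by (simp add: mult_ac)
  qed
  have Kf: "K < \<infinity>" using fin by (simp add: K_def c_def ennreal_mult_less_top)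
  \<comment> \<open>If every \<open>y\<close> failed, integrating over \<open>y\<close> would give
    \<open>(K + 1) * ?V \<le> K * ?V\<close> with \<open>?V\<close> positive and finite. The slack
    of 1 creates this contradiction.\<close>
  have "\<exists>y\<in>?B. nsq ?B (\<lambda>x. w x - w y) \<le> K + 1"
  proof (rule ccontr)
    assume "\<not> ?thesis"
    then have n: "K + 1 \<le> nsq ?B (\<lambda>x. w x - w y)" if "y \<in> ?B" for y using that by (auto simp: not_le intro: less_imp_le)
    have "(K + 1) * ?V = (\<integral>\<^sup>+y. (K + 1) * indicator ?B y \<partial>lborel)"
      by (simp add: nn_integral_cmult_indicator)
    also have "\<dots> \<le> J w"
      unfolding J_def
    proof (rule nn_integral_mono)
      fix y
      show "(K + 1) * indicator ?B y \<le> (\<integral>\<^sup>+x. ennreal ((w y - w x)\<^sup>2) * indicator ?B x \<partial>lborel) * indicator ?B y"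
        using n[of y] by (auto simp: indicator_def nsq_def power2_commute[of "w y"])
    qed
    also have "\<dots> \<le> K * ?V" by (rule JK)
    finally have "K * ?V + ?V \<le> K * ?V" by (simp add: distrib_right)
    moreover have "K * ?V < \<infinity>" using Kf V by (simp add: ennreal_mult_less_top)
    ultimately have "?V \<le> 0" using V by (metis add.right_neutral ennreal_add_left_cancel_le infinity_ennreal_def less_irrefl)
    then show False using V0 by simp
  qed
  then obtain y where "nsq ?B (\<lambda>x. w x - w y) \<le> K + 1" by blast
  moreover have "6 * c = ennreal (6 * (2 * \<rho>)\<^sup>2 * 2 ^ CARD('n))"
    unfolding c_def by (simp add: ennreal_mult mult.assoc)
  ultimately show ?thesis by (intro that[of "w y"]) (simp add: K_def)
qed

section \<open>Moser iteration and the Bombieri--Giusti lemma\<close>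

text \<open>The integrals are not divided by the volume: Jensen is applied only for radii up to 1/2,
  where the ball has measure at most 1.\<close>

definition ballint :: "(real ^ 'n \<Rightarrow> real) \<Rightarrow> real \<Rightarrow> real \<Rightarrow> real" where
  "ballint f p r = (LINT x|lborel. indicator (ball 0 r) x * f x powr p)"

definition ballfin :: "(real ^ 'n \<Rightarrow> real) \<Rightarrow> real \<Rightarrow> real \<Rightarrow> bool" where
  "ballfin f p r \<longleftrightarrow> integrable lborel (\<lambda>x. indicator (ball 0 r) x * f x powr p)"

text \<open>The ball fits into a unit cube.\<close>

lemma measure_ball_half_le: "measure lborel (ball (0::real^'n) (1/2)) \<le> 1"
proof -
  let ?a = "(\<chi> i. - (1/2)) :: real ^ 'n" and ?b = "(\<chi> i. 1/2) :: real ^ 'n"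
  have "ball (0::real^'n) (1/2) \<subseteq> cbox ?a ?b"
  proof
    fix x :: "real ^ 'n" assume "x \<in> ball 0 (1/2)"
    then have "- (1/2) \<le> x $ i \<and> x $ i \<le> 1/2" for i
      using component_le_norm_cart[of x i] by (simp add: dist_norm) linarith
    then show "x \<in> cbox ?a ?b" by (simp add: mem_box_cart)
  qed
  then have "measure lborel (ball (0::real^'n) (1/2)) \<le> measure lborel (cbox ?a ?b)"
    by (intro measure_mono_fmeasurable) auto
  also have "\<dots> = (\<Prod>b\<in>Basis. (?b - ?a) \<bullet> b)"
    by (rule measure_lborel_cbox) (auto simp: Basis_vec_def inner_axis)
  also have "\<dots> = 1"
    by (rule prod.neutral) (auto simp: Basis_vec_def inner_axis)
  finally show ?thesis .
qed

lemma measure_ball_pos: "r > 0 \<Longrightarrow> emeasure lborel (ball (0::real^'n) r) > 0"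
proof -
  assume "r > 0"
  then have ne: "ball (0::real^'n) r \<noteq> {}" by auto
  then have "\<not> negligible (ball (0::real^'n) r)" using open_not_negligible by blast
  then have "emeasure lborel (ball (0::real^'n) r) \<noteq> 0"
    by (simp add: negligible_iff_null_sets null_sets_def emeasure_completion)
  then show ?thesis by (simp add: zero_less_iff_neq_zero)
qed

context
  fixes f :: "real ^ 'n \<Rightarrow> real"
  assumes fm[measurable]: "f \<in> borel_measurable borel" and fpos: "\<And>x. f x > 0"
begin

lemma ballint_nonneg: "0 \<le> ballint f p r"
  unfolding ballint_def by (intro integral_nonneg_AE AE_I2) auto

lemma ballint_pos:
  assumes "ballfin f p r" "r > 0"
  shows "ballint f p r > 0"
proof -
  have "ballint f p r \<noteq> 0"
  proof
    assume "ballint f p r = 0"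
    then have "AE x in lborel. indicator (ball 0 r) x * f x powr p = 0"
      using assms(1) unfolding ballint_def ballfin_def by (subst (asm) integral_nonneg_eq_0_iff_AE) auto
    then have "AE x in lborel. x \<notin> ball (0::real^'n) r"
    proof eventually_elim
      case (elim x)
      moreover have "f x powr p > 0" using fpos[of x] by simp
      ultimately show ?case by (auto simp: indicator_def split: if_splits)
    qed
    then have "emeasure lborel (ball (0::real^'n) r) = 0"
      by (subst (asm) AE_iff_measurable[where N="ball 0 r"]) auto
    with measure_ball_pos[OF assms(2), where 'n='n] show False by simp
  qed
  with ballint_nonneg[of p r] show ?thesis by linarith
qed

lemma ballfin_subset: "ballfin f p R \<Longrightarrow> r \<le> R \<Longrightarrow> ballfin f p r"
  unfolding ballfin_def
  by (erule Bochner_Integration.integrable_bound) (auto simp: indicator_def intro!: AE_I2)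

lemma ballint_mono:
  assumes "ballfin f p R" "r \<le> R" shows "ballint f p r \<le> ballint f p R"
  using assms ballfin_subset[OF assms] unfolding ballint_def ballfin_def
  by (intro integral_mono) (auto simp: indicator_def)

text \<open>Hoelder for the two functions \<open>f powr q\<close> and 1 on the ball, indexed by a
  truth value; the volume factor is at most 1.\<close>

lemma ballint_Jensen:
  assumes p: "0 < p" "p \<le> q" and fin: "ballfin f q r" and r: "r \<le> 1/2"
  shows "ballfin f p r" "ballint f p r \<le> ballint f q r powr (p / q)"
proof -
  let ?B = "ball (0::real^'n) r"
  have V: "measure lborel ?B \<le> 1"
  proof -
    have "measure lborel ?B \<le> measure lborel (ball (0::real^'n) (1/2))"
      using r emeasure_lborel_ball_finite by (intro measure_mono_fmeasurable) (auto simp: fmeasurable_def)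
    with measure_ball_half_le[where 'n='n] show ?thesis by linarith
  qed
  have iB: "integrable lborel (indicator ?B :: _ \<Rightarrow> real)"
    using emeasure_lborel_ball_finite[of "0::real^'n" r] by simp
  have le: "f x powr p \<le> 1 + f x powr q" for x
  proof (cases "f x \<le> 1")
    case True
    then have "f x powr p \<le> 1" using p fpos[of x] by (intro powr_le1) auto
    then show ?thesis by (simp add: add_increasing2)
  next
    case False
    then have "f x powr p \<le> f x powr q" using p by (intro powr_mono) auto
    then show ?thesis by simp
  qed
  have "integrable lborel (\<lambda>x. indicator ?B x + indicator ?B x * f x powr q)"
    using fin iB unfolding ballfin_def by (intro Bochner_Integration.integrable_add) auto
  then show "ballfin f p r"
    unfolding ballfin_def
    by (rule Bochner_Integration.integrable_bound) (use le in \<open>auto simp: indicator_def intro!: AE_I2\<close>)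
  define e where "e b = (if b then p / q else 1 - p / q)" for b
  define g where "g b x = (if b then indicator ?B x * f x powr q else indicator ?B x)" for b x
  have q: "q > 0" using p by simp
  have "(LINT x|lborel. (\<Prod>b\<in>UNIV. pw (g b x) (e b))) \<le> (\<Prod>b\<in>UNIV. pw (LINT x|lborel. g b x) (e b))"
  proof (rule Holder_prod)
    show "integrable lborel (g b)" for b
      using fin iB by (cases b) (simp_all add: g_def[abs_def] ballfin_def)
  qed (use p q in \<open>auto simp: g_def e_def UNIV_bool\<close>)
  moreover have "(\<Prod>b\<in>UNIV. pw (g b x) (e b)) = indicator ?B x * f x powr p" for x
    using p q by (auto simp: UNIV_bool g_def e_def pw_def indicator_def powr_powr)
  moreover have "(\<Prod>b\<in>UNIV. pw (LINT x|lborel. g b x) (e b)) \<le> ballint f q r powr (p / q)"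
  proof -
    have "pw (measure lborel ?B) (1 - p / q) \<le> pw 1 (1 - p / q)"
      using V p q by (intro pw_mono) auto
    moreover have "pw 1 (1 - p / q) = 1" by (simp add: pw_def)
    ultimately have "pw (measure lborel ?B) (1 - p / q) \<le> 1" by linarith
    then have "ballint f q r powr (p / q) * pw (measure lborel ?B) (1 - p / q) \<le> ballint f q r powr (p / q)"
      by (simp add: mult_left_le)
    then show ?thesis using p q by (simp add: UNIV_bool g_def e_def ballint_def pw_def[of _ "p / q"] mult.commute)
  qed
  ultimately show "ballint f p r \<le> ballint f q r powr (p / q)" by (simp add: ballint_def)
qed

end

text \<open>The reverse Hoelder inequality supplied by the Sobolev and Caccioppoli inequalities; \<open>P\<close> bounds
  the admissible exponents.\<close>

definition revhoelder :: "(real ^ 'n \<Rightarrow> real) \<Rightarrow> real \<Rightarrow> real \<Rightarrow> real set \<Rightarrow> bool" where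
  "revhoelder f \<kappa> M P \<longleftrightarrow> (\<forall>\<alpha>\<in>P. \<forall>r R. 1/4 \<le> r \<longrightarrow> r < R \<longrightarrow> R \<le> 1/2 \<longrightarrow> ballfin f \<alpha> R \<longrightarrow>
     ballfin f (\<kappa> * \<alpha>) r \<and> ballint f (\<kappa> * \<alpha>) r powr (1 / \<kappa>) \<le> M * (1 + \<alpha>\<^sup>2) / (R - r)\<^sup>2 * ballint f \<alpha> R)"

text \<open>The infinite product of the step constants
  \<open>(b * L ^ j) powr ((1 / \<kappa>) ^ j)\<close> with
  \<open>b = 8 * M / \<delta>\<^sup>2\<close> and \<open>L = 4 * \<kappa>\<^sup>2\<close>, written
  as the exponential of two convergent series.\<close>

definition moser_const :: "real \<Rightarrow> real \<Rightarrow> real \<Rightarrow> real" where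
  "moser_const \<kappa> M \<delta> = exp ((\<Sum>j. (1 / \<kappa>) ^ j) * ln (8 * M / \<delta>\<^sup>2) + (\<Sum>j. real j * (1 / \<kappa>) ^ j) * ln (4 * \<kappa>\<^sup>2))"

lemma summable_geometric_moments:
  fixes \<kappa> :: real
  assumes "\<kappa> > 1"
  shows "summable (\<lambda>j. (1 / \<kappa>) ^ j)" "summable (\<lambda>j. real j * (1 / \<kappa>) ^ j)"
proof -
  have x: "0 < 1 / \<kappa>" "1 / \<kappa> < 1" using assms by auto
  show g: "summable (\<lambda>j. (1 / \<kappa>) ^ j)" using x by (intro summable_geometric) auto
  have "summable (\<lambda>n. diffs (\<lambda>_. 1) n * (1 / \<kappa>) ^ n)"
    by (rule termdiff_converges[of _ 1]) (use x in \<open>auto intro!: summable_geometric\<close>)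
  then have "summable (\<lambda>n. (1 + real n) * (1 / \<kappa>) ^ n)" by (simp add: diffs_def)
  then have "summable (\<lambda>n. (1 + real n) * (1 / \<kappa>) ^ n - (1 / \<kappa>) ^ n)"
    using g by (rule summable_diff)
  then show "summable (\<lambda>j. real j * (1 / \<kappa>) ^ j)" by (simp add: distrib_right)
qed

text \<open>Step \<open>k\<close> raises the exponent by the factor \<open>\<kappa>\<close> and
  halves the excess of the radius over \<open>r\<close>. Its constant grows like
  \<open>L ^ k\<close> but enters to the power \<open>(1 / \<kappa>) ^ k\<close>, so one constant
  serves every number \<open>K\<close> of steps.\<close>

lemma moser_iteration:
  fixes f :: "real ^ 'n \<Rightarrow> real"
  assumes fm[measurable]: "f \<in> borel_measurable borel" and fpos: "\<And>x. f x > 0"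
    and rh: "revhoelder f \<kappa> M P" and \<kappa>: "\<kappa> > 1" and M: "M \<ge> 1" and \<alpha>: "0 < \<alpha>" "\<alpha> \<le> 1"
    and P: "\<And>k. k < K \<Longrightarrow> \<alpha> * \<kappa> ^ k \<in> P" and r: "1/4 \<le> r" "r < R" "R \<le> 1/2" and fin: "ballfin f \<alpha> R"
  shows "ballfin f (\<alpha> * \<kappa> ^ K) r" "ballint f (\<alpha> * \<kappa> ^ K) r powr (1 / \<kappa> ^ K) \<le> moser_const \<kappa> M (R - r) * ballint f \<alpha> R"
proof -
  define \<rho> where "\<rho> k = r + (R - r) * (1/2) ^ k" for k :: nat
  define b where "b = 8 * M / (R - r)\<^sup>2"
  define L where "L = 4 * \<kappa>\<^sup>2"
  define s where "s k = (\<Sum>j<k. (1 / \<kappa>) ^ j * (ln b + real j * ln L))" for k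
  have b: "b \<ge> 1"
  proof -
    have "(R - r)\<^sup>2 \<le> 1\<^sup>2" using r by (intro power_mono) auto
    then have "(R - r)\<^sup>2 \<le> 8 * M" using M by simp
    then show ?thesis using r by (simp add: b_def)
  qed
  have L: "L \<ge> 1"
  proof -
    have "1\<^sup>2 \<le> \<kappa>\<^sup>2" using \<kappa> by (intro power_mono) auto
    then show ?thesis by (simp add: L_def)
  qed
  have \<rho>: "\<rho> 0 = R" "\<rho> (Suc k) < \<rho> k" "r < \<rho> k" "\<rho> k \<le> R" for k
  proof -
    show "\<rho> 0 = R" by (simp add: \<rho>_def)
    show "\<rho> (Suc k) < \<rho> k" using r by (simp add: \<rho>_def)
    show "r < \<rho> k" using r by (simp add: \<rho>_def)
    have "(1/2::real) ^ k \<le> 1" by (intro power_le_one) auto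
    then have "(R - r) * (1/2) ^ k \<le> (R - r) * 1" using r by (intro mult_left_mono) auto
    then show "\<rho> k \<le> R" by (simp add: \<rho>_def)
  qed
  \<comment> \<open>The radius gap is \<open>(R - r) / 2 ^ (k + 1)\<close>, whose inverse square
    contributes 4 and \<open>4 ^ k\<close>; \<open>1 + (\<alpha> * \<kappa> ^ k)\<^sup>2\<close>
    contributes 2 and \<open>(\<kappa>\<^sup>2) ^ k\<close> since \<open>\<alpha> \<le> 1\<close>.
    This explains \<open>b\<close> and \<open>L\<close>.\<close>
  have ck: "M * (1 + (\<alpha> * \<kappa> ^ k)\<^sup>2) / (\<rho> k - \<rho> (Suc k))\<^sup>2 \<le> b * L ^ k" for k
  proof -
    have "\<rho> k - \<rho> (Suc k) = (R - r) / (2 * 2 ^ k)" by (simp add: \<rho>_def power_one_over field_simps)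
    moreover have "((2::real) ^ k)\<^sup>2 = 4 ^ k" by (simp add: power2_eq_square flip: power_mult_distrib)
    ultimately have e1: "(\<rho> k - \<rho> (Suc k))\<^sup>2 = (R - r)\<^sup>2 / (4 * 4 ^ k)"
      by (simp add: power_divide power_mult_distrib)
    have e2: "1 + (\<alpha> * \<kappa> ^ k)\<^sup>2 \<le> 2 * (\<kappa>\<^sup>2) ^ k"
    proof -
      have "(\<alpha> * \<kappa> ^ k)\<^sup>2 \<le> (1 * \<kappa> ^ k)\<^sup>2" using \<alpha> \<kappa> by (intro power_mono mult_right_mono) auto
      moreover have "1 \<le> (\<kappa> ^ k)\<^sup>2" using \<kappa> by (intro one_le_power) auto
      ultimately show ?thesis by (simp add: power_mult[symmetric] mult.commute)
    qed
    have "M * (1 + (\<alpha> * \<kappa> ^ k)\<^sup>2) / (\<rho> k - \<rho> (Suc k))\<^sup>2 \<le> M * (2 * (\<kappa>\<^sup>2) ^ k) / ((R - r)\<^sup>2 / (4 * 4 ^ k))"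
      unfolding e1 using M e2 by (intro divide_right_mono mult_left_mono) auto
    also have "\<dots> = b * L ^ k" by (simp add: b_def L_def power_mult_distrib)
    finally show ?thesis .
  qed
  have main: "k \<le> K \<Longrightarrow> ballfin f (\<alpha> * \<kappa> ^ k) (\<rho> k) \<and>
      ballint f (\<alpha> * \<kappa> ^ k) (\<rho> k) powr (1 / \<kappa> ^ k) \<le> exp (s k) * ballint f \<alpha> R" for k
  proof (induction k)
    case 0
    show ?case using fin ballint_pos[OF fm fpos fin] r by (simp add: \<rho>(1) s_def)
  next
    case (Suc k)
    let ?p = "\<alpha> * \<kappa> ^ k"
    have IH: "ballfin f ?p (\<rho> k)" "ballint f ?p (\<rho> k) powr (1 / \<kappa> ^ k) \<le> exp (s k) * ballint f \<alpha> R"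
      using Suc by auto
    have inP: "?p \<in> P" using Suc.prems by (intro P) simp
    have st: "ballfin f (\<kappa> * ?p) (\<rho> (Suc k))"
      "ballint f (\<kappa> * ?p) (\<rho> (Suc k)) powr (1 / \<kappa>) \<le> M * (1 + ?p\<^sup>2) / (\<rho> k - \<rho> (Suc k))\<^sup>2 * ballint f ?p (\<rho> k)"
      using rh inP IH(1) \<rho>(2)[of k] \<rho>(3)[of "Suc k"] \<rho>(4)[of k] r unfolding revhoelder_def by auto
    have "ballint f (\<kappa> * ?p) (\<rho> (Suc k)) powr (1 / \<kappa>) \<le> (b * L ^ k) * ballint f ?p (\<rho> k)"
      using st(2) ck[of k] ballint_nonneg[OF fm fpos, of ?p "\<rho> k"] by (meson mult_right_mono order_trans)
    then have "(ballint f (\<kappa> * ?p) (\<rho> (Suc k)) powr (1 / \<kappa>)) powr (1 / \<kappa> ^ k) \<le> ((b * L ^ k) * ballint f ?p (\<rho> k)) powr (1 / \<kappa> ^ k)"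
      using \<kappa> by (intro powr_mono2) auto
    also have "\<dots> = (b * L ^ k) powr (1 / \<kappa> ^ k) * ballint f ?p (\<rho> k) powr (1 / \<kappa> ^ k)"
      using b L ballint_nonneg[OF fm fpos] by (intro powr_mult)
    also have "\<dots> \<le> (b * L ^ k) powr (1 / \<kappa> ^ k) * (exp (s k) * ballint f \<alpha> R)"
      using IH(2) by (intro mult_left_mono) auto
    also have "(b * L ^ k) powr (1 / \<kappa> ^ k) = exp ((1 / \<kappa>) ^ k * (ln b + real k * ln L))"
      using b L by (simp add: powr_def ln_mult ln_realpow power_one_over)
    also have "\<dots> * (exp (s k) * ballint f \<alpha> R) = exp (s (Suc k)) * ballint f \<alpha> R"
      by (simp add: s_def exp_add)
    finally have "ballint f (\<kappa> * ?p) (\<rho> (Suc k)) powr (1 / \<kappa> * (1 / \<kappa> ^ k)) \<le> exp (s (Suc k)) * ballint f \<alpha> R"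
      by (simp only: powr_powr)
    then show ?case using st(1) by (simp add: mult.left_commute mult.commute)
  qed
  have x: "0 < 1 / \<kappa>" using \<kappa> by auto
  note su = summable_geometric_moments[OF \<kappa>]
  have sK: "exp (s K) \<le> moser_const \<kappa> M (R - r)"
  proof -
    have "s K = (\<Sum>j<K. (1 / \<kappa>) ^ j) * ln b + (\<Sum>j<K. real j * (1 / \<kappa>) ^ j) * ln L"
      unfolding s_def distrib_left sum.distrib sum_distrib_right by (simp add: mult_ac)
    also have "\<dots> \<le> (\<Sum>j. (1 / \<kappa>) ^ j) * ln b + (\<Sum>j. real j * (1 / \<kappa>) ^ j) * ln L"
      using b L x su by (intro add_mono mult_right_mono sum_le_suminf) auto
    finally show ?thesis by (simp add: moser_const_def b_def L_def)
  qed
  have mK: "ballfin f (\<alpha> * \<kappa> ^ K) (\<rho> K)" "ballint f (\<alpha> * \<kappa> ^ K) (\<rho> K) powr (1 / \<kappa> ^ K) \<le> exp (s K) * ballint f \<alpha> R"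
    using main[of K] by auto
  show "ballfin f (\<alpha> * \<kappa> ^ K) r" using mK(1) \<rho>(3)[of K] by (intro ballfin_subset[OF fm fpos mK(1)]) auto
  have "ballint f (\<alpha> * \<kappa> ^ K) r powr (1 / \<kappa> ^ K) \<le> ballint f (\<alpha> * \<kappa> ^ K) (\<rho> K) powr (1 / \<kappa> ^ K)"
    using \<kappa> \<rho>(3)[of K] ballint_mono[OF fm fpos mK(1), of r] ballint_nonneg[OF fm fpos] by (intro powr_mono2) auto
  also note mK(2)
  also have "exp (s K) * ballint f \<alpha> R \<le> moser_const \<kappa> M (R - r) * ballint f \<alpha> R"
    using sK ballint_nonneg[OF fm fpos] by (intro mult_right_mono) auto
  finally show "ballint f (\<alpha> * \<kappa> ^ K) r powr (1 / \<kappa> ^ K) \<le> moser_const \<kappa> M (R - r) * ballint f \<alpha> R" .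
qed

lemma moser_const_ge_1:
  assumes "\<kappa> > 1" "M \<ge> 1" "0 < \<delta>" "\<delta> \<le> 1"
  shows "moser_const \<kappa> M \<delta> \<ge> 1"
proof -
  have "\<delta>\<^sup>2 \<le> 1\<^sup>2" using assms by (intro power_mono) auto
  then have "8 * M / \<delta>\<^sup>2 \<ge> 1" using assms by simp
  moreover have "4 * \<kappa>\<^sup>2 \<ge> 1"
  proof -
    have "1\<^sup>2 \<le> \<kappa>\<^sup>2" using assms by (intro power_mono) auto
    then show ?thesis by simp
  qed
  ultimately show ?thesis unfolding moser_const_def using assms
      summable_geometric_moments[OF assms(1)]
    by (auto intro!: add_nonneg_nonneg mult_nonneg_nonneg suminf_nonneg)
qed

text \<open>The iteration stops at the first exponent that is at least 1. All exponents to which the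
  reverse Hoelder inequality is applied are then below 1, and Jensen brings the overshoot back to
  1.\<close>

lemma moser_small_to_one:
  fixes f :: "real ^ 'n \<Rightarrow> real"
  assumes fm[measurable]: "f \<in> borel_measurable borel" and fpos: "\<And>x. f x > 0"
    and rh: "revhoelder f \<kappa> M P" and P: "{0<..<1} \<subseteq> P" and \<kappa>: "\<kappa> > 1" and M: "M \<ge> 1"
    and \<alpha>: "0 < \<alpha>" "\<alpha> \<le> 1" and r: "1/4 \<le> r" "r < R" "R \<le> 1/2" and fin: "ballfin f \<alpha> R"
  shows "ballint f 1 r \<le> (moser_const \<kappa> M (R - r) * ballint f \<alpha> R) powr (1 / \<alpha>)"
proof -
  obtain N where N: "1 / \<alpha> < \<kappa> ^ N" using real_arch_pow[OF \<kappa>] by blast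
  define K where "K = (LEAST K. 1 \<le> \<alpha> * \<kappa> ^ K)"
  have "1 \<le> \<alpha> * \<kappa> ^ N" using N \<alpha> by (simp add: field_simps)
  then have K: "1 \<le> \<alpha> * \<kappa> ^ K" unfolding K_def by (rule LeastI)
  have Kl: "\<alpha> * \<kappa> ^ k < 1" if "k < K" for k using that not_less_Least[of k "\<lambda>K. 1 \<le> \<alpha> * \<kappa> ^ K"] unfolding K_def by auto
  have kp: "\<alpha> * \<kappa> ^ k \<in> P" if "k < K" for k using Kl[OF that] \<alpha> \<kappa> P by auto
  note m = moser_iteration[OF fm fpos rh \<kappa> M \<alpha> kp r fin]
  let ?q = "\<alpha> * \<kappa> ^ K"
  have "ballint f 1 r \<le> ballint f ?q r powr (1 / ?q)"
    by (rule ballint_Jensen(2)[OF fm fpos _ _ m(1)]) (use K r in auto)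
  also have "\<dots> = (ballint f ?q r powr (1 / \<kappa> ^ K)) powr (1 / \<alpha>)" by (simp add: powr_powr mult.commute)
  also have "\<dots> \<le> (moser_const \<kappa> M (R - r) * ballint f \<alpha> R) powr (1 / \<alpha>)"
    using m(2) \<alpha> by (intro powr_mono2) auto
  finally show ?thesis .
qed

text \<open>Bombieri--Giusti: the exponent \<open>\<alpha>\<close> balances the part of the integral where \<open>ln f\<close> is at most half
  of \<open>\<psi>\<close> against the part controlled by the \<open>L\<^sup>2\<close> bound for \<open>ln f\<close>.\<close>

lemma bombieri_giusti_step:
  fixes f :: "real ^ 'n \<Rightarrow> real"
  assumes fm[measurable]: "f \<in> borel_measurable borel" and fpos: "\<And>x. f x > 0"
    and rh: "revhoelder f \<kappa> M P" and P: "{0<..<1} \<subseteq> P" and \<kappa>: "\<kappa> > 1" and M: "M \<ge> 1"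
    and fin: "ballfin f 1 (1/2)" and C: "C \<ge> 4"
    and ln: "integrable lborel (\<lambda>x. indicator (ball 0 (1/2)) x * (ln (f x))\<^sup>2)"
      "(LINT x|lborel. indicator (ball 0 (1/2)) x * (ln (f x))\<^sup>2) \<le> C"
    and r: "1/4 \<le> r" "r < R" "R \<le> 1/2"
  shows "ln (ballint f 1 r) \<le> 3 / 4 * ln (ballint f 1 R) + 2 * sqrt C * (2 * moser_const \<kappa> M (R - r))\<^sup>2"
proof -
  define Q where "Q = moser_const \<kappa> M (R - r)"
  have Q: "Q \<ge> 1" unfolding Q_def using \<kappa> M r by (intro moser_const_ge_1) auto
  have finr: "ballfin f 1 R" "ballfin f 1 r" using fin r by (auto intro: ballfin_subset[OF fm fpos])
  define \<psi> where "\<psi> = ln (ballint f 1 R)"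
  have pos: "ballint f 1 R > 0" "ballint f 1 r > 0" using r finr by (auto intro!: ballint_pos[OF fm fpos])
  then have e\<psi>: "ballint f 1 R = exp \<psi>" by (simp add: \<psi>_def)
  have mono: "ln (ballint f 1 r) \<le> \<psi>"
    unfolding \<psi>_def using pos ballint_mono[OF fm fpos finr(1), of r] r by simp
  \<comment> \<open>With this \<open>c\<close> and the \<open>\<alpha>\<close> below, the two parts
    of the integral have the same bound \<open>\<psi> / c\<close>. The hypothesis
    \<open>C \<ge> 4\<close> makes \<open>c\<close> at least 4.\<close>
  define c where "c = 2 * sqrt C"
  have c: "c \<ge> 4"
  proof -
    have "sqrt 4 \<le> sqrt C" using C by (rule real_sqrt_le_mono)
    then show ?thesis by (simp add: c_def)
  qed
  have Q2: "(2 * Q)\<^sup>2 \<ge> 1" using Q by (intro one_le_power) auto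
  show ?thesis
  proof (cases "\<psi> \<le> c * (2 * Q)\<^sup>2")
    \<comment> \<open>A small \<open>\<psi>\<close> is absorbed by the additive term, and
      monotonicity in the radius suffices.\<close>
    case True
    have "0 \<le> c * (2 * Q)\<^sup>2" using c by simp
    then have "\<psi> \<le> 3 / 4 * \<psi> + c * (2 * Q)\<^sup>2" using True by linarith
    then show ?thesis using mono by (simp add: \<psi>_def c_def Q_def)
  next
    case False
    have "c * 1 \<le> c * (2 * Q)\<^sup>2" using c Q2 by (intro mult_left_mono) auto
    then have \<psi>c: "\<psi> > c" using False by linarith
    then have \<psi>: "\<psi> > c" "\<psi> > 0" using c by linarith+
    define l where "l = ln (\<psi> / c)"
    have l0: "l > 0" using \<psi> c by (simp add: l_def)
    have lQ: "2 * ln (2 * Q) < l"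
    proof -
      have "(2 * Q)\<^sup>2 < \<psi> / c" using False c by (simp add: field_simps)
      then have "ln ((2 * Q)\<^sup>2) < l" unfolding l_def using Q \<psi> c by (subst ln_less_cancel_iff) auto
      moreover have "ln ((2 * Q)\<^sup>2) = 2 * ln (2 * Q)" using Q by (subst ln_realpow) auto
      ultimately show ?thesis by linarith
    qed
    have l4: "l \<le> \<psi> / 4"
    proof -
      have "l \<le> \<psi> / c - 1" unfolding l_def using \<psi> c by (intro ln_le_minus_one) auto
      also have "\<psi> / c \<le> \<psi> / 4" using \<psi> c by (intro divide_left_mono) auto
      finally show ?thesis by simp
    qed
    \<comment> \<open>Chosen so that \<open>exp (\<alpha> * \<psi> / 2) = \<psi> / c\<close>. The
      bound \<open>l \<le> \<psi> / 4\<close> gives \<open>2 * \<alpha> \<le> 1\<close>, which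
      Jensen needs to estimate the exponent \<open>2 * \<alpha>\<close> by the exponent 1.\<close>
    define \<alpha> where "\<alpha> = 2 * l / \<psi>"
    have \<alpha>: "\<alpha> > 0" "2 * \<alpha> \<le> 1" "\<alpha> \<le> 1" using l0 l4 \<psi> by (auto simp: \<alpha>_def field_simps)
    have \<alpha>\<psi>: "exp (\<alpha> * \<psi> / 2) = \<psi> / c" using \<psi> c by (simp add: \<alpha>_def l_def)
    have fa: "ballfin f \<alpha> R" "ballfin f (2 * \<alpha>) R" "ballint f (2 * \<alpha>) R \<le> ballint f 1 R powr (2 * \<alpha>)"
      using ballint_Jensen[OF fm fpos _ _ finr(1), of \<alpha>] ballint_Jensen[OF fm fpos _ _ finr(1), of "2 * \<alpha>"] \<alpha> r by auto
    let ?B = "ball (0::real^'n) R"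
    have [measurable]: "?B \<in> sets borel" by simp
    let ?h = "\<lambda>x. indicator ?B x * \<bar>ln (f x)\<bar>" and ?g = "\<lambda>x. indicator ?B x * f x powr \<alpha>"
    have sqh: "(?h x)\<^sup>2 = indicator ?B x * (ln (f x))\<^sup>2" and sqg: "(?g x)\<^sup>2 = indicator ?B x * f x powr (2 * \<alpha>)" for x
      using fpos[of x] by (auto simp: indicator_def powr_power mult.commute less_imp_neq[symmetric])
    have lnR: "integrable lborel (\<lambda>x. indicator ?B x * (ln (f x))\<^sup>2)"
      using ln(1) by (rule Bochner_Integration.integrable_bound) (use r in \<open>auto simp: indicator_def intro!: AE_I2\<close>)
    have lnC: "(LINT x|lborel. indicator ?B x * (ln (f x))\<^sup>2) \<le> C"
      using ln lnR r by (intro order_trans[OF integral_mono ln(2)]) (auto simp: indicator_def)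
    have ig: "integrable lborel (\<lambda>x. (?g x)\<^sup>2)" unfolding sqg using fa(2) by (simp add: ballfin_def)
    have ih: "integrable lborel (\<lambda>x. (?h x)\<^sup>2)" unfolding sqh by (rule lnR)
    note CS = Cauchy_Schwarz_integral[OF _ _ ig ih]
    have igh: "integrable lborel (\<lambda>x. ?g x * ?h x)" by (rule CS(1)) measurable
    have "(LINT x|lborel. ?g x * ?h x)\<^sup>2 \<le> (LINT x|lborel. (?g x)\<^sup>2) * (LINT x|lborel. (?h x)\<^sup>2)"
      by (rule CS(2)) measurable
    also have "\<dots> \<le> ballint f 1 R powr (2 * \<alpha>) * C"
      unfolding sqg sqh using fa(3) lnC by (intro mult_mono) (auto simp: ballint_def)
    also have "\<dots> = (exp (\<alpha> * \<psi>) * sqrt C)\<^sup>2"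
    proof -
      have "exp \<psi> powr (2 * \<alpha>) = exp (2 * (\<alpha> * \<psi>))" by (simp add: powr_def mult.assoc)
      also have "\<dots> = (exp (\<alpha> * \<psi>))\<^sup>2" by (rule exp_double)
      finally show ?thesis using C by (simp add: e\<psi> power_mult_distrib)
    qed
    finally have gh: "(LINT x|lborel. ?g x * ?h x) \<le> exp (\<alpha> * \<psi>) * sqrt C"
      by (rule power2_le_imp_le) (use C in simp)
    have iB: "integrable lborel (indicator ?B :: _ \<Rightarrow> real)"
      using emeasure_lborel_ball_finite[of "0::real^'n" R] by simp
    have pt: "?g x \<le> exp (\<alpha> * \<psi> / 2) * indicator ?B x + 2 / \<psi> * (?g x * ?h x)" for x
    proof (cases "x \<in> ?B")
      case True
      show ?thesis
      proof (cases "ln (f x) \<le> \<psi> / 2")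
        case True
        then have "\<alpha> * ln (f x) \<le> \<alpha> * \<psi> / 2" using \<alpha> by (simp add: mult_left_mono)
        then have "f x powr \<alpha> \<le> exp (\<alpha> * \<psi> / 2)" using fpos[of x] by (simp add: powr_def)
        then show ?thesis using \<open>x \<in> ?B\<close> \<psi> by (simp add: add_increasing2)
      next
        case False
        then have "1 \<le> 2 / \<psi> * \<bar>ln (f x)\<bar>" using \<psi> by (simp add: field_simps)
        then have "f x powr \<alpha> * 1 \<le> f x powr \<alpha> * (2 / \<psi> * \<bar>ln (f x)\<bar>)" by (intro mult_left_mono) auto
        then show ?thesis using \<open>x \<in> ?B\<close> by (simp add: add_increasing mult_ac)
      qed
    qed simp
    have "ballint f \<alpha> R \<le> (LINT x|lborel. exp (\<alpha> * \<psi> / 2) * indicator ?B x + 2 / \<psi> * (?g x * ?h x))"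
      unfolding ballint_def using fa(1) iB igh pt unfolding ballfin_def
      by (intro integral_mono Bochner_Integration.integrable_add integrable_mult_right) auto
    also have "\<dots> = exp (\<alpha> * \<psi> / 2) * measure lborel ?B + 2 / \<psi> * (LINT x|lborel. ?g x * ?h x)"
      using iB igh by (subst Bochner_Integration.integral_add) auto
    also have "\<dots> \<le> exp (\<alpha> * \<psi> / 2) * 1 + 2 / \<psi> * (exp (\<alpha> * \<psi>) * sqrt C)"
    proof -
      have "measure lborel ?B \<le> measure lborel (ball (0::real^'n) (1/2))"
        using r emeasure_lborel_ball_finite by (intro measure_mono_fmeasurable) (auto simp: fmeasurable_def)
      then have "measure lborel ?B \<le> 1" using measure_ball_half_le[where 'n='n] by linarith
      then show ?thesis using gh \<psi> by (intro add_mono mult_left_mono) auto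
    qed
    also have "2 / \<psi> * (exp (\<alpha> * \<psi>) * sqrt C) = exp (\<alpha> * \<psi> / 2)"
    proof -
      have "exp (\<alpha> * \<psi>) = exp (\<alpha> * \<psi> / 2) * exp (\<alpha> * \<psi> / 2)" by (simp flip: exp_add)
      then show ?thesis using \<psi> c by (simp add: \<alpha>\<psi> c_def field_simps)
    qed
    finally have Ia: "ballint f \<alpha> R \<le> 2 * exp (\<alpha> * \<psi> / 2)" by simp
    have "ballint f 1 r \<le> (Q * ballint f \<alpha> R) powr (1 / \<alpha>)"
      unfolding Q_def by (rule moser_small_to_one[OF fm fpos rh P \<kappa> M \<alpha>(1,3) r fa(1)])
    also have "\<dots> \<le> (Q * (2 * exp (\<alpha> * \<psi> / 2))) powr (1 / \<alpha>)"
      using Ia Q \<alpha> ballint_nonneg[OF fm fpos] by (intro powr_mono2 mult_left_mono mult_nonneg_nonneg) auto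
    finally have "ln (ballint f 1 r) \<le> ln ((Q * (2 * exp (\<alpha> * \<psi> / 2))) powr (1 / \<alpha>))"
      using pos Q by (subst ln_le_cancel_iff) auto
    also have "\<dots> = (1 / \<alpha>) * (ln (2 * Q) + \<alpha> * \<psi> / 2)"
    proof -
      have "ln (Q * (2 * exp (\<alpha> * \<psi> / 2))) = ln (2 * Q) + \<alpha> * \<psi> / 2"
        using Q by (simp add: ln_mult)
      then show ?thesis using Q by (simp add: ln_powr)
    qed
    \<comment> \<open>Half of \<open>\<psi>\<close> comes from the exponential and, since
      \<open>2 * ln (2 * Q) < l\<close>, at most a quarter from the Moser constant: together the
      factor 3/4.\<close>
    also have "\<dots> = \<psi> * (ln (2 * Q) / (2 * l)) + \<psi> / 2"
      using \<alpha> l0 \<psi> by (simp add: \<alpha>_def field_simps)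
    also have "\<psi> * (ln (2 * Q) / (2 * l)) \<le> \<psi> * (1 / 4)"
      using lQ l0 \<psi> by (intro mult_left_mono) (auto simp: field_simps)
    finally have "ln (ballint f 1 r) \<le> 3 / 4 * \<psi>" by simp
    moreover have "0 \<le> c * (2 * Q)\<^sup>2" using c by simp
    ultimately show ?thesis by (simp add: \<psi>_def c_def Q_def)
  qed
qed

text \<open>Iterating along radii that tend to \<open>b\<close> multiplies the unknown term by
  \<open>\<theta>\<close> each time. The a priori bound \<open>W\<close> only has to be finite: its
  coefficient tends to 0 and it is absent from the conclusion.\<close>

lemma absorption_iteration:
  fixes \<psi> :: "real \<Rightarrow> real"
  assumes \<theta>: "0 < \<theta>" "\<theta> < \<tau>" "\<tau> < 1" and m: "m > 0" and A: "A \<ge> 0" and ab: "a < b"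
    and step: "\<And>r R. a \<le> r \<Longrightarrow> r < R \<Longrightarrow> R \<le> b \<Longrightarrow> \<psi> r \<le> \<theta> * \<psi> R + A * (R - r) powr (- m)"
    and bd: "\<And>r. a \<le> r \<Longrightarrow> r \<le> b \<Longrightarrow> \<psi> r \<le> W"
  shows "\<psi> a \<le> A * ((b - a) * (1 - \<tau> powr (1 / m))) powr (- m) / (1 - \<theta> / \<tau>)"
proof -
  \<comment> \<open>The gaps shrink by the ratio \<open>t\<close>, so the singular factor grows by
    \<open>t powr (- m) = 1 / \<tau>\<close> per step; the errors thus form a geometric series with
    ratio \<open>\<theta> / \<tau> < 1\<close>.\<close>
  define t where "t = \<tau> powr (1 / m)"
  have t: "0 < t" "t < 1" using \<theta> m powr_less_mono2[of "1 / m" \<tau> 1] by (auto simp: t_def)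
  have tm: "t powr (- m) = 1 / \<tau>" using \<theta> m by (simp add: t_def powr_powr powr_minus_divide)
  define \<rho> where "\<rho> k = b - (b - a) * t ^ k" for k :: nat
  define A' where "A' = A * ((b - a) * (1 - t)) powr (- m)"
  have A': "A' \<ge> 0" using A by (simp add: A'_def)
  have \<rho>: "\<rho> 0 = a" "\<rho> k < \<rho> (Suc k)" "a \<le> \<rho> k" "\<rho> k \<le> b" for k
  proof -
    have p: "0 < t ^ k" "t ^ k \<le> 1" using t by (auto intro: power_le_one)
    show "\<rho> 0 = a" by (simp add: \<rho>_def)
    have "(b - a) * t ^ Suc k < (b - a) * t ^ k" using p t ab by (intro mult_strict_left_mono) auto
    then show "\<rho> k < \<rho> (Suc k)" by (simp add: \<rho>_def)
    have "(b - a) * t ^ k \<le> (b - a) * 1" using p ab by (intro mult_left_mono) auto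
    then show "a \<le> \<rho> k" by (simp add: \<rho>_def)
    show "\<rho> k \<le> b" using p ab by (simp add: \<rho>_def)
  qed
  have st: "\<psi> (\<rho> k) \<le> \<theta> * \<psi> (\<rho> (Suc k)) + A' * (1 / \<tau>) ^ k" for k
  proof -
    have "\<rho> (Suc k) - \<rho> k = ((b - a) * (1 - t)) * t ^ k" by (simp add: \<rho>_def algebra_simps)
    then have "(\<rho> (Suc k) - \<rho> k) powr (- m) = ((b - a) * (1 - t)) powr (- m) * (t powr (- m)) ^ k"
      using ab t by (simp add: powr_mult powr_power powr_realpow[symmetric] powr_powr mult_ac)
    then show ?thesis using step[OF \<rho>(3)[of k] \<rho>(2)[of k] \<rho>(4)[of "Suc k"]] by (simp add: A'_def tm)
  qed
  have it: "\<psi> a \<le> \<theta> ^ K * \<psi> (\<rho> K) + A' * (\<Sum>k<K. (\<theta> / \<tau>) ^ k)" for K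
  proof (induction K)
    case 0
    show ?case by (simp add: \<rho>(1))
  next
    case (Suc K)
    have "\<theta> ^ K * \<psi> (\<rho> K) \<le> \<theta> ^ K * (\<theta> * \<psi> (\<rho> (Suc K)) + A' * (1 / \<tau>) ^ K)"
      using st[of K] \<theta> by (intro mult_left_mono) auto
    also have "\<dots> = \<theta> ^ Suc K * \<psi> (\<rho> (Suc K)) + A' * (\<theta> / \<tau>) ^ K"
      by (simp add: algebra_simps power_divide)
    finally show ?case using Suc by (simp add: algebra_simps)
  qed
  have q: "0 < \<theta> / \<tau>" "\<theta> / \<tau> < 1" using \<theta> by auto
  have up: "\<psi> a \<le> \<theta> ^ K * W + A' * (1 / (1 - \<theta> / \<tau>))" for K
  proof -
    have "(\<Sum>k<K. (\<theta> / \<tau>) ^ k) \<le> (\<Sum>k. (\<theta> / \<tau>) ^ k)"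
      using q by (intro sum_le_suminf summable_geometric) auto
    also have "\<dots> = 1 / (1 - \<theta> / \<tau>)" using q by (intro suminf_geometric) auto
    finally have "A' * (\<Sum>k<K. (\<theta> / \<tau>) ^ k) \<le> A' * (1 / (1 - \<theta> / \<tau>))" using A' by (rule mult_left_mono)
    moreover have "\<theta> ^ K * \<psi> (\<rho> K) \<le> \<theta> ^ K * W" using \<theta> bd[OF \<rho>(3,4)] by (intro mult_left_mono) auto
    ultimately show ?thesis using it[of K] by linarith
  qed
  have "(\<lambda>K. \<theta> ^ K * W + A' * (1 / (1 - \<theta> / \<tau>))) \<longlonglongrightarrow> 0 * W + A' * (1 / (1 - \<theta> / \<tau>))"
    using \<theta> by (intro tendsto_intros LIMSEQ_power_zero) auto
  then have "\<psi> a \<le> 0 * W + A' * (1 / (1 - \<theta> / \<tau>))"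
    by (rule LIMSEQ_le_const) (use up in auto)
  then show ?thesis by (simp add: A'_def t_def)
qed

text \<open>The first identity provides the power of the radius gap for the absorption argument, the
  second the power of \<open>M\<close> from which the dependence on \<open>1 - q\<close> is read
  off.\<close>

lemma moser_const_power:
  assumes "\<kappa> > 1" "M \<ge> 1" "\<delta> > 0"
  defines "S \<equiv> (\<Sum>j. (1 / \<kappa>) ^ j)"
  shows "moser_const \<kappa> M \<delta> = moser_const \<kappa> M 1 * \<delta> powr (- (2 * S))"
    "moser_const \<kappa> M \<delta> = M powr S * moser_const \<kappa> 1 \<delta>"
proof -
  define T where "T = (\<Sum>j. real j * (1 / \<kappa>) ^ j) * ln (4 * \<kappa>\<^sup>2)"
  have mc: "moser_const \<kappa> M' \<delta>' = exp (S * ln (8 * M' / \<delta>'\<^sup>2) + T)" for M' \<delta>'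
    by (simp add: moser_const_def S_def T_def)
  have l1: "ln (8 * M / \<delta>\<^sup>2) = ln (8 * M / 1\<^sup>2) + (- 2) * ln \<delta>" using assms by (simp add: ln_div ln_realpow)
  show "moser_const \<kappa> M \<delta> = moser_const \<kappa> M 1 * \<delta> powr (- (2 * S))"
    unfolding mc l1 using assms(3) by (simp add: powr_def algebra_simps flip: exp_add)
  have l2: "ln (8 * M / \<delta>\<^sup>2) = ln M + ln (8 * 1 / \<delta>\<^sup>2)" using assms by (simp add: ln_div ln_realpow ln_mult)
  show "moser_const \<kappa> M \<delta> = M powr S * moser_const \<kappa> 1 \<delta>"
    unfolding mc l2 using assms(2) by (simp add: powr_def algebra_simps flip: exp_add)
qed

text \<open>\<open>E\<close> is obtained before \<open>f\<close> and \<open>P\<close> are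
  introduced: apart from the space it depends on \<open>\<kappa>\<close>, \<open>M\<close> and
  \<open>C\<close> alone, in particular neither on \<open>\<Lambda>\<close> nor on the
  solution.\<close>

lemma bombieri_giusti:
  fixes \<kappa> M C :: real
  assumes \<kappa>: "\<kappa> > 1" and M: "M \<ge> 1" and C: "C \<ge> 4"
  obtains E where "E \<ge> 1"
    "\<And>(f :: real ^ 'n \<Rightarrow> real) P. f \<in> borel_measurable borel \<Longrightarrow> (\<And>x. f x > 0) \<Longrightarrow> revhoelder f \<kappa> M P \<Longrightarrow>
      {0<..<1} \<subseteq> P \<Longrightarrow> ballfin f 1 (1/2) \<Longrightarrow>
      integrable lborel (\<lambda>x. indicator (ball 0 (1/2)) x * (ln (f x))\<^sup>2) \<Longrightarrow>
      (LINT x|lborel. indicator (ball 0 (1/2)) x * (ln (f x))\<^sup>2) \<le> C \<Longrightarrow> ballint f 1 (3/8) \<le> E"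
proof -
  define S where "S = (\<Sum>j. (1 / \<kappa>) ^ j)"
  \<comment> \<open>\<open>moser_const\<close> carries the gap to the power \<open>- (2 * S)\<close>
    and enters \<open>bombieri_giusti_step\<close> squared.\<close>
  define m where "m = 4 * S"
  define A where "A = 2 * sqrt C * (2 * moser_const \<kappa> M 1)\<^sup>2"
  have "1 / (1 - 1 / \<kappa>) = S" unfolding S_def using \<kappa> by (intro suminf_geometric[symmetric]) auto
  moreover have "1 / (1 - 1 / \<kappa>) > 0" using \<kappa> by simp
  ultimately have m: "m > 0" by (simp add: m_def)
  have A: "A \<ge> 0" using C by (simp add: A_def)
  \<comment> \<open>Here 3/4 is the contraction factor of \<open>bombieri_giusti_step\<close>, and
    7/8 is a choice of \<open>\<tau>\<close> between it and 1.\<close>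
  define T where "T = A * ((1/2 - 3/8) * (1 - (7/8) powr (1 / m))) powr (- m) / (1 - (3/4) / (7/8))"
  show ?thesis
  proof (rule that[of "exp (max T 0)"])
    fix f :: "real ^ 'n \<Rightarrow> real" and P
    assume fm: "f \<in> borel_measurable borel" and fpos: "\<And>x. f x > 0" and rh: "revhoelder f \<kappa> M P"
      and P: "{0<..<1} \<subseteq> P" and fin: "ballfin f 1 (1/2)"
      and ln: "integrable lborel (\<lambda>x. indicator (ball 0 (1/2)) x * (ln (f x))\<^sup>2)"
      "(LINT x|lborel. indicator (ball 0 (1/2)) x * (ln (f x))\<^sup>2) \<le> C"
    have pos: "ballint f 1 r > 0" if "3/8 \<le> r" "r \<le> 1/2" for r
      using that fin by (intro ballint_pos[OF fm fpos] ballfin_subset[OF fm fpos fin]) auto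
    have "ln (ballint f 1 (3/8)) \<le> T"
      unfolding T_def
    proof (rule absorption_iteration[where W="ln (ballint f 1 (1/2))"])
      fix r R :: real assume r: "3/8 \<le> r" "r < R" "R \<le> 1/2"
      have "2 * sqrt C * (2 * moser_const \<kappa> M (R - r))\<^sup>2 = A * (R - r) powr (- m)"
      proof -
        have "((R - r) powr (- (2 * S)))\<^sup>2 = (R - r) powr (- m)"
          using r by (simp add: powr_power m_def)
        then show ?thesis
          unfolding A_def S_def using r by (subst moser_const_power(1)[OF \<kappa> M]) (auto simp: power_mult_distrib)
      qed
      then show "ln (ballint f 1 r) \<le> 3/4 * ln (ballint f 1 R) + A * (R - r) powr (- m)"
        using bombieri_giusti_step[OF fm fpos rh P \<kappa> M fin C ln, of r R] r by simp
    next
      fix r :: real assume r: "3/8 \<le> r" "r \<le> 1/2"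
      show "ln (ballint f 1 r) \<le> ln (ballint f 1 (1/2))"
        using pos[OF r] pos[of "1/2"] ballint_mono[OF fm fpos fin r(2)] by simp
    qed (use m A in auto)
    then have "exp (ln (ballint f 1 (3/8))) \<le> exp (max T 0)" by simp
    then show "ballint f 1 (3/8) \<le> exp (max T 0)" using pos[of "3/8"] by simp
  qed simp
qed

text \<open>The norms of order \<open>\<kappa> ^ K\<close> are bounded by \<open>T\<close> for every
  \<open>K\<close>. By Chebyshev the set where \<open>f\<close> exceeds \<open>T * a\<close> has
  measure at most \<open>(1 / a) powr (\<kappa> ^ K)\<close>, which tends to 0 for each
  \<open>a > 1\<close>.\<close>

lemma moser_sup_bound:
  fixes f :: "real ^ 'n \<Rightarrow> real"
  assumes fm[measurable]: "f \<in> borel_measurable borel" and fpos: "\<And>x. f x > 0"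
    and rh: "revhoelder f \<kappa> M {0<..}" and \<kappa>: "\<kappa> > 1" and M: "M \<ge> 1" and fin: "ballfin f 1 (3/8)"
    and E: "ballint f 1 (3/8) \<le> E"
  shows "AE x in lborel. x \<in> ball 0 (1/4) \<longrightarrow> f x \<le> moser_const \<kappa> M (1/8) * E"
proof -
  define T where "T = moser_const \<kappa> M (1/8) * E"
  have E0: "E > 0" using E ballint_pos[OF fm fpos fin] by simp
  have T0: "T > 0" unfolding T_def moser_const_def using E0 by simp
  have it: "ballfin f (\<kappa> ^ K) (1/4)" "ballint f (\<kappa> ^ K) (1/4) \<le> T powr (\<kappa> ^ K)" for K
  proof -
    have P: "1 * \<kappa> ^ k \<in> {0<..}" if "k < K" for k using \<kappa> by simp
    note mi = moser_iteration[OF fm fpos rh \<kappa> M _ _ P, of K "1/4" "3/8"]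
    show "ballfin f (\<kappa> ^ K) (1/4)" using mi(1) fin by simp
    have "ballint f (\<kappa> ^ K) (1/4) powr (1 / \<kappa> ^ K) \<le> moser_const \<kappa> M (1/8) * ballint f 1 (3/8)"
      using mi(2) fin by simp
    also have "\<dots> \<le> T" unfolding T_def using E by (intro mult_left_mono) (auto simp: moser_const_def)
    finally have "(ballint f (\<kappa> ^ K) (1/4) powr (1 / \<kappa> ^ K)) powr (\<kappa> ^ K) \<le> T powr (\<kappa> ^ K)"
      using \<kappa> by (intro powr_mono2) auto
    then show "ballint f (\<kappa> ^ K) (1/4) \<le> T powr (\<kappa> ^ K)"
      using \<kappa> ballint_nonneg[OF fm fpos] by (simp add: powr_powr)
  qed
  let ?B = "ball (0::real^'n) (1/4)"
  have small: "AE x in lborel. x \<in> ?B \<longrightarrow> f x \<le> T * (1 + 1 / real (Suc n))" for n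
  proof -
    define a where "a = 1 + 1 / real (Suc n)"
    have a: "a > 1" by (simp add: a_def)
    define S where "S = {x \<in> ?B. f x > T * a}"
    have [measurable]: "S \<in> sets borel" unfolding S_def by measurable
    have fS: "emeasure lborel S < \<infinity>"
    proof -
      have "emeasure lborel S \<le> emeasure lborel ?B" by (intro emeasure_mono) (auto simp: S_def)
      then show ?thesis using emeasure_lborel_ball_finite[of "0::real^'n" "1/4"] by (rule le_less_trans)
    qed
    have le: "measure lborel S \<le> (1 / a) powr (\<kappa> ^ K)" for K
    proof -
      have iS: "integrable lborel (indicator S :: _ \<Rightarrow> real)" using fS by simp
      have "(T * a) powr (\<kappa> ^ K) * measure lborel S = (LINT x|lborel. (T * a) powr (\<kappa> ^ K) * indicator S x)"
        by simp
      also have "\<dots> \<le> ballint f (\<kappa> ^ K) (1/4)"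
        unfolding ballint_def
      proof (rule integral_mono)
        show "integrable lborel (\<lambda>x. indicator ?B x * f x powr (\<kappa> ^ K))" using it(1) by (simp add: ballfin_def)
        show "(T * a) powr (\<kappa> ^ K) * indicator S x \<le> indicator ?B x * f x powr (\<kappa> ^ K)" for x
          using T0 a \<kappa> by (auto simp: S_def indicator_def intro!: powr_mono2)
      qed (use iS in simp)
      also have "\<dots> \<le> T powr (\<kappa> ^ K)" by (rule it(2))
      finally have "(T * a) powr (\<kappa> ^ K) * measure lborel S \<le> T powr (\<kappa> ^ K)" .
      then have "T powr (\<kappa> ^ K) * (a powr (\<kappa> ^ K) * measure lborel S) \<le> T powr (\<kappa> ^ K) * 1"
        using T0 a by (simp add: powr_mult mult.assoc)
      then have "a powr (\<kappa> ^ K) * measure lborel S \<le> 1" using T0 by simp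
      then show ?thesis using a by (simp add: powr_divide field_simps)
    qed
    have "(\<lambda>K. (1 / a) powr (\<kappa> ^ K)) \<longlonglongrightarrow> 0"
    proof -
      have "filterlim (\<lambda>K. \<kappa> ^ K) at_top sequentially"
        using \<kappa> by (intro filterlim_at_infinity_imp_filterlim_at_top[OF filterlim_realpow_sequentially_gt1]) auto
      then have "filterlim (\<lambda>K. ln (1 / a) * \<kappa> ^ K) at_bot sequentially"
        using a by (intro filterlim_tendsto_neg_mult_at_bot[OF tendsto_const]) (auto simp: ln_div)
      then have "(\<lambda>K. exp (ln (1 / a) * \<kappa> ^ K)) \<longlonglongrightarrow> 0"
        by (rule filterlim_compose[OF exp_at_bot])
      then show ?thesis using a by (simp add: powr_def mult.commute)
    qed
    then have "measure lborel S \<le> 0" by (rule LIMSEQ_le_const) (use le in auto)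
    then have "measure lborel S = 0" using measure_nonneg[of lborel S] by linarith
    then have "emeasure lborel S = 0" using fS by (simp add: emeasure_eq_ennreal_measure)
    then have "AE x in lborel. x \<notin> S" by (intro AE_not_in) (auto simp: null_sets_def)
    then show ?thesis by eventually_elim (auto simp: S_def a_def not_less)
  qed
  have "AE x in lborel. \<forall>n. x \<in> ?B \<longrightarrow> f x \<le> T * (1 + 1 / real (Suc n))"
    unfolding AE_all_countable using small by blast
  then show ?thesis
  proof eventually_elim
    case (elim x)
    show ?case
    proof
      assume x: "x \<in> ?B"
      have "(\<lambda>n. T * (1 + 1 / real (Suc n))) \<longlonglongrightarrow> T * (1 + 0)"
        using LIMSEQ_inverse_real_of_nat by (intro tendsto_intros) (simp add: inverse_eq_divide)
      then have "f x \<le> T * (1 + 0)" by (rule LIMSEQ_le_const) (use elim x in auto)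
      then show "f x \<le> moser_const \<kappa> M (1/8) * E" by (simp add: T_def)
    qed
  qed
qed

text \<open>The start \<open>\<alpha> = p / \<kappa> ^ K\<close> is chosen so that \<open>K\<close>
  steps hit \<open>p\<close> exactly; one more step, applied at the largest admissible exponent
  \<open>p\<close>, reaches \<open>\<kappa> * p\<close>. As \<open>K\<close> is minimal,
  \<open>\<alpha>\<close> lies between \<open>1 / \<kappa>\<close> and 1, so the final power
  \<open>1 / \<alpha>\<close> is at most \<open>\<kappa>\<close>.\<close>

lemma moser_target_exponent:
  fixes f :: "real ^ 'n \<Rightarrow> real"
  assumes fm[measurable]: "f \<in> borel_measurable borel" and fpos: "\<And>x. f x > 0"
    and rh: "revhoelder f \<kappa> M {0<..p}" and \<kappa>: "\<kappa> > 1" and M: "M \<ge> 1" and fin: "ballfin f 1 (3/8)"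
    and E: "ballint f 1 (3/8) \<le> E" "1 \<le> E" and p: "1 \<le> p"
  shows "ballfin f (\<kappa> * p) (1/4)" "ballint f (\<kappa> * p) (1/4) powr (1 / (\<kappa> * p)) \<le> (moser_const \<kappa> M (1/8) * E) powr \<kappa>"
proof -
  define K where "K = (LEAST K. p \<le> \<kappa> ^ K)"
  obtain N where "p < \<kappa> ^ N" using real_arch_pow[OF \<kappa>] by blast
  then have "p \<le> \<kappa> ^ N" by simp
  then have K: "p \<le> \<kappa> ^ K" unfolding K_def by (rule LeastI)
  define \<alpha> where "\<alpha> = p / \<kappa> ^ K"
  have \<alpha>: "0 < \<alpha>" "\<alpha> \<le> 1" using p K \<kappa> by (auto simp: \<alpha>_def field_simps)
  have \<alpha>\<kappa>: "1 / \<kappa> \<le> \<alpha>"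
  proof (cases K)
    case 0
    then show ?thesis using p \<kappa> mult_mono[of 1 \<kappa> 1 p] by (simp add: \<alpha>_def field_simps)
  next
    case (Suc k)
    then have "\<not> p \<le> \<kappa> ^ k" using not_less_Least[of k "\<lambda>K. p \<le> \<kappa> ^ K"] by (simp add: K_def)
    then show ?thesis using \<kappa> by (simp add: \<alpha>_def Suc field_simps)
  qed
  have pk: "\<alpha> * \<kappa> ^ K = p" using \<kappa> by (simp add: \<alpha>_def)
  have P: "\<alpha> * \<kappa> ^ k \<in> {0<..p}" if "k < Suc K" for k
  proof -
    have "\<kappa> ^ k \<le> \<kappa> ^ K" using that \<kappa> by (intro power_increasing) auto
    then have "\<alpha> * \<kappa> ^ k \<le> \<alpha> * \<kappa> ^ K" using \<alpha> by (intro mult_left_mono) auto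
    then show ?thesis using \<alpha> \<kappa> pk by simp
  qed
  have fa: "ballfin f \<alpha> (3/8)" "ballint f \<alpha> (3/8) \<le> ballint f 1 (3/8) powr \<alpha>"
    using ballint_Jensen[OF fm fpos \<alpha>(1,2) fin] by auto
  note mi = moser_iteration[OF fm fpos rh \<kappa> M \<alpha> P, of "Suc K" "1/4" "3/8"]
  have e: "\<alpha> * \<kappa> ^ Suc K = \<kappa> * p" using pk by (simp add: mult_ac)
  show "ballfin f (\<kappa> * p) (1/4)" using mi(1) fa(1) unfolding e by simp
  have ia: "ballint f \<alpha> (3/8) \<le> E"
  proof -
    have "ballint f 1 (3/8) powr \<alpha> \<le> E powr \<alpha>"
      using E \<alpha> ballint_nonneg[OF fm fpos] by (intro powr_mono2) auto
    also have "\<dots> \<le> E powr 1" using E \<alpha> by (intro powr_mono) auto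
    finally show ?thesis using fa(2) E by simp
  qed
  define Q where "Q = moser_const \<kappa> M (1/8) * E"
  have Q: "Q \<ge> 1"
  proof -
    have "moser_const \<kappa> M (1/8) \<ge> 1" using \<kappa> M by (intro moser_const_ge_1) auto
    then have "1 * 1 \<le> Q" unfolding Q_def using E by (intro mult_mono) auto
    then show ?thesis by simp
  qed
  have "ballint f (\<kappa> * p) (1/4) powr (1 / \<kappa> ^ Suc K) \<le> moser_const \<kappa> M (1/8) * ballint f \<alpha> (3/8)"
    using mi(2) fa(1) unfolding e by simp
  also have "\<dots> \<le> Q" unfolding Q_def using ia by (intro mult_left_mono) (auto simp: moser_const_def)
  finally have "(ballint f (\<kappa> * p) (1/4) powr (1 / \<kappa> ^ Suc K)) powr (1 / \<alpha>) \<le> Q powr (1 / \<alpha>)"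
    using \<alpha> by (intro powr_mono2) auto
  also have "(ballint f (\<kappa> * p) (1/4) powr (1 / \<kappa> ^ Suc K)) powr (1 / \<alpha>) = ballint f (\<kappa> * p) (1/4) powr (1 / (\<kappa> * p))"
    unfolding powr_powr e[symmetric] by (simp add: mult.commute)
  also have "Q powr (1 / \<alpha>) \<le> Q powr \<kappa>"
    using Q \<alpha> \<alpha>\<kappa> \<kappa> by (intro powr_mono) (auto simp: field_simps)
  finally show "ballint f (\<kappa> * p) (1/4) powr (1 / (\<kappa> * p)) \<le> (moser_const \<kappa> M (1/8) * E) powr \<kappa>"
    by (simp add: Q_def)
qed

section \<open>Caccioppoli estimates for supersolutions\<close>

text \<open>A continuously differentiable substitute for the positive part, sufficient for building
  cutoffs since the approximations are needed only to first order.\<close>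

definition possq :: "real \<Rightarrow> real" where "possq t = (max 0 t)\<^sup>2"

lemma possq_deriv: "(possq has_real_derivative 2 * max 0 t) (at t)"
proof -
  consider "t > 0" | "t < 0" | "t = 0" by linarith
  then show ?thesis
  proof cases
    case 1
    have "((\<lambda>t. t\<^sup>2) has_real_derivative 2 * max 0 t) (at t)"
      using 1 by (auto intro!: derivative_eq_intros)
    then show ?thesis
      by (rule has_field_derivative_transform_within_open[where S="{0<..}"]) (use 1 in \<open>auto simp: possq_def\<close>)
  next
    case 2
    have "((\<lambda>t. 0) has_real_derivative 2 * max 0 t) (at t)" using 2 by simp
    then show ?thesis
      by (rule has_field_derivative_transform_within_open[where S="{..<0}"]) (use 2 in \<open>auto simp: possq_def\<close>)
  next
    case 3
    have "((\<lambda>h::real. possq h / h) \<longlongrightarrow> 0) (at 0)"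
    proof (rule Lim_null_comparison)
      show "\<forall>\<^sub>F h in at 0. norm (possq h / h) \<le> \<bar>h\<bar>"
        by (rule always_eventually) (auto simp: possq_def max_def power2_eq_square)
      show "((\<lambda>h::real. \<bar>h\<bar>) \<longlongrightarrow> 0) (at 0)" by (auto intro!: tendsto_eq_intros)
    qed
    then show ?thesis using 3 by (simp add: DERIV_def possq_def)
  qed
qed

definition is_cutoff :: "real \<Rightarrow> real \<Rightarrow> (real ^ 'n \<Rightarrow> real) \<Rightarrow> (real ^ 'n \<Rightarrow> real ^ 'n) \<Rightarrow> bool" where
  "is_cutoff r R \<eta> H \<longleftrightarrow> (\<forall>x. (\<eta> has_derivative (\<lambda>h. H x \<bullet> h)) (at x)) \<and> continuous_on UNIV H \<and>
     (\<forall>x. 0 \<le> \<eta> x \<and> \<eta> x \<le> 1 \<and> norm (H x) \<le> 8 / (R - r)) \<and> (\<forall>x\<in>ball 0 r. \<eta> x = 1) \<and>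
     (\<forall>x. x \<notin> ball 0 R \<longrightarrow> \<eta> x = 0 \<and> H x = 0)"

lemma is_cutoffD:
  assumes "is_cutoff r R \<eta> H"
  shows "(\<eta> has_derivative (\<lambda>h. H x \<bullet> h)) (at x)" "continuous_on UNIV H"
    "0 \<le> \<eta> x" "\<eta> x \<le> 1" "norm (H x) \<le> 8 / (R - r)" "x \<in> ball 0 r \<Longrightarrow> \<eta> x = 1"
    "x \<notin> ball 0 R \<Longrightarrow> \<eta> x = 0" "x \<notin> ball 0 R \<Longrightarrow> H x = 0"
  using assms unfolding is_cutoff_def by auto

text \<open>The profile is a composition of \<open>possq\<close> with a function of the squared
  norm, hence differentiable at the origin as well. The slopes multiply to at most 4, and
  \<open>4 * (2 / w) * (R + r)\<close> is the \<open>8 / (R - r)\<close> of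
  \<open>is_cutoff\<close>.\<close>

lemma cutoff_exists:
  assumes r: "0 < r" "r < R"
  obtains \<eta> :: "real ^ 'n \<Rightarrow> real" and H where "is_cutoff r R \<eta> H"
proof -
  define w where "w = R\<^sup>2 - r\<^sup>2"
  have w: "w = (R - r) * (R + r)" "w > 0"
    using r by (auto simp: w_def power2_eq_square algebra_simps intro!: mult_strict_mono)
  \<comment> \<open>A quadratic coordinate that is 0 on the sphere of radius \<open>r\<close> and 1
    on the sphere of radius \<open>R\<close>.\<close>
  define s where "s x = (x \<bullet> x - r\<^sup>2) / w" for x :: "real ^ 'n"
  define \<eta> where "\<eta> x = possq (1 - possq (s x))" for x
  define H where "H x = (- (2 * max 0 (1 - possq (s x)) * (2 * max 0 (s x))) * (2 / w)) *\<^sub>R x" for x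
  have pn: "0 \<le> possq t" for t by (simp add: possq_def)
  have ds: "(s has_derivative (\<lambda>h. (2 / w) * (x \<bullet> h))) (at x)" for x
    unfolding s_def[abs_def] using w(2) by (auto intro!: derivative_eq_intros simp: inner_commute)
  have d1: "((\<lambda>x. 1 - possq (s x)) has_derivative (\<lambda>h. - ((2 / w) * (x \<bullet> h) * (2 * max 0 (s x))))) (at x)" for x
    using has_derivative_diff[OF has_derivative_const[of 1] DERIV_compose_FDERIV[OF possq_deriv ds]] by simp
  have d: "(\<eta> has_derivative (\<lambda>h. H x \<bullet> h)) (at x)" for x
    using DERIV_compose_FDERIV[OF possq_deriv d1, of x]
    unfolding \<eta>_def[abs_def] by (rule has_derivative_eq_rhs) (auto simp: H_def fun_eq_iff)
  have ps: "continuous_on UNIV possq"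
    using possq_deriv DERIV_isCont by (intro continuous_at_imp_continuous_on) blast
  have sc: "continuous_on UNIV s" unfolding s_def[abs_def] using w(2) by (intro continuous_intros) auto
  have cH: "continuous_on UNIV H"
    unfolding H_def[abs_def] by (intro continuous_intros sc continuous_on_compose2[OF ps sc]) auto
  have out: "s x \<ge> 1" if "x \<notin> ball 0 R" for x
  proof -
    have "R\<^sup>2 \<le> (norm x)\<^sup>2" using that r by (intro power_mono) auto
    then show ?thesis using w(2) by (simp add: s_def w_def power2_norm_eq_inner)
  qed
  have o2: "1 - possq (s x) \<le> 0" if "s x \<ge> 1" for x
    using one_le_power[of "s x" 2] that by (simp add: possq_def)
  have e0: "0 \<le> \<eta> x" for x by (simp add: \<eta>_def pn)
  have e1: "\<eta> x \<le> 1" for x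
  proof -
    have "max 0 (1 - possq (s x)) \<le> 1" using pn[of "s x"] by simp
    then show ?thesis unfolding \<eta>_def possq_def[of "1 - _"] by (intro power_le_one) auto
  qed
  have one: "\<eta> x = 1" if "x \<in> ball 0 r" for x
    proof -
      have "(norm x)\<^sup>2 \<le> r\<^sup>2" using that by (intro power_mono) auto
      then have "s x \<le> 0" using w(2) by (simp add: s_def power2_norm_eq_inner divide_le_0_iff)
      then show ?thesis by (simp add: \<eta>_def possq_def)
    qed
  have zero: "\<eta> x = 0" "H x = 0" if "x \<notin> ball 0 R" for x
      using o2[OF out[OF that]] by (auto simp: \<eta>_def H_def possq_def[of "1 - _"])
  have grad: "norm (H x) \<le> 8 / (R - r)" for x
    proof (cases "x \<in> ball 0 R")
      case False
      then have "H x = 0" using o2[OF out[OF False]] by (simp add: H_def)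
      then show ?thesis using r by simp
    next
      case True
      let ?c = "2 * max 0 (1 - possq (s x)) * (2 * max 0 (s x))"
      have c: "0 \<le> ?c" "?c \<le> 4"
      proof -
        show "0 \<le> ?c" by simp
        show "?c \<le> 4"
        proof (cases "s x \<ge> 1")
          case True
          then show ?thesis using o2[OF True] by simp
        next
          case False
          have "max 0 (1 - possq (s x)) * max 0 (s x) \<le> 1 * 1"
            using False pn[of "s x"] by (intro mult_mono) auto
          then show ?thesis by simp
        qed
      qed
      have "norm (H x) = ?c * (2 / w) * norm x" using c w(2) by (simp add: H_def abs_mult)
      also have "\<dots> \<le> 4 * (2 / w) * (R + r)"
        using c w(2) True r by (intro mult_mono mult_right_mono) auto
      also have "\<dots> = 8 / (R - r)"
      proof -
        have "R - r \<noteq> 0" "R + r \<noteq> 0" using r by auto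
        then show ?thesis unfolding w(1) by (simp add: divide_simps)
      qed
      finally show ?thesis .
    qed
  have "is_cutoff r R \<eta> H"
    unfolding is_cutoff_def using d cH e0 e1 one zero grad by blast
  then show ?thesis by (rule that)
qed

section \<open>Powers and logarithm of the shifted supersolution\<close>

lemma powr_has_derivative_pos:
  "0 < t \<Longrightarrow> ((\<lambda>t. t powr e) has_real_derivative e * t powr (e - 1)) (at t)" for t e :: real
  by (auto intro!: derivative_eq_intros)

lemma continuous_powr_pos: "0 < \<delta> \<Longrightarrow> continuous_on {\<delta>..} (\<lambda>t::real. c * t powr e)"
  by (intro continuous_intros) auto

text \<open>\<open>Y\<close> stands for the flux, that is, the coefficient matrix applied to the
  gradient \<open>G\<close> of \<open>u\<close>. The matrix itself has disappeared:
  \<open>ell\<close> records two pointwise bounds and \<open>sup\<close> the inequality for test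
  functions given with a Borel version of their gradient. The shift does not affect \<open>G\<close>
  and \<open>Y\<close>.\<close>

locale shifted_supersolution =
  fixes u :: "real ^ 'n \<Rightarrow> real" and G Y :: "real ^ 'n \<Rightarrow> real ^ 'n" and \<Lambda> \<delta> :: real
  assumes w: "wgrad (ball 0 1) u G" and u0: "\<And>x. u x \<ge> 0" and Ym[measurable]: "Y \<in> borel_measurable borel"
    and \<Lambda>: "\<Lambda> \<ge> 1" and \<delta>: "\<delta> > 0"
    and ell: "AE x in lborel. (norm (G x))\<^sup>2 \<le> G x \<bullet> Y x \<and> (norm (Y x))\<^sup>2 \<le> \<Lambda> * (G x \<bullet> Y x)"
    and sup: "\<And>\<phi> \<Phi>. \<phi> \<in> W12_0 (ball 0 1) \<Longrightarrow> (\<And>x. 0 \<le> \<phi> x) \<Longrightarrow> \<Phi> \<in> borel_measurable borel \<Longrightarrow>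
      (AE x in lborel. x \<in> ball 0 1 \<longrightarrow> weak_grad (ball 0 1) \<phi> x = \<Phi> x) \<Longrightarrow> 0 \<le> (LINT x|lborel. \<Phi> x \<bullet> Y x)"
begin

definition vs :: "real ^ 'n \<Rightarrow> real" where "vs x = u x + \<delta>"

lemma vs_ge: "vs x \<ge> \<delta>" "vs x > 0" using u0[of x] \<delta> by (auto simp: vs_def)

lemma meas [measurable]: "u \<in> borel_measurable borel" "G \<in> borel_measurable borel" "vs \<in> borel_measurable borel"
proof -
  show [measurable]: "u \<in> borel_measurable borel" "G \<in> borel_measurable borel"
    using w by (simp_all add: wgrad_def)
  show "vs \<in> borel_measurable borel" unfolding vs_def[abs_def] by measurable
qed

lemma G_sq_integrable: "integrable lborel (\<lambda>x. (norm (G x))\<^sup>2)"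
proof -
  have "nsq UNIV (\<lambda>x. norm (G x)) < \<infinity>" using w by (simp add: wgrad_def nsq_def)
  then show ?thesis using nsq_finite_iff_integrable[of "\<lambda>x. norm (G x)" UNIV] by simp
qed

text \<open>Cauchy--Schwarz in the second part of \<open>ell\<close>. This cruder bound serves
  integrability only; the estimates use \<open>ell\<close> directly, which is better by a factor of
  order \<open>sqrt \<Lambda>\<close>.\<close>

lemma Y_le: "AE x in lborel. norm (Y x) \<le> \<Lambda> * norm (G x)"
  using ell
proof eventually_elim
  case (elim x)
  have "(norm (Y x))\<^sup>2 \<le> \<Lambda> * (norm (G x) * norm (Y x))"
    using elim norm_cauchy_schwarz[of "G x" "Y x"] \<Lambda> by (meson mult_left_mono order_trans zero_le_one)
  then show ?case
    by (cases "Y x = 0") (use \<Lambda> in \<open>auto simp: power2_eq_square mult_le_cancel_right mult.assoc[symmetric]\<close>)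
qed

lemma GY_integrable: "integrable lborel (\<lambda>x. G x \<bullet> Y x)"
proof (rule Bochner_Integration.integrable_bound)
  show "integrable lborel (\<lambda>x. \<Lambda> * (norm (G x))\<^sup>2)" using G_sq_integrable by simp
  show "AE x in lborel. norm (G x \<bullet> Y x) \<le> norm (\<Lambda> * (norm (G x))\<^sup>2)"
    using Y_le
  proof eventually_elim
    case (elim x)
    have "\<bar>G x \<bullet> Y x\<bar> \<le> norm (G x) * norm (Y x)" by (rule Cauchy_Schwarz_ineq2)
    also have "\<dots> \<le> norm (G x) * (\<Lambda> * norm (G x))" using elim by (intro mult_left_mono) auto
    finally show ?case using \<Lambda> by (simp add: power2_eq_square mult_ac)
  qed
qed measurable

text \<open>For \<open>e < 1\<close> the derivative of the power is largest in modulus at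
  \<open>\<delta>\<close>, so it is bounded on \<open>{\<delta>..}\<close> as
  \<open>aprx_chain\<close> requires.\<close>

lemma aprx_powr:
  assumes "e < 1" "r < 1"
  obtains F D where "aprx (ball 0 r) UNIV (\<lambda>x. vs x powr e) (\<lambda>x. (e * vs x powr (e - 1)) *\<^sub>R G x) F D"
proof -
  obtain F D where "aprx (ball 0 r) {\<delta>..} (\<lambda>x. u x + \<delta>) G F D" using wgrad_aprx[OF w u0 assms(2)] by blast
  then have "aprx (ball 0 r) UNIV (\<lambda>x. (u x + \<delta>) powr e) (\<lambda>x. (e * (u x + \<delta>) powr (e - 1)) *\<^sub>R G x)
      (\<lambda>n x. F n x powr e) (\<lambda>n x. (e * F n x powr (e - 1)) *\<^sub>R D n x)"
  proof (rule aprx_chain)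
    show "emeasure lborel (ball (0::real^'n) r) < \<infinity>" by (rule emeasure_lborel_ball_finite)
    show "((\<lambda>t. t powr e) has_real_derivative e * t powr (e - 1)) (at t)" if "\<delta> \<le> t" for t
      using that \<delta> by (intro powr_has_derivative_pos) simp
    show "continuous_on {\<delta>..} (\<lambda>t. e * t powr (e - 1))" by (rule continuous_powr_pos[OF \<delta>])
    show "\<bar>e * t powr (e - 1)\<bar> \<le> \<bar>e\<bar> * \<delta> powr (e - 1)" if "\<delta> \<le> t" for t
      unfolding abs_mult using that \<delta> assms(1) by (intro mult_mono) (auto intro!: powr_mono2')
  qed measurable
  then show ?thesis using that by (simp add: vs_def)
qed

lemma aprx_ln:
  assumes "r < 1"
  obtains F D where "aprx (ball 0 r) UNIV (\<lambda>x. ln (vs x)) (\<lambda>x. (1 / vs x) *\<^sub>R G x) F D"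
proof -
  obtain F D where "aprx (ball 0 r) {\<delta>..} (\<lambda>x. u x + \<delta>) G F D" using wgrad_aprx[OF w u0 assms] by blast
  then have "aprx (ball 0 r) UNIV (\<lambda>x. ln (u x + \<delta>)) (\<lambda>x. (1 / (u x + \<delta>)) *\<^sub>R G x)
      (\<lambda>n x. ln (F n x)) (\<lambda>n x. (1 / F n x) *\<^sub>R D n x)"
  proof (rule aprx_chain)
    show "emeasure lborel (ball (0::real^'n) r) < \<infinity>" by (rule emeasure_lborel_ball_finite)
    show "(ln has_real_derivative 1 / t) (at t)" if "\<delta> \<le> t" for t
      using that \<delta> by (intro DERIV_ln_divide) simp
    show "continuous_on {\<delta>..} (\<lambda>t. 1 / t)" using \<delta> by (intro continuous_intros) auto
    show "\<bar>1 / t\<bar> \<le> 1 / \<delta>" if "\<delta> \<le> t" for t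
      using that \<delta> by (simp add: frac_le)
  qed measurable
  then show ?thesis using that by (simp add: vs_def)
qed

text \<open>For \<open>p \<le> 0\<close> the power is at most \<open>\<delta> powr p\<close>; for
  \<open>p\<close> between 0 and 1 it is dominated by 1 plus the square of \<open>vs\<close>. Square
  integrability of \<open>u\<close> is therefore enough.\<close>

lemma powr_ball_integrable:
  assumes "p < 1" and g: "g \<in> borel_measurable borel" and K: "\<And>x. \<bar>g x\<bar> \<le> K" and z: "\<And>x. x \<notin> ball 0 1 \<Longrightarrow> g x = 0"
  shows "integrable lborel (\<lambda>x. g x * vs x powr p)"
proof -
  note [measurable] = g
  have K0: "K \<ge> 0" using K[of 0] by linarith
  have iu: "integrable lborel (\<lambda>x. (u x)\<^sup>2)"
    using w nsq_finite_iff_integrable[of u UNIV] by (simp add: wgrad_def)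
  let ?B = "ball (0::real^'n) 1"
  have iB: "integrable lborel (indicator ?B :: _ \<Rightarrow> real)"
    using emeasure_lborel_ball_finite[of "0::real^'n" 1] by simp
  let ?c = "\<delta> powr p + 1 + 2 * \<delta>\<^sup>2"
  have le: "vs x powr p \<le> ?c + 2 * (u x)\<^sup>2" for x
  proof (cases "p \<le> 0")
    case True
    then have "vs x powr p \<le> \<delta> powr p" using vs_ge[of x] \<delta> by (intro powr_mono2') auto
    then show ?thesis by (simp add: add_increasing2)
  next
    case False
    have "vs x powr p \<le> 1 + (vs x)\<^sup>2"
    proof (cases "vs x \<le> 1")
      case True
      then have "vs x powr p \<le> 1" using False vs_ge[of x] by (intro powr_le1) auto
      then show ?thesis by (simp add: add_increasing2)
    next
      case f: False
      then have "vs x powr p \<le> vs x powr 2" using assms(1) by (intro powr_mono) auto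
      then show ?thesis using vs_ge[of x] by (simp add: powr_numeral)
    qed
    moreover have "(vs x)\<^sup>2 \<le> 2 * (u x)\<^sup>2 + 2 * \<delta>\<^sup>2"
      using norm_add_sq_le[of "u x" \<delta>] by (simp add: vs_def)
    ultimately show ?thesis using powr_ge_zero[of \<delta> p] by linarith
  qed
  have "integrable lborel (\<lambda>x. K * (?c * indicator ?B x + 2 * (u x)\<^sup>2))" using iu iB by auto
  then show ?thesis
  proof (rule Bochner_Integration.integrable_bound)
    show "AE x in lborel. norm (g x * vs x powr p) \<le> norm (K * (?c * indicator ?B x + 2 * (u x)\<^sup>2))"
    proof (rule AE_I2)
      fix x
      show "norm (g x * vs x powr p) \<le> norm (K * (?c * indicator ?B x + 2 * (u x)\<^sup>2))"
      proof (cases "x \<in> ?B")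
        case True
        have "\<bar>g x\<bar> * vs x powr p \<le> K * (?c + 2 * (u x)\<^sup>2)" using K le K0 by (intro mult_mono) auto
        then show ?thesis using True K0 by (simp add: abs_mult)
      qed (simp add: z)
    qed
  qed measurable
qed

lemma G_weighted_integrable:
  assumes g: "g \<in> borel_measurable borel" and K: "\<And>x. \<bar>g x\<bar> \<le> K" and p: "p \<le> 0"
  shows "integrable lborel (\<lambda>x. g x * vs x powr p * (norm (G x))\<^sup>2)"
    "integrable lborel (\<lambda>x. g x * vs x powr p * (G x \<bullet> Y x))"
proof -
  note [measurable] = g
  have K0: "K \<ge> 0" using K[of 0] by linarith
  have b: "\<bar>g x * vs x powr p\<bar> \<le> K * \<delta> powr p" for x
    unfolding abs_mult using K K0 vs_ge[of x] \<delta> p by (intro mult_mono) (auto intro!: powr_mono2')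
  show "integrable lborel (\<lambda>x. g x * vs x powr p * (norm (G x))\<^sup>2)"
  proof (rule Bochner_Integration.integrable_bound)
    show "integrable lborel (\<lambda>x. (K * \<delta> powr p) * (norm (G x))\<^sup>2)" using G_sq_integrable by simp
    show "AE x in lborel. norm (g x * vs x powr p * (norm (G x))\<^sup>2) \<le> norm ((K * \<delta> powr p) * (norm (G x))\<^sup>2)"
    proof (rule AE_I2)
      fix x
      have "\<bar>g x * vs x powr p\<bar> * (norm (G x))\<^sup>2 \<le> K * \<delta> powr p * (norm (G x))\<^sup>2"
        using b by (rule mult_right_mono) simp
      then show "norm (g x * vs x powr p * (norm (G x))\<^sup>2) \<le> norm ((K * \<delta> powr p) * (norm (G x))\<^sup>2)"
        using K0 by (simp add: abs_mult)
    qed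
  qed measurable
  show "integrable lborel (\<lambda>x. g x * vs x powr p * (G x \<bullet> Y x))"
  proof (rule Bochner_Integration.integrable_bound)
    show "integrable lborel (\<lambda>x. (K * \<delta> powr p) * (G x \<bullet> Y x))" using GY_integrable by simp
    show "AE x in lborel. norm (g x * vs x powr p * (G x \<bullet> Y x)) \<le> norm ((K * \<delta> powr p) * (G x \<bullet> Y x))"
    proof (rule AE_I2)
      fix x
      have "\<bar>g x * vs x powr p\<bar> * \<bar>G x \<bullet> Y x\<bar> \<le> K * \<delta> powr p * \<bar>G x \<bullet> Y x\<bar>"
        using b by (rule mult_right_mono) simp
      then show "norm (g x * vs x powr p * (G x \<bullet> Y x)) \<le> norm ((K * \<delta> powr p) * (G x \<bullet> Y x))"
        using K0 by (simp add: abs_mult)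
    qed
  qed measurable
qed

text \<open>Testing with \<open>\<eta>\<^sup>2 v\<^sup>p\<^sup>-\<^sup>1\<close>; all exponents \<open>p - 1\<close> are negative, so the test function is bounded.\<close>

lemma caccioppoli:
  fixes \<eta> :: "real ^ 'n \<Rightarrow> real"
  assumes p: "p < 1" and r: "0 < r" "r < 1"
    and \<eta>: "\<And>x. (\<eta> has_derivative (\<lambda>h. H x \<bullet> h)) (at x)" "continuous_on UNIV H"
    and b: "\<And>x. 0 \<le> \<eta> x" "\<And>x. \<eta> x \<le> 1" "\<And>x. norm (H x) \<le> K"
    and z: "\<And>x. x \<notin> ball 0 r \<Longrightarrow> \<eta> x = 0" "\<And>x. x \<notin> ball 0 r \<Longrightarrow> H x = 0"
  shows "(LINT x|lborel. (\<eta> x)\<^sup>2 * vs x powr (p - 2) * (norm (G x))\<^sup>2)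
    \<le> 4 * \<Lambda> / (1 - p)\<^sup>2 * (LINT x|lborel. (norm (H x))\<^sup>2 * vs x powr p)"
proof -
  have \<eta>c: "continuous_on UNIV \<eta>" by (rule has_gradient_continuous[OF \<eta>(1)])
  have [measurable]: "\<eta> \<in> borel_measurable borel" "H \<in> borel_measurable borel"
    using \<eta>c \<eta>(2) by (auto intro: borel_measurable_continuous_onI)
  have K0: "K \<ge> 0" using b(3)[of 0] norm_ge_zero[of "H 0"] by linarith
  obtain F D where a: "aprx (ball 0 r) UNIV (\<lambda>x. vs x powr (p - 1)) (\<lambda>x. ((p - 1) * vs x powr (p - 2)) *\<^sub>R G x) F D"
    using aprx_powr[of "p - 1" r] p r by auto
  have \<eta>2: "((\<lambda>x. (\<eta> x)\<^sup>2) has_derivative (\<lambda>h. ((2 * \<eta> x) *\<^sub>R H x) \<bullet> h)) (at x)" for x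
    using has_derivative_power[OF \<eta>(1), where n=2] by (simp add: mult_ac)
  define \<phi> where "\<phi> x = (\<eta> x)\<^sup>2 * vs x powr (p - 1)" for x
  define \<Phi> where "\<Phi> x = (\<eta> x)\<^sup>2 *\<^sub>R (((p - 1) * vs x powr (p - 2)) *\<^sub>R G x) + vs x powr (p - 1) *\<^sub>R ((2 * \<eta> x) *\<^sub>R H x)" for x
  have cut: "aprx UNIV UNIV \<phi> \<Phi> (\<lambda>n x. (\<eta> x)\<^sup>2 * F n x) (\<lambda>n x. (\<eta> x)\<^sup>2 *\<^sub>R D n x + F n x *\<^sub>R ((2 * \<eta> x) *\<^sub>R H x))"
    unfolding \<phi>_def[abs_def] \<Phi>_def[abs_def]
  \<comment> \<open>One bound for both the squared cutoff, at most 1, and its gradient, at most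
    \<open>2 * K\<close>.\<close>
  proof (rule aprx_cutoff[OF a \<eta>2, where K="1 + 2 * K"])
    show "continuous_on UNIV (\<lambda>x. (2 * \<eta> x) *\<^sub>R H x)" by (intro continuous_intros \<eta>c \<eta>(2))
    fix x
    have "(\<eta> x)\<^sup>2 \<le> 1" using b by (intro power_le_one) auto
    then show "\<bar>(\<eta> x)\<^sup>2\<bar> \<le> 1 + 2 * K" using K0 by simp
    have "2 * (\<bar>\<eta> x\<bar> * norm (H x)) \<le> 2 * (1 * K)" using b K0 by (intro mult_left_mono mult_mono) auto
    then show "norm ((2 * \<eta> x) *\<^sub>R H x) \<le> 1 + 2 * K" by (simp add: abs_mult)
  qed (use z in auto)
  have cutfin: "nsq UNIV (\<lambda>x. (\<eta> x)\<^sup>2 * F n x) < \<infinity>" "nsq UNIV (\<lambda>x. (\<eta> x)\<^sup>2 *\<^sub>R D n x + F n x *\<^sub>R ((2 * \<eta> x) *\<^sub>R H x)) < \<infinity>" for n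
  proof -
    have Fc: "continuous_on UNIV (F n)" "continuous_on UNIV (D n)"
      using a unfolding aprx_def by (auto intro: has_gradient_continuous)
    have zz: "\<eta> x = 0" "H x = 0" if "norm x > r" for x using that z by auto
    have "integrable lborel (\<lambda>x. ((\<eta> x)\<^sup>2 * F n x)\<^sup>2)"
      by (rule continuous_cs_integrable[of _ r]) (auto intro!: continuous_intros \<eta>c Fc simp: zz)
    then show "nsq UNIV (\<lambda>x. (\<eta> x)\<^sup>2 * F n x) < \<infinity>" by (simp add: nsq_def nn_integral_eq_integral)
    have "integrable lborel (\<lambda>x. (norm ((\<eta> x)\<^sup>2 *\<^sub>R D n x + F n x *\<^sub>R ((2 * \<eta> x) *\<^sub>R H x)))\<^sup>2)"
      by (rule continuous_cs_integrable[of _ r]) (auto intro!: continuous_intros \<eta>c \<eta>(2) Fc simp: zz)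
    then show "nsq UNIV (\<lambda>x. (\<eta> x)\<^sup>2 *\<^sub>R D n x + F n x *\<^sub>R ((2 * \<eta> x) *\<^sub>R H x)) < \<infinity>"
      by (simp add: nsq_def nn_integral_eq_integral)
  qed
  note [measurable] = aprx_measurable(2,3)[OF cut]
  have wid: "(LINT x|lborel. \<phi> x * partial_deriv i K x) = - (LINT x|lborel. \<Phi> x $ i * K x)" if "smooth_cs K" for K i
    by (rule aprx_weak_identity[OF cut that cutfin])
  have fin: "nsq UNIV \<phi> < \<infinity>" "nsq UNIV \<Phi> < \<infinity>" using cut by (auto simp: aprx_def)
  have zero: "\<phi> x = 0 \<and> \<Phi> x = 0" if "x \<notin> ball 0 r" for x using z[OF that] by (simp add: \<phi>_def \<Phi>_def)
  have W: "\<phi> \<in> W12_0 (ball 0 1)" "AE x in lborel. x \<in> ball 0 1 \<longrightarrow> weak_grad (ball 0 1) \<phi> x = \<Phi> x"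
    by (rule compact_support_W12_0[OF _ _ fin r zero wid]; measurable)+
  have "0 \<le> (LINT x|lborel. \<Phi> x \<bullet> Y x)" by (rule sup[OF W(1) _ _ W(2)]) (auto simp: \<phi>_def)
  define g1 where "g1 x = (\<eta> x)\<^sup>2 * vs x powr (p - 2) * (G x \<bullet> Y x)" for x
  \<comment> \<open>Measuring the energy by \<open>G x \<bullet> Y x\<close> instead of the squared
    norm of \<open>G\<close> is what makes the constant linear in \<open>\<Lambda>\<close>: the
    mixed term then costs only \<open>sqrt \<Lambda>\<close>, whereas \<open>Y_le\<close> would lead
    to the square of \<open>\<Lambda>\<close>.\<close>
  define A where "A x = \<eta> x * vs x powr (p / 2 - 1) * sqrt (G x \<bullet> Y x)" for x
  define B where "B x = norm (H x) * vs x powr (p / 2)" for x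
  have \<eta>1: "\<bar>(\<eta> x)\<^sup>2\<bar> \<le> 1" for x using b power_le_one[of "\<eta> x" 2] by auto
  have i1: "integrable lborel g1"
    unfolding g1_def by (rule G_weighted_integrable(2)[OF _ \<eta>1]) (use p in auto)
  have i0: "integrable lborel (\<lambda>x. (\<eta> x)\<^sup>2 * vs x powr (p - 2) * (norm (G x))\<^sup>2)"
    by (rule G_weighted_integrable(1)[OF _ \<eta>1]) (use p in auto)
  have i2: "integrable lborel (\<lambda>x. (norm (H x))\<^sup>2 * vs x powr p)"
  proof (rule powr_ball_integrable[OF p, where K="K\<^sup>2"])
    show "\<bar>(norm (H x))\<^sup>2\<bar> \<le> K\<^sup>2" for x using b(3)[of x] by (simp add: power_mono)
    show "(norm (H x))\<^sup>2 = 0" if "x \<notin> ball 0 1" for x using that r by (auto intro!: z)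
  qed measurable
  have GY0: "AE x in lborel. 0 \<le> G x \<bullet> Y x" using ell by eventually_elim (meson order_trans zero_le_power2)
  have B2: "(B x)\<^sup>2 = (norm (H x))\<^sup>2 * vs x powr p" for x
    using vs_ge[of x] by (simp add: B_def power_mult_distrib powr_power)
  have A2: "AE x in lborel. (A x)\<^sup>2 = g1 x"
    using GY0
  proof eventually_elim
    case (elim x)
    then show ?case using vs_ge[of x] by (simp add: A_def g1_def power_mult_distrib powr_power right_diff_distrib)
  qed
  have [measurable]: "A \<in> borel_measurable borel" "B \<in> borel_measurable borel" "g1 \<in> borel_measurable borel"
    unfolding A_def[abs_def] B_def[abs_def] g1_def[abs_def] by measurable
  have iA: "integrable lborel (\<lambda>x. (A x)\<^sup>2)" and LA: "(LINT x|lborel. (A x)\<^sup>2) = (LINT x|lborel. g1 x)"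
    using Bochner_Integration.integrable_cong_AE[OF _ _ A2] integral_cong_AE[OF _ _ A2] i1 by auto
  have iB: "integrable lborel (\<lambda>x. (B x)\<^sup>2)" unfolding B2 by (rule i2)
  note CS = Cauchy_Schwarz_integral[OF _ _ iA iB]
  have iAB: "integrable lborel (\<lambda>x. A x * B x)" by (rule CS(1)) measurable
  have CS2: "(LINT x|lborel. A x * B x)\<^sup>2 \<le> (LINT x|lborel. g1 x) * (LINT x|lborel. (norm (H x))\<^sup>2 * vs x powr p)"
    using CS(2) unfolding LA B2 by simp
  have iPhi: "integrable lborel (\<lambda>x. (p - 1) * g1 x + 2 * sqrt \<Lambda> * (A x * B x))"
    using i1 iAB by auto
  have "(LINT x|lborel. \<Phi> x \<bullet> Y x) \<le> (LINT x|lborel. (p - 1) * g1 x + 2 * sqrt \<Lambda> * (A x * B x))"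
  proof (rule integral_mono_AE)
    \<comment> \<open>Only finiteness matters here, so the crude bound on the flux is
      enough.\<close>
    have iY: "nsq UNIV Y < \<infinity>"
    proof -
      have "nsq UNIV Y \<le> (\<integral>\<^sup>+x. ennreal (\<Lambda>\<^sup>2) * ennreal ((norm (G x))\<^sup>2) \<partial>lborel)"
        unfolding nsq_def
      proof (rule nn_integral_mono_AE)
        show "AE x in lborel. ennreal ((norm (Y x))\<^sup>2) * indicator UNIV x \<le> ennreal (\<Lambda>\<^sup>2) * ennreal ((norm (G x))\<^sup>2)"
          using Y_le
        proof eventually_elim
          case (elim x)
          then have "(norm (Y x))\<^sup>2 \<le> (\<Lambda> * norm (G x))\<^sup>2" by (intro power_mono) auto
          then show ?case by (simp add: power_mult_distrib ennreal_leI flip: ennreal_mult)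
        qed
      qed
      also have "\<dots> = ennreal (\<Lambda>\<^sup>2) * nsq UNIV G" by (simp add: nsq_def nn_integral_cmult)
      also have "\<dots> < \<infinity>" using w by (simp add: wgrad_def ennreal_mult_less_top)
      finally show ?thesis .
    qed
    have "integrable lborel (\<lambda>x. \<Sum>i\<in>UNIV. \<Phi> x $ i * Y x $ i)"
    proof (intro Bochner_Integration.integrable_sum integrable_mult_L2)
      fix i
      show "nsq UNIV (\<lambda>x. \<Phi> x $ i) < \<infinity>" "nsq UNIV (\<lambda>x. Y x $ i) < \<infinity>"
        using fin(2) iY nsq_finite_nth[of \<Phi> UNIV] nsq_finite_nth[of Y UNIV] by auto
    qed measurable
    then show "integrable lborel (\<lambda>x. \<Phi> x \<bullet> Y x)" by (simp add: inner_vec_def)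
    show "integrable lborel (\<lambda>x. (p - 1) * g1 x + 2 * sqrt \<Lambda> * (A x * B x))" by (rule iPhi)
    show "AE x in lborel. \<Phi> x \<bullet> Y x \<le> (p - 1) * g1 x + 2 * sqrt \<Lambda> * (A x * B x)"
      using ell
    proof eventually_elim
      case (elim x)
      have "(norm (Y x))\<^sup>2 \<le> (sqrt \<Lambda> * sqrt (G x \<bullet> Y x))\<^sup>2"
        using elim \<Lambda> order_trans[OF zero_le_power2 conjunct1[OF elim]] by (simp add: power_mult_distrib)
      moreover have "0 \<le> sqrt \<Lambda> * sqrt (G x \<bullet> Y x)"
        using \<Lambda> order_trans[OF zero_le_power2 conjunct1[OF elim]] by simp
      ultimately have nY: "norm (Y x) \<le> sqrt \<Lambda> * sqrt (G x \<bullet> Y x)" by (rule power2_le_imp_le)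
      have "H x \<bullet> Y x \<le> norm (H x) * (sqrt \<Lambda> * sqrt (G x \<bullet> Y x))"
        using norm_cauchy_schwarz[of "H x" "Y x"] mult_left_mono[OF nY, of "norm (H x)"] by simp
      then have "vs x powr (p - 1) * (2 * \<eta> x) * (H x \<bullet> Y x) \<le> vs x powr (p - 1) * (2 * \<eta> x) * (norm (H x) * (sqrt \<Lambda> * sqrt (G x \<bullet> Y x)))"
        using b by (intro mult_left_mono) auto
      also have "\<dots> = 2 * sqrt \<Lambda> * (A x * B x)"
      proof -
        have "vs x powr (p - 1) = vs x powr (p / 2 - 1) * vs x powr (p / 2)"
          by (simp flip: powr_add)
        then show ?thesis by (simp add: A_def B_def mult_ac)
      qed
      finally show ?case by (simp add: \<Phi>_def g1_def inner_add_left mult_ac)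
    qed
  qed
  then have "0 \<le> (p - 1) * (LINT x|lborel. g1 x) + 2 * sqrt \<Lambda> * (LINT x|lborel. A x * B x)"
    using \<open>0 \<le> (LINT x|lborel. \<Phi> x \<bullet> Y x)\<close> i1 iAB by simp
  then have main: "(1 - p) * (LINT x|lborel. g1 x) \<le> 2 * sqrt \<Lambda> * (LINT x|lborel. A x * B x)"
    by (simp add: algebra_simps)
  define T where "T = (LINT x|lborel. g1 x)"
  define U where "U = (LINT x|lborel. (norm (H x))\<^sup>2 * vs x powr p)"
  have T0: "T \<ge> 0" unfolding T_def LA[symmetric] by simp
  have U0: "U \<ge> 0" unfolding U_def by simp
  \<comment> \<open>Squaring \<open>main\<close> puts \<open>T\<close> to the second power on the
    left and to the first on the right; one factor cancels unless it is 0.\<close>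
  have "T \<le> 4 * \<Lambda> / (1 - p)\<^sup>2 * U"
  proof (cases "T = 0")
    case False
    have "((1 - p) * T)\<^sup>2 \<le> (2 * sqrt \<Lambda> * (LINT x|lborel. A x * B x))\<^sup>2"
      using main T0 p unfolding T_def by (intro power_mono) auto
    also have "\<dots> \<le> 4 * \<Lambda> * (T * U)"
      using CS2 \<Lambda> unfolding T_def U_def by (simp add: power_mult_distrib mult_left_mono)
    finally have "((1 - p)\<^sup>2 * T) * T \<le> (4 * \<Lambda> * U) * T" by (simp add: power_mult_distrib power2_eq_square[of T] mult_ac)
    then have "(1 - p)\<^sup>2 * T \<le> 4 * \<Lambda> * U" using False T0 by simp
    then show ?thesis using p by (simp add: field_simps)
  qed (use \<Lambda> U0 in simp)
  moreover have "(LINT x|lborel. (\<eta> x)\<^sup>2 * vs x powr (p - 2) * (norm (G x))\<^sup>2) \<le> T"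
    unfolding T_def
  proof (rule integral_mono_AE[OF i0 i1])
    show "AE x in lborel. (\<eta> x)\<^sup>2 * vs x powr (p - 2) * (norm (G x))\<^sup>2 \<le> g1 x"
      using ell by eventually_elim (auto simp: g1_def intro!: mult_left_mono)
  qed
  ultimately show ?thesis unfolding U_def by linarith
qed

end

context shifted_supersolution
begin

lemma vs_ballfin: "p < 1 \<Longrightarrow> r \<le> 1 \<Longrightarrow> ballfin vs p r"
  unfolding ballfin_def
  by (rule powr_ball_integrable[where K=1]) (auto simp: indicator_def)

text \<open>Sobolev for \<open>\<eta> * vs powr (p / 2)\<close>, whose gradient contains the
  Caccioppoli energy with the factor \<open>p / 2\<close> from the chain rule. That factor is the
  source of \<open>p\<^sup>2\<close> beside \<open>\<Lambda>\<close>, without which small exponents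
  would not be cheap.\<close>

lemma reverse_hoelder:
  assumes n: "CARD('n) \<ge> 3" and p: "p < 1" "p \<noteq> 0" and r: "0 < r" "r < R" "R \<le> 1/2"
  defines "k \<equiv> real CARD('n)"
  defines "S \<equiv> (2 * (k - 1) / (k - 2))\<^sup>2"
  shows "ballfin vs (k / (k - 2) * p) r"
    "ballint vs (k / (k - 2) * p) r powr ((k - 2) / k)
      \<le> 256 * S * (1 + \<Lambda> * p\<^sup>2 / (1 - p)\<^sup>2) / (R - r)\<^sup>2 * ballint vs p R"
proof -
  have k: "k \<ge> 3" using n by (simp add: k_def)
  define q where "q = 2 * k / (k - 2)"
  have q: "q > 0" "p / 2 * q = k / (k - 2) * p" using k by (auto simp: q_def field_simps)
  obtain \<eta> :: "real ^ 'n \<Rightarrow> real" and H where ic: "is_cutoff r R \<eta> H" using cutoff_exists[OF r(1,2)] by auto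
  note \<eta> = is_cutoffD(1,2)[OF ic] and b = is_cutoffD(3,4,5)[OF ic] and one = is_cutoffD(6)[OF ic]
    and z = is_cutoffD(7,8)[OF ic]
  have \<eta>c: "continuous_on UNIV \<eta>" by (rule has_gradient_continuous[OF \<eta>(1)])
  have [measurable]: "\<eta> \<in> borel_measurable borel" "H \<in> borel_measurable borel"
    using \<eta>c \<eta>(2) by (auto intro: borel_measurable_continuous_onI)
  define K where "K = 8 / (R - r)"
  have K0: "K \<ge> 0" using r by (simp add: K_def)
  obtain F D where a: "aprx (ball 0 R) UNIV (\<lambda>x. vs x powr (p / 2)) (\<lambda>x. (p / 2 * vs x powr (p / 2 - 1)) *\<^sub>R G x) F D"
    using aprx_powr[of "p / 2" R] p r by auto
  define f where "f x = \<eta> x * vs x powr (p / 2)" for x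
  define \<Phi> where "\<Phi> x = \<eta> x *\<^sub>R ((p / 2 * vs x powr (p / 2 - 1)) *\<^sub>R G x) + vs x powr (p / 2) *\<^sub>R H x" for x
  have cut: "aprx UNIV UNIV f \<Phi> (\<lambda>n x. \<eta> x * F n x) (\<lambda>n x. \<eta> x *\<^sub>R D n x + F n x *\<^sub>R H x)"
    unfolding f_def[abs_def] \<Phi>_def[abs_def]
  proof (rule aprx_cutoff[OF a \<eta>, where K="1 + K"])
    show "\<bar>\<eta> x\<bar> \<le> 1 + K" for x using b(1,2)[of x] K0 by linarith
    show "norm (H x) \<le> 1 + K" for x using b(3)[of x] unfolding K_def by linarith
  qed (use z in auto)
  note [measurable] = aprx_measurable(2,3)[OF cut]
  have zn: "\<eta> x * F n x = 0" if "norm x > R" for n x using that z(1)[of x] by simp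
  note sob = sobolev_aprx[OF n cut zn, folded k_def]
  have i0: "integrable lborel (\<lambda>x. (\<eta> x)\<^sup>2 * vs x powr (p - 2) * (norm (G x))\<^sup>2)"
  proof (rule G_weighted_integrable(1)[where K=1])
    show "\<bar>(\<eta> x)\<^sup>2\<bar> \<le> 1" for x using b[of x] power_le_one[of "\<eta> x" 2] by auto
  qed (use p in auto)
  have i2: "integrable lborel (\<lambda>x. (norm (H x))\<^sup>2 * vs x powr p)"
  proof (rule powr_ball_integrable[OF p(1), where K="K\<^sup>2"])
    show "\<bar>(norm (H x))\<^sup>2\<bar> \<le> K\<^sup>2" for x using b(3)[of x] by (simp add: power_mono K_def)
    show "(norm (H x))\<^sup>2 = 0" if "x \<notin> ball 0 1" for x using that r by (auto intro!: z)
  qed measurable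
  define U where "U = (LINT x|lborel. (norm (H x))\<^sup>2 * vs x powr p)"
  have cac: "(LINT x|lborel. (\<eta> x)\<^sup>2 * vs x powr (p - 2) * (norm (G x))\<^sup>2) \<le> 4 * \<Lambda> / (1 - p)\<^sup>2 * U"
    unfolding U_def by (rule caccioppoli[OF p(1) _ _ \<eta> b z]) (use r in auto)
  have pt: "(norm (\<Phi> x))\<^sup>2 \<le> p\<^sup>2 / 2 * ((\<eta> x)\<^sup>2 * vs x powr (p - 2) * (norm (G x))\<^sup>2) + 2 * ((norm (H x))\<^sup>2 * vs x powr p)" for x
  proof -
    have "(norm (\<Phi> x))\<^sup>2 \<le> 2 * (norm (\<eta> x *\<^sub>R ((p / 2 * vs x powr (p / 2 - 1)) *\<^sub>R G x)))\<^sup>2 + 2 * (norm (vs x powr (p / 2) *\<^sub>R H x))\<^sup>2"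
      unfolding \<Phi>_def by (rule norm_add_sq_le)
    also have "\<dots> = p\<^sup>2 / 2 * ((\<eta> x)\<^sup>2 * (vs x powr (p / 2 - 1))\<^sup>2 * (norm (G x))\<^sup>2) + 2 * ((norm (H x))\<^sup>2 * (vs x powr (p / 2))\<^sup>2)"
      by (simp add: power_mult_distrib power_divide)
    also have "(vs x powr (p / 2 - 1))\<^sup>2 = vs x powr (p - 2)"
      using vs_ge[of x] by (simp add: powr_power right_diff_distrib)
    also have "(vs x powr (p / 2))\<^sup>2 = vs x powr p"
      using vs_ge[of x] by (simp add: powr_power)
    finally show ?thesis .
  qed
  have i\<Phi>: "integrable lborel (\<lambda>x. (norm (\<Phi> x))\<^sup>2)"
  proof -
    have "nsq UNIV (\<lambda>x. norm (\<Phi> x)) < \<infinity>" using cut by (simp add: aprx_def nsq_def)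
    then show ?thesis using nsq_finite_iff_integrable[of "\<lambda>x. norm (\<Phi> x)" UNIV] by simp
  qed
  have "(LINT x|lborel. (norm (\<Phi> x))\<^sup>2)
      \<le> (LINT x|lborel. p\<^sup>2 / 2 * ((\<eta> x)\<^sup>2 * vs x powr (p - 2) * (norm (G x))\<^sup>2) + 2 * ((norm (H x))\<^sup>2 * vs x powr p))"
    using i\<Phi> i0 i2 pt by (intro integral_mono) auto
  also have "\<dots> = p\<^sup>2 / 2 * (LINT x|lborel. (\<eta> x)\<^sup>2 * vs x powr (p - 2) * (norm (G x))\<^sup>2) + 2 * U"
    unfolding U_def using i0 i2 by simp
  also have "\<dots> \<le> p\<^sup>2 / 2 * (4 * \<Lambda> / (1 - p)\<^sup>2 * U) + 2 * U"
    using cac by (intro add_right_mono mult_left_mono) auto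
  also have "\<dots> = 2 * (1 + \<Lambda> * p\<^sup>2 / (1 - p)\<^sup>2) * U" by (simp add: algebra_simps)
  finally have E: "(LINT x|lborel. (norm (\<Phi> x))\<^sup>2) \<le> 2 * (1 + \<Lambda> * p\<^sup>2 / (1 - p)\<^sup>2) * U" .
  have finR: "ballfin vs p R" using p r by (intro vs_ballfin) auto
  have U: "U \<le> 64 / (R - r)\<^sup>2 * ballint vs p R"
  proof -
    have "U \<le> (LINT x|lborel. 64 / (R - r)\<^sup>2 * (indicator (ball 0 R) x * vs x powr p))"
      unfolding U_def
    proof (rule integral_mono[OF i2])
      show "integrable lborel (\<lambda>x. 64 / (R - r)\<^sup>2 * (indicator (ball 0 R) x * vs x powr p))"
        using finR by (simp add: ballfin_def)
      fix x
      show "(norm (H x))\<^sup>2 * vs x powr p \<le> 64 / (R - r)\<^sup>2 * (indicator (ball 0 R) x * vs x powr p)"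
      proof (cases "x \<in> ball 0 R")
        case True
        have "(norm (H x))\<^sup>2 \<le> (8 / (R - r))\<^sup>2" using b(3)[of x] by (intro power_mono) auto
        then have "(norm (H x))\<^sup>2 * vs x powr p \<le> 64 / (R - r)\<^sup>2 * vs x powr p"
          by (intro mult_right_mono) (auto simp: power_divide)
        then show ?thesis using True by simp
      qed (simp add: z)
    qed
    then show ?thesis by (simp add: ballint_def)
  qed
  have fq: "\<bar>f x\<bar> powr q = vs x powr (k / (k - 2) * p)" if "x \<in> ball 0 r" for x
    unfolding f_def one[OF that] q(2)[symmetric] using vs_ge[of x] by (simp add: powr_powr)
  have if': "integrable lborel (\<lambda>x. \<bar>f x\<bar> powr q)" unfolding q_def by (rule sob(1))
  show fr: "ballfin vs (k / (k - 2) * p) r"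
    unfolding ballfin_def using if'
    by (rule Bochner_Integration.integrable_bound) (auto simp: indicator_def fq intro!: AE_I2)
  have "ballint vs (k / (k - 2) * p) r \<le> (LINT x|lborel. \<bar>f x\<bar> powr q)"
    unfolding ballint_def using fr if' fq unfolding ballfin_def
    by (intro integral_mono) (auto simp: indicator_def)
  then have "ballint vs (k / (k - 2) * p) r powr ((k - 2) / k) \<le> (LINT x|lborel. \<bar>f x\<bar> powr q) powr ((k - 2) / k)"
    using k by (intro powr_mono2) (auto simp: ballint_def)
  also have "\<dots> \<le> 2 * S * (LINT x|lborel. (norm (\<Phi> x))\<^sup>2)"
    unfolding q_def S_def using sob(2) by simp
  also have "\<dots> \<le> 2 * S * (2 * (1 + \<Lambda> * p\<^sup>2 / (1 - p)\<^sup>2) * (64 / (R - r)\<^sup>2 * ballint vs p R))"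
  proof (rule mult_left_mono)
    have "2 * (1 + \<Lambda> * p\<^sup>2 / (1 - p)\<^sup>2) * U \<le> 2 * (1 + \<Lambda> * p\<^sup>2 / (1 - p)\<^sup>2) * (64 / (R - r)\<^sup>2 * ballint vs p R)"
      using U \<Lambda> by (intro mult_left_mono) auto
    with E show "(LINT x|lborel. (norm (\<Phi> x))\<^sup>2) \<le> 2 * (1 + \<Lambda> * p\<^sup>2 / (1 - p)\<^sup>2) * (64 / (R - r)\<^sup>2 * ballint vs p R)" by linarith
  qed (simp add: S_def)
  \<comment> \<open>256 is 2 from \<open>sobolev_aprx\<close>, 2 from the square of a sum and 64
    from the squared cutoff gradient.\<close>
  also have "2 * S * (2 * (1 + \<Lambda> * p\<^sup>2 / (1 - p)\<^sup>2) * (64 / (R - r)\<^sup>2 * ballint vs p R))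
      = 256 * S * (1 + \<Lambda> * p\<^sup>2 / (1 - p)\<^sup>2) / (R - r)\<^sup>2 * ballint vs p R"
  proof -
    have "2 * S * (2 * Z * (64 / X * I)) = 256 * S * Z / X * I" for Z X I :: real by simp
    then show ?thesis by blast
  qed
  finally show "ballint vs (k / (k - 2) * p) r powr ((k - 2) / k)
      \<le> 256 * S * (1 + \<Lambda> * p\<^sup>2 / (1 - p)\<^sup>2) / (R - r)\<^sup>2 * ballint vs p R" .
qed

text \<open>At \<open>p = 0\<close> the Caccioppoli energy is that of \<open>ln vs\<close>, and its
  right-hand side contains no solution any more, only the cutoff. The gap 1/4 gives the squared
  gradient bound \<open>32\<^sup>2 = 1024\<close>, so 24576 is \<open>6 * 4 * 1024\<close>; one
  factor \<open>2 ^ CARD('n)\<close> bounds a volume and the other comes from the Poincare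
  inequality.\<close>

lemma log_oscillation:
  obtains m where "integrable lborel (\<lambda>x. indicator (ball 0 (1/2)) x * (ln (vs x) - m)\<^sup>2)"
    "(LINT x|lborel. indicator (ball 0 (1/2)) x * (ln (vs x) - m)\<^sup>2) \<le> 24576 * 4 ^ CARD('n) * \<Lambda> + 1"
proof -
  let ?B = "ball (0::real^'n) (1/2)"
  obtain \<eta> :: "real ^ 'n \<Rightarrow> real" and H where ic: "is_cutoff (1/2) (3/4) \<eta> H"
    using cutoff_exists[of "1/2" "3/4"] by auto
  note \<eta> = is_cutoffD(1,2)[OF ic] and b = is_cutoffD(3,4,5)[OF ic] and one = is_cutoffD(6)[OF ic]
    and z = is_cutoffD(7,8)[OF ic]
  have \<eta>c: "continuous_on UNIV \<eta>" by (rule has_gradient_continuous[OF \<eta>(1)])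
  have [measurable]: "\<eta> \<in> borel_measurable borel" "H \<in> borel_measurable borel"
    using \<eta>c \<eta>(2) by (auto intro: borel_measurable_continuous_onI)
  have V: "measure lborel (ball (0::real^'n) (3/4)) \<le> 2 ^ CARD('n)"
  proof -
    let ?a = "(\<chi> i. - 1) :: real ^ 'n" and ?b = "(\<chi> i. 1) :: real ^ 'n"
    have "ball (0::real^'n) (3/4) \<subseteq> cbox ?a ?b"
    proof
      fix x :: "real ^ 'n" assume "x \<in> ball 0 (3/4)"
      then have "- 1 \<le> x $ i \<and> x $ i \<le> 1" for i
        using component_le_norm_cart[of x i] by (simp add: dist_norm) linarith
      then show "x \<in> cbox ?a ?b" by (simp add: mem_box_cart)
    qed
    then have "measure lborel (ball (0::real^'n) (3/4)) \<le> measure lborel (cbox ?a ?b)"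
      by (intro measure_mono_fmeasurable) auto
    also have "\<dots> = (\<Prod>b\<in>Basis. (?b - ?a) \<bullet> b)"
      by (rule measure_lborel_cbox) (auto simp: Basis_vec_def inner_axis)
    also have "\<dots> = (\<Prod>b\<in>(Basis::(real^'n) set). 2)"
      by (rule prod.cong) (auto simp: Basis_vec_def inner_axis)
    finally show ?thesis by simp
  qed
  have i0: "integrable lborel (\<lambda>x. (\<eta> x)\<^sup>2 * vs x powr (0 - 2) * (norm (G x))\<^sup>2)"
  proof (rule G_weighted_integrable(1)[where K=1])
    show "\<bar>(\<eta> x)\<^sup>2\<bar> \<le> 1" for x using b[of x] power_le_one[of "\<eta> x" 2] by auto
  qed auto
  have "(LINT x|lborel. (\<eta> x)\<^sup>2 * vs x powr (0 - 2) * (norm (G x))\<^sup>2)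
      \<le> 4 * \<Lambda> / (1 - 0)\<^sup>2 * (LINT x|lborel. (norm (H x))\<^sup>2 * vs x powr 0)"
    by (rule caccioppoli[where r="3/4", OF _ _ _ \<eta> b z]) auto
  also have "(LINT x|lborel. (norm (H x))\<^sup>2 * vs x powr 0) \<le> (LINT x|lborel. 1024 * indicator (ball (0::real^'n) (3/4)) x)"
  proof (rule integral_mono')
    show "integrable lborel (\<lambda>x. 1024 * indicator (ball (0::real^'n) (3/4)) x :: real)"
      using emeasure_lborel_ball_finite[of "0::real^'n" "3/4"] by simp
    fix x
    show "(norm (H x))\<^sup>2 * vs x powr 0 \<le> 1024 * indicator (ball (0::real^'n) (3/4)) x"
    proof (cases "x \<in> ball 0 (3/4)")
      case True
      have "(norm (H x))\<^sup>2 \<le> 32\<^sup>2" using b(3)[of x] by (intro power_mono) auto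
      then show ?thesis using True vs_ge(2)[of x] by simp
    qed (simp add: z)
  qed auto
  also have "\<dots> \<le> 1024 * 2 ^ CARD('n)" using V by simp
  finally have C1: "(LINT x|lborel. (\<eta> x)\<^sup>2 * vs x powr (0 - 2) * (norm (G x))\<^sup>2) \<le> 4096 * 2 ^ CARD('n) * \<Lambda>"
    using \<Lambda> by (simp add: mult_left_mono mult_ac)
  obtain F D where a: "aprx ?B UNIV (\<lambda>x. ln (vs x)) (\<lambda>x. (1 / vs x) *\<^sub>R G x) F D"
    using aprx_ln[of "1/2"] by auto
  obtain m where m: "nsq ?B (\<lambda>x. ln (vs x) - m)
      \<le> ennreal (6 * (2 * (1/2))\<^sup>2 * 2 ^ CARD('n)) * nsq ?B (\<lambda>x. (1 / vs x) *\<^sub>R G x) + 1"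
    using poincare_aprx[OF _ a] by auto
  have "nsq ?B (\<lambda>x. (1 / vs x) *\<^sub>R G x) \<le> (\<integral>\<^sup>+x. ennreal ((\<eta> x)\<^sup>2 * vs x powr (0 - 2) * (norm (G x))\<^sup>2) \<partial>lborel)"
    unfolding nsq_def
  proof (rule nn_integral_mono)
    fix x
    have "vs x powr (0 - 2) = 1 / (vs x)\<^sup>2" using vs_ge(2)[of x] by (simp add: powr_minus_divide powr_numeral)
    then show "ennreal ((norm ((1 / vs x) *\<^sub>R G x))\<^sup>2) * indicator ?B x \<le> ennreal ((\<eta> x)\<^sup>2 * vs x powr (0 - 2) * (norm (G x))\<^sup>2)"
      using one[of x] vs_ge(2)[of x] by (auto simp: indicator_def power_mult_distrib power_divide)
  qed
  also have "\<dots> = ennreal (LINT x|lborel. (\<eta> x)\<^sup>2 * vs x powr (0 - 2) * (norm (G x))\<^sup>2)"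
    by (rule nn_integral_eq_integral[OF i0]) auto
  also have "\<dots> \<le> ennreal (4096 * 2 ^ CARD('n) * \<Lambda>)" using C1 by (rule ennreal_leI)
  finally have nG: "nsq ?B (\<lambda>x. (1 / vs x) *\<^sub>R G x) \<le> ennreal (4096 * 2 ^ CARD('n) * \<Lambda>)" .
  have "nsq ?B (\<lambda>x. ln (vs x) - m) \<le> ennreal (6 * (2 * (1/2))\<^sup>2 * 2 ^ CARD('n)) * ennreal (4096 * 2 ^ CARD('n) * \<Lambda>) + 1"
    using nG by (intro order_trans[OF m] add_mono mult_left_mono) auto
  also have "\<dots> = ennreal (24576 * 4 ^ CARD('n) * \<Lambda> + 1)"
  proof -
    have "(2::real) ^ CARD('n) * 2 ^ CARD('n) = 4 ^ CARD('n)" by (simp flip: power_mult_distrib)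
    then have "6 * (2 * (1/2))\<^sup>2 * 2 ^ CARD('n) * (4096 * 2 ^ CARD('n) * \<Lambda>) = 24576 * 4 ^ CARD('n) * \<Lambda>"
      by (simp add: mult_ac)
    then show ?thesis using \<Lambda> by (simp add: ennreal_plus flip: ennreal_mult)
  qed
  finally have N: "nsq ?B (\<lambda>x. ln (vs x) - m) \<le> ennreal (24576 * 4 ^ CARD('n) * \<Lambda> + 1)" .
  then have fin: "nsq ?B (\<lambda>x. ln (vs x) - m) < \<infinity>" by (rule le_less_trans) simp
  show ?thesis
  proof (rule that[of m])
    show i: "integrable lborel (\<lambda>x. indicator ?B x * (ln (vs x) - m)\<^sup>2)"
      using fin nsq_finite_iff_integrable[of "\<lambda>x. ln (vs x) - m" ?B] by simp
    have "(LINT x|lborel. indicator ?B x * (ln (vs x) - m)\<^sup>2) = enn2real (nsq ?B (\<lambda>x. ln (vs x) - m))"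
      using LINT_eq_nsq[of "\<lambda>x. ln (vs x) - m" ?B] by simp
    also have "\<dots> \<le> 24576 * 4 ^ CARD('n) * \<Lambda> + 1" using N \<Lambda> by (intro enn2real_leI) auto
    finally show "(LINT x|lborel. indicator ?B x * (ln (vs x) - m)\<^sup>2) \<le> 24576 * 4 ^ CARD('n) * \<Lambda> + 1" .
  qed
qed

end

section \<open>The weak Harnack inequality\<close>

definition sob_const :: "nat \<Rightarrow> real" where
  "sob_const n = (2 * (real n - 1) / (real n - 2))\<^sup>2"

text \<open>The ratio of the Sobolev exponent to 2, that is, the gain of one reverse Hoelder step
  and also the ratio of the final exponent to \<open>q\<close>.\<close>

definition dim_exp :: "nat \<Rightarrow> real" where
  "dim_exp n = real n / (real n - 2)"

lemma sob_const_ge_1: "n \<ge> 3 \<Longrightarrow> sob_const n \<ge> 1"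
  unfolding sob_const_def by (intro one_le_power) (auto simp: field_simps)

lemma dim_exp_gt_1: "n \<ge> 3 \<Longrightarrow> dim_exp n > 1"
  by (auto simp: dim_exp_def field_simps)

context shifted_supersolution
begin

text \<open>The sign of \<open>e\<close> is free, so that one definition covers both the small power
  of the normalised solution and its reciprocal.\<close>

definition rescaled :: "real \<Rightarrow> real \<Rightarrow> real ^ 'n \<Rightarrow> real" where
  "rescaled e m x = (vs x * exp (- m)) powr e"

lemma rescaled_pos: "rescaled e m x > 0"
  using vs_ge[of x] by (simp add: rescaled_def)

lemma rescaled_measurable [measurable]: "rescaled e m \<in> borel_measurable borel"
  by (simp add: rescaled_def[abs_def])

lemma rescaled_powr: "rescaled e m x powr \<alpha> = exp (- (m * (e * \<alpha>))) * vs x powr (e * \<alpha>)"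
proof -
  have "rescaled e m x powr \<alpha> = (vs x * exp (- m)) powr (e * \<alpha>)" by (simp add: rescaled_def powr_powr)
  also have "\<dots> = vs x powr (e * \<alpha>) * exp (- m) powr (e * \<alpha>)" by (rule powr_mult)
  also have "exp (- m) powr (e * \<alpha>) = exp (- (m * (e * \<alpha>)))" by (simp add: powr_def mult.commute)
  finally show ?thesis by simp
qed

lemma rescaled_ballfin: "ballfin (rescaled e m) \<alpha> r \<longleftrightarrow> ballfin vs (e * \<alpha>) r"
  unfolding ballfin_def rescaled_powr by (simp add: mult.left_commute[of _ "exp _"])

lemma rescaled_ballint: "ballint (rescaled e m) \<alpha> r = exp (- (m * (e * \<alpha>))) * ballint vs (e * \<alpha>) r"
  unfolding ballint_def rescaled_powr by (simp add: mult.left_commute[of _ "exp _"])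

text \<open>The normalising factor appears as \<open>exp (- (m * p))\<close> on both sides and drops
  out. The term \<open>\<Lambda> * p\<^sup>2\<close> is at most \<open>\<alpha>\<^sup>2\<close> by
  the smallness of \<open>e\<close>, and \<open>c\<close> bounds the distance of \<open>p\<close>
  from the critical exponent 1.\<close>

lemma rescaled_revhoelder:
  assumes n: "CARD('n) \<ge> 3" and e: "e\<^sup>2 * \<Lambda> \<le> 1" "e \<noteq> 0" and c: "0 < c" "c \<le> 1"
    and P: "\<And>\<alpha>. \<alpha> \<in> P \<Longrightarrow> \<alpha> \<noteq> 0 \<and> e * \<alpha> < 1 \<and> c \<le> (1 - e * \<alpha>)\<^sup>2"
  shows "revhoelder (rescaled e m) (dim_exp CARD('n)) (256 * sob_const CARD('n) / c) P"
  unfolding revhoelder_def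
proof (intro ballI allI impI)
  fix \<alpha> r R assume \<alpha>: "\<alpha> \<in> P" and r: "1/4 \<le> r" "r < R" "R \<le> (1/2::real)" and fin: "ballfin (rescaled e m) \<alpha> R"
  define p where "p = e * \<alpha>"
  define \<kappa> where "\<kappa> = dim_exp CARD('n)"
  have \<kappa>: "\<kappa> > 1" unfolding \<kappa>_def by (rule dim_exp_gt_1[OF n])
  have p: "p < 1" "p \<noteq> 0" "c \<le> (1 - p)\<^sup>2" using P[OF \<alpha>] e by (auto simp: p_def)
  have \<kappa>': "(real CARD('n) - 2) / real CARD('n) = 1 / \<kappa>" by (simp add: \<kappa>_def dim_exp_def)
  have rh: "ballfin vs (\<kappa> * p) r"
    "ballint vs (\<kappa> * p) r powr (1 / \<kappa>) \<le> 256 * sob_const CARD('n) * (1 + \<Lambda> * p\<^sup>2 / (1 - p)\<^sup>2) / (R - r)\<^sup>2 * ballint vs p R"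
    using reverse_hoelder[OF n p(1,2) _ r(2,3)] r unfolding \<kappa>_def[symmetric, unfolded dim_exp_def] \<kappa>' sob_const_def by auto
  have e\<kappa>: "e * (\<kappa> * \<alpha>) = \<kappa> * p" by (simp add: p_def)
  have le: "1 + \<Lambda> * p\<^sup>2 / (1 - p)\<^sup>2 \<le> (1 + \<alpha>\<^sup>2) / c"
  proof -
    have "\<Lambda> * p\<^sup>2 = (e\<^sup>2 * \<Lambda>) * \<alpha>\<^sup>2" by (simp add: p_def power_mult_distrib)
    also have "\<dots> \<le> 1 * \<alpha>\<^sup>2" using e by (intro mult_right_mono) auto
    finally have "\<Lambda> * p\<^sup>2 / (1 - p)\<^sup>2 \<le> \<alpha>\<^sup>2 / c" using p c by (intro frac_le) auto
    moreover have "1 \<le> 1 / c" using c by simp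
    ultimately show ?thesis by (simp add: add_divide_distrib)
  qed
  show "ballfin (rescaled e m) (\<kappa> * \<alpha>) r \<and>
      ballint (rescaled e m) (\<kappa> * \<alpha>) r powr (1 / \<kappa>)
        \<le> 256 * sob_const CARD('n) / c * (1 + \<alpha>\<^sup>2) / (R - r)\<^sup>2 * ballint (rescaled e m) \<alpha> R"
  proof
    show "ballfin (rescaled e m) (\<kappa> * \<alpha>) r" unfolding rescaled_ballfin e\<kappa> by (rule rh(1))
    have I0: "0 \<le> ballint vs p R" by (rule ballint_nonneg[OF meas(3) vs_ge(2)])
    have "ballint (rescaled e m) (\<kappa> * \<alpha>) r powr (1 / \<kappa>)
        = exp (- (m * (\<kappa> * p))) powr (1 / \<kappa>) * ballint vs (\<kappa> * p) r powr (1 / \<kappa>)"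
      unfolding rescaled_ballint e\<kappa> by (rule powr_mult)
    also have "exp (- (m * (\<kappa> * p))) powr (1 / \<kappa>) = exp (- (m * p))" using \<kappa> by (simp add: powr_def)
    also have "exp (- (m * p)) * ballint vs (\<kappa> * p) r powr (1 / \<kappa>)
        \<le> exp (- (m * p)) * (256 * sob_const CARD('n) * ((1 + \<alpha>\<^sup>2) / c) / (R - r)\<^sup>2 * ballint vs p R)"
    proof (rule mult_left_mono)
      have "256 * sob_const CARD('n) * (1 + \<Lambda> * p\<^sup>2 / (1 - p)\<^sup>2) / (R - r)\<^sup>2 * ballint vs p R
          \<le> 256 * sob_const CARD('n) * ((1 + \<alpha>\<^sup>2) / c) / (R - r)\<^sup>2 * ballint vs p R"
        using le I0 sob_const_ge_1[OF n] by (intro mult_right_mono divide_right_mono mult_left_mono) auto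
      with rh(2) show "ballint vs (\<kappa> * p) r powr (1 / \<kappa>) \<le> 256 * sob_const CARD('n) * ((1 + \<alpha>\<^sup>2) / c) / (R - r)\<^sup>2 * ballint vs p R"
        by linarith
    qed simp
    also have "\<dots> = 256 * sob_const CARD('n) / c * (1 + \<alpha>\<^sup>2) / (R - r)\<^sup>2 * ballint (rescaled e m) \<alpha> R"
      unfolding rescaled_ballint p_def[symmetric] by simp
    finally show "ballint (rescaled e m) (\<kappa> * \<alpha>) r powr (1 / \<kappa>)
        \<le> 256 * sob_const CARD('n) / c * (1 + \<alpha>\<^sup>2) / (R - r)\<^sup>2 * ballint (rescaled e m) \<alpha> R" .
  qed
qed

text \<open>Both \<open>(v e\<^sup>-\<^sup>m)\<^sup>s\<close> and its reciprocal satisfy the hypotheses of the Bombieri--Giusti lemma with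
  constants depending only on the dimension, since \<open>s = \<Lambda>\<^sup>-\<^sup>1\<^sup>/\<^sup>2 / 2\<close> absorbs the size of \<open>\<nabla> ln v\<close>.\<close>

lemma weak_harnack_shifted:
  assumes n: "CARD('n) \<ge> 3" and q: "1/2 \<le> q" "q < 1" and E1: "E \<ge> 1"
    and E: "\<And>(f :: real ^ 'n \<Rightarrow> real) P. f \<in> borel_measurable borel \<Longrightarrow> (\<And>x. f x > 0) \<Longrightarrow>
      revhoelder f (dim_exp CARD('n)) (1024 * sob_const CARD('n)) P \<Longrightarrow>
      {0<..<1} \<subseteq> P \<Longrightarrow> ballfin f 1 (1/2) \<Longrightarrow>
      integrable lborel (\<lambda>x. indicator (ball 0 (1/2)) x * (ln (f x))\<^sup>2) \<Longrightarrow>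
      (LINT x|lborel. indicator (ball 0 (1/2)) x * (ln (f x))\<^sup>2) \<le> 24576 * 4 ^ CARD('n) + 4 \<Longrightarrow> ballint f 1 (3/8) \<le> E"
  defines "\<kappa> \<equiv> dim_exp CARD('n)"
  defines "Z \<equiv> (moser_const \<kappa> (256 * sob_const CARD('n) / (1 - q)\<^sup>2) (1/8) * E) powr \<kappa>"
  defines "T \<equiv> moser_const \<kappa> (1024 * sob_const CARD('n)) (1/8) * E"
  shows "ballfin vs (\<kappa> * q) (1/4)"
    "AE x in lborel. x \<in> ball 0 (1/4) \<longrightarrow> ballint vs (\<kappa> * q) (1/4) powr (1 / (\<kappa> * q)) \<le> (Z * T) powr (2 * sqrt \<Lambda>) * vs x"
proof -
  \<comment> \<open>Then \<open>s\<^sup>2 * \<Lambda>\<close> is 1/4, which compensates the growth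
    of \<open>log_oscillation\<close> in \<open>\<Lambda>\<close>, and \<open>s \<le> 1/2\<close>
    keeps positive exponents of \<open>vs\<close> away from 1.\<close>
  define s where "s = 1 / (2 * sqrt \<Lambda>)"
  have L1: "sqrt \<Lambda> \<ge> 1" using \<Lambda> by simp
  have s: "s > 0" "s \<le> 1/2" "s\<^sup>2 * \<Lambda> = 1 / 4" "1 / s = 2 * sqrt \<Lambda>"
    using \<Lambda> L1 by (auto simp: s_def power_divide power_mult_distrib field_simps)
  have \<kappa>: "\<kappa> > 1" unfolding \<kappa>_def by (rule dim_exp_gt_1[OF n])
  have S1: "sob_const CARD('n) \<ge> 1" by (rule sob_const_ge_1[OF n])
  obtain m where m: "integrable lborel (\<lambda>x. indicator (ball 0 (1/2)) x * (ln (vs x) - m)\<^sup>2)"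
    "(LINT x|lborel. indicator (ball 0 (1/2)) x * (ln (vs x) - m)\<^sup>2) \<le> 24576 * 4 ^ CARD('n) * \<Lambda> + 1"
    using log_oscillation by blast
  have lnf: "(ln (rescaled e m x))\<^sup>2 = e\<^sup>2 * (ln (vs x) - m)\<^sup>2" for e x
    using vs_ge[of x] by (simp add: rescaled_def ln_powr ln_mult power_mult_distrib)
  have ln: "integrable lborel (\<lambda>x. indicator (ball 0 (1/2)) x * (ln (rescaled e m x))\<^sup>2)"
    "(LINT x|lborel. indicator (ball 0 (1/2)) x * (ln (rescaled e m x))\<^sup>2) \<le> 24576 * 4 ^ CARD('n) + 4"
    if e: "e\<^sup>2 = s\<^sup>2" for e
  proof -
    have eq: "(\<lambda>x. indicator (ball 0 (1/2)) x * (ln (rescaled e m x))\<^sup>2) = (\<lambda>x. s\<^sup>2 * (indicator (ball 0 (1/2)) x * (ln (vs x) - m)\<^sup>2))"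
      by (simp add: lnf e mult.left_commute)
    show "integrable lborel (\<lambda>x. indicator (ball 0 (1/2)) x * (ln (rescaled e m x))\<^sup>2)"
      unfolding eq using m(1) by (rule integrable_mult_right)
    have "(LINT x|lborel. indicator (ball 0 (1/2)) x * (ln (rescaled e m x))\<^sup>2)
        = s\<^sup>2 * (LINT x|lborel. indicator (ball 0 (1/2)) x * (ln (vs x) - m)\<^sup>2)"
      unfolding eq by simp
    also have "\<dots> \<le> s\<^sup>2 * (24576 * 4 ^ CARD('n) * \<Lambda> + 1)" using m(2) by (rule mult_left_mono) simp
    also have "\<dots> = 24576 * 4 ^ CARD('n) * (s\<^sup>2 * \<Lambda>) + s\<^sup>2" by (simp add: algebra_simps)
    also have "\<dots> \<le> 24576 * 4 ^ CARD('n) + 4"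
    proof -
      have "s\<^sup>2 \<le> (1/2)\<^sup>2" using s by (intro power_mono) auto
      then have "s\<^sup>2 \<le> 1/4" by (simp add: power_divide)
      moreover have "(0::real) \<le> 4 ^ CARD('n)" by simp
      ultimately show ?thesis unfolding s(3) by linarith
    qed
    finally show "(LINT x|lborel. indicator (ball 0 (1/2)) x * (ln (rescaled e m x))\<^sup>2) \<le> 24576 * 4 ^ CARD('n) + 4" .
  qed
  let ?f = "rescaled s m" and ?g = "rescaled (- s) m"
  have sL: "s\<^sup>2 * \<Lambda> \<le> 1" "(- s)\<^sup>2 * \<Lambda> \<le> 1" using s by auto
  \<comment> \<open>The lower bound 1/4 for the square of \<open>1 - p\<close> is valid for both
    functions: for \<open>?f\<close> because \<open>p = s * \<alpha>\<close> is at most 1/2, for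
    \<open>?g\<close> because \<open>p\<close> is negative.\<close>
  have quarter: "256 * sob_const CARD('n) / (1/4) = 1024 * sob_const CARD('n)" by simp
  have rf: "revhoelder ?f \<kappa> (1024 * sob_const CARD('n)) {0<..<1}"
    unfolding \<kappa>_def quarter[symmetric]
  proof (rule rescaled_revhoelder[OF n sL(1)])
    fix \<alpha> :: real assume "\<alpha> \<in> {0<..<1}"
    then have a: "0 < \<alpha>" "\<alpha> < 1" by auto
    then have "s * \<alpha> \<le> 1/2 * 1" using s by (intro mult_mono) auto
    then have sa: "1/2 \<le> 1 - s * \<alpha>" by simp
    have "(1/2)\<^sup>2 \<le> (1 - s * \<alpha>)\<^sup>2" using sa by (rule power_mono) simp
    then show "\<alpha> \<noteq> 0 \<and> s * \<alpha> < 1 \<and> 1/4 \<le> (1 - s * \<alpha>)\<^sup>2" using a sa by (simp add: power_divide)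
  qed (use s in auto)
  \<comment> \<open>For the reciprocal all exponents of \<open>vs\<close> are negative and never
    approach 1, so every positive \<open>\<alpha>\<close> is admissible; this permits the passage to
    the supremum.\<close>
  have rg: "revhoelder ?g \<kappa> (1024 * sob_const CARD('n)) {0<..}"
    unfolding \<kappa>_def quarter[symmetric]
  proof (rule rescaled_revhoelder[OF n sL(2)])
    fix \<alpha> :: real assume "\<alpha> \<in> {0<..}"
    then have "\<alpha> > 0" "s * \<alpha> > 0" using s by auto
    moreover have "1 \<le> (1 - - s * \<alpha>)\<^sup>2" using \<open>s * \<alpha> > 0\<close> by (intro one_le_power) auto
    then have "1/4 \<le> (1 - - s * \<alpha>)\<^sup>2" by linarith
    ultimately show "\<alpha> \<noteq> 0 \<and> - s * \<alpha> < 1 \<and> 1/4 \<le> (1 - - s * \<alpha>)\<^sup>2"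
      by (intro conjI) auto
  qed (use s in auto)
  \<comment> \<open>A second reverse Hoelder inequality for the same \<open>?f\<close>, up to
    exponent \<open>q\<close> of \<open>vs\<close>. It is the one place where the constant depends
    on \<open>1 - q\<close>.\<close>
  have rt: "revhoelder ?f \<kappa> (256 * sob_const CARD('n) / (1 - q)\<^sup>2) {0<..q / s}"
    unfolding \<kappa>_def
  proof (rule rescaled_revhoelder[OF n sL(1)])
    show "(1 - q)\<^sup>2 \<le> 1" using q by (intro power_le_one) auto
    fix \<alpha> :: real assume "\<alpha> \<in> {0<..q / s}"
    then have a: "0 < \<alpha>" "s * \<alpha> \<le> q" using s by (auto simp: field_simps)
    have "(1 - q)\<^sup>2 \<le> (1 - s * \<alpha>)\<^sup>2" using a q by (intro power_mono) auto
    then show "\<alpha> \<noteq> 0 \<and> s * \<alpha> < 1 \<and> (1 - q)\<^sup>2 \<le> (1 - s * \<alpha>)\<^sup>2" using a q by auto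
  qed (use s q in auto)
  have bf: "ballfin (rescaled e m) 1 r" if "e < 1" "r \<le> 1" for e r
    unfolding rescaled_ballfin using that by (intro vs_ballfin) auto
  have Ef: "ballint ?f 1 (3/8) \<le> E"
    by (rule E[OF _ rescaled_pos rf[unfolded \<kappa>_def] _ _ ln]) (use s in \<open>auto intro!: bf\<close>)
  have Eg: "ballint ?g 1 (3/8) \<le> E"
    by (rule E[OF _ rescaled_pos rg[unfolded \<kappa>_def] _ _ ln]) (use s in \<open>auto intro!: bf\<close>)
  have sup: "AE x in lborel. x \<in> ball 0 (1/4) \<longrightarrow> ?g x \<le> T"
    unfolding T_def by (rule moser_sup_bound[OF _ rescaled_pos rg \<kappa> _ _ Eg]) (use S1 s in \<open>auto intro!: bf\<close>)
  have Mq: "256 * sob_const CARD('n) / (1 - q)\<^sup>2 \<ge> 1"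
  proof -
    have "(1 - q)\<^sup>2 \<le> 1" using q by (intro power_le_one) auto
    then show ?thesis using S1 q by (simp add: le_divide_eq)
  qed
  \<comment> \<open>Here \<open>q \<ge> 1/2\<close> is used, against \<open>s \<le> 1/2\<close>: the
    target exponent is at least 1, as \<open>moser_target_exponent\<close> requires.\<close>
  have qs: "1 \<le> q / s" using q s by (simp add: field_simps)
  have b38: "ballfin ?f 1 (3/8)" using s by (intro bf) auto
  have tg: "ballfin ?f (\<kappa> * (q / s)) (1/4)" "ballint ?f (\<kappa> * (q / s)) (1/4) powr (1 / (\<kappa> * (q / s))) \<le> Z"
    unfolding Z_def by (rule moser_target_exponent[OF rescaled_measurable rescaled_pos rt \<kappa> Mq b38 Ef E1 qs])+
  have sq: "s * (\<kappa> * (q / s)) = \<kappa> * q" using s by simp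
  show fin: "ballfin vs (\<kappa> * q) (1/4)" using tg(1) unfolding rescaled_ballfin sq .
  define I where "I = ballint vs (\<kappa> * q) (1/4)"
  have I0: "I \<ge> 0" unfolding I_def by (rule ballint_nonneg[OF meas(3) vs_ge(2)])
  have "ballint ?f (\<kappa> * (q / s)) (1/4) powr (1 / (\<kappa> * (q / s))) = exp (- (m * s)) * I powr (s / (\<kappa> * q))"
  proof -
    have "ballint ?f (\<kappa> * (q / s)) (1/4) powr (1 / (\<kappa> * (q / s)))
        = exp (- (m * (\<kappa> * q))) powr (s / (\<kappa> * q)) * I powr (s / (\<kappa> * q))"
      unfolding rescaled_ballint sq I_def[symmetric] using I0 by (simp add: powr_mult)
    also have "exp (- (m * (\<kappa> * q))) powr (s / (\<kappa> * q)) = exp (- (m * s))"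
      using \<kappa> q by (simp add: powr_def)
    finally show ?thesis .
  qed
  with tg(2) have IZ: "exp (- (m * s)) * I powr (s / (\<kappa> * q)) \<le> Z" by simp
  show "AE x in lborel. x \<in> ball 0 (1/4) \<longrightarrow> ballint vs (\<kappa> * q) (1/4) powr (1 / (\<kappa> * q)) \<le> (Z * T) powr (2 * sqrt \<Lambda>) * vs x"
    using sup
  proof eventually_elim
    case (elim x)
    show ?case
    proof
      assume "x \<in> ball 0 (1/4)"
      then have "?g x \<le> T" using elim by simp
      moreover have "?g x = exp (m * s) * vs x powr (- s)"
        using rescaled_powr[of "- s" m x 1] rescaled_pos[of "- s" m x] by simp
      ultimately have gT: "exp (m * s) * vs x powr (- s) \<le> T" by simp
      \<comment> \<open>In the product of the two bounds the factors with the unknown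
        \<open>m\<close> cancel.\<close>
      have "I powr (s / (\<kappa> * q)) * vs x powr (- s)
          = (exp (- (m * s)) * I powr (s / (\<kappa> * q))) * (exp (m * s) * vs x powr (- s))"
        by (simp add: exp_minus field_simps)
      also have "\<dots> \<le> Z * T" using IZ gT by (intro mult_mono) (auto simp: Z_def)
      finally have "I powr (s / (\<kappa> * q)) \<le> (Z * T) * vs x powr s"
        using vs_ge[of x] by (simp add: powr_minus field_simps)
      then have "(I powr (s / (\<kappa> * q))) powr (1 / s) \<le> ((Z * T) * vs x powr s) powr (1 / s)"
        using s \<Lambda> by (intro powr_mono2) auto
      also have "\<dots> = (Z * T) powr (1 / s) * (vs x powr s) powr (1 / s)"
        by (rule powr_mult)
      also have "(vs x powr s) powr (1 / s) = vs x" using s(1) vs_ge[of x] by (simp add: powr_powr)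
      also have "(I powr (s / (\<kappa> * q))) powr (1 / s) = I powr (1 / (\<kappa> * q))" using s(1) by (simp add: powr_powr)
      finally show "ballint vs (\<kappa> * q) (1/4) powr (1 / (\<kappa> * q)) \<le> (Z * T) powr (2 * sqrt \<Lambda>) * vs x"
        by (simp add: I_def s(4))
    qed
  qed
qed

end

section \<open>From the coefficient field to the locale, and uniform constants\<close>

lemma wgrad_cong:
  fixes u :: "real ^ 'n \<Rightarrow> real"
  assumes w: "wgrad \<Omega> u G" and [measurable]: "v \<in> borel_measurable borel"
    and uv: "AE x in lborel. u x = v x" and z: "\<And>x. x \<notin> \<Omega> \<Longrightarrow> v x = 0"
  shows "wgrad \<Omega> v G"
proof -
  have [measurable]: "u \<in> borel_measurable borel" using w by (simp add: wgrad_def)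
  have "nsq UNIV v = nsq UNIV u"
    unfolding nsq_def by (rule nn_integral_cong_AE) (use uv in eventually_elim, simp)
  moreover have "(LINT x|lborel. v x * partial_deriv i \<phi> x) = (LINT x|lborel. u x * partial_deriv i \<phi> x)"
    if \<phi>: "\<phi> \<in> test_functions \<Omega>" for \<phi> i
  proof (rule integral_cong_AE)
    have [measurable]: "partial_deriv i \<phi> \<in> borel_measurable borel"
      using smooth_cs_continuous[OF smooth_cs_partial_deriv[OF test_functions_smooth_cs[OF \<phi>]]]
      by (auto intro: borel_measurable_continuous_onI)
    show "(\<lambda>x. v x * partial_deriv i \<phi> x) \<in> borel_measurable lborel" by simp
    show "(\<lambda>x. u x * partial_deriv i \<phi> x) \<in> borel_measurable lborel" by simp
    show "AE x in lborel. v x * partial_deriv i \<phi> x = u x * partial_deriv i \<phi> x"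
      using uv by eventually_elim simp
  qed
  ultimately show ?thesis using w z unfolding wgrad_def by auto
qed

text \<open>Coercivity makes \<open>A\<close> injective and hence invertible; the bound on the
  inverse is then applied to the vector \<open>A *v g\<close>.\<close>

lemma elliptic_flux_bounds:
  fixes A :: "real ^ 'n ^ 'n"
  assumes A: "\<And>\<xi>. \<xi> \<bullet> (A *v \<xi>) \<ge> (norm \<xi>)\<^sup>2" "\<And>\<xi>. \<xi> \<bullet> (matrix_inv A *v \<xi>) \<ge> inverse \<Lambda> * (norm \<xi>)\<^sup>2"
    and \<Lambda>: "\<Lambda> \<ge> 1"
  shows "(norm (A *v g))\<^sup>2 \<le> \<Lambda> * (g \<bullet> (A *v g))"
proof -
  have "\<forall>\<xi>. A *v \<xi> = 0 \<longrightarrow> \<xi> = 0"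
  proof (intro allI impI)
    fix \<xi> assume "A *v \<xi> = 0"
    then show "\<xi> = 0" using A(1)[of \<xi>] by simp
  qed
  then have "invertible A" unfolding invertible_left_inverse matrix_left_invertible_ker .
  then have "matrix_inv A ** A = mat 1" unfolding invertible_def matrix_inv_def by (rule someI2_ex) simp
  then have "matrix_inv A *v (A *v g) = g" by (simp add: matrix_vector_mul_assoc)
  then have "inverse \<Lambda> * (norm (A *v g))\<^sup>2 \<le> g \<bullet> (A *v g)" using A(2)[of "A *v g"] by (simp add: inner_commute)
  then show ?thesis using \<Lambda> by (simp add: field_simps)
qed

lemma measurable_mat_nth:
  fixes a :: "'a \<Rightarrow> real ^ 'n ^ 'm"
  assumes "a \<in> borel_measurable M" shows "(\<lambda>x. a x $ i $ j) \<in> borel_measurable M"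
proof -
  have "(\<lambda>A :: real ^ 'n ^ 'm. A $ i $ j) \<in> borel_measurable borel"
    by (intro borel_measurable_continuous_onI continuous_intros)
  from measurable_compose[OF assms this] show ?thesis .
qed

text \<open>The positive part \<open>w\<close> of a Borel representative is nonnegative everywhere
  and agrees with \<open>u\<close> almost everywhere in the ball, so it keeps the same weak
  gradient. \<open>G\<close> and \<open>Y\<close> are fixed before \<open>\<delta>\<close>, which
  allows the shift to tend to 0 later.\<close>

lemma supersolution_representative:
  fixes u :: "real ^ 'n \<Rightarrow> real"
  assumes ne: "normalized_elliptic (ball 0 1) \<Lambda> a" and ss: "weak_supersolution (ball 0 1) a u"
    and pos: "AE x in lebesgue_on (ball 0 1). 0 < u x"
  obtains w G Y where "w \<in> borel_measurable borel" "\<And>x. w x \<ge> 0" "AE x in lborel. x \<in> ball 0 1 \<longrightarrow> u x = w x"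
    "\<And>\<delta>. \<delta> > 0 \<Longrightarrow> shifted_supersolution w G Y \<Lambda> \<delta>"
proof -
  let ?B = "ball (0 :: real ^ 'n) 1"
  have uW: "u \<in> W12 ?B" using ss by (simp add: weak_supersolution_def)
  obtain u' G where wg: "wgrad ?B u' G" and uu: "AE x in lborel. x \<in> ?B \<longrightarrow> u x = u' x"
    and gg: "AE x in lborel. x \<in> ?B \<longrightarrow> weak_grad ?B u x = G x" by (rule W12_wgrad[OF uW])
  have [measurable]: "u' \<in> borel_measurable borel" "G \<in> borel_measurable borel" using wg by (auto simp: wgrad_def)
  have zero: "u' x = 0" "G x = 0" if "x \<notin> ?B" for x using wg that by (auto simp: wgrad_def)
  have pos': "AE x in lborel. x \<in> ?B \<longrightarrow> 0 < u x" using pos by (simp add: AE_lebesgue_on_iff)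
  define w where "w x = max 0 (u' x)" for x
  have wm[measurable]: "w \<in> borel_measurable borel" unfolding w_def[abs_def] by measurable
  have w_eq: "AE x in lborel. u' x = w x"
    using pos' uu
  proof eventually_elim
    case (elim x)
    then show ?case using zero(1)[of x] by (cases "x \<in> ?B") (auto simp: w_def)
  qed
  have ww: "wgrad ?B w G" by (rule wgrad_cong[OF wg wm w_eq]) (simp add: w_def zero)
  have uw: "AE x in lborel. x \<in> ?B \<longrightarrow> u x = w x" using uu w_eq by eventually_elim auto
  let ?W = "weak_grad ?B u"
  have am: "a \<in> borel_measurable (lebesgue_on ?B)" and \<Lambda>: "1 \<le> \<Lambda>" using ne by (auto simp: normalized_elliptic_def)
  have ael: "AE x in lborel. x \<in> ?B \<longrightarrow> (\<forall>\<xi>. \<xi> \<bullet> (a x *v \<xi>) \<ge> (norm \<xi>)\<^sup>2 \<and>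
        \<xi> \<bullet> (matrix_inv (a x) *v \<xi>) \<ge> inverse \<Lambda> * (norm \<xi>)\<^sup>2)"
    using ne by (simp add: normalized_elliptic_def AE_lebesgue_on_iff)
  obtain Y where Ym[measurable]: "Y \<in> borel_measurable borel" and Yz: "\<And>x. x \<notin> ?B \<Longrightarrow> Y x = 0"
    and YW: "AE x in lborel. x \<in> ?B \<longrightarrow> a x *v ?W x = Y x"
  proof (rule borel_vec_representative)
    fix i
    have [measurable]: "(\<lambda>x. ?W x $ j) \<in> borel_measurable (lebesgue_on ?B)" for j
    proof (rule measurable_lebesgue_on_AE[where g="\<lambda>x. G x $ j"])
      show "AE x in lborel. x \<in> ?B \<longrightarrow> ?W x $ j = G x $ j" using gg by eventually_elim auto
    qed auto
    have [measurable]: "(\<lambda>x. a x $ i $ j) \<in> borel_measurable (lebesgue_on ?B)" for j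
      by (rule measurable_mat_nth[OF am])
    show "(\<lambda>x. (a x *v ?W x) $ i) \<in> borel_measurable (lebesgue_on ?B)"
      by (simp add: matrix_vector_mult_def)
  qed auto
  have ell: "AE x in lborel. (norm (G x))\<^sup>2 \<le> G x \<bullet> Y x \<and> (norm (Y x))\<^sup>2 \<le> \<Lambda> * (G x \<bullet> Y x)"
    using ael gg YW
  proof eventually_elim
    case (elim x)
    show ?case
    proof (cases "x \<in> ?B")
      case True
      then have "Y x = a x *v G x" using elim by auto
      then show ?thesis using elim True elliptic_flux_bounds[of "a x" \<Lambda> "G x"] \<Lambda> by auto
    qed (simp add: zero Yz)
  qed
  have sup: "0 \<le> (LINT x|lborel. \<Phi> x \<bullet> Y x)"
    if \<phi>: "\<phi> \<in> W12_0 ?B" "\<And>x. 0 \<le> \<phi> x" and [measurable]: "\<Phi> \<in> borel_measurable borel"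
      and \<Phi>: "AE x in lborel. x \<in> ?B \<longrightarrow> weak_grad ?B \<phi> x = \<Phi> x" for \<phi> \<Phi>
  proof -
    have "0 \<le> bilin_form ?B a u \<phi>" using ss \<phi> by (auto simp: weak_supersolution_def)
    also have "\<dots> = (LINT x|lborel. indicator ?B x * (\<Phi> x \<bullet> Y x))"
      unfolding bilin_form_def
    proof (rule lebesgue_on_eq_lborel)
      show "AE x in lborel. x \<in> ?B \<longrightarrow> weak_grad ?B \<phi> x \<bullet> (a x *v ?W x) = \<Phi> x \<bullet> Y x"
        using \<Phi> YW by eventually_elim auto
    qed auto
    also have "\<dots> = (LINT x|lborel. \<Phi> x \<bullet> Y x)"
      by (rule Bochner_Integration.integral_cong) (auto simp: indicator_def Yz)
    finally show ?thesis .
  qed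
  have "shifted_supersolution w G Y \<Lambda> \<delta>" if "\<delta> > 0" for \<delta>
    by (rule shifted_supersolution.intro[OF ww _ Ym \<Lambda> that ell sup]) (auto simp: w_def)
  then show ?thesis by (rule that[OF wm _ uw, rotated]) (auto simp: w_def)
qed

text \<open>The explicit constants are sorted: \<open>E\<close>, \<open>A\<close>, \<open>T\<close>
  and \<open>D\<close> depend on the dimension only. The dependence on \<open>q\<close> is a factor
  \<open>M powr \<sigma>\<close> with \<open>M = 256 * S / (1 - q)\<^sup>2\<close>, raised to
  \<open>\<kappa>\<close> by the target exponent and squared by \<open>1 / s\<close>, so the
  exponent of \<open>1 - q\<close> is \<open>4 * \<sigma> * \<kappa>\<close>.\<close>

lemma uniform_weak_harnack:
  assumes n: "CARD('n::finite) \<ge> 3"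
  obtains C \<gamma> where "C > 0" "\<gamma> \<ge> 0"
    "\<And>(u :: real ^ 'n \<Rightarrow> real) G Y \<Lambda> \<delta> q. shifted_supersolution u G Y \<Lambda> \<delta> \<Longrightarrow> 1/2 \<le> q \<Longrightarrow> q < 1 \<Longrightarrow>
      ballfin (\<lambda>x. u x + \<delta>) (dim_exp CARD('n) * q) (1/4) \<and>
      (AE x in lborel. x \<in> ball 0 (1/4) \<longrightarrow> ballint (\<lambda>x. u x + \<delta>) (dim_exp CARD('n) * q) (1/4) powr (1 / (dim_exp CARD('n) * q))
          \<le> (C / (1 - q) powr \<gamma>) powr sqrt \<Lambda> * (u x + \<delta>))"
proof -
  define \<kappa> where "\<kappa> = dim_exp CARD('n)"
  define S where "S = sob_const CARD('n)"
  define \<sigma> where "\<sigma> = (\<Sum>j. (1 / \<kappa>) ^ j)"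
  have \<kappa>: "\<kappa> > 1" unfolding \<kappa>_def by (rule dim_exp_gt_1[OF n])
  have S1: "S \<ge> 1" unfolding S_def by (rule sob_const_ge_1[OF n])
  have \<sigma>: "\<sigma> \<ge> 0" unfolding \<sigma>_def using \<kappa> by (intro suminf_nonneg summable_geometric) auto
  have M1: "1024 * S \<ge> 1" using S1 by simp
  have C4: "24576 * 4 ^ CARD('n) + 4 \<ge> (4::real)" by simp
  obtain E where E1: "E \<ge> 1" and E: "\<And>(f :: real ^ 'n \<Rightarrow> real) P. f \<in> borel_measurable borel \<Longrightarrow> (\<And>x. f x > 0) \<Longrightarrow>
      revhoelder f \<kappa> (1024 * S) P \<Longrightarrow> {0<..<1} \<subseteq> P \<Longrightarrow> ballfin f 1 (1/2) \<Longrightarrow>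
      integrable lborel (\<lambda>x. indicator (ball 0 (1/2)) x * (ln (f x))\<^sup>2) \<Longrightarrow>
      (LINT x|lborel. indicator (ball 0 (1/2)) x * (ln (f x))\<^sup>2) \<le> 24576 * 4 ^ CARD('n) + 4 \<Longrightarrow> ballint f 1 (3/8) \<le> E"
    by (rule bombieri_giusti[OF \<kappa> M1 C4]) (rule that, assumption, blast)
  define A where "A = moser_const \<kappa> 1 (1/8) * E"
  define T where "T = moser_const \<kappa> (1024 * S) (1/8) * E"
  define D where "D = ((256 * S) powr \<sigma> * A) powr \<kappa> * T"
  define g where "g = 2 * \<sigma> * \<kappa>"
  have A0: "A > 0" and T0: "T > 0" using E1 by (auto simp: A_def T_def moser_const_def)
  have D0: "D > 0" using A0 T0 S1 by (auto simp: D_def)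
  show ?thesis
  proof (rule that)
    show "D powr 2 > 0" using D0 by simp
    show "2 * g \<ge> 0" using \<sigma> \<kappa> by (simp add: g_def)
    fix u :: "real ^ 'n \<Rightarrow> real" and G Y \<Lambda> \<delta> q
    assume ss: "shifted_supersolution u G Y \<Lambda> \<delta>" and q: "1/2 \<le> q" "q < (1::real)"
    have vs: "shifted_supersolution.vs u \<delta> = (\<lambda>x. u x + \<delta>)" by (rule ext) (rule shifted_supersolution.vs_def[OF ss])
    define Z where "Z = (moser_const \<kappa> (256 * S / (1 - q)\<^sup>2) (1/8) * E) powr \<kappa>"
    have Mq: "256 * S / (1 - q)\<^sup>2 \<ge> 1"
    proof -
      have "(1 - q)\<^sup>2 \<le> 1" using q by (intro power_le_one) auto
      then show ?thesis using S1 q by (simp add: le_divide_eq)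
    qed
    have "moser_const \<kappa> (256 * S / (1 - q)\<^sup>2) (1/8) * E = (256 * S / (1 - q)\<^sup>2) powr \<sigma> * A"
      using moser_const_power(2)[OF \<kappa> Mq, of "1/8"] by (simp add: A_def \<sigma>_def)
    also have "(256 * S / (1 - q)\<^sup>2) powr \<sigma> = (256 * S) powr \<sigma> / (1 - q) powr (2 * \<sigma>)"
      using q S1 by (simp add: powr_divide powr_powr flip: powr_numeral)
    finally have "Z = (((256 * S) powr \<sigma> * A) / (1 - q) powr (2 * \<sigma>)) powr \<kappa>" by (simp add: Z_def)
    also have "\<dots> = ((256 * S) powr \<sigma> * A) powr \<kappa> / (1 - q) powr g"
      using A0 by (simp add: powr_divide powr_powr g_def)
    finally have ZT: "Z * T = D / (1 - q) powr g" by (simp add: D_def)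
    \<comment> \<open>The 2 in the power \<open>2 * sqrt \<Lambda>\<close> goes into the dimensional
      constant, which leaves the power \<open>sqrt \<Lambda>\<close> of the theorem.\<close>
    have "(Z * T) powr (2 * sqrt \<Lambda>) = ((Z * T) powr 2) powr sqrt \<Lambda>" by (simp add: powr_powr)
    also have "(Z * T) powr 2 = D powr 2 / (1 - q) powr (2 * g)"
      unfolding ZT using D0 by (simp add: powr_divide powr_powr mult.commute)
    finally have eq: "(Z * T) powr (2 * sqrt \<Lambda>) = (D powr 2 / (1 - q) powr (2 * g)) powr sqrt \<Lambda>" .
    note wh = shifted_supersolution.weak_harnack_shifted[OF ss n q E1 E[unfolded \<kappa>_def S_def]]
    show "ballfin (\<lambda>x. u x + \<delta>) (dim_exp CARD('n) * q) (1/4) \<and>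
      (AE x in lborel. x \<in> ball 0 (1/4) \<longrightarrow> ballint (\<lambda>x. u x + \<delta>) (dim_exp CARD('n) * q) (1/4) powr (1 / (dim_exp CARD('n) * q))
          \<le> (D powr 2 / (1 - q) powr (2 * g)) powr sqrt \<Lambda> * (u x + \<delta>))"
      using wh unfolding vs \<kappa>_def[symmetric] S_def[symmetric] T_def[symmetric] Z_def[symmetric] eq by (rule conjI)
  qed
qed

text \<open>Two reductions at once: Jensen lowers the exponent from \<open>P\<close> to
  \<open>p\<close>, and monotonicity in the shift bounds the integral of \<open>w\<close> by that of
  \<open>w + \<delta>\<close>. The right-hand side is affine in \<open>\<delta>\<close>, so the
  limit is pointwise.\<close>

lemma harnack_shift_limit:
  fixes w :: "real ^ 'n \<Rightarrow> real"
  assumes wm[measurable]: "w \<in> borel_measurable borel" and w0: "\<And>x. w x \<ge> 0" and p: "0 < p" "p \<le> P"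
    and bd: "\<And>\<delta>. \<delta> > 0 \<Longrightarrow> ballfin (\<lambda>x. w x + \<delta>) P (1/4) \<and>
      (AE x in lborel. x \<in> ball 0 (1/4) \<longrightarrow> ballint (\<lambda>x. w x + \<delta>) P (1/4) powr (1 / P) \<le> K * (w x + \<delta>))"
  shows "ballfin w p (1/4)"
    "AE x in lborel. x \<in> ball 0 (1/4) \<longrightarrow> ballint w p (1/4) powr (1 / p) \<le> K * w x"
proof -
  have ws[measurable]: "(\<lambda>x. w x + \<delta>) \<in> borel_measurable borel" for \<delta> by measurable
  have wpos: "w x + \<delta> > 0" if "\<delta> > 0" for x \<delta> using w0[of x] that by simp
  have J: "ballfin (\<lambda>x. w x + \<delta>) p (1/4)"
    "ballint (\<lambda>x. w x + \<delta>) p (1/4) \<le> ballint (\<lambda>x. w x + \<delta>) P (1/4) powr (p / P)" if "\<delta> > 0" for \<delta>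
    using ballint_Jensen[OF ws wpos[OF that] p] bd[OF that] by auto
  have le: "w x powr p \<le> (w x + \<delta>) powr p" if "\<delta> > 0" for x \<delta>
    using w0[of x] that p by (intro powr_mono2) auto
  show fin: "ballfin w p (1/4)"
    unfolding ballfin_def
  proof (rule Bochner_Integration.integrable_bound)
    show "integrable lborel (\<lambda>x. indicator (ball 0 (1/4)) x * (w x + 1) powr p)" using J(1)[of 1] by (simp add: ballfin_def)
    show "AE x in lborel. norm (indicator (ball 0 (1/4)) x * w x powr p) \<le> norm (indicator (ball 0 (1/4)) x * (w x + 1) powr p)"
      using le[of 1] by (intro AE_I2) (auto simp: indicator_def)
    show "(\<lambda>x. indicator (ball 0 (1/4)) x * w x powr p) \<in> borel_measurable lborel"
      by (intro borel_measurable_times borel_measurable_indicator powr_real_measurable) (use wm in auto)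
  qed
  have mono: "ballint w p (1/4) powr (1 / p) \<le> ballint (\<lambda>x. w x + \<delta>) P (1/4) powr (1 / P)" if \<delta>: "\<delta> > 0" for \<delta>
  proof -
    have "ballint w p (1/4) \<le> ballint (\<lambda>x. w x + \<delta>) p (1/4)"
      unfolding ballint_def
      by (rule integral_mono) (use fin J(1)[OF \<delta>] le[OF \<delta>] in \<open>auto simp: ballfin_def indicator_def\<close>)
    also note J(2)[OF \<delta>]
    finally have "ballint w p (1/4) powr (1 / p) \<le> (ballint (\<lambda>x. w x + \<delta>) P (1/4) powr (p / P)) powr (1 / p)"
      using p by (intro powr_mono2) (auto simp: ballint_def)
    also have "\<dots> = ballint (\<lambda>x. w x + \<delta>) P (1/4) powr (1 / P)" using p by (simp add: powr_powr)
    finally show ?thesis .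
  qed
  \<comment> \<open>The exceptional set depends on the shift; a sequence of shifts makes it a
    countable union.\<close>
  have "AE x in lborel. \<forall>k. x \<in> ball 0 (1/4) \<longrightarrow> ballint w p (1/4) powr (1 / p) \<le> K * (w x + inverse (real (Suc k)))"
    unfolding AE_all_countable
  proof
    fix k
    have k: "inverse (real (Suc k)) > 0" by simp
    have "AE x in lborel. x \<in> ball 0 (1/4) \<longrightarrow>
        ballint (\<lambda>x. w x + inverse (real (Suc k))) P (1/4) powr (1 / P) \<le> K * (w x + inverse (real (Suc k)))"
      using bd[OF k] by blast
    then show "AE x in lborel. x \<in> ball 0 (1/4) \<longrightarrow> ballint w p (1/4) powr (1 / p) \<le> K * (w x + inverse (real (Suc k)))"
      by eventually_elim (use mono[OF k] in auto)
  qed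
  then show "AE x in lborel. x \<in> ball 0 (1/4) \<longrightarrow> ballint w p (1/4) powr (1 / p) \<le> K * w x"
  proof eventually_elim
    case (elim x)
    have "(\<lambda>k. K * (w x + inverse (real (Suc k)))) \<longlonglongrightarrow> K * (w x + 0)"
      by (intro tendsto_intros LIMSEQ_inverse_real_of_nat)
    then show ?case using elim by (auto intro: LIMSEQ_le_const)
  qed
qed

lemma essinf_ge:
  assumes "f \<in> borel_measurable M" and "AE x in M. c \<le> f x"
  shows "ereal c \<le> essinf M f"
proof -
  have "esssup M (\<lambda>x. - ereal (f x)) \<le> - ereal c"
    by (rule esssup_I) (use assms in auto)
  then show ?thesis unfolding essinf_def by (metis ereal_minus_le_minus ereal_uminus_uminus)
qed

text \<open>Integrability is part of the conclusion because the integral of a non-integrable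
  function is 0 by convention, so the inequality alone would not assert a finite norm.\<close>

theorem theorem2p2:
  assumes "CARD('n::finite) \<ge> 3"
  shows "\<exists>C>0. \<exists>\<gamma>::real. \<forall>(\<Lambda>::real) (a :: real ^ 'n \<Rightarrow> real ^ 'n ^ 'n) (q::real) (u :: real ^ 'n \<Rightarrow> real) (qstar::real).
    normalized_elliptic (ball 0 1) \<Lambda> a \<longrightarrow>
    0 < q \<longrightarrow> q < 1 \<longrightarrow>
    weak_supersolution (ball 0 1) a u \<longrightarrow>
    (AE x in lebesgue_on (ball 0 1). 0 < u x) \<longrightarrow>
    qstar = q * real CARD('n) / (real CARD('n) - 2) \<longrightarrow>
      integrable (lebesgue_on (ball 0 (1/4))) (\<lambda>x. \<bar>u x\<bar> powr qstar) \<and>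
      ereal ((LINT x|lebesgue_on (ball 0 (1/4)). \<bar>u x\<bar> powr qstar) powr (1 / qstar))
        \<le> ereal ((C / (1 - q) powr \<gamma>) powr sqrt \<Lambda>) * essinf (lebesgue_on (ball 0 (1/4))) u"
proof -
  obtain C \<gamma> where C: "C > 0" and \<gamma>: "\<gamma> \<ge> 0"
    and wh: "\<And>(u :: real ^ 'n \<Rightarrow> real) G Y \<Lambda> \<delta> q. shifted_supersolution u G Y \<Lambda> \<delta> \<Longrightarrow> 1/2 \<le> q \<Longrightarrow> q < 1 \<Longrightarrow>
      ballfin (\<lambda>x. u x + \<delta>) (dim_exp CARD('n) * q) (1/4) \<and>
      (AE x in lborel. x \<in> ball 0 (1/4) \<longrightarrow> ballint (\<lambda>x. u x + \<delta>) (dim_exp CARD('n) * q) (1/4) powr (1 / (dim_exp CARD('n) * q))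
          \<le> (C / (1 - q) powr \<gamma>) powr sqrt \<Lambda> * (u x + \<delta>))"
    by (rule uniform_weak_harnack[OF assms]) (rule that)
  show ?thesis
  \<comment> \<open>The factor \<open>2 powr \<gamma>\<close> comes from replacing \<open>q\<close>
    by \<open>r = max q (1/2)\<close>: since \<open>1 - r\<close> is at least half of
    \<open>1 - q\<close>, the bound at \<open>r\<close> is controlled by a power of
    \<open>1 - q\<close>.\<close>
  proof (rule exI[of _ "C * 2 powr \<gamma>"], intro conjI, use C in simp, rule exI[of _ \<gamma>], intro allI impI)
    fix \<Lambda> and a :: "real ^ 'n \<Rightarrow> real ^ 'n ^ 'n" and q and u :: "real ^ 'n \<Rightarrow> real" and qstar :: real
    assume ne: "normalized_elliptic (ball 0 1) \<Lambda> a" and q: "0 < q" "q < 1"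
      and ss: "weak_supersolution (ball 0 1) a u" and pos: "AE x in lebesgue_on (ball 0 1). 0 < u x"
      and qstar: "qstar = q * real CARD('n) / (real CARD('n) - 2)"
    let ?b = "ball (0 :: real ^ 'n) (1/4)"
    obtain w G Y where wm[measurable]: "w \<in> borel_measurable borel" and w0: "\<And>x. w x \<ge> 0"
      and uw: "AE x in lborel. x \<in> ball 0 1 \<longrightarrow> u x = w x"
      and sh: "\<And>\<delta>. \<delta> > 0 \<Longrightarrow> shifted_supersolution w G Y \<Lambda> \<delta>"
      by (rule supersolution_representative[OF ne ss pos]) (rule that)
    define r where "r = max q (1/2)"
    define K where "K = (C * 2 powr \<gamma> / (1 - q) powr \<gamma>) powr sqrt \<Lambda>"
    have r: "1/2 \<le> r" "r < 1" "q \<le> r" "(1 - q) / 2 \<le> 1 - r" using q by (auto simp: r_def max_def)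
    have \<kappa>: "dim_exp CARD('n) > 1" by (rule dim_exp_gt_1[OF assms])
    have qs: "qstar = dim_exp CARD('n) * q" by (simp add: qstar dim_exp_def)
    have p: "0 < qstar" "qstar \<le> dim_exp CARD('n) * r" using \<kappa> q r by (auto simp: qs)
    have "C / (1 - r) powr \<gamma> \<le> C / ((1 - q) / 2) powr \<gamma>"
      using C \<gamma> r q by (intro divide_left_mono powr_mono2 mult_pos_pos) auto
    also have "\<dots> = C * 2 powr \<gamma> / (1 - q) powr \<gamma>" using q by (simp add: powr_divide)
    finally have "(C / (1 - r) powr \<gamma>) powr sqrt \<Lambda> \<le> K"
      unfolding K_def using C ne by (intro powr_mono2) (auto simp: normalized_elliptic_def)
    then have mono: "(C / (1 - r) powr \<gamma>) powr sqrt \<Lambda> * (w x + \<delta>) \<le> K * (w x + \<delta>)" if "\<delta> > 0" for x \<delta>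
      using w0[of x] that by (intro mult_right_mono) auto
    have bd: "ballfin (\<lambda>x. w x + \<delta>) (dim_exp CARD('n) * r) (1/4) \<and>
        (AE x in lborel. x \<in> ?b \<longrightarrow> ballint (\<lambda>x. w x + \<delta>) (dim_exp CARD('n) * r) (1/4) powr (1 / (dim_exp CARD('n) * r))
          \<le> K * (w x + \<delta>))" if \<delta>: "\<delta> > 0" for \<delta>
    proof
      note 1 = wh[OF sh[OF \<delta>] r(1,2)]
      show "ballfin (\<lambda>x. w x + \<delta>) (dim_exp CARD('n) * r) (1/4)" using 1 by (rule conjunct1)
      show "AE x in lborel. x \<in> ?b \<longrightarrow> ballint (\<lambda>x. w x + \<delta>) (dim_exp CARD('n) * r) (1/4) powr (1 / (dim_exp CARD('n) * r))
          \<le> K * (w x + \<delta>)"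
        using conjunct2[OF 1]
      proof eventually_elim
        case (elim x)
        then show ?case using mono[OF \<delta>, of x] by auto
      qed
    qed
    have lim: "ballfin w qstar (1/4)" "AE x in lborel. x \<in> ?b \<longrightarrow> ballint w qstar (1/4) powr (1 / qstar) \<le> K * w x"
      by (rule harnack_shift_limit[OF wm w0 p bd], assumption)+
    have uwb: "AE x in lborel. x \<in> ?b \<longrightarrow> u x = w x" using uw by eventually_elim auto
    have ae: "AE x in lborel. x \<in> ?b \<longrightarrow> \<bar>u x\<bar> powr qstar = w x powr qstar"
      using uwb by eventually_elim (simp add: w0)
    have int: "integrable (lebesgue_on ?b) (\<lambda>x. \<bar>u x\<bar> powr qstar)"
      using lim(1) lebesgue_on_eq_lborel(2)[OF _ _ ae] by (simp add: ballfin_def)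
    have I: "(LINT x|lebesgue_on ?b. \<bar>u x\<bar> powr qstar) = ballint w qstar (1/4)"
      using lebesgue_on_eq_lborel(1)[OF _ _ ae] by (simp add: ballint_def)
    have K0: "K > 0" using C q by (simp add: K_def)
    define L where "L = ballint w qstar (1/4) powr (1 / qstar)"
    \<comment> \<open>Dividing by the positive \<open>K\<close> turns the a.e. inequality into a
      constant lower bound for \<open>u\<close>, which passes to the essential infimum.\<close>
    have "ereal (L / K) \<le> essinf (lebesgue_on ?b) u"
    proof (rule essinf_ge)
      show "u \<in> borel_measurable (lebesgue_on ?b)" by (rule measurable_lebesgue_on_AE[OF wm _ uwb]) simp
      have "AE x in lborel. x \<in> ?b \<longrightarrow> L / K \<le> u x"
        using lim(2) uwb
      proof eventually_elim
        case (elim x)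
        then show ?case using K0 by (auto simp: L_def pos_divide_le_eq mult.commute)
      qed
      then show "AE x in lebesgue_on ?b. L / K \<le> u x" by (simp add: AE_lebesgue_on_iff)
    qed
    then have "ereal K * ereal (L / K) \<le> ereal K * essinf (lebesgue_on ?b) u"
      using K0 by (intro ereal_mult_left_mono) auto
    then have "ereal L \<le> ereal K * essinf (lebesgue_on ?b) u" using K0 by simp
    with int show "integrable (lebesgue_on ?b) (\<lambda>x. \<bar>u x\<bar> powr qstar) \<and>
      ereal ((LINT x|lebesgue_on ?b. \<bar>u x\<bar> powr qstar) powr (1 / qstar))
        \<le> ereal ((C * 2 powr \<gamma> / (1 - q) powr \<gamma>) powr sqrt \<Lambda>) * essinf (lebesgue_on ?b) u"
      unfolding I L_def[symmetric] K_def[symmetric] by (rule conjI)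
  qed
qed

end
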